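(* For the cubic nonlinear Schrödinger equation $i\partial_tu+\Delta u=|u|^2u$ on $\mathbb T^d$ the general resonance based scheme $U_k^{n,r}$ (recalled in the context) takes at second order ($r=1$) the form (i) $$u^{\ell+1}=e^{i\tau\Delta}u^\ell-i\tau e^{i\tau\Delta}\Big((u^\ell)^2\big(\varphi_1(-2i\tau\Delta)-\varphi_2(-2i\tau\Delta)\big)\overline{u^\ell}\Big)-i\tau\big(e^{i\tau\Delta}u^\ell\big)^2\varphi_2(-2i\tau\Delta)e^{i\tau\Delta}\overline{u^\ell}-\frac{\tau^2}2e^{i\tau\Delta}\big(|u^\ell|^4u^\ell\big)$$ with a local error of order $\mathcal O(\tau^3\Delta u)$ and filter function $\varphi_2(\sigma)=\frac{e^\sigma-\varphi_1(\sigma)}\sigma$. (ii) In case of more regular solutions the general scheme takes the simplified form $$u^{\ell+1}=e^{i\tau\Delta}u^\ell-i\tau e^{i\tau\Delta}\Big((u^\ell)^2\big(\varphi_1(-2i\tau\Delta)-\tfrac12\big)\overline{u^\ell}\Big)-\frac{i\tau}2\big(e^{i\tau\Delta}u^\ell\big)^2e^{i\tau\Delta}\overline{u^\ell}-\frac{\tau^2}2e^{i\tau\Delta}\big(|u^\ell|^4u^\ell\big)$$ with a local error of order $\mathcal O(\tau^3\nabla^3u)$. (iii) For smooth solutions it takes the form $$u^{\ell+1}=e^{i\tau\Delta}u^\ell-i\tau e^{i\tau\Delta}\Big(\Psi_1-i\Psi_2\tfrac12\tau\Delta\Big)|u^\ell|^2u^\ell+\frac{\tau^2}2e^{i\tau\Delta}\Psi_3\Big(-(u^\ell)^2\Delta\overline{u^\ell}+2|u^\ell|^2\Delta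 u^\ell-|u^\ell|^4u^\ell\Big)$$ with a local error of order $\mathcal O(\tau^3\Delta^2u)$ and suitable filter functions $\Psi_j=\Psi_j(i\tau\Delta)$, $j=1,2,3$, satisfying $\Psi_j(0)=1$ and $\|\tau\Psi_j(i\tau\Delta)\Delta\|\le1$.
   Context: $\varphi_1(\sigma)=\frac{e^\sigma-1}\sigma$; functions of $\Delta$ are Fourier multipliers on $\mathbb T^d$, and $\varphi_j(-2i\tau\Delta)$ acts only on the function $\overline{u^\ell}$ (or $e^{i\tau\Delta}\overline{u^\ell}$) it precedes. **General scheme.** The $k$-th Fourier coefficient of one step from $v$ is $$U_k^{n,r}(\tau,v)=\sum_T\frac{\Upsilon^p(\lambda_kT)(v)}{S(T)}\,\Pi^n\big(\mathcal D^r(\mathcal I_{(\mathfrak t_1,0)}(\lambda_kT))\big)(\tau),$$ with $r$ the order parameter and $n\in\mathbb N$ the regularity assumed a priori. Here edges of decorated trees carry $(\mathfrak t,p)$, $\mathfrak t\in\{\mathfrak t_1,\mathfrak t_2\}$, $p\in\{0,1\}$; $\mathcal I_o(\lambda_kF)$ joins the roots of the forest $F$ into a node with frequency $k\in\mathbb Z^d$ and grafts it by an edge $o$ onto a new root; $\mathbf 1$ is the empty forest; $k^2=|k|^2$; $P_{\mathfrak t_1}(k)=-k^2$, $P_{\mathfrak t_2}(k)=k^2$ and $P_{(\mathfrak t,p)}(k)=(-1)^pP_{\mathfrak t}((-1)^pk)$. For $r=1$ the sum runs over the following trees, with all $k_i\in\mathbb Z^d$ satisfying the stated relation: $T_0=\mathbf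 1$; $T_1=\mathcal I_{(\mathfrak t_2,0)}(\lambda_k\mathcal I_{(\mathfrak t_1,1)}(\lambda_{k_1})\mathcal I_{(\mathfrak t_1,0)}(\lambda_{k_2})\mathcal I_{(\mathfrak t_1,0)}(\lambda_{k_3}))$, $k=-k_1+k_2+k_3$; $T_2=\mathcal I_{(\mathfrak t_2,0)}(\lambda_k\mathcal I_{(\mathfrak t_1,1)}(\lambda_{k_4})\mathcal I_{(\mathfrak t_1,0)}(\lambda_{-k_1+k_2+k_3}T_1)\mathcal I_{(\mathfrak t_1,0)}(\lambda_{k_5}))$, $k=-k_1+k_2+k_3-k_4+k_5$; $T_3=\mathcal I_{(\mathfrak t_2,0)}(\lambda_k\mathcal I_{(\mathfrak t_1,0)}(\lambda_{k_4})\mathcal I_{(\mathfrak t_1,1)}(\lambda_{-k_1+k_2+k_3}\overline{T_1})\mathcal I_{(\mathfrak t_1,0)}(\lambda_{k_5}))$, $k=k_1-k_2-k_3+k_4+k_5$, where inside $T_2,T_3$ the tree $T_1$ has frequency $-k_1+k_2+k_3$ and $\overline{T_1}$ is $T_1$ with the second component of every edge decoration flipped. The coefficients are $\Upsilon^p(\lambda_kT_0)(v)=\hat v_k$, $\Upsilon^p(\lambda_kT_1)(v)=2\overline{\hat v_{k_1}}\hat v_{k_2}\hat v_{k_3}$, $\Upsilon^p(\lambda_kT_2)(v)=4\overline{\hat v_{k_1}}\hat v_{k_2}\hat v_{k_3}\overline{\hat v_{k_4}}\hat v_{k_5}$, $\Upsilon^p(\lambda_kT_3)(v)=4\hat v_{k_1}\overline{\hat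 v_{k_2}}\,\overline{\hat v_{k_3}}\hat v_{k_4}\hat v_{k_5}$, and the symmetry factors are $S(T_0)=1$, $S(T_1)=S(T_2)=2$, $S(T_3)=4$. $\mathcal D^r$ marks a tree with the order $r$ (and sends it to $0$ if it has more than $r+1$ edges of type $\mathfrak t_2$ on a path to the root). $\Pi^n$ is multiplicative over forests, $\Pi^n\mathcal D^r(\mathbf 1)=1$, $\Pi^n(\mathcal D^r\mathcal I_{(\mathfrak t_1,p)}(\lambda_kF))(\tau)=e^{i\tau P_{(\mathfrak t_1,p)}(k)}(\Pi^n\mathcal D^rF)(\tau)$, $\Pi^n(\mathcal D^r\mathcal I_{(\mathfrak t_2,p)}(\lambda_kF))=\mathcal K^{k,r}_{(\mathfrak t_2,p)}(\Pi^n\mathcal D^{r-1}F,n)$. For $G(\xi)=\xi^qe^{i\xi Q}$, $Q$ a polynomial in the frequencies, write $P_{(\mathfrak t_2,p)}(k)+Q=\mathcal L_{\mathrm{dom}}+\mathcal L_{\mathrm{low}}$, where, if the highest monomials are of the form $a\sum_i(a_ik_i)^m$ ($a\in\mathbb Z$, $a_i\in\{0,1\}$), $\mathcal L_{\mathrm{dom}}=a(\sum_ia_ik_i)^m$, and $\mathcal L_{\mathrm{dom}}=0$ otherwise (for $T_1$: $\mathcal L_{\mathrm{dom}}=2k_1^2$, $\mathcal L_{\mathrm{low}}=-2k_1(k_2+k_3)+2k_2k_3$). Let $\deg$ be the largest power of a single $k_i$ in a polynomial, $f=e^{i\xi\mathcal L_{\mathrm{dom}}}$, $g=e^{i\xi\mathcal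 L_{\mathrm{low}}}$, $\tilde g=fg$, $c_p=-i(-1)^p$. Then $\mathcal K^{k,r}_{(\mathfrak t_2,p)}(G,n)(\tau)$ is $0$ if $r<q$; $c_p\sum_{\ell\le r-q}\frac{\tilde g^{(\ell)}(0)}{\ell!}\int_0^\tau\xi^{\ell+q}d\xi$ if $n\ge\deg(\mathcal L_{\mathrm{dom}}^{r+1})$; and otherwise $c_p\sum_{\ell\le r-q}\frac{g^{(\ell)}(0)}{\ell!}\Psi_\ell(\tau)$, with $\Psi_\ell=\int_0^\tau\xi^{\ell+q}f\,d\xi$ if $(r-q-\ell+1)\deg\mathcal L_{\mathrm{dom}}+\ell\deg\mathcal L_{\mathrm{low}}>n$ and $\Psi_\ell=\sum_{m\le r-q-\ell}\frac{f^{(m)}(0)}{m!}\int_0^\tau\xi^{\ell+m+q}d\xi$ otherwise; $\mathcal K$ is extended linearly. For stability, in practice $g'(0)$ is replaced by the difference quotient $\frac{g(\tau)-g(0)}\tau$ (used in (i), (ii)), or filter functions $\Psi$ are inserted (used in (iii)). Forms (i), (ii), (iii) correspond to $n=2$, $n=3$, $n\ge4$. **Local error.** $\varphi^\tau(v)=u(\tau)$ is the exact solution with initial value $v$ and $\Phi^\tau(v)=u^1$ one step of the scheme with $u^0=v$. Local error of order $\mathcal O(\tau^\gamma\tilde{\mathcal L}u)$ means that in a suitable norm (e.g. a Sobolev norm) $\|\varphi^\tau(v)-\Phi^\tau(v)\|\le C\tau^\gamma\sup_{0\le t\le\tau}\|q(\tilde{\mathcal L}\varphi^t(v))\|$ for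 some polynomial $q$ and a constant $C$ independent of $\tau$. *)

theory Defs
  imports "HOL-Analysis.Analysis" "HOL-Library.Poly_Mapping"
    "HOL-Computational_Algebra.Polynomial"
begin

section \<open>Functions on the torus\<close>

text \<open>The torus is \<open>(\<real>/2\<pi>\<int>)\<^sup>d\<close> with \<open>d = CARD('d)\<close>; functions on it are
  \<open>2\<pi>\<close>-periodic functions on \<^typ>\<open>real ^ 'd\<close>, frequencies are elements of \<^typ>\<open>int ^ 'd\<close>.\<close>

definition rvec :: "int ^ 'd \<Rightarrow> real ^ 'd" where
  "rvec k = (\<chi> a. real_of_int (k $ a))"

definition mode :: "int ^ 'd::finite \<Rightarrow> real ^ 'd \<Rightarrow> complex" where
  "mode k x = exp (\<i> * complex_of_real (rvec k \<bullet> x))"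

definition fourier_coeff :: "(real ^ 'd::finite \<Rightarrow> complex) \<Rightarrow> int ^ 'd \<Rightarrow> complex" where
  "fourier_coeff f k =
     integral (cbox 0 (\<chi> a. 2 * pi)) (\<lambda>x. f x * mode (- k) x) / of_real ((2 * pi) ^ CARD('d))"

definition periodic_fun :: "(real ^ 'd::finite \<Rightarrow> complex) \<Rightarrow> bool" where
  "periodic_fun f \<longleftrightarrow> (\<forall>x a. f (x + axis a (2 * pi)) = f x)"

text \<open>The space \<open>H\<^sup>s\<close>. It is only used for \<open>s > d/2\<close>, where every class has a unique continuous
  representative; the elements below are these representatives.\<close>

definition sobolev :: "real \<Rightarrow> (real ^ 'd::finite \<Rightarrow> complex) set" where
  "sobolev s = {f. periodic_fun f \<and> continuous_on UNIV f \<and>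
     (\<lambda>k. (1 + (norm (rvec k))\<^sup>2) powr s * (cmod (fourier_coeff f k))\<^sup>2) summable_on UNIV}"

definition sobolev_norm :: "real \<Rightarrow> (real ^ 'd::finite \<Rightarrow> complex) \<Rightarrow> real" where
  "sobolev_norm s f =
     sqrt (\<Sum>\<^sub>\<infinity>k. (1 + (norm (rvec k))\<^sup>2) powr s * (cmod (fourier_coeff f k))\<^sup>2)"

definition multiplier ::
  "(int ^ 'd::finite \<Rightarrow> complex) \<Rightarrow> (real ^ 'd \<Rightarrow> complex) \<Rightarrow> real ^ 'd \<Rightarrow> complex" where
  "multiplier a f = (\<lambda>x. \<Sum>\<^sub>\<infinity>k. a k * fourier_coeff f k * mode k x)"

text \<open>\<open>lapfun h\<close> is the operator \<open>h(\<Delta>)\<close>.\<close>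

definition lapfun ::
  "(complex \<Rightarrow> complex) \<Rightarrow> (real ^ 'd::finite \<Rightarrow> complex) \<Rightarrow> real ^ 'd \<Rightarrow> complex" where
  "lapfun h = multiplier (\<lambda>k. h (- of_real ((norm (rvec k))\<^sup>2)))"

abbreviation laplace :: "(real ^ 'd::finite \<Rightarrow> complex) \<Rightarrow> real ^ 'd \<Rightarrow> complex" where
  "laplace \<equiv> lapfun (\<lambda>z. z)"

abbreviation free_flow :: "real \<Rightarrow> (real ^ 'd::finite \<Rightarrow> complex) \<Rightarrow> real ^ 'd \<Rightarrow> complex" where
  "free_flow \<tau> \<equiv> lapfun (\<lambda>z. exp (\<i> * of_real \<tau> * z))"

definition partial :: "'d \<Rightarrow> (real ^ 'd::finite \<Rightarrow> complex) \<Rightarrow> real ^ 'd \<Rightarrow> complex" where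
  "partial a = multiplier (\<lambda>k. \<i> * of_int (k $ a))"

definition grad3_norm :: "real \<Rightarrow> (real ^ 'd::finite \<Rightarrow> complex) \<Rightarrow> real" where
  "grad3_norm s f =
     sqrt (\<Sum>a\<in>UNIV. \<Sum>b\<in>UNIV. \<Sum>c\<in>UNIV. (sobolev_norm s (partial a (partial b (partial c f))))\<^sup>2)"


section \<open>Exact solutions and the local error\<close>

definition nls_solution :: "real \<Rightarrow> real \<Rightarrow> (real \<Rightarrow> real ^ 'd::finite \<Rightarrow> complex) \<Rightarrow> bool" where
  "nls_solution \<sigma> T u \<longleftrightarrow>
     (\<forall>t\<in>{0..T}. u t \<in> sobolev \<sigma> \<and>
        ((\<lambda>r. sobolev_norm \<sigma> (\<lambda>x. u r x - u t x)) \<longlongrightarrow> 0) (at t within {0..T}) \<and>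
        (\<forall>x. \<exists>w. ((\<lambda>r. u r x) has_vector_derivative w) (at t within {0..T}) \<and>
             \<i> * w + laplace (u t) x = of_real ((cmod (u t x))\<^sup>2) * u t x))"

text \<open>Local error of order \<open>\<O>(\<tau>\<^sup>\<gamma> L u)\<close>, measured in \<open>H\<^sup>s\<close>, of the one-step map \<open>\<Phi>\<close> along
  solutions in \<open>C([0,\<tau>], H\<^sup>\<sigma>)\<close>. The argument \<open>Lnorm\<close> is \<open>u \<mapsto> \<parallel>L u\<parallel>\<close>. The polynomial is applied
  to \<open>\<parallel>u\<parallel> + \<parallel>L u\<parallel>\<close>: for spatially constant \<open>u\<close> one has \<open>L u = 0\<close> while the error grows with
  \<open>u\<close>, so \<open>L u\<close> alone cannot control it. The constant and the polynomial depend neither on the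
  step size nor on the solution.\<close>

definition local_error_order ::
  "real \<Rightarrow> real \<Rightarrow> (real \<Rightarrow> (real ^ 'd::finite \<Rightarrow> complex) \<Rightarrow> real ^ 'd \<Rightarrow> complex) \<Rightarrow> nat \<Rightarrow>
     ((real ^ 'd \<Rightarrow> complex) \<Rightarrow> real) \<Rightarrow> bool" where
  "local_error_order s \<sigma> \<Phi> \<gamma> Lnorm \<longleftrightarrow>
     (\<exists>(C::real) (q::real poly). \<forall>\<tau>>0. \<forall>u. nls_solution \<sigma> \<tau> u \<longrightarrow>
        (\<lambda>x. u \<tau> x - \<Phi> \<tau> (u 0) x) \<in> sobolev s \<and>
        sobolev_norm s (\<lambda>x. u \<tau> x - \<Phi> \<tau> (u 0) x)
          \<le> C * \<tau> ^ \<gamma> * (SUP t\<in>{0..\<tau>}. poly q (sobolev_norm s (u t) + Lnorm (u t))))"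


section \<open>The general resonance based scheme\<close>

text \<open>Polynomials with integer coefficients in the formal frequencies \<open>k\<^sub>1, k\<^sub>2, \<dots>\<close>.\<close>

type_synonym fpoly = "(nat \<Rightarrow>\<^sub>0 nat) \<Rightarrow>\<^sub>0 int"

definition X :: "nat \<Rightarrow> fpoly" where
  "X i = Poly_Mapping.single (Poly_Mapping.single i 1) 1"

definition peval :: "(nat \<Rightarrow> int) \<Rightarrow> fpoly \<Rightarrow> int" where
  "peval x p = (\<Sum>m\<in>Poly_Mapping.keys p. Poly_Mapping.lookup p m *
      (\<Prod>i\<in>Poly_Mapping.keys m. x i ^ Poly_Mapping.lookup m i))"

text \<open>Values at frequencies \<open>\<kappa> i \<in> \<int>\<^sup>d\<close>: \<open>vec_eval\<close> for linear forms; \<open>quad_eval\<close> for quadratic forms,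
  where the product \<open>k\<^sub>i k\<^sub>j\<close> stands for the inner product (hence the sum over the coordinates).
  All phases below are quadratic forms.\<close>

definition vec_eval :: "(nat \<Rightarrow> int ^ 'd) \<Rightarrow> fpoly \<Rightarrow> int ^ 'd" where
  "vec_eval \<kappa> p = (\<chi> a. peval (\<lambda>i. \<kappa> i $ a) p)"

definition quad_eval :: "(nat \<Rightarrow> int ^ 'd::finite) \<Rightarrow> fpoly \<Rightarrow> real" where
  "quad_eval \<kappa> p = real_of_int (\<Sum>a\<in>UNIV. peval (\<lambda>i. \<kappa> i $ a) p)"

definition pdeg :: "fpoly \<Rightarrow> nat" where
  "pdeg p = Max (insert 0 {Poly_Mapping.lookup m i | m i.
      m \<in> Poly_Mapping.keys p \<and> i \<in> Poly_Mapping.keys m})"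

definition highest_part :: "fpoly \<Rightarrow> fpoly" where
  "highest_part p = (\<Sum>m | m \<in> Poly_Mapping.keys p \<and> (\<exists>i. Poly_Mapping.lookup m i = pdeg p).
      Poly_Mapping.single m (Poly_Mapping.lookup p m))"

text \<open>The coefficients \<open>a\<^sub>i \<in> {0,1}\<close> are encoded by the set \<open>S\<close> of those \<open>i\<close> with \<open>a\<^sub>i = 1\<close>.\<close>

definition is_ldom :: "fpoly \<Rightarrow> fpoly \<Rightarrow> bool" where
  "is_ldom p L \<longleftrightarrow> pdeg p > 0 \<and> (\<exists>(a::int) S. finite S \<and>
      highest_part p = of_int a * (\<Sum>i\<in>S. X i ^ pdeg p) \<and>
      L = of_int a * (\<Sum>i\<in>S. X i) ^ pdeg p)"

definition ldom :: "fpoly \<Rightarrow> fpoly" where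
  "ldom p = (if \<exists>L. is_ldom p L then THE L. is_ldom p L else 0)"

datatype edge_type = E1 | E2

text \<open>\<open>Graft t p k F\<close> is \<open>\<I>\<^bsub>(t,p)\<^esub>(\<lambda>\<^sub>k F)\<close>; a forest is a list of such planted trees.\<close>

datatype dtree = Graft edge_type nat fpoly "dtree list"

fun phase_t :: "edge_type \<Rightarrow> fpoly \<Rightarrow> fpoly" where
  "phase_t E1 k = - (k ^ 2)"
| "phase_t E2 k = k ^ 2"

definition phase :: "edge_type \<Rightarrow> nat \<Rightarrow> fpoly \<Rightarrow> fpoly" where
  "phase t p k = (- 1) ^ p * phase_t t ((- 1) ^ p * k)"

fun flip :: "dtree \<Rightarrow> dtree" where
  "flip (Graft t p k F) = Graft t (1 - p) k (map flip F)"

fun depth2 :: "dtree \<Rightarrow> nat" where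
  "depth2 (Graft t p k F) = (if t = E2 then 1 else 0) + Max (insert 0 (set (map depth2 F)))"

text \<open>For fixed values \<open>\<kappa>\<close> of the frequencies, a list of triples \<open>(c,q,Q)\<close> represents the function
  \<open>\<xi> \<mapsto> \<Sum> c \<xi>\<^sup>q e\<^bsup>i\<xi>Q\<^esup>\<close>. The exponents \<open>Q\<close> have to be kept as formal polynomials, since the
  splitting into dominant and lower part depends on their form and not on their values.\<close>

type_synonym osc = "(complex \<times> nat \<times> fpoly) list"

definition osc_eval :: "(nat \<Rightarrow> int ^ 'd::finite) \<Rightarrow> osc \<Rightarrow> real \<Rightarrow> complex" where
  "osc_eval \<kappa> G \<xi> =
     (\<Sum>(c, q, Q)\<leftarrow>G. c * of_real \<xi> ^ q * exp (\<i> * of_real (\<xi> * quad_eval \<kappa> Q)))"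

definition osc_scale :: "complex \<Rightarrow> osc \<Rightarrow> osc" where
  "osc_scale c G = map (\<lambda>(b, q, Q). (c * b, q, Q)) G"

definition osc_mult :: "osc \<Rightarrow> osc \<Rightarrow> osc" where
  "osc_mult G H = [(a * b, p + q, P + Q). (a, p, P) \<leftarrow> G, (b, q, Q) \<leftarrow> H]"

text \<open>\<open>\<integral>\<^sub>0\<^sup>\<tau> \<xi>\<^sup>j d\<xi>\<close> and \<open>\<integral>\<^sub>0\<^sup>\<tau> \<xi>\<^sup>j e\<^bsup>i\<xi>L\<^esup> d\<xi>\<close> as functions of \<open>\<tau>\<close>; see \<open>osc_integral\<close> below.\<close>

definition mono_int :: "nat \<Rightarrow> osc" where
  "mono_int j = [(1 / of_nat (Suc j), Suc j, 0)]"

fun osc_int :: "(nat \<Rightarrow> int ^ 'd::finite) \<Rightarrow> fpoly \<Rightarrow> nat \<Rightarrow> osc" where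
  "osc_int \<kappa> L j =
     (if quad_eval \<kappa> L = 0 then mono_int j
      else let b = 1 / (\<i> * of_real (quad_eval \<kappa> L)) in
        case j of
          0 \<Rightarrow> [(b, 0, L), (- b, 0, 0)]
        | Suc j' \<Rightarrow> (b, j, L) # osc_scale (- of_nat j * b) (osc_int \<kappa> L j'))"

declare osc_int.simps [simp del]

lemma peval_0 [simp]: "peval x 0 = 0"
  by (simp add: peval_def)

lemma quad_eval_0 [simp]: "quad_eval \<kappa> 0 = 0"
  by (simp add: quad_eval_def)

lemma osc_eval_Nil [simp]: "osc_eval \<kappa> [] \<xi> = 0"
  by (simp add: osc_eval_def)

lemma osc_eval_Cons [simp]:
  "osc_eval \<kappa> ((c, q, Q) # G) \<xi> =
     c * of_real \<xi> ^ q * exp (\<i> * of_real (\<xi> * quad_eval \<kappa> Q)) + osc_eval \<kappa> G \<xi>"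
  by (simp add: osc_eval_def)

lemma osc_eval_scale [simp]: "osc_eval \<kappa> (osc_scale c G) \<xi> = c * osc_eval \<kappa> G \<xi>"
  by (induction G) (auto simp: osc_scale_def osc_eval_def algebra_simps)

lemma osc_eval_mono_int:
  "osc_eval \<kappa> (mono_int j) \<xi> = of_real \<xi> ^ Suc j / of_nat (Suc j)"
  by (simp add: mono_int_def)

lemma osc_int_zero: "osc_eval \<kappa> (osc_int \<kappa> L j) 0 = 0"
proof (induction j)
  case 0
  then show ?case by (subst osc_int.simps) (simp add: osc_eval_mono_int Let_def)
next
  case (Suc j)
  then show ?case by (subst osc_int.simps) (simp add: osc_eval_mono_int Let_def)
qed

lemma osc_int_deriv:
  "((\<lambda>t. osc_eval \<kappa> (osc_int \<kappa> L j) t) has_vector_derivative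
     of_real \<xi> ^ j * exp (\<i> * of_real (\<xi> * quad_eval \<kappa> L))) (at \<xi> within A)"
proof (cases "quad_eval \<kappa> L = 0")
  case True
  then have "osc_eval \<kappa> (osc_int \<kappa> L j) = (\<lambda>t. of_real (t ^ Suc j / real (Suc j)))"
    by (subst osc_int.simps) (auto simp: osc_eval_mono_int)
  moreover have "((\<lambda>t. of_real (t ^ Suc j / real (Suc j)) :: complex) has_vector_derivative
      of_real (\<xi> ^ j)) (at \<xi> within A)"
    by (rule has_vector_derivative_of_real)
      (auto intro!: derivative_eq_intros simp: field_simps simp del: power_Suc of_nat_Suc)
  ultimately show ?thesis using True by simp
next
  case False
  define l where "l = quad_eval \<kappa> L"
  have l: "l \<noteq> 0" using False by (simp add: l_def)
  have e: "((\<lambda>t. exp (\<i> * of_real (t * l))) has_vector_derivative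
      \<i> * of_real l * exp (\<i> * of_real (\<xi> * l))) (at \<xi> within A)" for \<xi>
  proof -
    have "((\<lambda>z. exp (\<i> * (z * of_real l))) has_field_derivative
        \<i> * of_real l * exp (\<i> * (of_real \<xi> * of_real l))) (at (of_real \<xi>))"
      by (auto intro!: derivative_eq_intros)
    from has_vector_derivative_real_field[OF this] show ?thesis
      by (auto intro: has_vector_derivative_at_within)
  qed
  show ?thesis
  proof (induction j)
    case 0
    have eq: "osc_eval \<kappa> (osc_int \<kappa> L 0) =
        (\<lambda>t. 1 / (\<i> * of_real l) * exp (\<i> * of_real (t * l)) + - (1 / (\<i> * of_real l)))"
      using False by (subst osc_int.simps) (auto simp: Let_def l_def fun_eq_iff)
    have "((\<lambda>t. 1 / (\<i> * of_real l) * exp (\<i> * of_real (t * l)) + - (1 / (\<i> * of_real l)))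
        has_vector_derivative
        1 / (\<i> * of_real l) * (\<i> * of_real l * exp (\<i> * of_real (\<xi> * l))) + 0) (at \<xi> within A)"
      by (intro has_vector_derivative_add has_vector_derivative_mult_right e
          has_vector_derivative_const)
    then show ?case using l unfolding eq by (simp add: l_def)
  next
    case (Suc j)
    let ?b = "1 / (\<i> * of_real l)"
    have eq: "osc_eval \<kappa> (osc_int \<kappa> L (Suc j)) =
        (\<lambda>t. ?b * (of_real (t ^ Suc j) * exp (\<i> * of_real (t * l)))
             + (- of_nat (Suc j) * ?b) * osc_eval \<kappa> (osc_int \<kappa> L j) t)"
      using False by (subst osc_int.simps) (auto simp: Let_def l_def fun_eq_iff)
    have p: "((\<lambda>t. of_real (t ^ Suc j) :: complex) has_vector_derivative
        of_real (real (Suc j) * \<xi> ^ j)) (at \<xi> within A)"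
      by (rule has_vector_derivative_of_real)
        (auto intro!: derivative_eq_intros simp del: power_Suc of_nat_Suc)
    have "((\<lambda>t. ?b * (of_real (t ^ Suc j) * exp (\<i> * of_real (t * l)))
             + (- of_nat (Suc j) * ?b) * osc_eval \<kappa> (osc_int \<kappa> L j) t) has_vector_derivative
        ?b * (of_real (\<xi> ^ Suc j) * (\<i> * of_real l * exp (\<i> * of_real (\<xi> * l)))
              + of_real (real (Suc j) * \<xi> ^ j) * exp (\<i> * of_real (\<xi> * l)))
          + (- of_nat (Suc j) * ?b) * (of_real \<xi> ^ j * exp (\<i> * of_real (\<xi> * l))))
        (at \<xi> within A)"
      using Suc.IH unfolding l_def [symmetric]
      by (intro has_vector_derivative_add has_vector_derivative_mult_right
          has_vector_derivative_mult p e) 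
    moreover have "?b * (of_real (\<xi> ^ Suc j) * (\<i> * of_real l * exp (\<i> * of_real (\<xi> * l)))
              + of_real (real (Suc j) * \<xi> ^ j) * exp (\<i> * of_real (\<xi> * l)))
          + (- of_nat (Suc j) * ?b) * (of_real \<xi> ^ j * exp (\<i> * of_real (\<xi> * l)))
        = of_real \<xi> ^ Suc j * exp (\<i> * of_real (\<xi> * l))"
      using l by (simp add: field_simps)
    ultimately show ?case unfolding eq l_def by simp
  qed
qed

lemma osc_integral:
  assumes "0 \<le> \<tau>"
  shows "((\<lambda>\<xi>. of_real \<xi> ^ j * exp (\<i> * of_real (\<xi> * quad_eval \<kappa> L)))
           has_integral osc_eval \<kappa> (osc_int \<kappa> L j) \<tau>) {0..\<tau>}"
  using fundamental_theorem_of_calculus[OF assms osc_int_deriv[where \<kappa> = \<kappa> and L = L and j = j]]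
  by (simp add: osc_int_zero)

text \<open>The argument \<open>sl\<close> maps the value of the lower part to the number used as \<open>g'(0)\<close>: the true
  derivative for \<open>exact_slope\<close>, the difference quotient over one step for \<open>quotient_slope \<tau>\<close>.\<close>

definition exact_slope :: "real \<Rightarrow> complex" where
  "exact_slope l = \<i> * of_real l"

definition quotient_slope :: "real \<Rightarrow> real \<Rightarrow> complex" where
  "quotient_slope \<tau> l = (exp (\<i> * of_real (\<tau> * l)) - 1) / of_real \<tau>"

text \<open>The operator \<open>\<K>\<close> of order \<open>r\<close> applied to \<open>c \<xi>\<^sup>q e\<^bsup>i\<xi>Q\<^esup>\<close>; the derivatives at \<open>0\<close> are
  \<open>(i R)\<^sup>l\<close>, \<open>(i L\<^sub>l\<^sub>o\<^sub>w)\<^sup>l\<close> and \<open>(i L\<^sub>d\<^sub>o\<^sub>m)\<^sup>m\<close>. The order is an integer because it drops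
  to \<open>-1\<close> inside a tree.\<close>

definition Kop_term ::
  "(nat \<Rightarrow> int ^ 'd::finite) \<Rightarrow> (real \<Rightarrow> complex) \<Rightarrow> nat \<Rightarrow> int \<Rightarrow> nat \<Rightarrow> fpoly \<Rightarrow>
     complex \<times> nat \<times> fpoly \<Rightarrow> osc" where
  "Kop_term \<kappa> sl n r p k = (\<lambda>(c, q, Q).
     let R = phase E2 p k + Q; Ld = ldom R; Ll = R - Ld;
         cp = - \<i> * (- 1) ^ p; N = nat (r - int q)
     in if r < int q then []
        else if n \<ge> pdeg (Ld ^ nat (r + 1)) then
          concat (map (\<lambda>l. osc_scale (c * cp * (\<i> * of_real (quad_eval \<kappa> R)) ^ l / fact l)
                               (mono_int (l + q))) [0..<Suc N])
        else
          concat (map (\<lambda>l. osc_scale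
              (c * cp * (if l = 1 then sl (quad_eval \<kappa> Ll)
                         else (\<i> * of_real (quad_eval \<kappa> Ll)) ^ l) / fact l)
              (if (N - l + 1) * pdeg Ld + l * pdeg Ll > n then osc_int \<kappa> Ld (l + q)
               else concat (map (\<lambda>m. osc_scale ((\<i> * of_real (quad_eval \<kappa> Ld)) ^ m / fact m)
                                         (mono_int (l + m + q))) [0..<Suc (N - l)])))
            [0..<Suc N]))"

text \<open>\<open>Pi_tree \<kappa> sl n r T\<close> is \<open>\<Pi>\<^sup>n(\<D>\<^sup>r T)\<close>.\<close>

fun Pi_tree ::
  "(nat \<Rightarrow> int ^ 'd::finite) \<Rightarrow> (real \<Rightarrow> complex) \<Rightarrow> nat \<Rightarrow> int \<Rightarrow> dtree \<Rightarrow> osc" where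
  "Pi_tree \<kappa> sl n r (Graft t p k F) =
     (if int (depth2 (Graft t p k F)) > r + 1 then []
      else case t of
        E1 \<Rightarrow> osc_mult [(1, 0, phase E1 p k)]
                (foldr osc_mult (map (\<lambda>T. Pi_tree \<kappa> sl n r T) F) [(1, 0, 0)])
      | E2 \<Rightarrow> concat (map (Kop_term \<kappa> sl n r p k)
                (foldr osc_mult (map (\<lambda>T. Pi_tree \<kappa> sl n (r - 1) T) F) [(1, 0, 0)])))"

text \<open>The trees \<open>T\<^sub>0, \<dots>, T\<^sub>3\<close> occurring for \<open>r = 1\<close>, in the formal frequencies
  \<open>k\<^sub>1, \<dots>, k\<^sub>5\<close>. The free frequency \<open>k\<close> of \<open>T\<^sub>0\<close> is called \<open>k\<^sub>1\<close>.\<close>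

datatype shape = S0 | S1 | S2 | S3

fun nvars :: "shape \<Rightarrow> nat" where
  "nvars S0 = 1" | "nvars S1 = 3" | "nvars S2 = 5" | "nvars S3 = 5"

fun root_freq :: "shape \<Rightarrow> fpoly" where
  "root_freq S0 = X 1"
| "root_freq S1 = - X 1 + X 2 + X 3"
| "root_freq S2 = - X 1 + X 2 + X 3 - X 4 + X 5"
| "root_freq S3 = X 1 - X 2 - X 3 + X 4 + X 5"

definition tree1 :: dtree where
  "tree1 = Graft E2 0 (- X 1 + X 2 + X 3)
     [Graft E1 1 (X 1) [], Graft E1 0 (X 2) [], Graft E1 0 (X 3) []]"

fun shape_forest :: "shape \<Rightarrow> dtree list" where
  "shape_forest S0 = []"
| "shape_forest S1 = [tree1]"
| "shape_forest S2 = [Graft E2 0 (root_freq S2)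
     [Graft E1 1 (X 4) [], Graft E1 0 (- X 1 + X 2 + X 3) [tree1], Graft E1 0 (X 5) []]]"
| "shape_forest S3 = [Graft E2 0 (root_freq S3)
     [Graft E1 0 (X 4) [], Graft E1 1 (- X 1 + X 2 + X 3) [flip tree1], Graft E1 0 (X 5) []]]"

text \<open>\<open>\<Upsilon>\<^sup>p\<close> (as a function of the Fourier coefficients \<open>w\<close> of \<open>v\<close>) and the symmetry factor \<open>S\<close>.\<close>

fun upsilon :: "(int ^ 'd \<Rightarrow> complex) \<Rightarrow> shape \<Rightarrow> (nat \<Rightarrow> int ^ 'd) \<Rightarrow> complex" where
  "upsilon w S0 \<kappa> = w (\<kappa> 1)"
| "upsilon w S1 \<kappa> = 2 * cnj (w (\<kappa> 1)) * w (\<kappa> 2) * w (\<kappa> 3)"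
| "upsilon w S2 \<kappa> = 4 * cnj (w (\<kappa> 1)) * w (\<kappa> 2) * w (\<kappa> 3) * cnj (w (\<kappa> 4)) * w (\<kappa> 5)"
| "upsilon w S3 \<kappa> = 4 * w (\<kappa> 1) * cnj (w (\<kappa> 2)) * cnj (w (\<kappa> 3)) * w (\<kappa> 4) * w (\<kappa> 5)"

fun symfactor :: "shape \<Rightarrow> nat" where
  "symfactor S0 = 1" | "symfactor S1 = 2" | "symfactor S2 = 2" | "symfactor S3 = 4"

text \<open>The decorated trees with root frequency \<open>k\<close>: a shape and values of its frequencies (set to
  \<open>0\<close> at the indices which do not occur).\<close>

definition trees :: "int ^ 'd \<Rightarrow> (shape \<times> (nat \<Rightarrow> int ^ 'd)) set" where
  "trees k = {(S, \<kappa>). vec_eval \<kappa> (root_freq S) = k \<and> (\<forall>i. i \<notin> {1..nvars S} \<longrightarrow> \<kappa> i = 0)}"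

definition scheme_term ::
  "(real \<Rightarrow> complex) \<Rightarrow> nat \<Rightarrow> real \<Rightarrow> (real ^ 'd::finite \<Rightarrow> complex) \<Rightarrow>
     shape \<times> (nat \<Rightarrow> int ^ 'd) \<Rightarrow> complex" where
  "scheme_term sl n \<tau> v = (\<lambda>(S, \<kappa>).
     upsilon (fourier_coeff v) S \<kappa> / of_nat (symfactor S) *
     osc_eval \<kappa> (Pi_tree \<kappa> sl n 1 (Graft E1 0 (root_freq S) (shape_forest S))) \<tau>)"

text \<open>\<open>U\<^sub>k\<^sup>n\<^sup>,\<^sup>r(\<tau>, v)\<close> for \<open>r = 1\<close>.\<close>

definition general_scheme ::
  "(real \<Rightarrow> complex) \<Rightarrow> nat \<Rightarrow> real \<Rightarrow> (real ^ 'd::finite \<Rightarrow> complex) \<Rightarrow> int ^ 'd \<Rightarrow> complex" where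
  "general_scheme sl n \<tau> v k = (\<Sum>\<^sub>\<infinity>T\<in>trees k. scheme_term sl n \<tau> v T)"

text \<open>The one-step map value \<open>w\<close> is the function with Fourier coefficients \<open>U\<^sub>k\<^sup>n\<^sup>,\<^sup>1(\<tau>, v)\<close>.\<close>

definition is_general_step ::
  "real \<Rightarrow> (real \<Rightarrow> complex) \<Rightarrow> nat \<Rightarrow> real \<Rightarrow> (real ^ 'd::finite \<Rightarrow> complex) \<Rightarrow>
     (real ^ 'd \<Rightarrow> complex) \<Rightarrow> bool" where
  "is_general_step s sl n \<tau> v w \<longleftrightarrow> w \<in> sobolev s \<and>
     (\<forall>k. scheme_term sl n \<tau> v summable_on trees k \<and>
          fourier_coeff w k = general_scheme sl n \<tau> v k)"


section \<open>The second order schemes\<close>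

text \<open>The values at \<open>0\<close> are the removable singularities.\<close>

definition phi1 :: "complex \<Rightarrow> complex" where
  "phi1 \<sigma> = (if \<sigma> = 0 then 1 else (exp \<sigma> - 1) / \<sigma>)"

definition phi2 :: "complex \<Rightarrow> complex" where
  "phi2 \<sigma> = (if \<sigma> = 0 then 1 / 2 else (exp \<sigma> - phi1 \<sigma>) / \<sigma>)"

definition scheme_i :: "real \<Rightarrow> (real ^ 'd::finite \<Rightarrow> complex) \<Rightarrow> real ^ 'd \<Rightarrow> complex" where
  "scheme_i \<tau> v = (\<lambda>x.
       free_flow \<tau> v x
     - \<i> * of_real \<tau> * free_flow \<tau>
         (\<lambda>y. (v y)\<^sup>2 * lapfun (\<lambda>z. phi1 (- 2 * \<i> * of_real \<tau> * z) - phi2 (- 2 * \<i> * of_real \<tau> * z))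
                            (\<lambda>y. cnj (v y)) y) x
     - \<i> * of_real \<tau> * (free_flow \<tau> v x)\<^sup>2 *
         lapfun (\<lambda>z. phi2 (- 2 * \<i> * of_real \<tau> * z)) (free_flow \<tau> (\<lambda>y. cnj (v y))) x
     - of_real (\<tau>\<^sup>2 / 2) * free_flow \<tau> (\<lambda>y. of_real (cmod (v y) ^ 4) * v y) x)"

definition scheme_ii :: "real \<Rightarrow> (real ^ 'd::finite \<Rightarrow> complex) \<Rightarrow> real ^ 'd \<Rightarrow> complex" where
  "scheme_ii \<tau> v = (\<lambda>x.
       free_flow \<tau> v x
     - \<i> * of_real \<tau> * free_flow \<tau>
         (\<lambda>y. (v y)\<^sup>2 * lapfun (\<lambda>z. phi1 (- 2 * \<i> * of_real \<tau> * z) - 1 / 2)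
                            (\<lambda>y. cnj (v y)) y) x
     - \<i> * of_real \<tau> / 2 * (free_flow \<tau> v x)\<^sup>2 * free_flow \<tau> (\<lambda>y. cnj (v y)) x
     - of_real (\<tau>\<^sup>2 / 2) * free_flow \<tau> (\<lambda>y. of_real (cmod (v y) ^ 4) * v y) x)"

definition scheme_iii ::
  "(complex \<Rightarrow> complex) \<Rightarrow> (complex \<Rightarrow> complex) \<Rightarrow> (complex \<Rightarrow> complex) \<Rightarrow> real \<Rightarrow>
     (real ^ 'd::finite \<Rightarrow> complex) \<Rightarrow> real ^ 'd \<Rightarrow> complex" where
  "scheme_iii \<Psi>1 \<Psi>2 \<Psi>3 \<tau> v = (\<lambda>x.
       free_flow \<tau> v x
     - \<i> * of_real \<tau> * free_flow \<tau>
         (lapfun (\<lambda>z. \<Psi>1 (\<i> * of_real \<tau> * z) - \<i> * \<Psi>2 (\<i> * of_real \<tau> * z) * (1 / 2) * of_real \<tau> * z)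
            (\<lambda>y. of_real ((cmod (v y))\<^sup>2) * v y)) x
     + of_real (\<tau>\<^sup>2 / 2) * free_flow \<tau>
         (lapfun (\<lambda>z. \<Psi>3 (\<i> * of_real \<tau> * z))
            (\<lambda>y. - (v y)\<^sup>2 * laplace (\<lambda>y. cnj (v y)) y
                 + 2 * of_real ((cmod (v y))\<^sup>2) * laplace v y
                 - of_real (cmod (v y) ^ 4) * v y)) x)"

text \<open>\<open>\<Psi>(0) = 1\<close> and \<open>\<parallel>\<tau> \<Psi>(i\<tau>\<Delta>) \<Delta>\<parallel> \<le> 1\<close> as an operator in \<open>H\<^sup>s\<close> with domain \<open>H\<^sup>s\<^sup>+\<^sup>2\<close>.
  The first argument fixes the dimension of the torus.\<close>

definition filter_function :: "'d::finite itself \<Rightarrow> real \<Rightarrow> (complex \<Rightarrow> complex) \<Rightarrow> bool" where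
  "filter_function D s \<Psi> \<longleftrightarrow> \<Psi> 0 = 1 \<and>
     (\<forall>\<tau>>0. \<forall>f :: real ^ 'd \<Rightarrow> complex. f \<in> sobolev (s + 2) \<longrightarrow>
        (\<lambda>x. of_real \<tau> * lapfun (\<lambda>z. \<Psi> (\<i> * of_real \<tau> * z)) (laplace f) x) \<in> sobolev s \<and>
        sobolev_norm s (\<lambda>x. of_real \<tau> * lapfun (\<lambda>z. \<Psi> (\<i> * of_real \<tau> * z)) (laplace f) x)
          \<le> sobolev_norm s f)"

text \<open>Suitability of filters: \<open>\<Psi>(-i\<sigma>) = 1 + \<O>(\<sigma>\<^sup>m)\<close> for \<open>\<sigma> = \<tau>|k|\<^sup>2 \<ge> 0\<close>. A second order
  local error forces \<open>m = 2\<close> for \<open>\<Psi>\<^sub>1\<close>, since this filter is multiplied by \<open>\<tau>\<close> only.\<close>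

definition consistent_filter :: "nat \<Rightarrow> (complex \<Rightarrow> complex) \<Rightarrow> bool" where
  "consistent_filter m \<Psi> \<longleftrightarrow>
     (\<exists>C. \<forall>\<sigma>\<ge>0. cmod (\<Psi> (- \<i> * of_real \<sigma>) - 1) \<le> C * \<sigma> ^ m)"

definition suitable_filters ::
  "'d::finite itself \<Rightarrow> real \<Rightarrow> (complex \<Rightarrow> complex) \<Rightarrow> (complex \<Rightarrow> complex) \<Rightarrow>
     (complex \<Rightarrow> complex) \<Rightarrow> bool" where
  "suitable_filters D s \<Psi>1 \<Psi>2 \<Psi>3 \<longleftrightarrow>
     filter_function D s \<Psi>1 \<and> filter_function D s \<Psi>2 \<and> filter_function D s \<Psi>3 \<and>
     consistent_filter 2 \<Psi>1 \<and> consistent_filter 1 \<Psi>2 \<and> consistent_filter 1 \<Psi>3"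

end

(* In the interaction picture a_k(t) = exp(i t |k|^2) u_k(t) of the Fourier coefficients, the equation
   reads a' = -i T_{exp(i t R)}(a, a, a), where T_m is the trilinear convolution with multiplier m and
   R = |k|^2 + |k1|^2 - |k2|^2 - |k3|^2 for k = -k1 + k2 + k3.  Iterating Duhamel's formula, one step of
   the flow is a(0) - i T_K(a, a, a) - (tau^2 / 2) |v|^4 v + O(tau^3) with K the integral of
   exp(i xi R) over [0, tau].  Each scheme has the same structure with K replaced by a kernel W.  Pointwise
   K - W is bounded by tau^3 times a power p of <k1> <k2> <k3> with p = 2, 3, 4 respectively, which is
   the loss of derivatives, and the algebra property of H^s for s > d/2 turns this into the
   local error bound.  On the algebraic side R = 2 k1^2 + (cross terms), so the tree T_1 has dominant
   part 2 k1^2 and its decorated integral is W; for T_2 and T_3 only a constant is integrated, and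
   their weights add up to -tau^2 + tau^2 / 2 = -tau^2 / 2. *)
theory Submission
  imports Defs
begin

section \<open>Fourier series on the torus\<close>

text \<open>The loss in (i) is only 2 because not R is Taylor expanded but its lower part l = R - 2
  |k1|^2, a sum of inner products of two different frequencies: |l| is at most a multiple of
  <k1><k2><k3>, whereas R costs the square of this product. The kernel errors are governed by l^2, l
  |k1|^2 and R^2, whence 2, 3 and 4. Freezing the phase in the quintic term costs exp(i t R) - 1 =
  O(t R), so 2 derivatives are also the price of expanding the flow itself. A solution is continuous
  in time with values in H^\<sigma>, but solves the equation only pointwise in x. Time derivatives
  are therefore taken one Fourier coefficient at a time, and a mean value inequality for coefficient
  sequences replaces Duhamel integrals in function spaces. The bounds hold for all step sizes and
  all solutions, so no smallness absorbs high powers of the norm M. The cubic term is substituted at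
  most twice, the remainder has degree at most 7 in M, and 1 + M^7 dominates all lower
  powers.\<close>

abbreviation torus_box :: "(real ^ 'd::finite) set" where
  "torus_box \<equiv> cbox 0 (\<chi> a. 2 * pi)"

section \<open>Characters and their orthogonality\<close>

lemma rvec_add [simp]: "rvec (k + l) = rvec k + rvec l"
  and rvec_uminus [simp]: "rvec (- k) = - rvec k"
  and rvec_diff [simp]: "rvec (k - l) = rvec k - rvec l"
  and rvec_0 [simp]: "rvec 0 = 0"
  by (simp_all add: rvec_def vec_eq_iff)

lemma mode_add: "mode (k + l) x = mode k x * mode l x"
  by (simp add: mode_def inner_add_left exp_add [symmetric] algebra_simps)

lemma mode_0 [simp]: "mode 0 x = 1"
  by (simp add: mode_def)

lemma norm_mode [simp]: "cmod (mode k x) = 1"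
  by (simp add: mode_def)

lemma cnj_mode: "cnj (mode k x) = mode (- k) x"
  by (simp add: mode_def exp_cnj)

lemma continuous_mode [continuous_intros]: "continuous_on A (mode k)"
  unfolding mode_def [abs_def] by (intro continuous_intros)

lemma periodic_mode: "periodic_fun (mode k)"
proof -
  have "mode k (x + axis a (2 * pi)) = mode k x" for x a
  proof -
    have "\<i> * complex_of_real (rvec k \<bullet> (x + axis a (2 * pi))) =
        \<i> * complex_of_real (rvec k \<bullet> x) + 2 * of_real pi * of_int (k $ a) * \<i>"
      by (simp add: inner_add_right inner_axis rvec_def distrib_left mult_ac)
    also have "exp \<dots> = exp (\<i> * complex_of_real (rvec k \<bullet> x)) * exp (2 * of_real pi * of_int (k $ a) * \<i>)"
      by (rule exp_add)
    also have "exp (2 * of_real pi * of_int (k $ a) * \<i>) = 1"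
      using exp_integer_2pi[of "of_int (k $ a)"] by (simp add: mult_ac)
    finally show ?thesis by (simp add: mode_def)
  qed
  then show ?thesis by (simp add: periodic_fun_def)
qed

lemma Basis_cart_real: "(Basis :: (real ^ 'd) set) = range (\<lambda>i. axis i 1)"
  by (auto simp: Basis_vec_def)

lemma content_torus_box: "measure lborel (torus_box :: (real ^ 'd) set) = (2 * pi) ^ CARD('d::finite)"
  by (subst content_cbox_cart) (auto simp: interval_ne_empty_cart(1))

text \<open>The antiderivative takes the same value at both ends because n is an integer. The
  integral is a Lebesgue integral over the whole line with an indicator, the form in which it occurs
  as a factor of a product integral.\<close>

lemma integral_exp_period:
  fixes n :: int
  shows "(LINT t|lborel. indicator {0..2*pi} t *\<^sub>R exp (\<i> * of_real (real_of_int n * t))) =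
    (if n = 0 then complex_of_real (2 * pi) else 0)"
proof (cases "n = 0")
  case True
  then show ?thesis by (simp add: scaleR_conv_of_real)
next
  case False
  let ?f = "\<lambda>t. exp (\<i> * of_real (real_of_int n * t))"
  have d: "((\<lambda>t. 1 / (\<i> * of_int n) * ?f t) has_vector_derivative ?f t) (at t within {0..2*pi})" for t
  proof -
    have "((\<lambda>z. 1 / (\<i> * of_int n) * exp (\<i> * (of_int n * z))) has_field_derivative
        exp (\<i> * (of_int n * of_real t))) (at (of_real t))"
      using False by (auto intro!: derivative_eq_intros simp: field_simps)
    from has_vector_derivative_real_field[OF this] show ?thesis
      by (auto intro: has_vector_derivative_at_within)
  qed
  have "(LINT t|lborel. indicator {0..2*pi} t *\<^sub>R ?f t) = integral {0..2*pi} ?f"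
  proof -
    have "set_integrable lborel {0..2*pi} ?f"
      unfolding set_integrable_def indicator_scaleR_eq_if
      by (intro borel_integrable_compact continuous_intros) simp
    from set_borel_integral_eq_integral(2)[OF this] show ?thesis
      by (simp add: set_lebesgue_integral_def)
  qed
  also have "\<dots> = 1 / (\<i> * of_int n) * ?f (2 * pi) - 1 / (\<i> * of_int n) * ?f 0"
    by (intro integral_unique fundamental_theorem_of_calculus d) simp
  also have "?f (2 * pi) = 1"
    using exp_integer_2pi[of "of_int n"] by (simp add: mult_ac)
  finally show ?thesis using False by simp
qed

text \<open>A character is a product of functions of single coordinates, so its integral is a
  product of one-dimensional integrals, and a coordinate in which k is nonzero contributes the
  factor 0.\<close>

lemma integral_mode:
  "integral torus_box (mode k) = (if k = 0 then of_real ((2 * pi) ^ CARD('d)) else 0)"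
  for k :: "int ^ 'd::finite"
proof (cases "k = 0")
  case True
  then have "mode k = (\<lambda>_. 1)" by (auto simp: fun_eq_iff)
  then show ?thesis using True by (simp add: content_torus_box scaleR_conv_of_real)
next
  case False
  then obtain a where a: "k $ a \<noteq> 0" by (auto simp: vec_eq_iff)
  let ?g = "\<lambda>b t. indicator {0..2*pi} t *\<^sub>R exp (\<i> * of_real ((rvec k \<bullet> b) * t))"
  have bi: "rvec k \<bullet> axis i 1 = real_of_int (k $ i)" for i by (simp add: rvec_def inner_axis)
  have intg: "integrable lborel (?g b)" if "b \<in> Basis" for b :: "real ^ 'd"
    unfolding indicator_scaleR_eq_if by (intro borel_integrable_compact continuous_intros) simp
  \<comment> \<open>The indicator of the box is distributed over the coordinates as well, so that
    the integrand is a product over \<open>Basis\<close> on the whole space.\<close>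
  have prod: "indicator torus_box x *\<^sub>R mode k x = (\<Prod>b\<in>Basis. ?g b (x \<bullet> b))" for x :: "real ^ 'd"
  proof (cases "x \<in> torus_box")
    case True
    then have "indicator {0..2*pi} (x \<bullet> b) = (1::real)" if "b \<in> Basis" for b
      using that by (auto simp: Basis_cart_real mem_box_cart inner_axis)
    then have "(\<Prod>b\<in>Basis. ?g b (x \<bullet> b)) = (\<Prod>b\<in>Basis. exp (\<i> * of_real ((rvec k \<bullet> b) * (x \<bullet> b))))"
      by (intro prod.cong) auto
    also have "\<dots> = exp (\<Sum>b\<in>Basis. \<i> * of_real ((rvec k \<bullet> b) * (x \<bullet> b)))"
      by (simp add: exp_sum)
    also have "(\<Sum>b\<in>Basis. \<i> * of_real ((rvec k \<bullet> b) * (x \<bullet> b))) = \<i> * of_real (rvec k \<bullet> x)"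
      by (subst euclidean_inner[of "rvec k" x]) (simp add: sum_distrib_left)
    finally show ?thesis using True by (simp add: mode_def)
  next
    case False
    then obtain i where "x $ i \<notin> {0..2*pi}" by (auto simp: mem_box_cart)
    then have "\<exists>b\<in>Basis. ?g b (x \<bullet> b) = 0"
      by (auto simp: Basis_cart_real inner_axis intro!: exI[of _ i])
    then have "(\<Prod>b\<in>Basis. ?g b (x \<bullet> b)) = 0" by (simp add: prod_zero_iff)
    then show ?thesis using False by simp
  qed
  interpret product_sigma_finite "\<lambda>_. lborel :: real measure" ..
  have "integral torus_box (mode k) = (LINT x|lborel. indicator torus_box x *\<^sub>R mode k x)"
  proof -
    have "set_integrable lborel torus_box (mode k)"
      unfolding set_integrable_def
      by (rule borel_integrable_compact[OF compact_cbox continuous_mode])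
    from set_borel_integral_eq_integral(2)[OF this] show ?thesis
      by (simp add: set_lebesgue_integral_def)
  qed
  \<comment> \<open>Lebesgue measure is the image of the product measure indexed by
    \<open>Basis\<close>; this is where the integral is split.\<close>
  also have "\<dots> = (LINT x|distr (\<Pi>\<^sub>M b\<in>Basis. lborel) borel (\<lambda>f. \<Sum>b\<in>Basis. f b *\<^sub>R b).
      (\<Prod>b\<in>Basis. ?g b (x \<bullet> b)))"
    by (subst lborel_eq) (simp only: prod)
  also have "\<dots> = (LINT f|(\<Pi>\<^sub>M b\<in>Basis. lborel). (\<Prod>b\<in>Basis. ?g b ((\<Sum>b\<in>Basis. f b *\<^sub>R b) \<bullet> b)))"
    by (intro integral_distr) measurable
  also have "\<dots> = (LINT f|(\<Pi>\<^sub>M b\<in>Basis. lborel). (\<Prod>b\<in>Basis. ?g b (f b)))"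
    by (intro Bochner_Integration.integral_cong refl prod.cong) (simp_all add: inner_sum_left_Basis)
  also have "\<dots> = (\<Prod>b\<in>Basis. LINT t|lborel. ?g b t)"
    by (intro product_integral_prod intg) auto
  also have "\<dots> = 0"
  proof (rule prod_zero)
    have "(LINT t|lborel. ?g (axis a 1) t) = 0"
      using integral_exp_period[of "k $ a"] a by (simp only: bi) auto
    then show "\<exists>b\<in>Basis. (LINT t|lborel. ?g b t) = 0"
      by (auto simp: Basis_cart_real)
  qed auto
  finally show ?thesis using False by simp
qed

section \<open>Lattice periodicity and density of trigonometric polynomials\<close>

lemma periodic_fun_shift:
  fixes f :: "real ^ 'd::finite \<Rightarrow> complex"
  assumes "periodic_fun f"
  shows "f (x + (2 * pi) *\<^sub>R rvec n) = f x"
proof -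
  have step: "f (x + axis a (2 * pi * of_int m)) = f x" for x a m
  proof (induction m arbitrary: x rule: int_induct[where k = 0])
    case base
    have "axis a (0::real) = (0 :: real ^ 'd)" by (simp add: vec_eq_iff axis_def)
    then show ?case by (simp only: of_int_0 mult_zero_right add_0_right)
  next
    case (step1 i)
    have "axis a (2 * pi * of_int (i + 1)) = axis a (2 * pi * of_int i) + axis a (2 * pi)"
      by (simp add: vec_eq_iff axis_def algebra_simps)
    then have "f (x + axis a (2 * pi * of_int (i + 1))) = f ((x + axis a (2 * pi * of_int i)) + axis a (2 * pi))"
      by (simp add: add.assoc)
    also have "\<dots> = f (x + axis a (2 * pi * of_int i))" using assms by (simp only: periodic_fun_def)
    finally show ?case using step1 by simp
  next
    case (step2 i)
    have "axis a (2 * pi * of_int i) = axis a (2 * pi * of_int (i - 1)) + axis a (2 * pi)"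
      by (simp add: vec_eq_iff axis_def algebra_simps)
    then have "f (x + axis a (2 * pi * of_int i)) = f ((x + axis a (2 * pi * of_int (i - 1))) + axis a (2 * pi))"
      by (simp add: add.assoc)
    also have "\<dots> = f (x + axis a (2 * pi * of_int (i - 1)))" using assms by (simp only: periodic_fun_def)
    finally show ?case using step2 by simp
  qed
  have "f (x + (\<Sum>i\<in>A. axis i (2 * pi * of_int (n $ i)))) = f x" if "finite A" for A
    using that
  proof (induction A)
    case (insert i A)
    have "f (x + (\<Sum>i\<in>insert i A. axis i (2 * pi * of_int (n $ i)))) =
        f ((x + (\<Sum>i\<in>A. axis i (2 * pi * of_int (n $ i)))) + axis i (2 * pi * of_int (n $ i)))"
      using insert by (simp add: algebra_simps)
    then show ?case using insert step by simp
  qed simp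
  from this[of UNIV] have "f (x + (\<Sum>i\<in>UNIV. axis i (2 * pi * of_int (n $ i)))) = f x" by simp
  moreover have "(\<Sum>i\<in>UNIV. axis i (2 * pi * of_int (n $ i))) = (2 * pi) *\<^sub>R rvec n"
    by (simp add: vec_eq_iff axis_def rvec_def if_distrib cong: if_cong)
  ultimately show ?thesis by simp
qed

lemma torus_box_representative:
  obtains n where "x + (2 * pi) *\<^sub>R rvec n \<in> torus_box"
proof
  let ?n = "\<chi> i. - \<lfloor>x $ i / (2 * pi)\<rfloor>"
  have "0 \<le> x $ i - 2 * pi * of_int \<lfloor>x $ i / (2 * pi)\<rfloor> \<and> x $ i - 2 * pi * of_int \<lfloor>x $ i / (2 * pi)\<rfloor> \<le> 2 * pi" for i
  proof -
    have "2 * pi > 0" by simp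
    from floor_divide_lower[OF this, of "x $ i"] floor_divide_upper[OF this, of "x $ i"]
    show ?thesis by (simp add: algebra_simps)
  qed
  then show "x + (2 * pi) *\<^sub>R rvec ?n \<in> torus_box"
    by (auto simp: mem_box_cart rvec_def)
qed

text \<open>Linear combinations of characters, generated inductively so that orthogonality and
  closure under products follow by rule induction.\<close>

inductive trig_poly :: "(real ^ 'd::finite \<Rightarrow> complex) \<Rightarrow> bool" where
  trig_poly_mode: "trig_poly (\<lambda>x. c * mode k x)"
| trig_poly_add: "trig_poly f \<Longrightarrow> trig_poly g \<Longrightarrow> trig_poly (\<lambda>x. f x + g x)"

lemma trig_poly_const: "trig_poly (\<lambda>x. c)"
  using trig_poly_mode[of c 0] by simp

lemma trig_poly_mult: "trig_poly f \<Longrightarrow> trig_poly g \<Longrightarrow> trig_poly (\<lambda>x. f x * g x)"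
proof (induction f rule: trig_poly.induct)
  case (trig_poly_mode c k)
  then show ?case
  proof (induction g rule: trig_poly.induct)
    case (trig_poly_mode c' k')
    have "(\<lambda>x. c * mode k x * (c' * mode k' x)) = (\<lambda>x. (c * c') * mode (k + k') x)"
      by (simp add: mode_add mult_ac)
    then show ?case using trig_poly.trig_poly_mode by metis
  next
    case (trig_poly_add f g)
    from trig_poly.trig_poly_add[OF trig_poly_add.IH] show ?case by (simp add: distrib_left)
  qed
next
  case (trig_poly_add f1 f2)
  from trig_poly.trig_poly_add[OF trig_poly_add.IH(1)[OF trig_poly_add.prems] trig_poly_add.IH(2)[OF trig_poly_add.prems]]
  show ?case by (simp add: distrib_right)
qed

lemma trig_poly_sum: "finite A \<Longrightarrow> (\<And>a. a \<in> A \<Longrightarrow> trig_poly (f a)) \<Longrightarrow> trig_poly (\<lambda>x. \<Sum>a\<in>A. f a x)"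
  by (induction A rule: finite_induct) (auto intro: trig_poly_const trig_poly_add)

lemma continuous_trig_poly: "trig_poly f \<Longrightarrow> continuous_on A f"
  by (induction rule: trig_poly.induct) (auto intro!: continuous_intros)

text \<open>Embeds the torus as a compact subset of C^d. Polynomials in the real and imaginary parts
  of the coordinates pull back to trigonometric polynomials, which makes the Stone-Weierstrass
  theorem applicable.\<close>

definition torus_map :: "real ^ 'd::finite \<Rightarrow> complex ^ 'd" where
  "torus_map x = (\<chi> i. cis (x $ i))"

lemma trig_poly_cos: "trig_poly (\<lambda>x. of_real (cos (x $ i)))"
  and trig_poly_sin: "trig_poly (\<lambda>x. of_real (sin (x $ i)))"
proof -
  have m: "mode (axis i 1) x = cis (x $ i)" "mode (- axis i 1) x = cis (- (x $ i))" for x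
  proof -
    have "rvec (axis i 1) = axis i 1" by (simp add: rvec_def vec_eq_iff axis_def)
    then show "mode (axis i 1) x = cis (x $ i)" "mode (- axis i 1) x = cis (- (x $ i))"
      by (simp_all add: mode_def cis_conv_exp inner_axis' )
  qed
  have "trig_poly (\<lambda>x. 1/2 * mode (axis i 1) x + 1/2 * mode (- axis i 1) x)"
    by (intro trig_poly.intros)
  moreover have "1/2 * mode (axis i 1) x + 1/2 * mode (- axis i 1) x = of_real (cos (x $ i))" for x
    unfolding m by (simp add: complex_eq_iff)
  ultimately show "trig_poly (\<lambda>x. of_real (cos (x $ i)))" by simp
  have "trig_poly (\<lambda>x. (- \<i>/2) * mode (axis i 1) x + (\<i>/2) * mode (- axis i 1) x)"
    by (intro trig_poly.intros)
  moreover have "(- \<i>/2) * mode (axis i 1) x + (\<i>/2) * mode (- axis i 1) x = of_real (sin (x $ i))" for x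
    unfolding m by (simp add: complex_eq_iff)
  ultimately show "trig_poly (\<lambda>x. of_real (sin (x $ i)))" by simp
qed

lemma trig_poly_real_polynomial:
  "real_polynomial_function q \<Longrightarrow> trig_poly (\<lambda>x. of_real (q (torus_map x)))"
proof (induction rule: real_polynomial_function.induct)
  case (linear f)
  then interpret bounded_linear f .
  have f: "f (torus_map x) = (\<Sum>b\<in>Basis. (torus_map x \<bullet> b) * f b)" for x
  proof -
    have "f (torus_map x) = f (\<Sum>b\<in>Basis. (torus_map x \<bullet> b) *\<^sub>R b)" by (simp add: euclidean_representation)
    then show ?thesis by (simp add: sum scaleR)
  qed
  have "trig_poly (\<lambda>x. of_real ((torus_map x \<bullet> b)))" if "b \<in> Basis" for b :: "complex ^ 'd"
  proof -
    from that obtain i u where b: "b = axis i u" "u \<in> Basis" by (auto simp: Basis_vec_def)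
    show ?thesis using b(2) unfolding b(1)
      by (auto simp: torus_map_def inner_axis Basis_complex_def inner_complex_def trig_poly_cos trig_poly_sin)
  qed
  then show ?case unfolding f
    unfolding of_real_sum of_real_mult by (auto intro!: trig_poly_sum trig_poly_mult trig_poly_const)
next
  case (const c)
  show ?case by (rule trig_poly_const)
next
  case (add f g)
  from trig_poly_add[OF add.IH] show ?case by simp
next
  case (mult f g)
  from trig_poly_mult[OF mult.IH] show ?case by simp
qed

lemma continuous_torus_map [continuous_intros]: "continuous_on A torus_map"
  unfolding torus_map_def by (intro continuous_intros)

text \<open>A continuous periodic function descends to a continuous function on the image of
  \<open>torus_map\<close>, where polynomials are uniformly dense.\<close>

lemma trig_poly_approx:
  fixes f :: "real ^ 'd::finite \<Rightarrow> complex"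
  assumes cont: "continuous_on UNIV f" and per: "periodic_fun f" and e: "0 < e"
  obtains p where "trig_poly p" "\<And>x. x \<in> torus_box \<Longrightarrow> cmod (f x - p x) < e"
proof -
  have eq: "f x = f y" if "torus_map x = torus_map y" for x y
  proof -
    have "\<exists>n::int. x $ i = y $ i + 2 * pi * n" for i
    proof -
      have "cis (x $ i) = cis (y $ i)" using that by (simp add: torus_map_def vec_eq_iff)
      then have "sin (x $ i) = sin (y $ i) \<and> cos (x $ i) = cos (y $ i)" by (simp add: complex_eq_iff)
      then show ?thesis using sin_cos_eq_iff[of "x $ i" "y $ i"] by (auto simp: mult_ac)
    qed
    then obtain n :: "'d \<Rightarrow> int" where "\<And>i. x $ i = y $ i + 2 * pi * n i" by metis
    then have "x = y + (2 * pi) *\<^sub>R rvec (\<chi> i. n i)" by (simp add: vec_eq_iff rvec_def)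
    then show ?thesis using periodic_fun_shift[OF per] by simp
  qed
  let ?K = "torus_map ` (torus_box :: (real ^ 'd) set)"
  \<comment> \<open>The choice of the preimage does not matter, because points with equal image
    differ by a period vector.\<close>
  define g where "g z = f (SOME x. torus_map x = z)" for z
  have g: "g (torus_map x) = f x" for x
    unfolding g_def by (rule eq) (rule someI[of "\<lambda>y. torus_map y = torus_map x"], simp)
  \<comment> \<open>A continuous surjection from a compact space onto a Hausdorff space is a
    quotient map, so continuity of \<open>g\<close> can be tested after composing with
    \<open>torus_map\<close>.\<close>
  have q: "quotient_map (top_of_set torus_box) (top_of_set ?K) torus_map"
    unfolding quotient_map_def using Abstract_Topology_2.continuous_imp_quotient_map[of torus_box torus_map ?K]
    by (auto simp: continuous_torus_map vimage_def Int_def)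
  have "continuous_map (top_of_set torus_box) euclidean (g \<circ> torus_map)"
    using continuous_on_subset[OF cont] by (simp add: o_def g)
  then have "continuous_on ?K g"
    using continuous_compose_quotient_map_eq[OF q, of euclidean g] by simp
  moreover have "compact ?K" by (intro compact_continuous_image continuous_intros compact_cbox)
  ultimately obtain p where p: "polynomial_function p" "\<And>z. z \<in> ?K \<Longrightarrow> norm (g z - p z) < e"
    using Stone_Weierstrass_polynomial_function[of ?K g e] e by metis
  have "real_polynomial_function (Re \<circ> p)" "real_polynomial_function (Im \<circ> p)"
    using p(1) bounded_linear_Re bounded_linear_Im unfolding polynomial_function_def by blast+
  then have "trig_poly (\<lambda>x. of_real ((Re \<circ> p) (torus_map x)) + \<i> * of_real ((Im \<circ> p) (torus_map x)))"
    by (intro trig_poly_add trig_poly_mult trig_poly_const trig_poly_real_polynomial)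
  then have "trig_poly (\<lambda>x. p (torus_map x))" by (simp flip: complex_eq)
  then show thesis
    using p(2) by (intro that[of "\<lambda>x. p (torus_map x)"]) (auto simp flip: g)
qed

lemma fourier_coeff_uminus_integral:
  "integral torus_box (\<lambda>x. f x * mode k x) = fourier_coeff f (- k) * of_real ((2 * pi) ^ CARD('d))"
  for f :: "real ^ 'd::finite \<Rightarrow> complex"
  by (simp add: fourier_coeff_def)

text \<open>Vanishing coefficients make f orthogonal to every trigonometric polynomial.
  Approximating the conjugate of f uniformly by such polynomials shows that the integral of |f|^2
  vanishes.\<close>

theorem fourier_uniqueness:
  fixes f :: "real ^ 'd::finite \<Rightarrow> complex"
  assumes cont: "continuous_on UNIV f" and per: "periodic_fun f" and zero: "\<And>k. fourier_coeff f k = 0"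
  shows "f x = 0"
proof -
  have c[continuous_intros]: "continuous_on A f" for A using cont continuous_on_subset by blast
  have orth: "integral torus_box (\<lambda>x. f x * p x) = 0" if "trig_poly p" for p
    using that
  proof induction
    case (trig_poly_mode c k)
    have "integral torus_box (\<lambda>x. f x * (c * mode k x)) = c * integral torus_box (\<lambda>x. f x * mode k x)"
      by (subst integral_mult_right [symmetric]) (simp add: mult_ac)
    then show ?case by (simp add: fourier_coeff_uminus_integral zero)
  next
    case (trig_poly_add p q)
    have "integral torus_box (\<lambda>x. f x * (p x + q x)) =
        integral torus_box (\<lambda>x. f x * p x) + integral torus_box (\<lambda>x. f x * q x)"
      unfolding distrib_left using trig_poly_add.hyps
      by (intro Henstock_Kurzweil_Integration.integral_add integrable_continuous continuous_intros continuous_trig_poly)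
    then show ?case using trig_poly_add.IH by simp
  qed
  have "bounded (f ` torus_box)" by (intro compact_imp_bounded compact_continuous_image c compact_cbox)
  then obtain B where B: "\<And>x. x \<in> torus_box \<Longrightarrow> cmod (f x) \<le> B" "B > 0"
    unfolding bounded_pos by auto
  have cper: "periodic_fun (\<lambda>x. cnj (f x))" using per by (simp add: periodic_fun_def)
  let ?V = "measure lborel (torus_box :: (real ^ 'd) set)"
  have small: "cmod (integral torus_box (\<lambda>x. f x * cnj (f x))) \<le> B * e * ?V" if e: "0 < e" for e
  proof -
    obtain p where p: "trig_poly p" "\<And>x. x \<in> torus_box \<Longrightarrow> cmod (cnj (f x) - p x) < e"
      using trig_poly_approx[OF _ cper e] c continuous_on_cnj by blast
    note [continuous_intros] = continuous_trig_poly[OF p(1)]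
    have "integral torus_box (\<lambda>x. f x * (cnj (f x) - p x)) =
        integral torus_box (\<lambda>x. f x * cnj (f x)) - integral torus_box (\<lambda>x. f x * p x)"
      unfolding right_diff_distrib
      by (intro Henstock_Kurzweil_Integration.integral_diff integrable_continuous continuous_intros)
    moreover have "cmod (integral torus_box (\<lambda>x. f x * (cnj (f x) - p x))) \<le> B * e * ?V"
    proof (rule integrable_bound)
      fix x :: "real ^ 'd" assume "x \<in> torus_box"
      then show "norm (f x * (cnj (f x) - p x)) \<le> B * e"
        unfolding norm_mult using B p(2)[of x] by (intro mult_mono) (auto simp: less_imp_le)
    qed (use B e in \<open>auto intro!: integrable_continuous continuous_intros\<close>)
    ultimately show ?thesis by (simp add: orth p(1))
  qed
  have V: "?V > 0" by (simp add: content_torus_box)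
  have "integral torus_box (\<lambda>x. f x * cnj (f x)) = 0"
  proof (rule ccontr)
    assume n: "integral torus_box (\<lambda>x. f x * cnj (f x)) \<noteq> 0" (is "?I \<noteq> 0")
    \<comment> \<open>With e = |I| / (2 B V) the estimate reads |I| \<le> |I| / 2.\<close>
    have "cmod ?I \<le> B * (cmod ?I / (2 * B * ?V)) * ?V" using n B V by (intro small) auto
    then show False using n B V by simp
  qed
  moreover have "((\<lambda>x. f x * cnj (f x)) has_integral integral torus_box (\<lambda>x. f x * cnj (f x))) torus_box"
    by (intro integrable_integral integrable_continuous continuous_intros)
  ultimately have "((\<lambda>x. f x * cnj (f x)) has_integral 0) torus_box" by simp
  from has_integral_linear[OF this bounded_linear_Re]
  have h: "((\<lambda>x. (cmod (f x))\<^sup>2) has_integral 0) torus_box"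
    by (simp add: o_def complex_mult_cnj cmod_def)
  have z: "(cmod (f x))\<^sup>2 = 0" if "x \<in> torus_box" for x
    by (rule has_integral_0_cbox_imp_0[OF _ _ h _ that])
      (auto intro!: continuous_intros simp: interval_ne_empty_cart)
  \<comment> \<open>The integral controls f only on the box, and every point has a translate
    there.\<close>
  obtain n where "x + (2 * pi) *\<^sub>R rvec n \<in> torus_box" by (rule torus_box_representative)
  from z[OF this] periodic_fun_shift[OF per, of x n] show ?thesis by simp
qed

text \<open>The index set is arbitrary and frequencies may repeat. A product of such series is then
  a series over pairs of indices without any regrouping, and convolution sums arise only when
  coefficients are read off.\<close>

definition trig_series ::
  "(real ^ 'd::finite \<Rightarrow> complex) \<Rightarrow> 'j set \<Rightarrow> ('j \<Rightarrow> complex) \<Rightarrow> ('j \<Rightarrow> int ^ 'd) \<Rightarrow> bool" where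
  "trig_series f J c m \<longleftrightarrow> (\<lambda>j. cmod (c j)) summable_on J \<and>
     (\<forall>x. f x = (\<Sum>\<^sub>\<infinity>j\<in>J. c j * mode (m j) x))"

lemma trig_series_summable: "trig_series f J c m \<Longrightarrow> (\<lambda>j. cmod (c j)) summable_on J"
  by (simp add: trig_series_def)

lemma trig_series_has_sum:
  assumes "trig_series f J c m"
  shows "((\<lambda>j. c j * mode (m j) x) has_sum f x) J"
proof -
  have "(\<lambda>j. cmod (c j * mode (m j) x)) summable_on J"
    using assms by (simp add: norm_mult trig_series_def)
  then have "(\<lambda>j. c j * mode (m j) x) summable_on J" by (rule abs_summable_summable)
  then show ?thesis using assms by (simp add: trig_series_def)
qed

lemma trig_seriesI:
  assumes "(\<lambda>j. cmod (c j)) summable_on J" "\<And>x. ((\<lambda>j. c j * mode (m j) x) has_sum f x) J"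
  shows "trig_series f J c m"
  using assms(1) infsumI[OF assms(2)] by (simp add: trig_series_def)

lemma trig_series_uniform_limit:
  assumes "trig_series f J c m"
  shows "uniform_limit A (\<lambda>X x. \<Sum>j\<in>X. c j * mode (m j) x) f (finite_subsets_at_top J)"
  by (rule Weierstrass_m_test_general'[where M = "\<lambda>j. cmod (c j)"])
    (use assms in \<open>auto simp: norm_mult trig_series_summable trig_series_has_sum\<close>)

lemma trig_series_continuous:
  assumes "trig_series f J c m"
  shows "continuous_on A f"
  by (rule uniform_limit_theorem[OF _ trig_series_uniform_limit[OF assms]])
    (auto intro!: always_eventually continuous_intros)

lemma trig_series_periodic:
  assumes "trig_series f J c m"
  shows "periodic_fun f"
proof -
  have "mode k (x + axis a (2 * pi)) = mode k x" for k :: "int ^ 'a" and x a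
    using periodic_mode[of k] by (simp add: periodic_fun_def)
  then show ?thesis using assms by (simp add: periodic_fun_def trig_series_def)
qed

text \<open>Uniform convergence permits termwise integration, and orthogonality keeps exactly the
  indices of frequency k.\<close>

lemma trig_series_coeff:
  fixes f :: "real ^ 'd::finite \<Rightarrow> complex"
  assumes "trig_series f J c m"
  shows "(c has_sum fourier_coeff f k) {j \<in> J. m j = k}"
proof -
  define V where "V = complex_of_real ((2 * pi) ^ CARD('d))"
  have V: "V \<noteq> 0" by (simp add: V_def)
  have t: "trig_series (\<lambda>x. f x * mode (- k) x) J c (\<lambda>j. m j - k)"
  proof (rule trig_seriesI)
    show "((\<lambda>j. c j * mode (m j - k) x) has_sum f x * mode (- k) x) J" for x
      using has_sum_cmult_left[OF trig_series_has_sum[OF assms, of x], of "mode (- k) x"]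
      by (simp add: mult.assoc mode_add [symmetric])
  qed (rule trig_series_summable[OF assms])
  obtain I L where
    I: "\<And>X. ((\<lambda>x. \<Sum>j\<in>X. c j * mode (m j - k) x) has_integral I X) torus_box" and
    L: "((\<lambda>x. f x * mode (- k) x) has_integral L) torus_box" and
    lim: "(I \<longlongrightarrow> L) (finite_subsets_at_top J)"
    by (rule uniform_limit_integral_cbox[OF trig_series_uniform_limit[OF t, of torus_box]])
      (auto intro!: continuous_intros)
  have int1: "((\<lambda>x. c j * mode (m j - k) x) has_integral (if m j = k then c j * V else 0)) torus_box" for j
  proof -
    have "(mode (m j - k) has_integral (if m j - k = 0 then V else 0)) torus_box"
      unfolding V_def integral_mode [symmetric] by (intro integrable_integral integrable_continuous continuous_intros)
    from has_integral_mult_right[OF this, of "c j"] show ?thesis by (auto split: if_splits)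
  qed
  have "I X = (\<Sum>j\<in>X. if m j = k then c j * V else 0)" if "finite X" for X
    by (rule has_integral_unique[OF I has_integral_sum[OF that int1]])
  then have "((\<lambda>X. \<Sum>j\<in>X. if m j = k then c j * V else 0) \<longlongrightarrow> L) (finite_subsets_at_top J)"
    by (intro Lim_transform_eventually[OF lim] eventually_finite_subsets_at_top_weakI) auto
  then have "((\<lambda>j. if m j = k then c j * V else 0) has_sum L) J" by (simp add: has_sum_def)
  also have "?this \<longleftrightarrow> ((\<lambda>j. c j * V) has_sum L) {j \<in> J. m j = k}"
    by (rule has_sum_cong_neutral) auto
  finally have "((\<lambda>j. c j * V * inverse V) has_sum L * inverse V) {j \<in> J. m j = k}"
    by (rule has_sum_cmult_left)
  moreover have "L * inverse V = fourier_coeff f k"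
    using integral_unique[OF L] by (simp add: fourier_coeff_def V_def field_simps)
  ultimately show ?thesis using V by (simp add: mult.assoc)
qed

lemma trig_series_cnj:
  assumes "trig_series f J c m"
  shows "trig_series (\<lambda>x. cnj (f x)) J (\<lambda>j. cnj (c j)) (\<lambda>j. - m j)"
proof (rule trig_seriesI)
  show "((\<lambda>j. cnj (c j) * mode (- m j) x) has_sum cnj (f x)) J" for x
    using trig_series_has_sum[OF assms, of x]
    by (simp only: cnj_mode [symmetric] complex_cnj_mult [symmetric] has_sum_cnj_iff)
qed (use trig_series_summable[OF assms] in simp)

section \<open>Products of absolutely convergent series and Fourier multipliers\<close>

lemma summable_norm_product:
  fixes f :: "'a \<Rightarrow> complex" and g :: "'b \<Rightarrow> complex"
  assumes "(\<lambda>x. cmod (f x)) summable_on A" "(\<lambda>y. cmod (g y)) summable_on B"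
  shows "(\<lambda>(x, y). cmod (f x * g y)) summable_on A \<times> B"
proof -
  have "(\<lambda>p. cmod (f (fst p)) * cmod (g (snd p))) summable_on Sigma A (\<lambda>_. B)"
    by (rule summable_on_SigmaI[where g = "\<lambda>x. cmod (f x) * infsum (\<lambda>y. cmod (g y)) B"])
      (use assms in \<open>auto intro!: has_sum_cmult_right summable_on_cmult_left\<close>)
  then show ?thesis by (simp add: case_prod_unfold norm_mult)
qed

lemma has_sum_product_complex:
  fixes f :: "'a \<Rightarrow> complex" and g :: "'b \<Rightarrow> complex"
  assumes "(\<lambda>x. cmod (f x)) summable_on A" "(\<lambda>y. cmod (g y)) summable_on B"
    and "(f has_sum F) A" "(g has_sum G) B"
  shows "((\<lambda>(x, y). f x * g y) has_sum F * G) (A \<times> B)"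
proof (rule has_sum_SigmaI[where g = "\<lambda>x. f x * G"])
  show "(\<lambda>(x, y). f x * g y) summable_on A \<times> B"
    using summable_norm_product[OF assms(1,2)]
    by - (rule abs_summable_summable, simp add: case_prod_unfold)
  show "((\<lambda>x. f x * G) has_sum F * G) A" using assms(3) by (rule has_sum_cmult_left)
  show "((\<lambda>y. case (x, y) of (x, y) \<Rightarrow> f x * g y) has_sum f x * G) B" for x
    using has_sum_cmult_right[OF assms(4), of "f x"] by simp
qed

lemma trig_series_mult:
  assumes "trig_series f J c m" "trig_series g K d n"
  shows "trig_series (\<lambda>x. f x * g x) (J \<times> K) (\<lambda>(i, j). c i * d j) (\<lambda>(i, j). m i + n j)"
proof (rule trig_seriesI)
  show "(\<lambda>j. cmod (case j of (i, j) \<Rightarrow> c i * d j)) summable_on J \<times> K"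
    using summable_norm_product[OF assms[THEN trig_series_summable]] by (simp add: case_prod_unfold)
  show "((\<lambda>j. (case j of (i, j) \<Rightarrow> c i * d j) * mode (case j of (i, j) \<Rightarrow> m i + n j) x) has_sum f x * g x) (J \<times> K)" for x
  proof -
    have "(\<lambda>j. cmod (c j * mode (m j) x)) summable_on J" "(\<lambda>j. cmod (d j * mode (n j) x)) summable_on K"
      using assms[THEN trig_series_summable] by (simp_all add: norm_mult)
    from has_sum_product_complex[OF this assms[THEN trig_series_has_sum]] show ?thesis
      by (rule has_sum_cong[THEN iffD1, rotated]) (auto simp: mode_add)
  qed
qed

text \<open>\<open>multiplier\<close> sums over frequencies, the series over J. Splitting J into the
  fibres of m turns one sum into the other, since the symbol is constant on a fibre.\<close>

lemma trig_series_multiplier: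
  fixes f :: "real ^ 'd::finite \<Rightarrow> complex"
  assumes f: "trig_series f J c m" and sum: "(\<lambda>j. cmod (\<mu> (m j) * c j)) summable_on J"
  shows "trig_series (multiplier \<mu> f) J (\<lambda>j. \<mu> (m j) * c j) m"
proof (rule trig_seriesI)
  fix x
  have "(\<lambda>j. cmod (\<mu> (m j) * c j * mode (m j) x)) summable_on J"
    using sum by (simp add: norm_mult)
  then obtain S where S: "((\<lambda>j. \<mu> (m j) * c j * mode (m j) x) has_sum S) J"
    using has_sum_infsum[OF abs_summable_summable] by metis
  have b: "bij_betw snd (SIGMA k:UNIV. {j \<in> J. m j = k}) J"
    by (auto simp: bij_betw_def inj_on_def image_iff)
  have S': "((\<lambda>p. \<mu> (m (snd p)) * c (snd p) * mode (m (snd p)) x) has_sum S) (SIGMA k:UNIV. {j \<in> J. m j = k})"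
    using S has_sum_reindex_bij_betw[OF b, of "\<lambda>j. \<mu> (m j) * c j * mode (m j) x"] by simp
  have "((\<lambda>k. \<mu> k * fourier_coeff f k * mode k x) has_sum S) UNIV"
  proof (rule has_sum_SigmaD[OF S'])
    fix k
    have "((\<lambda>j. \<mu> k * c j * mode k x) has_sum \<mu> k * fourier_coeff f k * mode k x) {j \<in> J. m j = k}"
      by (intro has_sum_cmult_left has_sum_cmult_right trig_series_coeff[OF f])
    then show "((\<lambda>j. \<mu> (m (snd (k, j))) * c (snd (k, j)) * mode (m (snd (k, j))) x) has_sum
        \<mu> k * fourier_coeff f k * mode k x) {j \<in> J. m j = k}"
      by (rule has_sum_cong[THEN iffD1, rotated]) auto
  qed
  then have "multiplier \<mu> f x = S" by (simp add: multiplier_def infsumI)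
  then show "((\<lambda>j. \<mu> (m j) * c j * mode (m j) x) has_sum multiplier \<mu> f x) J" using S by simp
qed (rule sum)

section \<open>Linearity of the coefficients and Fourier inversion\<close>

lemma fourier_coeff_add:
  assumes "continuous_on UNIV f" "continuous_on UNIV g"
  shows "fourier_coeff (\<lambda>x. f x + g x) k = fourier_coeff f k + fourier_coeff g k"
proof -
  note [continuous_intros] = assms[THEN continuous_on_subset, OF subset_UNIV]
  have "integral torus_box (\<lambda>x. (f x + g x) * mode (- k) x) =
      integral torus_box (\<lambda>x. f x * mode (- k) x) + integral torus_box (\<lambda>x. g x * mode (- k) x)"
    unfolding distrib_right
    by (intro Henstock_Kurzweil_Integration.integral_add integrable_continuous continuous_intros)
  then show ?thesis by (simp add: fourier_coeff_def add_divide_distrib)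
qed

lemma fourier_coeff_cmult: "fourier_coeff (\<lambda>x. a * f x) k = a * fourier_coeff f k"
proof -
  have "integral torus_box (\<lambda>x. a * f x * mode (- k) x) = a * integral torus_box (\<lambda>x. f x * mode (- k) x)"
    by (subst integral_mult_right [symmetric]) (simp add: mult_ac)
  then show ?thesis by (simp add: fourier_coeff_def)
qed

lemma fourier_coeff_diff:
  assumes "continuous_on UNIV f" "continuous_on UNIV g"
  shows "fourier_coeff (\<lambda>x. f x - g x) k = fourier_coeff f k - fourier_coeff g k"
  using fourier_coeff_add[of f "\<lambda>x. - 1 * g x" k] assms fourier_coeff_cmult[of "- 1" g k]
  by (simp add: continuous_on_minus)

lemma trig_series_of_coeffs:
  assumes "(\<lambda>k. cmod (a k)) summable_on UNIV"
  shows "trig_series (\<lambda>x. \<Sum>\<^sub>\<infinity>k. a k * mode k x) UNIV a (\<lambda>k. k)"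
  using assms by (simp add: trig_series_def)

lemma trig_series_UNIV_coeff: "trig_series f UNIV a (\<lambda>k. k) \<Longrightarrow> fourier_coeff f k = a k"
  using trig_series_coeff[of f UNIV a "\<lambda>k. k" k] has_sum_finite[of "{k}" a] has_sum_unique
  by fastforce

text \<open>The Fourier series converges to a continuous periodic function with the same
  coefficients as f; uniqueness identifies the two.\<close>

lemma fourier_inversion:
  assumes "continuous_on UNIV f" "periodic_fun f" "(\<lambda>k. cmod (fourier_coeff f k)) summable_on UNIV"
  shows "trig_series f UNIV (fourier_coeff f) (\<lambda>k. k)"
proof -
  define g where "g x = (\<Sum>\<^sub>\<infinity>k. fourier_coeff f k * mode k x)" for x
  have g: "trig_series g UNIV (fourier_coeff f) (\<lambda>k. k)"
    unfolding g_def using assms(3) by (rule trig_series_of_coeffs)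
  note cg = trig_series_continuous[OF g]
  have "f x - g x = 0" for x
  proof (rule fourier_uniqueness)
    show "periodic_fun (\<lambda>x. f x - g x)"
      using assms(2) trig_series_periodic[OF g] by (simp add: periodic_fun_def)
    show "fourier_coeff (\<lambda>x. f x - g x) k = 0" for k
      using fourier_coeff_diff[OF assms(1) cg] trig_series_UNIV_coeff[OF g] by simp
    show "continuous_on UNIV (\<lambda>x. f x - g x)" by (rule continuous_on_diff[OF assms(1) cg])
  qed
  then have "f = g" by auto
  with g show ?thesis by simp
qed

lemma trig_series_add:
  assumes "trig_series f J c m" "trig_series g J d m"
  shows "trig_series (\<lambda>x. f x + g x) J (\<lambda>j. c j + d j) m"
proof (rule trig_seriesI)
  have "(\<lambda>j. cmod (c j) + cmod (d j)) summable_on J"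
    using assms[THEN trig_series_summable] by (rule summable_on_add)
  then show "(\<lambda>j. cmod (c j + d j)) summable_on J"
    by (rule Infinite_Sum.abs_summable_on_comparison_test') (rule norm_triangle_ineq)
  show "((\<lambda>j. (c j + d j) * mode (m j) x) has_sum f x + g x) J" for x
    unfolding distrib_right by (intro has_sum_add trig_series_has_sum assms)
qed

lemma trig_series_cmult:
  assumes "trig_series f J c m"
  shows "trig_series (\<lambda>x. a * f x) J (\<lambda>j. a * c j) m"
  using trig_series_summable[OF assms] has_sum_cmult_right[OF trig_series_has_sum[OF assms], of a]
  by (intro trig_seriesI) (auto simp: norm_mult mult.assoc intro!: summable_on_cmult_right)

lemma trig_series_minus:
  assumes "trig_series f J c m" "trig_series g J d m"
  shows "trig_series (\<lambda>x. f x - g x) J (\<lambda>j. c j - d j) m"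
  using trig_series_add[OF assms(1) trig_series_cmult[OF assms(2), of "- 1"]] by simp

lemma trig_series_cong:
  assumes "trig_series f J c m" "\<And>x. f x = g x" "\<And>j. j \<in> J \<Longrightarrow> c j = d j"
  shows "trig_series g J d m"
proof -
  have "g = f" using assms(2) by auto
  then show ?thesis using assms(1) unfolding trig_series_def
    by (auto cong: summable_on_cong infsum_cong simp: assms(3))
qed

section \<open>Weighted square summable coefficients\<close>

text \<open>The square of the Japanese bracket <k>. Exponents therefore appear halved: the H^s
  weight of a coefficient is \<open>jb k powr (s / 2)\<close>.\<close>

definition jb :: "int ^ 'd::finite \<Rightarrow> real" where
  "jb k = 1 + (norm (rvec k))\<^sup>2"

lemma jb_ge_1: "1 \<le> jb k"
  by (simp add: jb_def)

lemma jb_pos [simp]: "0 < jb k"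
  using jb_ge_1[of k] by linarith

lemma jb_nonneg [simp]: "0 \<le> jb k" and jb_nonzero [simp]: "jb k \<noteq> 0"
  using jb_pos[of k] by (auto simp del: jb_pos)

lemma jb_powr_mono: "s \<le> t \<Longrightarrow> jb k powr s \<le> jb k powr t"
  by (intro powr_mono jb_ge_1)

lemma jb_powr_ge_1: "0 \<le> t \<Longrightarrow> 1 \<le> jb k powr t"
  using jb_ge_1 by (intro ge_one_powr_ge_zero) auto

text \<open>\<open>sob_le s a B\<close> says that \<open>a\<close> is the coefficient sequence of a function in \<open>H\<^sup>s\<close> of norm at most
  \<open>B\<close>. Testing on finite sets makes membership and the estimate a single statement.\<close>

definition sob_le :: "real \<Rightarrow> (int ^ 'd::finite \<Rightarrow> complex) \<Rightarrow> real \<Rightarrow> bool" where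
  "sob_le s a B \<longleftrightarrow> (\<forall>A. finite A \<longrightarrow> L2_set (\<lambda>k. jb k powr (s / 2) * cmod (a k)) A \<le> B)"

lemma sob_leD: "sob_le s a B \<Longrightarrow> finite A \<Longrightarrow> L2_set (\<lambda>k. jb k powr (s / 2) * cmod (a k)) A \<le> B"
  by (simp add: sob_le_def)

lemma sob_le_nonneg: "sob_le s a B \<Longrightarrow> 0 \<le> B"
  using sob_leD[of s a B "{}"] by simp

lemma sob_le_coeff: "sob_le s a B \<Longrightarrow> jb k powr (s / 2) * cmod (a k) \<le> B"
  using sob_leD[of s a B "{k}"] by simp

lemma sob_le_weighted_mono:
  assumes "sob_le t b B" "\<And>k. jb k powr (s / 2) * cmod (a k) \<le> jb k powr (t / 2) * cmod (b k)" "B \<le> B'"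
  shows "sob_le s a B'"
  unfolding sob_le_def
proof (intro allI impI)
  fix A :: "(int ^ 'a) set" assume "finite A"
  have "L2_set (\<lambda>k. jb k powr (s / 2) * cmod (a k)) A \<le> L2_set (\<lambda>k. jb k powr (t / 2) * cmod (b k)) A"
    using assms(2) by (intro L2_set_mono) auto
  also have "\<dots> \<le> B" using assms(1) \<open>finite A\<close> by (rule sob_leD)
  finally show "L2_set (\<lambda>k. jb k powr (s / 2) * cmod (a k)) A \<le> B'" using assms(3) by simp
qed

lemma sob_le_mono:
  assumes "sob_le s b B" "\<And>k. cmod (a k) \<le> cmod (b k)" "B \<le> B'"
  shows "sob_le s a B'"
  using assms(1) by (rule sob_le_weighted_mono) (use assms in \<open>auto intro: mult_left_mono\<close>)

lemma sob_le_bound: "sob_le s a B \<Longrightarrow> B \<le> B' \<Longrightarrow> sob_le s a B'"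
  by (erule sob_le_mono) auto

lemma sob_le_order_mono: "sob_le t a B \<Longrightarrow> s \<le> t \<Longrightarrow> sob_le s a B"
  by (erule sob_le_weighted_mono) (auto intro!: mult_right_mono jb_powr_mono)

text \<open>Moves a weight <k>^p between the sequence and the order of the space; this is how a loss
  of p derivatives is accounted for.\<close>

lemma sob_le_weight: "sob_le s (\<lambda>k. of_real (jb k powr (p / 2)) * a k) B \<longleftrightarrow> sob_le (s + p) a B"
proof -
  have "jb k powr (s / 2) * cmod (of_real (jb k powr (p / 2)) * a k) =
      jb k powr ((s + p) / 2) * cmod (a k)" for k
    by (simp add: norm_mult add_divide_distrib powr_add)
  then show ?thesis by (simp add: sob_le_def)
qed

lemma sob_le_zero: "sob_le s (\<lambda>k. 0) 0"
  by (simp add: sob_le_def L2_set_def)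

lemma sob_le_add:
  assumes "sob_le s a A" "sob_le s b B"
  shows "sob_le s (\<lambda>k. a k + b k) (A + B)"
  unfolding sob_le_def
proof (intro allI impI)
  fix F :: "(int ^ 'a) set" assume F: "finite F"
  let ?w = "\<lambda>k::int^'a. jb k powr (s / 2)"
  have "L2_set (\<lambda>k. ?w k * cmod (a k + b k)) F \<le> L2_set (\<lambda>k. ?w k * cmod (a k) + ?w k * cmod (b k)) F"
    by (intro L2_set_mono) (auto simp flip: distrib_left intro!: mult_left_mono norm_triangle_ineq)
  also have "\<dots> \<le> L2_set (\<lambda>k. ?w k * cmod (a k)) F + L2_set (\<lambda>k. ?w k * cmod (b k)) F"
    by (rule L2_set_triangle_ineq)
  also have "\<dots> \<le> A + B" using assms F by (intro add_mono sob_leD)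
  finally show "L2_set (\<lambda>k. ?w k * cmod (a k + b k)) F \<le> A + B" .
qed

lemma sob_le_cmult:
  assumes "sob_le s a A"
  shows "sob_le s (\<lambda>k. c * a k) (cmod c * A)"
  unfolding sob_le_def
proof (intro allI impI)
  fix F :: "(int ^ 'a) set" assume F: "finite F"
  have "L2_set (\<lambda>k. jb k powr (s / 2) * cmod (c * a k)) F =
      cmod c * L2_set (\<lambda>k. jb k powr (s / 2) * cmod (a k)) F"
    by (subst L2_set_right_distrib) (auto simp: norm_mult mult_ac)
  also have "\<dots> \<le> cmod c * A" using assms F by (intro mult_left_mono sob_leD) auto
  finally show "L2_set (\<lambda>k. jb k powr (s / 2) * cmod (c * a k)) F \<le> cmod c * A" .
qed

lemma sob_le_uminus: "sob_le s a A \<Longrightarrow> sob_le s (\<lambda>k. - a k) A"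
  by (erule sob_le_mono) auto

lemma sob_le_diff: "sob_le s a A \<Longrightarrow> sob_le s b B \<Longrightarrow> sob_le s (\<lambda>k. a k - b k) (A + B)"
  using sob_le_add[OF _ sob_le_uminus, of s a A b B] by simp

lemma sob_le_sum:
  assumes "finite Y" "\<And>j. j \<in> Y \<Longrightarrow> sob_le s (F j) (b j)"
  shows "sob_le s (\<lambda>k. \<Sum>j\<in>Y. F j k) (\<Sum>j\<in>Y. b j)"
  using assms by (induction Y rule: finite_induct) (auto intro: sob_le_zero sob_le_add)

text \<open>The squares of the finite-set norms are the partial sums of a nonnegative family, so a
  uniform bound amounts to summability together with a bound on the sum.\<close>

lemma sob_le_iff_summable:
  fixes a :: "int ^ 'd::finite \<Rightarrow> complex"
  shows "sob_le s a B \<longleftrightarrow> (\<lambda>k. jb k powr s * (cmod (a k))\<^sup>2) summable_on UNIV \<and>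
    sqrt (\<Sum>\<^sub>\<infinity>k. jb k powr s * (cmod (a k))\<^sup>2) \<le> B"
proof -
  let ?f = "\<lambda>k. jb k powr s * (cmod (a k))\<^sup>2"
  have sq: "(jb k powr (s / 2) * cmod (a k))\<^sup>2 = ?f k" for k
    by (simp add: power_mult_distrib power2_eq_square powr_add [symmetric])
  show ?thesis
  proof safe
    assume a: "sob_le s a B"
    have B: "0 \<le> B" by (rule sob_le_nonneg[OF a])
    have le: "sum ?f A \<le> B\<^sup>2" if "finite A" for A
    proof -
      have "sqrt (sum ?f A) \<le> B" using sob_leD[OF a that] by (simp add: L2_set_def sq)
      then show ?thesis using B by (simp add: real_le_rsqrt sqrt_le_D)
    qed
    show sm: "?f summable_on UNIV"
      using le by (intro nonneg_bdd_above_summable_on bdd_aboveI2[where M = "B\<^sup>2"]) auto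
    have "infsum ?f UNIV \<le> B\<^sup>2" using le by (intro infsum_le_finite_sums sm) auto
    then show "sqrt (infsum ?f UNIV) \<le> B" using B by (simp add: real_le_lsqrt)
  next
    assume sm: "?f summable_on UNIV" and B: "sqrt (infsum ?f UNIV) \<le> B"
    show "sob_le s a B"
      unfolding sob_le_def
    proof (intro allI impI)
      fix A :: "(int ^ 'd) set" assume "finite A"
      then have "sum ?f A \<le> infsum ?f UNIV" by (intro finite_sum_le_infsum sm) auto
      then have "sqrt (sum ?f A) \<le> sqrt (infsum ?f UNIV)" by simp
      then show "L2_set (\<lambda>k. jb k powr (s / 2) * cmod (a k)) A \<le> B"
        using B unfolding L2_set_def sq by linarith
    qed
  qed
qed

text \<open>Minkowski's inequality for infinite sums, with absolute values taken inside. Finite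
  partial sums obey the triangle inequality, and since the norm is tested on finite sets the bound
  survives the limit.\<close>

lemma sob_le_infsum:
  assumes F: "\<And>j. j \<in> J \<Longrightarrow> sob_le s (F j) (b j)" and b: "b summable_on J"
  shows "(\<lambda>j. cmod (F j k)) summable_on J"
    and "sob_le s (\<lambda>k. of_real (\<Sum>\<^sub>\<infinity>j\<in>J. cmod (F j k))) (infsum b J)"
proof -
  show sm: "(\<lambda>j. cmod (F j k)) summable_on J" for k
  proof (rule Infinite_Sum.abs_summable_on_comparison_test'[OF summable_on_cmult_right[OF b, of "inverse (jb k powr (s / 2))"]])
    fix j assume "j \<in> J"
    from sob_le_coeff[OF F[OF this], of k]
    show "norm (F j k) \<le> inverse (jb k powr (s / 2)) * b j"
      by (simp add: field_simps)
  qed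
  show "sob_le s (\<lambda>k. of_real (\<Sum>\<^sub>\<infinity>j\<in>J. cmod (F j k))) (infsum b J)"
    unfolding sob_le_def
  proof (intro allI impI)
    fix A :: "(int ^ 'b) set" assume A: "finite A"
    let ?L = "\<lambda>g. L2_set (\<lambda>k. jb k powr (s / 2) * \<bar>g k\<bar>) A"
    have "((\<lambda>X. ?L (\<lambda>k. \<Sum>j\<in>X. cmod (F j k))) \<longlongrightarrow> ?L (\<lambda>k. \<Sum>\<^sub>\<infinity>j\<in>J. cmod (F j k))) (finite_subsets_at_top J)"
      unfolding L2_set_def by (intro tendsto_intros infsum_tendsto sm)
    moreover have "\<forall>\<^sub>F X in finite_subsets_at_top J. ?L (\<lambda>k. \<Sum>j\<in>X. cmod (F j k)) \<le> infsum b J"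
    proof (rule eventually_finite_subsets_at_top_weakI)
      fix X assume X: "finite X" "X \<subseteq> J"
      have "sob_le s (\<lambda>k. \<Sum>j\<in>X. of_real (cmod (F j k))) (sum b X)"
      proof (rule sob_le_sum[OF X(1)])
        fix j assume "j \<in> X"
        then have "sob_le s (F j) (b j)" using X F by auto
        then show "sob_le s (\<lambda>k. of_real (cmod (F j k))) (b j)" by (rule sob_le_mono) auto
      qed
      from sob_leD[OF this A]
      have "?L (\<lambda>k. \<Sum>j\<in>X. cmod (F j k)) \<le> sum b X" by (simp flip: of_real_sum)
      also have "\<dots> \<le> infsum b J"
        using X by (intro finite_sum_le_infsum b) (auto intro: sob_le_nonneg F)
      finally show "?L (\<lambda>k. \<Sum>j\<in>X. cmod (F j k)) \<le> infsum b J" .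
    qed
    ultimately have "?L (\<lambda>k. \<Sum>\<^sub>\<infinity>j\<in>J. cmod (F j k)) \<le> infsum b J"
      by (intro tendsto_upperbound) auto
    then show "L2_set (\<lambda>k. jb k powr (s / 2) * cmod (of_real (\<Sum>\<^sub>\<infinity>j\<in>J. cmod (F j k)))) A \<le> infsum b J"
      by simp
  qed
qed

text \<open>The scalar function g(t), the weighted inner product of D(t) with the fixed vector
  D(\<tau>) over finitely many frequencies, satisfies |g'| \<le> L B and g(\<tau>) = L^2. Hence L^2
  \<le> \<tau> L B, and coefficientwise derivatives give a bound for the whole norm.\<close>

lemma sob_le_mean_value:
  fixes D :: "real \<Rightarrow> int ^ 'd::finite \<Rightarrow> complex"
  assumes "0 \<le> \<tau>" and zero: "\<And>k. D 0 k = 0"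
    and deriv: "\<And>t k. t \<in> {0..\<tau>} \<Longrightarrow> ((\<lambda>t. D t k) has_vector_derivative D' t k) (at t within {0..\<tau>})"
    and bound: "\<And>t. t \<in> {0..\<tau>} \<Longrightarrow> sob_le s (D' t) B"
  shows "sob_le s (D \<tau>) (\<tau> * B)"
  unfolding sob_le_def
proof (intro allI impI)
  fix A :: "(int ^ 'd) set" assume A: "finite A"
  let ?w = "\<lambda>k::int^'d. jb k powr (s / 2)"
  define L where "L = L2_set (\<lambda>k. ?w k * cmod (D \<tau> k)) A"
  define g where "g t = (\<Sum>k\<in>A. of_real (?w k * ?w k) * cnj (D \<tau> k) * D t k)" for t
  define g' where "g' t = (\<Sum>k\<in>A. of_real (?w k * ?w k) * cnj (D \<tau> k) * D' t k)" for t
  have "(g has_vector_derivative g' t) (at t within {0..\<tau>})" if "t \<in> {0..\<tau>}" for t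
    unfolding g_def g'_def by (intro has_vector_derivative_sum has_vector_derivative_mult_right deriv that)
  moreover have "norm (g' t) \<le> L * B" if "t \<in> {0..\<tau>}" for t
  proof -
    have "norm (g' t) \<le> (\<Sum>k\<in>A. \<bar>?w k * cmod (D \<tau> k)\<bar> * \<bar>?w k * cmod (D' t k)\<bar>)"
      unfolding g'_def by (rule sum_norm_le) (simp add: norm_mult)
    also have "\<dots> \<le> L * L2_set (\<lambda>k. ?w k * cmod (D' t k)) A"
      unfolding L_def by (rule L2_set_mult_ineq)
    also have "\<dots> \<le> L * B"
      unfolding L_def by (intro mult_left_mono sob_leD[OF bound[OF that] A]) auto
    finally show ?thesis .
  qed
  ultimately have "norm (g \<tau> - g 0) \<le> L * B * norm (\<tau> - 0)"
    using \<open>0 \<le> \<tau>\<close>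
    by (intro differentiable_bound[of "{0..\<tau>}" g "\<lambda>t h. h *\<^sub>R g' t"])
      (auto simp: has_vector_derivative_def onorm_scaleR_left bounded_linear_ident onorm_id)
  moreover have "g 0 = 0" by (simp add: g_def zero)
  moreover have "g \<tau> = of_real (L\<^sup>2)"
  proof -
    have "L\<^sup>2 = (\<Sum>k\<in>A. (?w k * cmod (D \<tau> k))\<^sup>2)"
      unfolding L_def L2_set_def by (simp add: sum_nonneg)
    moreover have "of_real ((?w k * cmod (D \<tau> k))\<^sup>2) = of_real (?w k * ?w k) * cnj (D \<tau> k) * D \<tau> k" for k
      using complex_norm_square[of "D \<tau> k"] by (simp add: power_mult_distrib power2_eq_square mult_ac)
    ultimately show ?thesis by (simp add: g_def)
  qed
  ultimately have "L * L \<le> L * (\<tau> * B)" using \<open>0 \<le> \<tau>\<close> by (simp add: power2_eq_square norm_mult mult_ac)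
  moreover have "0 \<le> L" by (simp add: L_def)
  moreover have "0 \<le> B" using bound[of 0] \<open>0 \<le> \<tau>\<close> sob_le_nonneg by auto
  ultimately have "L \<le> \<tau> * B" using \<open>0 \<le> \<tau>\<close> by (cases "L = 0") auto
  then show "L2_set (\<lambda>k. ?w k * cmod (D \<tau> k)) A \<le> \<tau> * B" by (simp add: L_def)
qed

section \<open>Embedding of H^s into the absolutely summable sequences for s > d/2\<close>

lemma summable_jb_powr:
  assumes "s > real CARD('d::finite) / 2"
  shows "(\<lambda>k::int ^ 'd. jb k powr (- s)) summable_on UNIV"
proof -
  \<comment> \<open>The weight in d dimensions is at most a product of one-dimensional weights with
    exponent s/d > 1/2, so the lattice sum is bounded by the d-th power of a convergent sum over the
    integers.\<close>
  define r where "r = s / real CARD('d)"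
  have r: "2 * r > 1" using assms by (simp add: r_def field_simps)
  define h where "h n = (1 + (real_of_int n)\<^sup>2) powr (- r)" for n
  have h0: "0 \<le> h n" for n by (simp add: h_def)
  have hn: "h (int n) \<le> (if n = 0 then 1 else 0) + real n powr (- (2 * r))" for n
  proof (cases "n = 0")
    case False
    have "h (int n) \<le> ((real n)\<^sup>2) powr (- r)"
      unfolding h_def using False r by (intro powr_mono2') auto
    also have "(real n)\<^sup>2 powr (- r) = real n powr (- (2 * r))"
      using False by (simp add: powr_powr flip: powr_numeral)
    finally show ?thesis using False by simp
  qed (simp add: h_def)
  have sm: "summable (\<lambda>n. (if n = 0 then 1 else 0) + real n powr (- (2 * r)))"
    using r by (intro summable_add) (auto simp: summable_real_powr_iff)
  \<comment> \<open>The factor 2 covers n and -n; the index 0 is counted twice, which only enlarges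
    the bound.\<close>
  define Z where "Z = 2 * suminf (\<lambda>n. (if n = 0 then 1 else 0) + real n powr (- (2 * r)))"
  have Z: "(\<Sum>n\<in>{- int N..int N}. h n) \<le> Z" for N
  proof -
    have "{- int N..int N} \<subseteq> int ` {..N} \<union> (\<lambda>n. - int n) ` {..N}"
    proof
      fix x assume "x \<in> {- int N..int N}"
      then have "nat \<bar>x\<bar> \<le> N" "x = int (nat \<bar>x\<bar>) \<or> x = - int (nat \<bar>x\<bar>)" by auto
      then show "x \<in> int ` {..N} \<union> (\<lambda>n. - int n) ` {..N}" by blast
    qed
    then have "(\<Sum>n\<in>{- int N..int N}. h n) \<le> sum h (int ` {..N} \<union> (\<lambda>n. - int n) ` {..N})"
      by (intro sum_mono2) (auto simp: h0)
    also have "\<dots> \<le> sum h (int ` {..N}) + sum h ((\<lambda>n. - int n) ` {..N})"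
      by (subst sum_Un) (auto simp: h0 sum_nonneg)
    also have "\<dots> = 2 * (\<Sum>n\<le>N. h (int n))"
      by (simp add: sum.reindex inj_on_def h_def)
    also have "(\<Sum>n\<le>N. h (int n)) \<le> (\<Sum>n\<le>N. (if n = 0 then 1 else 0) + real n powr (- (2 * r)))"
      by (intro sum_mono hn)
    also have "\<dots> \<le> suminf (\<lambda>n. (if n = 0 then 1 else 0) + real n powr (- (2 * r)))"
      by (intro sum_le_suminf sm) auto
    finally show ?thesis by (simp add: Z_def)
  qed
  have "sum (\<lambda>k::int^'d. jb k powr (- s)) A \<le> Z ^ CARD('d)" if A: "finite A" for A
  proof -
    \<comment> \<open>A finite set of frequencies lies in a cube, over which the sum of products
      factorizes.\<close>
    obtain N where N: "\<And>k i. k \<in> A \<Longrightarrow> \<bar>k $ i\<bar> \<le> int N"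
    proof
      let ?N = "nat (Max ((\<lambda>(k, i). \<bar>k $ i\<bar>) ` (A \<times> UNIV)))"
      show "\<bar>k $ i\<bar> \<le> int ?N" if "k \<in> A" for k i
      proof -
        have "\<bar>k $ i\<bar> \<le> Max ((\<lambda>(k, i). \<bar>k $ i\<bar>) ` (A \<times> UNIV))"
          using that A by (intro Max_ge) (auto intro!: image_eqI[of _ _ "(k, i)"])
        then show ?thesis by linarith
      qed
    qed
    have le: "jb k powr (- s) \<le> (\<Prod>i\<in>UNIV. h (k $ i))" for k :: "int ^ 'd"
    proof -
      have "jb k powr (- s) = (\<Prod>i\<in>(UNIV :: 'd set). jb k powr (- r))"
        by (simp add: r_def powr_powr flip: powr_realpow)
      also have "\<dots> \<le> (\<Prod>i\<in>UNIV. h (k $ i))"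
      proof (intro prod_mono conjI)
        fix i
        have "\<bar>real_of_int (k $ i)\<bar> \<le> norm (rvec k)"
          using component_le_norm_cart[of "rvec k" i] by (simp add: rvec_def)
        from power_mono[OF this, of 2] have "(real_of_int (k $ i))\<^sup>2 \<le> (norm (rvec k))\<^sup>2" by simp
        then show "jb k powr (- r) \<le> h (k $ i)"
          unfolding h_def jb_def using r by (intro powr_mono2') (auto simp: add_pos_nonneg)
      qed auto
      finally show ?thesis .
    qed
    have "sum (\<lambda>k::int^'d. jb k powr (- s)) A \<le> (\<Sum>k\<in>A. \<Prod>i\<in>UNIV. h (k $ i))"
      by (intro sum_mono le)
    also have "\<dots> \<le> (\<Sum>k\<in>vec_lambda ` (PiE UNIV (\<lambda>_::'d. {- int N..int N})). \<Prod>i\<in>UNIV. h (k $ i))"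
    proof (rule sum_mono2)
      show "A \<subseteq> vec_lambda ` (PiE UNIV (\<lambda>_::'d. {- int N..int N}))"
      proof
        fix k assume "k \<in> A"
        then have "- int N \<le> k $ i \<and> k $ i \<le> int N" for i using N[of k i] by linarith
        then show "k \<in> vec_lambda ` (PiE UNIV (\<lambda>_::'d. {- int N..int N}))"
          by (intro image_eqI[of _ _ "vec_nth k"]) (auto simp: PiE_def)
      qed
    qed (auto simp: h0 prod_nonneg intro!: finite_PiE)
    also have "\<dots> = (\<Sum>g\<in>PiE UNIV (\<lambda>_::'d. {- int N..int N}). \<Prod>i\<in>UNIV. h (g i))"
      by (subst sum.reindex) (auto simp: inj_on_def vec_lambda_inject)
    also have "\<dots> = (\<Prod>i\<in>(UNIV::'d set). \<Sum>n\<in>{- int N..int N}. h n)"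
      by (subst prod_sum_PiE) auto
    also have "\<dots> \<le> (\<Prod>i\<in>(UNIV::'d set). Z)"
      by (intro prod_mono) (auto simp: Z h0 sum_nonneg)
    finally show ?thesis by simp
  qed
  then show ?thesis by (intro nonneg_bdd_above_summable_on bdd_aboveI2) auto
qed

lemma cauchy_schwarz_jb:
  fixes a :: "int ^ 'd::finite \<Rightarrow> complex"
  assumes s: "s > real CARD('d) / 2" and a: "sob_le s a A" and "finite F"
  shows "(\<Sum>k\<in>F. cmod (a k)) \<le> sqrt (\<Sum>\<^sub>\<infinity>k::int ^ 'd. jb k powr (- s)) * A"
proof -
  have "(\<Sum>k\<in>F. cmod (a k)) = (\<Sum>k\<in>F. \<bar>jb k powr (- s / 2)\<bar> * \<bar>jb k powr (s / 2) * cmod (a k)\<bar>)"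
    by (intro sum.cong refl) (simp add: powr_minus field_simps)
  also have "\<dots> \<le> L2_set (\<lambda>k. jb k powr (- s / 2)) F * L2_set (\<lambda>k. jb k powr (s / 2) * cmod (a k)) F"
    by (rule L2_set_mult_ineq)
  also have "\<dots> \<le> sqrt (\<Sum>\<^sub>\<infinity>k::int ^ 'd. jb k powr (- s)) * A"
  proof (intro mult_mono sob_leD[OF a \<open>finite F\<close>])
    have "(\<Sum>k\<in>F. jb k powr (- s)) \<le> (\<Sum>\<^sub>\<infinity>k::int ^ 'd. jb k powr (- s))"
      using \<open>finite F\<close> by (intro finite_sum_le_infsum summable_jb_powr s) auto
    moreover have "(jb k powr (- s / 2))\<^sup>2 = jb k powr (- s)" for k :: "int ^ 'd"
      by (simp add: power2_eq_square flip: powr_add)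
    ultimately show "L2_set (\<lambda>k. jb k powr (- s / 2)) F \<le> sqrt (\<Sum>\<^sub>\<infinity>k::int ^ 'd. jb k powr (- s))"
      unfolding L2_set_def by simp
  qed (auto intro: infsum_nonneg)
  finally show ?thesis .
qed

text \<open>The Cauchy-Schwarz constant of the embedding of H^s into l^1. The type argument fixes
  the dimension, on which the sum depends.\<close>

definition emb_const :: "'d::finite itself \<Rightarrow> real \<Rightarrow> real" where
  "emb_const _ s = sqrt (\<Sum>\<^sub>\<infinity>k::int ^ 'd. jb k powr (- s))"

lemma sob_le_l1:
  fixes a :: "int ^ 'd::finite \<Rightarrow> complex"
  assumes "s > real CARD('d) / 2" "sob_le s a A"
  shows "(\<lambda>k. cmod (a k)) summable_on UNIV"
    and "(\<Sum>\<^sub>\<infinity>k. cmod (a k)) \<le> emb_const TYPE('d) s * A"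
proof -
  note cs = cauchy_schwarz_jb[OF assms, folded emb_const_def[of "TYPE('d)"]]
  show sm: "(\<lambda>k. cmod (a k)) summable_on UNIV"
    using cs by (intro nonneg_bdd_above_summable_on bdd_aboveI2[where M = "emb_const TYPE('d) s * A"]) auto
  show "(\<Sum>\<^sub>\<infinity>k. cmod (a k)) \<le> emb_const TYPE('d) s * A"
    using cs by (intro infsum_le_finite_sums sm) auto
qed

section \<open>Young's inequality and the trilinear convolution\<close>

lemma sob_le_reindex:
  fixes a :: "int ^ 'd::finite \<Rightarrow> complex" and h :: "int ^ 'd \<Rightarrow> int ^ 'd"
  assumes "sob_le 0 a A" "inj h"
  shows "sob_le 0 (\<lambda>k. a (h k)) A"
  unfolding sob_le_def
proof (intro allI impI)
  fix F :: "(int ^ 'd) set" assume F: "finite F"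
  have "inj_on h F" using assms(2) by (rule inj_on_subset) simp
  then have "L2_set (\<lambda>k. jb k powr (0 / 2) * cmod (a (h k))) F = L2_set (\<lambda>k. jb k powr (0 / 2) * cmod (a k)) (h ` F)"
    by (simp add: L2_set_def sum.reindex)
  also have "\<dots> \<le> A" using F by (intro sob_leD[OF assms(1)]) auto
  finally show "L2_set (\<lambda>k. jb k powr (0 / 2) * cmod (a (h k))) F \<le> A" .
qed

text \<open>Young's inequality for l^1 and l^2 (order 0 is l^2), written with injective reindexings
  instead of translations so that reflections are covered as well. A reindexing does not increase
  the l^2 norm.\<close>

lemma sob_le_young:
  fixes a :: "int ^ 'd::finite \<Rightarrow> complex" and h :: "'j \<Rightarrow> int ^ 'd \<Rightarrow> int ^ 'd"
  assumes a: "sob_le 0 a A" and b: "(\<lambda>j. cmod (b j)) summable_on J" and h: "\<And>j. j \<in> J \<Longrightarrow> inj (h j)"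
  shows "(\<lambda>j. cmod (b j * a (h j k))) summable_on J"
    and "sob_le 0 (\<lambda>k. of_real (\<Sum>\<^sub>\<infinity>j\<in>J. cmod (b j * a (h j k)))) ((\<Sum>\<^sub>\<infinity>j\<in>J. cmod (b j)) * A)"
proof -
  have 1: "sob_le 0 (\<lambda>k. b j * a (h j k)) (cmod (b j) * A)" if "j \<in> J" for j
    by (rule sob_le_cmult[OF sob_le_reindex[OF a h[OF that]]])
  have 2: "(\<lambda>j. cmod (b j) * A) summable_on J" using b by (rule summable_on_cmult_left)
  show "(\<lambda>j. cmod (b j * a (h j k))) summable_on J"
    using sob_le_infsum(1)[of J 0 "\<lambda>j k. b j * a (h j k)", OF 1 2] .
  show "sob_le 0 (\<lambda>k. of_real (\<Sum>\<^sub>\<infinity>j\<in>J. cmod (b j * a (h j k)))) ((\<Sum>\<^sub>\<infinity>j\<in>J. cmod (b j)) * A)"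
    using sob_le_infsum(2)[of J 0 "\<lambda>j k. b j * a (h j k)", OF 1 2] infsum_cmult_left'[of "\<lambda>j. cmod (b j)" A J]
    by simp
qed

definition triads :: "int ^ 'd \<Rightarrow> ((int ^ 'd) \<times> (int ^ 'd) \<times> (int ^ 'd)) set" where
  "triads k = {(k1, k2, k3). - k1 + k2 + k3 = k}"

text \<open>The coefficients of the product of conj(f), g and h, with a symbol m inserted. The
  coefficient of conj(f) at -k1 is the conjugate of that of f at k1, whence the sign of k1 in
  \<open>triads\<close>.\<close>

definition tri :: "(int ^ 'd \<Rightarrow> int ^ 'd \<Rightarrow> int ^ 'd \<Rightarrow> complex) \<Rightarrow> (int ^ 'd \<Rightarrow> complex) \<Rightarrow>
    (int ^ 'd \<Rightarrow> complex) \<Rightarrow> (int ^ 'd \<Rightarrow> complex) \<Rightarrow> int ^ 'd \<Rightarrow> complex" where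
  "tri m a b c k = (\<Sum>\<^sub>\<infinity>(k1, k2, k3)\<in>triads k. m k1 k2 k3 * cnj (a k1) * b k2 * c k3)"

text \<open>Any two of the three frequencies are free. The third one, determined by k, belongs to
  the factor that is measured in l^2.\<close>

lemma bij_triads:
  "bij_betw (\<lambda>(k2, k3). (k2 + k3 - k, k2, k3)) UNIV (triads k)"
  "bij_betw (\<lambda>(k1, k3). (k1, k + k1 - k3, k3)) UNIV (triads k)"
  "bij_betw (\<lambda>(k1, k2). (k1, k2, k + k1 - k2)) UNIV (triads k)"
  by (auto simp: bij_betw_def inj_on_def triads_def image_iff algebra_simps)

lemma summable_norm_pairs:
  fixes f :: "'a \<Rightarrow> complex" and g :: "'b \<Rightarrow> complex"
  assumes f: "(\<lambda>x. cmod (f x)) summable_on UNIV" "(\<Sum>\<^sub>\<infinity>x. cmod (f x)) \<le> F"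
    and g: "(\<lambda>y. cmod (g y)) summable_on UNIV" "(\<Sum>\<^sub>\<infinity>y. cmod (g y)) \<le> G"
  shows "(\<lambda>(x, y). cmod (f x * g y)) summable_on UNIV"
    and "(\<Sum>\<^sub>\<infinity>(x, y). cmod (f x * g y)) \<le> F * G"
proof -
  let ?F = "\<Sum>\<^sub>\<infinity>x. cmod (f x)" and ?G = "\<Sum>\<^sub>\<infinity>y. cmod (g y)"
  let ?h = "\<lambda>p. cmod (f (fst p)) * cmod (g (snd p))"
  have 1: "((\<lambda>y. ?h (x, y)) has_sum cmod (f x) * ?G) UNIV" for x
    using has_sum_cmult_right[OF has_sum_infsum[OF g(1)], of "cmod (f x)"] by simp
  have 2: "((\<lambda>x. cmod (f x) * ?G) has_sum ?F * ?G) UNIV"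
    by (rule has_sum_cmult_left[OF has_sum_infsum[OF f(1)]])
  have 3: "?h summable_on UNIV \<times> UNIV"
    by (rule summable_on_SigmaI[OF 1]) (use 2 in \<open>auto dest: has_sum_imp_summable\<close>)
  have 4: "(?h has_sum ?F * ?G) (UNIV \<times> UNIV)"
    using 1 2 3 by (rule has_sum_SigmaI)
  have eq: "(\<lambda>(x, y). cmod (f x * g y)) = ?h" by (auto simp: norm_mult)
  show "(\<lambda>(x, y). cmod (f x * g y)) summable_on UNIV" using 3 by (simp only: eq UNIV_Times_UNIV)
  have "(\<Sum>\<^sub>\<infinity>(x, y). cmod (f x * g y)) = ?F * ?G"
    unfolding eq using infsumI[OF 4] by simp
  also have "\<dots> \<le> F * G"
    using f g infsum_nonneg[of UNIV "\<lambda>x. cmod (f x)"] infsum_nonneg[of UNIV "\<lambda>x. cmod (g x)"]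
    by (intro mult_mono) auto
  finally show "(\<Sum>\<^sub>\<infinity>(x, y). cmod (f x * g y)) \<le> F * G" .
qed

text \<open>Two factors are measured in l^1, each at the price of one embedding constant, and one in
  l^2. There are three versions because the weight <k>^s may have to be put on any of the
  factors.\<close>

lemma triads_young:
  fixes a b c :: "int ^ 'd::finite \<Rightarrow> complex"
  assumes s: "s > real CARD('d) / 2"
  defines "E \<equiv> emb_const TYPE('d) s"
  shows "sob_le 0 a A \<Longrightarrow> sob_le s b B \<Longrightarrow> sob_le s c D \<Longrightarrow>
      (\<forall>k. (\<lambda>(k1, k2, k3). cmod (a k1 * b k2 * c k3)) summable_on triads k) \<and>
      sob_le 0 (\<lambda>k. of_real (\<Sum>\<^sub>\<infinity>(k1, k2, k3)\<in>triads k. cmod (a k1 * b k2 * c k3))) (E\<^sup>2 * A * B * D)"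
    and "sob_le s a A \<Longrightarrow> sob_le 0 b B \<Longrightarrow> sob_le s c D \<Longrightarrow>
      (\<forall>k. (\<lambda>(k1, k2, k3). cmod (a k1 * b k2 * c k3)) summable_on triads k) \<and>
      sob_le 0 (\<lambda>k. of_real (\<Sum>\<^sub>\<infinity>(k1, k2, k3)\<in>triads k. cmod (a k1 * b k2 * c k3))) (E\<^sup>2 * A * B * D)"
    and "sob_le s a A \<Longrightarrow> sob_le s b B \<Longrightarrow> sob_le 0 c D \<Longrightarrow>
      (\<forall>k. (\<lambda>(k1, k2, k3). cmod (a k1 * b k2 * c k3)) summable_on triads k) \<and>
      sob_le 0 (\<lambda>k. of_real (\<Sum>\<^sub>\<infinity>(k1, k2, k3)\<in>triads k. cmod (a k1 * b k2 * c k3))) (E\<^sup>2 * A * B * D)"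
proof -
  \<comment> \<open>Here x is the factor in l^2, while y and z form an absolutely summable family
    over pairs that shifts or reflects the argument of x.\<close>
  have key: "(\<forall>k. (\<lambda>t. cmod (f t)) summable_on triads k) \<and>
      sob_le 0 (\<lambda>k. of_real (\<Sum>\<^sub>\<infinity>t\<in>triads k. cmod (f t))) (E\<^sup>2 * A * B * D)"
    if x: "sob_le 0 x A" and y: "sob_le s y B" and z: "sob_le s z D"
      and bij: "\<And>k. bij_betw (\<pi> k) UNIV (triads k)"
      and eq: "\<And>k p. cmod (f (\<pi> k p)) = cmod (y (fst p) * z (snd p) * x (h p k))"
      and h: "\<And>p. inj (h p)"
    for x y z :: "int ^ 'd \<Rightarrow> complex" and A B D \<pi> h and f :: "(int ^ 'd) \<times> (int ^ 'd) \<times> (int ^ 'd) \<Rightarrow> complex"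
  proof -
    note yz = summable_norm_pairs[OF sob_le_l1[OF s y] sob_le_l1[OF s z]]
    have yz1: "(\<lambda>p. cmod (y (fst p) * z (snd p))) summable_on UNIV"
      using yz(1) by (simp add: case_prod_unfold)
    have yz2: "(\<Sum>\<^sub>\<infinity>p. cmod (y (fst p) * z (snd p))) \<le> E * B * (E * D)"
      using yz(2) by (simp add: case_prod_unfold E_def)
    note Y = sob_le_young[OF x yz1 h]
    have "(\<lambda>t. cmod (f t)) summable_on triads k" for k
      using Y(1)[where k = k] summable_on_reindex_bij_betw[OF bij[of k], of "\<lambda>t. cmod (f t)"] by (simp add: eq)
    moreover have "(\<Sum>\<^sub>\<infinity>t\<in>triads k. cmod (f t)) = (\<Sum>\<^sub>\<infinity>p. cmod (y (fst p) * z (snd p) * x (h p k)))" for k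
      using infsum_reindex_bij_betw[OF bij[of k], of "\<lambda>t. cmod (f t)"] by (simp add: eq)
    moreover have "(\<Sum>\<^sub>\<infinity>p. cmod (y (fst p) * z (snd p))) * A \<le> E\<^sup>2 * A * B * D"
      using mult_right_mono[OF yz2 sob_le_nonneg[OF x]] by (simp add: power2_eq_square mult_ac)
    ultimately show ?thesis using sob_le_bound[OF Y(2)] by simp
  qed
  have inj: "inj (\<lambda>k. c - k)" "inj (\<lambda>k. k + c - c')" for c c' :: "int ^ 'd" by (auto simp: inj_on_def)
  show "sob_le 0 a A \<Longrightarrow> sob_le s b B \<Longrightarrow> sob_le s c D \<Longrightarrow>
      (\<forall>k. (\<lambda>(k1, k2, k3). cmod (a k1 * b k2 * c k3)) summable_on triads k) \<and>
      sob_le 0 (\<lambda>k. of_real (\<Sum>\<^sub>\<infinity>(k1, k2, k3)\<in>triads k. cmod (a k1 * b k2 * c k3))) (E\<^sup>2 * A * B * D)"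
    using key[of a A b B c D, OF _ _ _ bij_triads(1), of "\<lambda>t. a (fst t) * b (fst (snd t)) * c (snd (snd t))"
        "\<lambda>p k. fst p + snd p - k"] inj
    by (simp add: case_prod_unfold norm_mult mult_ac)
  show "sob_le s a A \<Longrightarrow> sob_le 0 b B \<Longrightarrow> sob_le s c D \<Longrightarrow>
      (\<forall>k. (\<lambda>(k1, k2, k3). cmod (a k1 * b k2 * c k3)) summable_on triads k) \<and>
      sob_le 0 (\<lambda>k. of_real (\<Sum>\<^sub>\<infinity>(k1, k2, k3)\<in>triads k. cmod (a k1 * b k2 * c k3))) (E\<^sup>2 * A * B * D)"
    using key[of b B a A c D, OF _ _ _ bij_triads(2), of "\<lambda>t. a (fst t) * b (fst (snd t)) * c (snd (snd t))"
        "\<lambda>p k. k + (fst p - snd p)"] inj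
    by (simp add: case_prod_unfold norm_mult mult_ac algebra_simps)
  show "sob_le s a A \<Longrightarrow> sob_le s b B \<Longrightarrow> sob_le 0 c D \<Longrightarrow>
      (\<forall>k. (\<lambda>(k1, k2, k3). cmod (a k1 * b k2 * c k3)) summable_on triads k) \<and>
      sob_le 0 (\<lambda>k. of_real (\<Sum>\<^sub>\<infinity>(k1, k2, k3)\<in>triads k. cmod (a k1 * b k2 * c k3))) (E\<^sup>2 * A * B * D)"
    using key[of c D a A b B, OF _ _ _ bij_triads(3), of "\<lambda>t. a (fst t) * b (fst (snd t)) * c (snd (snd t))"
        "\<lambda>p k. k + (fst p - snd p)"] inj
    by (simp add: case_prod_unfold norm_mult mult_ac algebra_simps)
qed

text \<open>The square of a sum of three terms is at most 3 times the sum of their squares, and that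
  sum is at most 3 times its largest term: this is the origin of 9. The r-th power of the largest
  term is among the terms on the right.\<close>

lemma jb_triad:
  assumes "(k1, k2, k3) \<in> triads k" "0 \<le> r"
  shows "jb k powr r \<le> 9 powr r * (jb k1 powr r + jb k2 powr r + jb k3 powr r)"
proof -
  have k: "rvec k = - rvec k1 + rvec k2 + rvec k3" using assms(1) by (auto simp: triads_def)
  let ?M = "max (jb k1) (max (jb k2) (jb k3))"
  have "norm (rvec k) \<le> norm (rvec k1) + norm (rvec k2) + norm (rvec k3)"
    unfolding k using norm_triangle_ineq[of "- rvec k1 + rvec k2" "rvec k3"] norm_triangle_ineq[of "- rvec k1" "rvec k2"]
    by simp
  then have "(norm (rvec k))\<^sup>2 \<le> (norm (rvec k1) + norm (rvec k2) + norm (rvec k3))\<^sup>2"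
    by (intro power_mono) auto
  also have "\<dots> \<le> 3 * ((norm (rvec k1))\<^sup>2 + (norm (rvec k2))\<^sup>2 + (norm (rvec k3))\<^sup>2)"
    using sum_squares_bound[of "norm (rvec k1)" "norm (rvec k2)"]
      sum_squares_bound[of "norm (rvec k1)" "norm (rvec k3)"] sum_squares_bound[of "norm (rvec k2)" "norm (rvec k3)"]
    by (simp add: power2_eq_square algebra_simps)
  finally have "jb k \<le> 3 * (jb k1 + jb k2 + jb k3)" by (simp add: jb_def)
  moreover have "x \<le> 9 * M" if "x \<le> 3 * (a + b + c)" "a \<le> M" "b \<le> M" "c \<le> M" for x a b c M :: real
    using that by (simp add: distrib_left)
  ultimately have "jb k \<le> 9 * ?M" by simp
  then have "jb k powr r \<le> (9 * ?M) powr r" using assms(2) by (intro powr_mono2) auto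
  also have "\<dots> = 9 powr r * ?M powr r" by (intro powr_mult) 
  also have "\<dots> \<le> 9 powr r * (jb k1 powr r + jb k2 powr r + jb k3 powr r)"
    by (intro mult_left_mono) (auto simp: max_def)
  finally show ?thesis .
qed

text \<open>The factor 3 counts the positions of the weight, \<open>9 powr (s / 2)\<close> comes
  from \<open>jb_triad\<close>, and the two embedding constants from the two factors taken in
  l^1.\<close>

definition tri_const :: "'d::finite itself \<Rightarrow> real \<Rightarrow> real" where
  "tri_const D s = 3 * 9 powr (s / 2) * (emb_const D s)\<^sup>2"

lemma tri_const_nonneg: "0 \<le> tri_const TYPE('d::finite) s"
  by (simp add: tri_const_def)

text \<open>The algebra property of H^s: the weight at k is dominated by the sum of the weights at
  k1, k2, k3, and each of the three resulting sums is estimated by Young's inequality with the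
  weighted factor in l^2.\<close>

lemma triads_algebra:
  fixes a b c :: "int ^ 'd::finite \<Rightarrow> complex"
  assumes s: "s > real CARD('d) / 2" and a: "sob_le s a A" and b: "sob_le s b B" and c: "sob_le s c D"
  shows "(\<lambda>(k1, k2, k3). cmod (a k1 * b k2 * c k3)) summable_on triads k"
    and "sob_le s (\<lambda>k. of_real (\<Sum>\<^sub>\<infinity>(k1, k2, k3)\<in>triads k. cmod (a k1 * b k2 * c k3)))
      (tri_const TYPE('d) s * A * B * D)"
proof -
  have s0: "0 \<le> s / 2" using s by (smt (verit) divide_nonneg_pos of_nat_0_le_iff)
  let ?w = "\<lambda>k::int^'d. jb k powr (s / 2)"
  let ?E = "emb_const TYPE('d) s"
  have w: "sob_le 0 (\<lambda>k. of_real (?w k) * x k) M" if "sob_le s x M" for x :: "int ^ 'd \<Rightarrow> complex" and M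
    using that sob_le_weight[of 0 s x M] by simp
  have sob0: "sob_le 0 x M" if "sob_le s x M" for x :: "int ^ 'd \<Rightarrow> complex" and M
    using sob_le_order_mono[OF that, of 0] s0 by simp
  have sm: "(\<lambda>(k1, k2, k3). cmod (a k1 * b k2 * c k3)) summable_on triads k" for k
    using triads_young(1)[OF s sob0[OF a] b c] by simp
  then show "(\<lambda>(k1, k2, k3). cmod (a k1 * b k2 * c k3)) summable_on triads k" .
  define f where "f k = (\<Sum>\<^sub>\<infinity>(k1, k2, k3)\<in>triads k. cmod (a k1 * b k2 * c k3))" for k
  define f1 where "f1 k = (\<Sum>\<^sub>\<infinity>(k1, k2, k3)\<in>triads k. cmod ((of_real (?w k1) * a k1) * b k2 * c k3))" for k
  define f2 where "f2 k = (\<Sum>\<^sub>\<infinity>(k1, k2, k3)\<in>triads k. cmod (a k1 * (of_real (?w k2) * b k2) * c k3))" for k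
  define f3 where "f3 k = (\<Sum>\<^sub>\<infinity>(k1, k2, k3)\<in>triads k. cmod (a k1 * b k2 * (of_real (?w k3) * c k3)))" for k
  note Y1 = triads_young(1)[OF s w[OF a] b c]
  note Y2 = triads_young(2)[OF s a w[OF b] c]
  note Y3 = triads_young(3)[OF s a b w[OF c]]
  have f0: "0 \<le> f k" "0 \<le> f1 k" "0 \<le> f2 k" "0 \<le> f3 k" for k
    unfolding f_def f1_def f2_def f3_def by (auto intro!: infsum_nonneg)
  have le: "?w k * f k \<le> 9 powr (s / 2) * (f1 k + f2 k + f3 k)" for k
  proof -
    have "?w k * f k = (\<Sum>\<^sub>\<infinity>t\<in>triads k. ?w k * (case t of (k1, k2, k3) \<Rightarrow> cmod (a k1 * b k2 * c k3)))"
      unfolding f_def by (rule infsum_cmult_right' [symmetric])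
    also have "\<dots> \<le> (\<Sum>\<^sub>\<infinity>t\<in>triads k. 9 powr (s / 2) *
        ((case t of (k1, k2, k3) \<Rightarrow> cmod ((of_real (?w k1) * a k1) * b k2 * c k3)) +
         (case t of (k1, k2, k3) \<Rightarrow> cmod (a k1 * (of_real (?w k2) * b k2) * c k3)) +
         (case t of (k1, k2, k3) \<Rightarrow> cmod (a k1 * b k2 * (of_real (?w k3) * c k3)))))"
    proof (rule infsum_mono)
      show "(\<lambda>t. ?w k * (case t of (k1, k2, k3) \<Rightarrow> cmod (a k1 * b k2 * c k3))) summable_on triads k"
        using sm by (rule summable_on_cmult_right)
      show "(\<lambda>t. 9 powr (s / 2) *
        ((case t of (k1, k2, k3) \<Rightarrow> cmod ((of_real (?w k1) * a k1) * b k2 * c k3)) +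
         (case t of (k1, k2, k3) \<Rightarrow> cmod (a k1 * (of_real (?w k2) * b k2) * c k3)) +
         (case t of (k1, k2, k3) \<Rightarrow> cmod (a k1 * b k2 * (of_real (?w k3) * c k3))))) summable_on triads k"
        using Y1 Y2 Y3 by (intro summable_on_cmult_right summable_on_add) blast+
      fix t assume t: "t \<in> triads k"
      obtain k1 k2 k3 where [simp]: "t = (k1, k2, k3)" by (cases t)
      let ?n = "cmod (a k1 * b k2 * c k3)"
      have "?w k * ?n \<le> 9 powr (s / 2) * (?w k1 + ?w k2 + ?w k3) * ?n"
        using t s0 by (intro mult_right_mono jb_triad) auto
      then show "?w k * (case t of (k1, k2, k3) \<Rightarrow> cmod (a k1 * b k2 * c k3)) \<le> 9 powr (s / 2) *
        ((case t of (k1, k2, k3) \<Rightarrow> cmod ((of_real (?w k1) * a k1) * b k2 * c k3)) +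
         (case t of (k1, k2, k3) \<Rightarrow> cmod (a k1 * (of_real (?w k2) * b k2) * c k3)) +
         (case t of (k1, k2, k3) \<Rightarrow> cmod (a k1 * b k2 * (of_real (?w k3) * c k3))))"
        by (simp add: norm_mult algebra_simps)
    qed
    also have "\<dots> = 9 powr (s / 2) * (f1 k + f2 k + f3 k)"
      unfolding f1_def f2_def f3_def infsum_cmult_right'
      using Y1 Y2 Y3 by (simp add: infsum_add summable_on_add)
    finally show ?thesis .
  qed
  have Y: "sob_le 0 (\<lambda>k. of_real (f1 k)) (?E\<^sup>2 * A * B * D)"
      "sob_le 0 (\<lambda>k. of_real (f2 k)) (?E\<^sup>2 * A * B * D)"
      "sob_le 0 (\<lambda>k. of_real (f3 k)) (?E\<^sup>2 * A * B * D)"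
    unfolding f1_def f2_def f3_def using Y1 Y2 Y3 by blast+
  have S: "sob_le 0 (\<lambda>k. of_real (9 powr (s / 2)) * (of_real (f1 k) + of_real (f2 k) + of_real (f3 k)))
      (cmod (of_real (9 powr (s / 2))) * (?E\<^sup>2 * A * B * D + ?E\<^sup>2 * A * B * D + ?E\<^sup>2 * A * B * D))"
    by (intro sob_le_cmult sob_le_add Y)
  show "sob_le s (\<lambda>k. of_real (\<Sum>\<^sub>\<infinity>(k1, k2, k3)\<in>triads k. cmod (a k1 * b k2 * c k3)))
      (tri_const TYPE('d) s * A * B * D)"
    unfolding f_def [symmetric]
  proof (rule sob_le_weighted_mono[OF S])
    show "jb k powr (s / 2) * cmod (of_real (f k)) \<le> jb k powr (0 / 2) *
        cmod (of_real (9 powr (s / 2)) * (of_real (f1 k) + of_real (f2 k) + of_real (f3 k)))" for k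
      using le[of k] f0[of k] by (simp add: norm_mult flip: of_real_add)
    show "cmod (of_real (9 powr (s / 2))) * (?E\<^sup>2 * A * B * D + ?E\<^sup>2 * A * B * D + ?E\<^sup>2 * A * B * D) \<le>
      tri_const TYPE('d) s * A * B * D"
      by (simp add: tri_const_def algebra_simps)
  qed
qed

text \<open>A symbol of size (<k1><k2><k3>)^p is absorbed by weighting every factor with <k_i>^p,
  which reduces the claim to the algebra property. Losses of derivatives in the trilinear terms
  enter through this estimate.\<close>

lemma tri_bound:
  fixes a b c :: "int ^ 'd::finite \<Rightarrow> complex"
  assumes s: "s > real CARD('d) / 2"
    and a: "sob_le (s + p) a A" and b: "sob_le (s + p) b B" and c: "sob_le (s + p) c D"
    and m: "\<And>k1 k2 k3. cmod (m k1 k2 k3) \<le> C * (jb k1 * jb k2 * jb k3) powr (p / 2)"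
  shows "(\<lambda>(k1, k2, k3). cmod (m k1 k2 k3 * cnj (a k1) * b k2 * c k3)) summable_on triads k"
    and "(\<lambda>(k1, k2, k3). m k1 k2 k3 * cnj (a k1) * b k2 * c k3) summable_on triads k"
    and "sob_le s (tri m a b c) (tri_const TYPE('d) s * C * A * B * D)"
proof -
  \<comment> \<open>The sign of C is read off from the bound at the zero frequencies.\<close>
  have C: "0 \<le> C"
  proof -
    have "0 \<le> C * (jb (0::int^'d) * jb (0::int^'d) * jb (0::int^'d)) powr (p / 2)" using m[of 0 0 0] norm_ge_zero order_trans by blast
    then show ?thesis by (simp add: zero_le_mult_iff)
  qed
  let ?w = "\<lambda>k::int^'d. complex_of_real (jb k powr (p / 2))"
  note T = triads_algebra[OF s, of "\<lambda>k. ?w k * a k" A "\<lambda>k. ?w k * b k" B "\<lambda>k. ?w k * c k" D, unfolded sob_le_weight, OF a b c]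
  let ?f = "\<lambda>t. case t of (k1, k2, k3) \<Rightarrow> m k1 k2 k3 * cnj (a k1) * b k2 * c k3"
  let ?g = "\<lambda>t. case t of (k1, k2, k3) \<Rightarrow> cmod (?w k1 * a k1 * (?w k2 * b k2) * (?w k3 * c k3))"
  have le: "cmod (?f t) \<le> C * ?g t" for t
  proof -
    obtain k1 k2 k3 where t: "t = (k1, k2, k3)" by (cases t)
    have "cmod (m k1 k2 k3) * (cmod (a k1) * cmod (b k2) * cmod (c k3)) \<le>
        C * (jb k1 * jb k2 * jb k3) powr (p / 2) * (cmod (a k1) * cmod (b k2) * cmod (c k3))"
      by (intro mult_right_mono m) auto
    then show ?thesis by (simp add: t norm_mult powr_mult mult_ac)
  qed
  have sm: "(\<lambda>t. cmod (?f t)) summable_on triads k" for k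
    using summable_on_cmult_right[OF T(1)[of k], of C] le by (rule Infinite_Sum.abs_summable_on_comparison_test')
  then show "(\<lambda>(k1, k2, k3). cmod (m k1 k2 k3 * cnj (a k1) * b k2 * c k3)) summable_on triads k"
    by (simp add: case_prod_unfold)
  show "?f summable_on triads k" using sm by (rule abs_summable_summable)
  show "sob_le s (tri m a b c) (tri_const TYPE('d) s * C * A * B * D)"
  proof (rule sob_le_mono[OF sob_le_cmult[OF T(2), of "of_real C"]])
    fix k
    have "cmod (tri m a b c k) \<le> (\<Sum>\<^sub>\<infinity>t\<in>triads k. cmod (?f t))"
      unfolding tri_def using sm by (rule norm_infsum_bound)
    also have "\<dots> \<le> (\<Sum>\<^sub>\<infinity>t\<in>triads k. C * ?g t)"
      using sm summable_on_cmult_right[OF T(1)] le by (intro infsum_mono) auto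
    also have "\<dots> = C * infsum ?g (triads k)" by (rule infsum_cmult_right')
    finally show "cmod (tri m a b c k) \<le> cmod (of_real C * of_real (infsum ?g (triads k)))"
      using C by (simp add: norm_mult infsum_nonneg case_prod_unfold)
  qed (use C in \<open>simp add: mult_ac\<close>)
qed

section \<open>Sobolev functions and their coefficients\<close>

lemma sobolev_iff:
  "f \<in> sobolev s \<longleftrightarrow> periodic_fun f \<and> continuous_on UNIV f \<and> (\<exists>B. sob_le s (fourier_coeff f) B)"
  by (auto simp: sobolev_def sob_le_iff_summable jb_def)

lemma sobolev_sob_le: "f \<in> sobolev s \<Longrightarrow> sob_le s (fourier_coeff f) (sobolev_norm s f)"
  by (auto simp: sobolev_def sob_le_iff_summable jb_def sobolev_norm_def)

lemma sob_le_sobolev_norm: "sob_le s (fourier_coeff f) B \<Longrightarrow> sobolev_norm s f \<le> B"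
  by (auto simp: sob_le_iff_summable jb_def sobolev_norm_def)

lemma sobolev_continuous: "f \<in> sobolev s \<Longrightarrow> continuous_on A f"
  by (auto simp: sobolev_def intro: continuous_on_subset)

lemma sobolev_order_mono: "f \<in> sobolev t \<Longrightarrow> s \<le> t \<Longrightarrow> f \<in> sobolev s"
  by (auto simp: sobolev_iff intro: sob_le_order_mono)

lemma sobolev_norm_nonneg: "0 \<le> sobolev_norm s f"
  by (simp add: sobolev_norm_def infsum_nonneg)

text \<open>For s > d/2 the coefficients are absolutely summable, so inversion applies to the
  continuous representative.\<close>

lemma sobolev_series:
  fixes f :: "real ^ 'd::finite \<Rightarrow> complex"
  assumes "s > real CARD('d) / 2" "f \<in> sobolev s"
  shows "trig_series f UNIV (fourier_coeff f) (\<lambda>k. k)"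
  using assms sob_le_l1(1)[OF assms(1) sobolev_sob_le[OF assms(2)]]
  by (intro fourier_inversion) (auto simp: sobolev_def)

lemma trig_series_sobolev:
  assumes "trig_series f UNIV a (\<lambda>k. k)" "sob_le s a B"
  shows "f \<in> sobolev s"
proof -
  have "fourier_coeff f = a" using trig_series_UNIV_coeff[OF assms(1)] by auto
  then show ?thesis
    using trig_series_continuous[OF assms(1)] trig_series_periodic[OF assms(1)] assms(2)
    by (auto simp: sobolev_iff)
qed

lemma sobolev_sup_bound:
  fixes f :: "real ^ 'd::finite \<Rightarrow> complex"
  assumes "s > real CARD('d) / 2" "trig_series f UNIV a (\<lambda>k. k)" "sob_le s a A"
  shows "cmod (f x) \<le> emb_const TYPE('d) s * A"
proof -
  have "cmod (f x) \<le> (\<Sum>\<^sub>\<infinity>k. cmod (a k))"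
    using norm_infsum_bound[of "\<lambda>k. a k * mode k x" UNIV] assms(2) by (simp add: trig_series_def norm_mult)
  also have "\<dots> \<le> emb_const TYPE('d) s * A" using sob_le_l1[OF assms(1,3)] by simp
  finally show ?thesis .
qed

lemma fourier_coeff_diff_sobolev:
  assumes "f \<in> sobolev s" "g \<in> sobolev s"
  shows "fourier_coeff (\<lambda>x. f x - g x) = (\<lambda>k. fourier_coeff f k - fourier_coeff g k)"
  using assms[THEN sobolev_continuous] by (intro ext fourier_coeff_diff)

lemma sobolev_diff:
  assumes "f \<in> sobolev s" "g \<in> sobolev s"
  shows "(\<lambda>x. f x - g x) \<in> sobolev s"
proof -
  have "sob_le s (fourier_coeff (\<lambda>x. f x - g x)) (sobolev_norm s f + sobolev_norm s g)"
    unfolding fourier_coeff_diff_sobolev[OF assms] by (intro sob_le_diff sobolev_sob_le assms)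
  moreover have "continuous_on UNIV (\<lambda>x. f x - g x)"
    using assms[THEN sobolev_continuous] by (rule continuous_on_diff)
  moreover have "periodic_fun (\<lambda>x. f x - g x)" using assms by (simp add: sobolev_def periodic_fun_def)
  ultimately show ?thesis by (auto simp: sobolev_iff)
qed

lemma trig_series_tri:
  assumes "trig_series f J a l" "trig_series g K b m" "trig_series h L c n"
  shows "trig_series (\<lambda>x. cnj (f x) * g x * h x) (J \<times> K \<times> L)
    (\<lambda>(i, j, k). cnj (a i) * b j * c k) (\<lambda>(i, j, k). - l i + m j + n k)"
  using trig_series_mult[OF trig_series_cnj[OF assms(1)] trig_series_mult[OF assms(2,3)]]
  by (simp add: case_prod_unfold mult.assoc algebra_simps)

lemma fourier_coeff_tri:
  assumes "trig_series f UNIV a (\<lambda>k. k)" "trig_series g UNIV b (\<lambda>k. k)" "trig_series h UNIV c (\<lambda>k. k)"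
  shows "fourier_coeff (\<lambda>x. cnj (f x) * g x * h x) k = tri (\<lambda>_ _ _. 1) a b c k"
proof -
  have "{j \<in> UNIV \<times> UNIV \<times> UNIV. (case j of (i, j, k) \<Rightarrow> - i + j + k) = k} = triads k"
    by (auto simp: triads_def)
  then show ?thesis
    using infsumI[OF trig_series_coeff[OF trig_series_tri[OF assms], of k]]
    by (simp add: tri_def case_prod_unfold)
qed

lemma trig_series_lapfun:
  fixes f :: "real ^ 'd::finite \<Rightarrow> complex"
  assumes "trig_series f J c m"
    and "(\<lambda>j. cmod (h (- of_real ((norm (rvec (m j)))\<^sup>2)) * c j)) summable_on J"
  shows "trig_series (lapfun h f) J (\<lambda>j. h (- of_real ((norm (rvec (m j)))\<^sup>2)) * c j) m"
  unfolding lapfun_def using trig_series_multiplier[OF assms(1), of "\<lambda>k. h (- of_real ((norm (rvec k))\<^sup>2))"] assms(2)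
  by simp

lemma sob_le_laplace:
  assumes "sob_le (s + 2) a A"
  shows "sob_le s (\<lambda>k. - of_real ((norm (rvec k))\<^sup>2) * a k) A"
proof (rule sob_le_weighted_mono[OF assms])
  fix k
  have "jb k powr (s / 2) * (norm (rvec k))\<^sup>2 * cmod (a k) \<le> jb k powr (s / 2) * jb k * cmod (a k)"
    by (intro mult_right_mono mult_left_mono) (auto simp: jb_def)
  also have "jb k powr (s / 2) * jb k = jb k powr ((s + 2) / 2)"
    by (simp add: add_divide_distrib powr_add)
  finally show "jb k powr (s / 2) * cmod (- of_real ((norm (rvec k))\<^sup>2) * a k) \<le> jb k powr ((s + 2) / 2) * cmod (a k)"
    by (simp add: norm_mult norm_power mult_ac)
qed simp

lemma laplace_series:
  fixes f :: "real ^ 'd::finite \<Rightarrow> complex"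
  assumes s: "s > real CARD('d) / 2" and f: "f \<in> sobolev (s + 2)"
  shows "trig_series (laplace f) UNIV (\<lambda>k. - of_real ((norm (rvec k))\<^sup>2) * fourier_coeff f k) (\<lambda>k. k)"
proof -
  have "trig_series f UNIV (fourier_coeff f) (\<lambda>k. k)"
    using s f by (intro sobolev_series[of "s + 2"]) auto
  then show ?thesis
    by (rule trig_series_lapfun)
      (rule sob_le_l1(1)[OF s sob_le_laplace[OF sobolev_sob_le[OF f]]])
qed

section \<open>The equation for the Fourier coefficients\<close>

text \<open>A modulus of continuity in time that is uniform in x upgrades continuity in each
  variable to joint continuity, as the Leibniz rule asks for.\<close>

lemma jointly_continuous:
  fixes G :: "real \<Rightarrow> real ^ 'd::finite \<Rightarrow> complex"
  assumes cont: "\<And>t. t \<in> U \<Longrightarrow> continuous_on UNIV (G t)"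
    and lim: "\<And>t. t \<in> U \<Longrightarrow> ((\<lambda>r. b r t) \<longlongrightarrow> 0) (at t within U)"
    and bound: "\<And>r t x. r \<in> U \<Longrightarrow> t \<in> U \<Longrightarrow> cmod (G r x - G t x) \<le> b r t"
  shows "continuous_on (U \<times> A) (\<lambda>(t, x). G t x)"
  unfolding continuous_on_iff
proof (intro ballI allI impI)
  fix p :: "real \<times> (real ^ 'd)" and e :: real assume p: "p \<in> U \<times> A" and e: "0 < e"
  obtain t x where tx: "p = (t, x)" by (cases p)
  have t: "t \<in> U" using p tx by auto
  obtain d1 where d1: "0 < d1" "\<And>r. r \<in> U \<Longrightarrow> r \<noteq> t \<Longrightarrow> dist r t < d1 \<Longrightarrow> dist (b r t) 0 < e / 2"
    using lim[OF t] e unfolding Lim_within by (metis half_gt_zero zero_less_dist_iff)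
  have "continuous (at x) (G t)" using cont[OF t] by (simp add: continuous_on_eq_continuous_at)
  then obtain d2 where d2: "0 < d2" "\<And>y. dist y x < d2 \<Longrightarrow> dist (G t y) (G t x) < e / 2"
    using e unfolding continuous_at_eps_delta by (metis half_gt_zero)
  show "\<exists>d>0. \<forall>q\<in>U \<times> A. dist q p < d \<longrightarrow> dist (case q of (t, x) \<Rightarrow> G t x) (case p of (t, x) \<Rightarrow> G t x) < e"
  proof (intro exI[of _ "min d1 d2"] conjI ballI impI)
    fix q assume q: "q \<in> U \<times> A" "dist q p < min d1 d2"
    obtain r y where ry: "q = (r, y)" by (cases q)
    have r: "r \<in> U" using q ry by auto
    have "dist r t < d1" "dist y x < d2"
      using q dist_fst_le[of q p] dist_snd_le[of q p] by (auto simp: ry tx)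
    then have "dist (G t y) (G t x) < e / 2" "cmod (G r y - G t y) < e / 2"
      using d1(2)[OF r] d2(2)[of y] bound[OF r t, of y] e
      by (cases "r = t"; fastforce)+
    then show "dist (case q of (t, x) \<Rightarrow> G t x) (case p of (t, x) \<Rightarrow> G t x) < e"
      using dist_triangle[of "G r y" "G t x" "G t y"] by (simp add: ry tx dist_norm)
  qed (use d1 d2 in auto)
qed

text \<open>The equation holds pointwise in x, and differentiation under the integral carries it
  over to coefficients. For this the right-hand side has to be jointly continuous; since it contains
  the Laplacian, the sup bounds are taken from the norm of order s + 2.\<close>

lemma nls_coeff_derivative:
  fixes u :: "real \<Rightarrow> real ^ 'd::finite \<Rightarrow> complex"
  assumes s: "s > real CARD('d) / 2" and u: "nls_solution (s + 2) T u" and t: "t \<in> {0..T}"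
  shows "((\<lambda>t. fourier_coeff (u t) k) has_vector_derivative
    - \<i> * (of_real ((norm (rvec k))\<^sup>2) * fourier_coeff (u t) k +
      tri (\<lambda>_ _ _. 1) (fourier_coeff (u t)) (fourier_coeff (u t)) (fourier_coeff (u t)) k)) (at t within {0..T})"
proof -
  let ?U = "{0..T}"
  let ?E = "emb_const TYPE('d)"
  have us: "u t \<in> sobolev (s + 2)" if "t \<in> ?U" for t using u that by (simp add: nls_solution_def)
  have s2: "s + 2 > real CARD('d) / 2" using s by simp
  note S = sobolev_series[OF s2 us] and L = laplace_series[OF s us]
  have lim: "((\<lambda>r. sobolev_norm (s + 2) (\<lambda>x. u r x - u t x)) \<longlongrightarrow> 0) (at t within ?U)" if "t \<in> ?U" for t
    using u that by (simp add: nls_solution_def)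
  have d: "sob_le (s + 2) (\<lambda>k. fourier_coeff (u r) k - fourier_coeff (u t) k) (sobolev_norm (s + 2) (\<lambda>x. u r x - u t x))"
    if "r \<in> ?U" "t \<in> ?U" for r t
    using sobolev_sob_le[OF sobolev_diff[OF us us, OF that]] fourier_coeff_diff_sobolev[OF us us, OF that] by simp
  have ub: "cmod (u r x - u t x) \<le> ?E (s + 2) * sobolev_norm (s + 2) (\<lambda>x. u r x - u t x)"
    if "r \<in> ?U" "t \<in> ?U" for r t x
    by (rule sobolev_sup_bound[OF s2 trig_series_minus[OF S S] d, OF that that])
  have lb: "cmod (laplace (u r) x - laplace (u t) x) \<le> ?E s * sobolev_norm (s + 2) (\<lambda>x. u r x - u t x)"
    if "r \<in> ?U" "t \<in> ?U" for r t x
    by (rule sobolev_sup_bound[OF s trig_series_minus[OF L L]])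
      (use that sob_le_laplace[OF d[OF that]] in \<open>simp_all add: algebra_simps\<close>)
  have cu: "continuous_on (?U \<times> torus_box) (\<lambda>(t, x). u t x)"
    by (rule jointly_continuous[OF trig_series_continuous[OF S] _ ub]) (auto intro!: tendsto_eq_intros lim)
  have cl: "continuous_on (?U \<times> torus_box) (\<lambda>(t, x). laplace (u t) x)"
    by (rule jointly_continuous[OF trig_series_continuous[OF L] _ lb]) (auto intro!: tendsto_eq_intros lim)
  \<comment> \<open>The time derivative dictated by the equation, with |u|^2 u written as conj(u) u
    u so that it matches \<open>tri\<close>.\<close>
  define w where "w t x = - \<i> * (cnj (u t x) * u t x * u t x - laplace (u t) x)" for t x
  have ut: "((\<lambda>r. u r x) has_vector_derivative w t x) (at t within ?U)" if "t \<in> ?U" for t x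
  proof -
    obtain w' where w': "((\<lambda>r. u r x) has_vector_derivative w') (at t within ?U)"
      "\<i> * w' + laplace (u t) x = of_real ((cmod (u t x))\<^sup>2) * u t x"
      using u \<open>t \<in> ?U\<close> unfolding nls_solution_def by metis
    have "\<i> * w' = cnj (u t x) * u t x * u t x - laplace (u t) x"
      using w'(2) complex_norm_square[of "u t x"] by (simp add: algebra_simps)
    then have "- \<i> * (\<i> * w') = w t x" by (simp add: w_def)
    then have "w' = w t x" by (simp flip: mult.assoc)
    then show ?thesis using w'(1) by simp
  qed
  have cw: "continuous_on (?U \<times> torus_box) (\<lambda>(t, x). w t x * mode (- k) x)"
    unfolding w_def case_prod_unfold
    using cu cl continuous_on_compose2[OF continuous_mode[of UNIV "- k"] continuous_on_snd[OF continuous_on_id]]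
    by (intro continuous_intros) (auto simp: case_prod_unfold)
  have cx: "continuous_on A (u t)" if "t \<in> ?U" for t A by (rule trig_series_continuous[OF S[OF that]])
  have "((\<lambda>t. integral torus_box (\<lambda>x. u t x * mode (- k) x)) has_vector_derivative
      integral torus_box (\<lambda>x. w t x * mode (- k) x)) (at t within ?U)"
  proof (rule leibniz_rule_vector_derivative[OF _ _ cw t])
    show "((\<lambda>t. u t x * mode (- k) x) has_vector_derivative w t x * mode (- k) x) (at t within ?U)" if "t \<in> ?U" for t x
      by (intro has_vector_derivative_mult_left ut that)
    show "(\<lambda>x. u t x * mode (- k) x) integrable_on torus_box" if "t \<in> ?U" for t
      by (intro integrable_continuous continuous_on_mult cx that continuous_mode)
  qed simp
  from has_vector_derivative_divide[OF this, of "of_real ((2 * pi) ^ CARD('d))"]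
  have D: "((\<lambda>t. fourier_coeff (u t) k) has_vector_derivative fourier_coeff (w t) k) (at t within ?U)"
    by (simp add: fourier_coeff_def)
  let ?a = "fourier_coeff (u t)"
  have c3: "continuous_on UNIV (\<lambda>x. cnj (u t x) * u t x * u t x)" "continuous_on UNIV (laplace (u t))"
    using cx[OF t] trig_series_continuous[OF L[OF t]] by (auto intro!: continuous_intros)
  have "fourier_coeff (w t) k = - \<i> * (fourier_coeff (\<lambda>x. cnj (u t x) * u t x * u t x) k - fourier_coeff (laplace (u t)) k)"
    unfolding w_def fourier_coeff_cmult by (simp add: fourier_coeff_diff[OF c3])
  also have "fourier_coeff (\<lambda>x. cnj (u t x) * u t x * u t x) k = tri (\<lambda>_ _ _. 1) ?a ?a ?a k"
    by (rule fourier_coeff_tri[OF S S S, OF t t t])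
  also have "fourier_coeff (laplace (u t)) k = - of_real ((norm (rvec k))\<^sup>2) * ?a k"
    by (rule trig_series_UNIV_coeff[OF L[OF t]])
  finally have "fourier_coeff (w t) k =
      - \<i> * (of_real ((norm (rvec k))\<^sup>2) * ?a k + tri (\<lambda>_ _ _. 1) ?a ?a ?a k)"
    by (simp add: algebra_simps)
  then show ?thesis using D by simp
qed

definition resonance :: "int ^ 'd::finite \<Rightarrow> int ^ 'd \<Rightarrow> int ^ 'd \<Rightarrow> real" where
  "resonance k1 k2 k3 = (norm (rvec (- k1 + k2 + k3)))\<^sup>2 + (norm (rvec k1))\<^sup>2
     - (norm (rvec k2))\<^sup>2 - (norm (rvec k3))\<^sup>2"

definition osc_kernel :: "real \<Rightarrow> int ^ 'd::finite \<Rightarrow> int ^ 'd \<Rightarrow> int ^ 'd \<Rightarrow> complex" where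
  "osc_kernel t k1 k2 k3 = exp (\<i> * of_real (t * resonance k1 k2 k3))"

definition twist :: "real \<Rightarrow> (int ^ 'd::finite \<Rightarrow> complex) \<Rightarrow> int ^ 'd \<Rightarrow> complex" where
  "twist t a k = exp (\<i> * of_real (t * (norm (rvec k))\<^sup>2)) * a k"

lemma norm_twist [simp]: "cmod (twist t a k) = cmod (a k)"
  by (simp add: twist_def norm_mult)

lemma twist_0 [simp]: "twist 0 a = a"
  by (simp add: twist_def fun_eq_iff)

text \<open>The phases of k, k2, k3 and the conjugated phase of k1 recombine to exp(i t R), which
  becomes a part of the symbol.\<close>

lemma twist_tri:
  "twist t (tri m a b c) k =
    tri (\<lambda>k1 k2 k3. osc_kernel t k1 k2 k3 * m k1 k2 k3) (twist t a) (twist t b) (twist t c) k"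
  unfolding tri_def twist_def infsum_cmult_right' [symmetric]
proof (rule infsum_cong)
  fix p assume p: "p \<in> triads k"
  obtain k1 k2 k3 where [simp]: "p = (k1, k2, k3)" by (cases p)
  have k: "k = - k1 + k2 + k3" using p by (auto simp: triads_def)
  let ?n = "\<lambda>k. (norm (rvec k))\<^sup>2"
  have "exp (\<i> * of_real (t * ?n k)) = osc_kernel t k1 k2 k3 * cnj (exp (\<i> * of_real (t * ?n k1))) *
      exp (\<i> * of_real (t * ?n k2)) * exp (\<i> * of_real (t * ?n k3))"
    unfolding k osc_kernel_def resonance_def exp_cnj exp_add [symmetric]
    by (rule arg_cong[where f = exp]) (simp add: algebra_simps)
  then show "exp (\<i> * of_real (t * ?n k)) * (case p of (k1, k2, k3) \<Rightarrow> m k1 k2 k3 * cnj (a k1) * b k2 * c k3) =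
     (case p of (k1, k2, k3) \<Rightarrow> osc_kernel t k1 k2 k3 * m k1 k2 k3 * cnj (exp (\<i> * of_real (t * ?n k1)) * a k1) *
        (exp (\<i> * of_real (t * ?n k2)) * b k2) * (exp (\<i> * of_real (t * ?n k3)) * c k3))"
    by (simp add: mult_ac)
qed

lemma has_vector_derivative_exp_i:
  "((\<lambda>t. exp (\<i> * of_real (t * L))) has_vector_derivative \<i> * of_real L * exp (\<i> * of_real (x * L))) (at x within S)"
proof -
  have "((\<lambda>z. exp (\<i> * (z * of_real L))) has_field_derivative
      \<i> * of_real L * exp (\<i> * (of_real x * of_real L))) (at (of_real x))"
    by (auto intro!: derivative_eq_intros)
  from has_vector_derivative_real_field[OF this] show ?thesis
    by (auto intro: has_vector_derivative_at_within)
qed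

text \<open>Differentiating the exponential cancels the linear term, and only the oscillating
  trilinear term survives.\<close>

lemma nls_twisted_derivative:
  fixes u :: "real \<Rightarrow> real ^ 'd::finite \<Rightarrow> complex"
  assumes s: "s > real CARD('d) / 2" and u: "nls_solution (s + 2) T u" and t: "t \<in> {0..T}"
  defines "a \<equiv> \<lambda>t. twist t (fourier_coeff (u t))"
  shows "((\<lambda>t. a t k) has_vector_derivative - \<i> * tri (osc_kernel t) (a t) (a t) (a t) k) (at t within {0..T})"
proof -
  let ?n = "(norm (rvec k))\<^sup>2" and ?f = "fourier_coeff (u t)"
  have "((\<lambda>t. a t k) has_vector_derivative
      exp (\<i> * of_real (t * ?n)) * (- \<i> * (of_real ?n * ?f k + tri (\<lambda>_ _ _. 1) ?f ?f ?f k)) +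
      \<i> * of_real ?n * exp (\<i> * of_real (t * ?n)) * ?f k) (at t within {0..T})"
    unfolding a_def twist_def
    by (rule has_vector_derivative_mult[OF has_vector_derivative_exp_i nls_coeff_derivative[OF s u t]])
  also have "exp (\<i> * of_real (t * ?n)) * (- \<i> * (of_real ?n * ?f k + tri (\<lambda>_ _ _. 1) ?f ?f ?f k)) +
      \<i> * of_real ?n * exp (\<i> * of_real (t * ?n)) * ?f k = - \<i> * twist t (tri (\<lambda>_ _ _. 1) ?f ?f ?f) k"
    by (simp add: twist_def algebra_simps)
  finally show ?thesis unfolding twist_tri by (simp add: a_def)
qed

section \<open>The local error of a kernel\<close>

lemma power_le_1_plus_power:
  fixes M :: real
  assumes "0 \<le> M" "j \<le> n"
  shows "M ^ j \<le> 1 + M ^ n"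
proof (cases "M \<le> 1")
  case True
  then have "M ^ j \<le> 1" using assms by (simp add: power_le_one)
  then show ?thesis using assms by (simp add: add_increasing2)
next
  case False
  then have "M ^ j \<le> M ^ n" using assms by (intro power_increasing) auto
  then show ?thesis by simp
qed

lemma norm_exp_i_minus_1: "cmod (exp (\<i> * of_real x) - 1) \<le> \<bar>x\<bar>"
  using Taylor_exp[of "\<i> * of_real x" 0] by (simp add: norm_mult)

lemma norm_exp_i_minus_2: "cmod (exp (\<i> * of_real x) - 1 - \<i> * of_real x) \<le> x\<^sup>2"
  using Taylor_exp[of "\<i> * of_real x" 1] by (simp add: norm_mult power2_eq_square algebra_simps)

lemma jb_products:
  "jb k1 \<le> jb k1 * jb k2 * jb k3" "jb k2 \<le> jb k1 * jb k2 * jb k3" "jb k3 \<le> jb k1 * jb k2 * jb k3"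
proof -
  have *: "x \<le> x * y * z" if "1 \<le> x" "1 \<le> y" "1 \<le> z" for x y z :: real
  proof -
    have "x * 1 \<le> x * (y * z)" using that mult_mono[of 1 y 1 z] by (intro mult_left_mono) auto
    then show ?thesis by (simp add: mult.assoc)
  qed
  show "jb k1 \<le> jb k1 * jb k2 * jb k3" "jb k2 \<le> jb k1 * jb k2 * jb k3" "jb k3 \<le> jb k1 * jb k2 * jb k3"
    using *[of "jb k1" "jb k2" "jb k3", OF jb_ge_1 jb_ge_1 jb_ge_1]
      *[of "jb k2" "jb k1" "jb k3", OF jb_ge_1 jb_ge_1 jb_ge_1]
      *[of "jb k3" "jb k1" "jb k2", OF jb_ge_1 jb_ge_1 jb_ge_1]
    by (simp_all add: mult_ac)
qed

text \<open>The output frequency accounts for 27 = 9 times 3 by \<open>jb_triad\<close>, each input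
  frequency for 1. The exponent is left as \<open>2 / 2\<close> to fit the form \<open>p / 2\<close>
  in \<open>tri_bound\<close>.\<close>

lemma resonance_bound: "\<bar>resonance k1 k2 k3\<bar> \<le> 30 * (jb k1 * jb k2 * jb k3) powr (2 / 2)"
proof -
  let ?P = "jb k1 * jb k2 * jb k3" and ?n = "\<lambda>k. (norm (rvec k))\<^sup>2"
  have "jb (- k1 + k2 + k3) \<le> 9 * jb k1 + 9 * jb k2 + 9 * jb k3"
    using jb_triad[of k1 k2 k3 "- k1 + k2 + k3" 1] by (simp add: triads_def)
  moreover have p: "jb k1 \<le> ?P" "jb k2 \<le> ?P" "jb k3 \<le> ?P" by (rule jb_products)+
  ultimately have 0: "?n (- k1 + k2 + k3) \<le> 27 * ?P" unfolding jb_def[of "- k1 + k2 + k3"] by linarith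
  have n: "0 \<le> ?n k" "?n k \<le> jb k" for k :: "int ^ 'a" by (auto simp: jb_def)
  have "?n k1 \<le> ?P" "?n k2 \<le> ?P" "?n k3 \<le> ?P"
    using p n(2)[of k1] n(2)[of k2] n(2)[of k3] by linarith+
  with 0 n(1)[of k1] n(1)[of k2] n(1)[of k3] n(1)[of "- k1 + k2 + k3"]
  have "\<bar>resonance k1 k2 k3\<bar> \<le> 30 * ?P" unfolding resonance_def by linarith
  then show ?thesis by simp
qed

lemma norm_osc_kernel [simp]: "cmod (osc_kernel t k1 k2 k3) = 1"
  by (simp add: osc_kernel_def)

lemma osc_kernel_0 [simp]: "osc_kernel 0 = (\<lambda>_ _ _. 1)"
  by (simp add: osc_kernel_def fun_eq_iff)

lemma osc_kernel_diff:
  assumes "0 \<le> t"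
  shows "cmod (osc_kernel t k1 k2 k3 - 1) \<le> t * 30 * (jb k1 * jb k2 * jb k3) powr (2 / 2)"
proof -
  have "cmod (osc_kernel t k1 k2 k3 - 1) \<le> t * \<bar>resonance k1 k2 k3\<bar>"
    using norm_exp_i_minus_1[of "t * resonance k1 k2 k3"] assms by (simp add: osc_kernel_def abs_mult)
  also have "\<dots> \<le> t * (30 * (jb k1 * jb k2 * jb k3) powr (2 / 2))"
    using assms by (intro mult_left_mono resonance_bound)
  finally show ?thesis by simp
qed

text \<open>\<open>osc_int0 L t\<close> is \<open>\<integral>\<^sub>0\<^sup>t e\<^bsup>i\<xi>L\<^esup> d\<xi>\<close>.\<close>

definition osc_int0 :: "real \<Rightarrow> real \<Rightarrow> complex" where
  "osc_int0 L t = (if L = 0 then of_real t else (exp (\<i> * of_real (t * L)) - 1) / (\<i> * of_real L))"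

lemma osc_int0_zero [simp]: "osc_int0 L 0 = 0"
  by (simp add: osc_int0_def)

text \<open>The remainder is linear in L, also in the removable case L = 0. Summed as a trilinear
  symbol it therefore costs 2 derivatives, just like R.\<close>

lemma osc_int0_remainder:
  "cmod (osc_int0 L y - osc_int0 L t - (y - t) *\<^sub>R exp (\<i> * of_real (t * L))) \<le> \<bar>L\<bar> * (y - t)\<^sup>2"
proof (cases "L = 0")
  case False
  let ?h = "(y - t) * L"
  have e: "exp (\<i> * of_real (y * L)) = exp (\<i> * of_real (t * L)) * exp (\<i> * of_real ?h)"
    by (simp add: exp_add [symmetric] algebra_simps)
  have "osc_int0 L y - osc_int0 L t - (y - t) *\<^sub>R exp (\<i> * of_real (t * L)) =
      exp (\<i> * of_real (t * L)) * (exp (\<i> * of_real ?h) - 1 - \<i> * of_real ?h) / (\<i> * of_real L)"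
    using False unfolding osc_int0_def e by (simp add: scaleR_conv_of_real field_simps)
  also have "cmod \<dots> = cmod (exp (\<i> * of_real ?h) - 1 - \<i> * of_real ?h) / \<bar>L\<bar>"
    by (simp only: norm_mult norm_divide) (simp add: norm_mult)
  also have "\<dots> \<le> ?h\<^sup>2 / \<bar>L\<bar>" by (intro divide_right_mono norm_exp_i_minus_2) auto
  also have "\<dots> = \<bar>L\<bar> * (y - t)\<^sup>2"
  proof -
    have "L\<^sup>2 / \<bar>L\<bar> = \<bar>L\<bar>" by (cases "L > 0") (auto simp: power2_eq_square divide_simps)
    then show ?thesis by (simp add: power_mult_distrib flip: times_divide_eq_right)
  qed
  finally show ?thesis .
qed (simp add: osc_int0_def scaleR_conv_of_real)

text \<open>Turns remainder estimates, in particular those obtained for infinite sums, into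
  derivatives.\<close>

lemma has_vector_derivative_quadratic:
  fixes f :: "real \<Rightarrow> complex"
  assumes "\<And>y. cmod (f y - f t - (y - t) *\<^sub>R f') \<le> B * (y - t)\<^sup>2"
  shows "(f has_vector_derivative f') (at t within S)"
  unfolding has_vector_derivative_def has_derivative_within_alt
proof (intro conjI allI impI bounded_linear_scaleR_left)
  fix e :: real assume e: "0 < e"
  show "\<exists>d>0. \<forall>y\<in>S. norm (y - t) < d \<longrightarrow> norm (f y - f t - (y - t) *\<^sub>R f') \<le> e * norm (y - t)"
  \<comment> \<open>Dividing by \<open>\<bar>B\<bar> + 1\<close> keeps the radius positive whatever
    the sign of B.\<close>
  proof (intro exI[of _ "e / (\<bar>B\<bar> + 1)"] conjI ballI impI)
    fix y assume "norm (y - t) < e / (\<bar>B\<bar> + 1)"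
    then have "(\<bar>B\<bar> + 1) * \<bar>y - t\<bar> \<le> e" by (simp add: field_simps)
    then have "(\<bar>B\<bar> + 1) * \<bar>y - t\<bar> * \<bar>y - t\<bar> \<le> e * \<bar>y - t\<bar>" by (rule mult_right_mono) simp
    moreover have "B * (y - t)\<^sup>2 \<le> (\<bar>B\<bar> + 1) * (y - t)\<^sup>2" by (intro mult_right_mono) auto
    ultimately show "norm (f y - f t - (y - t) *\<^sub>R f') \<le> e * norm (y - t)"
      using assms[of y] by (simp add: power2_eq_square mult.assoc) 
  qed (use e in auto)
qed

lemma osc_int0_deriv: "(osc_int0 L has_vector_derivative exp (\<i> * of_real (t * L))) (at t within S)"
  by (rule has_vector_derivative_quadratic[OF osc_int0_remainder])

lemma has_integral_osc_int0:
  "0 \<le> t \<Longrightarrow> ((\<lambda>\<xi>. exp (\<i> * of_real (\<xi> * L))) has_integral osc_int0 L t) {0..t}"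
  using fundamental_theorem_of_calculus[OF _ osc_int0_deriv, of 0 t L] by simp

text \<open>One statement for linearity in an argument and linearity in the symbol: it asks for an
  identity of the summands on the triads, so symbols and arguments may change together.\<close>

lemma tri_lincomb:
  fixes a b c a' b' c' :: "int ^ 'd::finite \<Rightarrow> complex"
  assumes "(\<lambda>(k1, k2, k3). m k1 k2 k3 * cnj (a k1) * b k2 * c k3) summable_on triads k"
    and "(\<lambda>(k1, k2, k3). m' k1 k2 k3 * cnj (a' k1) * b' k2 * c' k3) summable_on triads k"
    and "\<And>k1 k2 k3. (k1, k2, k3) \<in> triads k \<Longrightarrow> n k1 k2 k3 * cnj (a'' k1) * b'' k2 * c'' k3 =
      m k1 k2 k3 * cnj (a k1) * b k2 * c k3 + x * (m' k1 k2 k3 * cnj (a' k1) * b' k2 * c' k3)"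
  shows "tri n a'' b'' c'' k = tri m a b c k + x * tri m' a' b' c' k"
proof -
  have "tri n a'' b'' c'' k = (\<Sum>\<^sub>\<infinity>t\<in>triads k. (case t of (k1, k2, k3) \<Rightarrow> m k1 k2 k3 * cnj (a k1) * b k2 * c k3) +
      x * (case t of (k1, k2, k3) \<Rightarrow> m' k1 k2 k3 * cnj (a' k1) * b' k2 * c' k3))"
    unfolding tri_def by (rule infsum_cong) (use assms(3) in auto)
  also have "\<dots> = tri m a b c k + x * tri m' a' b' c' k"
    unfolding tri_def infsum_cmult_right' [symmetric]
    by (intro infsum_add assms(1) summable_on_cmult_right assms(2))
  finally show ?thesis .
qed

section \<open>Perturbation and time derivative of the trilinear term\<close>

context
  fixes s :: real
  assumes s: "s > real CARD('d::finite) / 2"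
begin

lemma tri_unit_bound:
  fixes a b c :: "int ^ 'd \<Rightarrow> complex"
  assumes "sob_le s a A" "sob_le s b B" "sob_le s c D" "\<And>k1 k2 k3. cmod (m k1 k2 k3) \<le> 1"
  shows "(\<lambda>(k1, k2, k3). m k1 k2 k3 * cnj (a k1) * b k2 * c k3) summable_on triads k"
    and "sob_le s (tri m a b c) (tri_const TYPE('d) s * A * B * D)"
  using tri_bound(2,3)[of s 0 a A b B c D m 1] s assms by simp_all

text \<open>A telescoping sum: the symbol is exchanged while all arguments are still of order s + 2,
  which pays for the growth of the difference of symbols; then the arguments are replaced one at a
  time in H^s.\<close>

lemma tri_difference:
  fixes a b c a' b' c' :: "int ^ 'd \<Rightarrow> complex"
  assumes m: "\<And>k1 k2 k3. cmod (m k1 k2 k3) \<le> 1" "\<And>k1 k2 k3. cmod (m' k1 k2 k3) \<le> 1"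
    and mm: "\<And>k1 k2 k3. cmod (m k1 k2 k3 - m' k1 k2 k3) \<le> C * (jb k1 * jb k2 * jb k3) powr (2 / 2)"
    and a: "sob_le (s + 2) a A" "sob_le s a' A" "sob_le s (\<lambda>k. a k - a' k) dA"
    and b: "sob_le (s + 2) b B" "sob_le s b' B" "sob_le s (\<lambda>k. b k - b' k) dB"
    and c: "sob_le (s + 2) c D" "sob_le s c' D" "sob_le s (\<lambda>k. c k - c' k) dD"
  shows "sob_le s (\<lambda>k. tri m a b c k - tri m' a' b' c' k)
    (tri_const TYPE('d) s * C * A * B * D + tri_const TYPE('d) s * dA * B * D + tri_const TYPE('d) s * A * dB * D + tri_const TYPE('d) s * A * B * dD)"
    and "tri m a b c k - tri m a' b' c' k =
      tri m (\<lambda>k. a k - a' k) b c k + tri m a' (\<lambda>k. b k - b' k) c k + tri m a' b' (\<lambda>k. c k - c' k) k"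
proof -
  have a0: "sob_le s a A" and b0: "sob_le s b B" and c0: "sob_le s c D"
    using a(1) b(1) c(1) by (auto elim: sob_le_order_mono)
  note S = tri_unit_bound(1)
  have add1: "tri n a b c k = tri n (\<lambda>k. a k - a' k) b c k + 1 * tri n a' b c k" if "\<And>k1 k2 k3. cmod (n k1 k2 k3) \<le> 1" for n k
    by (rule tri_lincomb[OF S[OF a(3) b0 c0 that] S[OF a(2) b0 c0 that]]) (simp add: algebra_simps)
  have add2: "tri n a' b c k = tri n a' (\<lambda>k. b k - b' k) c k + 1 * tri n a' b' c k" if "\<And>k1 k2 k3. cmod (n k1 k2 k3) \<le> 1" for n k
    by (rule tri_lincomb[OF S[OF a(2) b(3) c0 that] S[OF a(2) b(2) c0 that]]) (simp add: algebra_simps)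
  have add3: "tri n a' b' c k = tri n a' b' (\<lambda>k. c k - c' k) k + 1 * tri n a' b' c' k" if "\<And>k1 k2 k3. cmod (n k1 k2 k3) \<le> 1" for n k
    by (rule tri_lincomb[OF S[OF a(2) b(2) c(3) that] S[OF a(2) b(2) c(2) that]]) (simp add: algebra_simps)
  have expand: "tri n a b c k - tri n a' b' c' k =
      tri n (\<lambda>k. a k - a' k) b c k + tri n a' (\<lambda>k. b k - b' k) c k + tri n a' b' (\<lambda>k. c k - c' k) k"
    if "\<And>k1 k2 k3. cmod (n k1 k2 k3) \<le> 1" for n k
    using add1[OF that] add2[OF that] add3[OF that] by simp
  show "tri m a b c k - tri m a' b' c' k =
      tri m (\<lambda>k. a k - a' k) b c k + tri m a' (\<lambda>k. b k - b' k) c k + tri m a' b' (\<lambda>k. c k - c' k) k"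
    by (rule expand[OF m(1)])
  have K: "tri m a b c k = tri (\<lambda>k1 k2 k3. m k1 k2 k3 - m' k1 k2 k3) a b c k + 1 * tri m' a b c k" for k
    by (rule tri_lincomb[OF tri_bound(2)[OF s a(1) b(1) c(1) mm] S[OF a0 b0 c0 m(2)]]) (simp add: algebra_simps)
  have eq: "tri m a b c k - tri m' a' b' c' k = tri (\<lambda>k1 k2 k3. m k1 k2 k3 - m' k1 k2 k3) a b c k +
      tri m' (\<lambda>k. a k - a' k) b c k + tri m' a' (\<lambda>k. b k - b' k) c k + tri m' a' b' (\<lambda>k. c k - c' k) k" for k
    using K[where k = k] expand[OF m(2), where k = k] by (simp add: algebra_simps)
  show "sob_le s (\<lambda>k. tri m a b c k - tri m' a' b' c' k)
    (tri_const TYPE('d) s * C * A * B * D + tri_const TYPE('d) s * dA * B * D + tri_const TYPE('d) s * A * dB * D + tri_const TYPE('d) s * A * B * dD)"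
    unfolding eq
    by (intro sob_le_add tri_bound(3)[OF s a(1) b(1) c(1) mm]
        tri_unit_bound(2)[OF a(3) b0 c0 m(2)] tri_unit_bound(2)[OF a(2) b(3) c0 m(2)]
        tri_unit_bound(2)[OF a(2) b(2) c(3) m(2)])
qed

text \<open>The remainder of order (y - t)^2 in each kernel value, summed by
  \<open>tri_bound\<close>, is again of order (y - t)^2, so the infinite sum may be differentiated
  term by term.\<close>

lemma tri_osc_int0_deriv:
  fixes a :: "int ^ 'd \<Rightarrow> complex"
  assumes a: "sob_le (s + 2) a A"
  shows "((\<lambda>t. tri (\<lambda>k1 k2 k3. osc_int0 (resonance k1 k2 k3) t) a a a k) has_vector_derivative
    tri (osc_kernel t) a a a k) (at t within S)"
proof -
  let ?I = "\<lambda>t k1 k2 k3. osc_int0 (resonance k1 k2 k3) t"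
  have rem: "cmod (?I y k1 k2 k3 - ?I t k1 k2 k3 - of_real (y - t) * osc_kernel t k1 k2 k3) \<le>
      (30 * (y - t)\<^sup>2) * (jb k1 * jb k2 * jb k3) powr (2 / 2)" for y t :: real and k1 k2 k3 :: "int ^ 'd"
  proof -
    have "cmod (?I y k1 k2 k3 - ?I t k1 k2 k3 - of_real (y - t) * osc_kernel t k1 k2 k3) \<le>
        \<bar>resonance k1 k2 k3\<bar> * (y - t)\<^sup>2"
      using osc_int0_remainder[of "resonance k1 k2 k3" y t] by (simp add: osc_kernel_def scaleR_conv_of_real)
    also have "\<dots> \<le> 30 * (jb k1 * jb k2 * jb k3) powr (2 / 2) * (y - t)\<^sup>2"
      by (intro mult_right_mono resonance_bound) auto
    finally show ?thesis by (simp add: mult_ac)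
  qed
  have one: "1 \<le> (jb k1 * jb k2 * jb k3) powr (2 / 2)" for k1 k2 k3 :: "int ^ 'd"
    using order_trans[OF jb_ge_1[of k1] jb_products(1)[of k1 k2 k3]] by simp
  have e_sm: "(\<lambda>(k1, k2, k3). osc_kernel t k1 k2 k3 * cnj (a k1) * a k2 * a k3) summable_on triads k" for t k
    by (rule tri_bound(2)[OF s a a a, where C = 1]) (use one in simp)
  have I_bound: "cmod (?I t k1 k2 k3) \<le> (\<bar>t\<bar> + 30 * t\<^sup>2) * (jb k1 * jb k2 * jb k3) powr (2 / 2)"
    for t :: real and k1 k2 k3 :: "int ^ 'd"
  proof -
    have "cmod (?I t k1 k2 k3) \<le> \<bar>t\<bar> + 30 * t\<^sup>2 * (jb k1 * jb k2 * jb k3) powr (2 / 2)"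
      using rem[of k1 k2 k3 t 0] norm_triangle_sub[of "?I t k1 k2 k3" "of_real t"] by simp
    also have "\<dots> \<le> \<bar>t\<bar> * (jb k1 * jb k2 * jb k3) powr (2 / 2) + 30 * t\<^sup>2 * (jb k1 * jb k2 * jb k3) powr (2 / 2)"
      using mult_left_mono[OF one, of "\<bar>t\<bar>" k1 k2 k3] by simp
    finally show ?thesis by (simp add: distrib_right)
  qed
  have I_sm: "(\<lambda>(k1, k2, k3). ?I t k1 k2 k3 * cnj (a k1) * a k2 * a k3) summable_on triads k" for t k
    by (rule tri_bound(2)[OF s a a a I_bound])
  have "cmod (tri (?I y) a a a k - tri (?I t) a a a k - (y - t) *\<^sub>R tri (osc_kernel t) a a a k) \<le>
      (tri_const TYPE('d) s * 30 * A * A * A) * (y - t)\<^sup>2" for y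
  proof -
    let ?m = "\<lambda>k1 k2 k3. ?I y k1 k2 k3 - ?I t k1 k2 k3 - of_real (y - t) * osc_kernel t k1 k2 k3"
    have 1: "tri (\<lambda>k1 k2 k3. ?I y k1 k2 k3 - ?I t k1 k2 k3) a a a k = tri (?I y) a a a k + (- 1) * tri (?I t) a a a k"
      by (rule tri_lincomb[OF I_sm I_sm]) (simp add: algebra_simps)
    have 2: "tri (\<lambda>k1 k2 k3. ?I y k1 k2 k3 - ?I t k1 k2 k3) a a a k =
        tri ?m a a a k + of_real (y - t) * tri (osc_kernel t) a a a k"
      by (rule tri_lincomb[OF tri_bound(2)[OF s a a a rem] e_sm]) (simp add: algebra_simps)
    have "tri (?I y) a a a k - tri (?I t) a a a k - (y - t) *\<^sub>R tri (osc_kernel t) a a a k = tri ?m a a a k"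
      using 1 2 unfolding scaleR_conv_of_real by algebra
    moreover have "cmod (tri ?m a a a k) \<le> (tri_const TYPE('d) s * 30 * A * A * A) * (y - t)\<^sup>2"
    proof -
      have "jb k powr (s / 2) * cmod (tri ?m a a a k) \<le> tri_const TYPE('d) s * (30 * (y - t)\<^sup>2) * A * A * A"
        by (rule sob_le_coeff[OF tri_bound(3)[OF s a a a rem]])
      moreover have "1 * cmod (tri ?m a a a k) \<le> jb k powr (s / 2) * cmod (tri ?m a a a k)"
        using s by (intro mult_right_mono jb_powr_ge_1) (auto intro: less_imp_le order_le_less_trans[rotated])
      ultimately show ?thesis by (simp add: mult_ac)
    qed
    ultimately show ?thesis by simp
  qed
  then show ?thesis by (rule has_vector_derivative_quadratic)
qed

end

text \<open>The coefficients of M^5 and M^7 in the bound \<open>b\<close> of the expansion below,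
  added up; the leading 3 counts the argument slots.\<close>

definition err_const :: "'d::finite itself \<Rightarrow> real \<Rightarrow> real" where
  "err_const D s = 3 * (30 * tri_const D s * tri_const D (s + 2) + 30 * (tri_const D s)\<^sup>2 +
     3 * (tri_const D s)\<^sup>2 * tri_const D (s + 2) + 2 * tri_const D s * (tri_const D (s + 2))\<^sup>2)"

text \<open>The remainder vanishes at time 0 and its derivative is -i H, where H compares the
  trilinear term with its linearization around the initial value. H is O(t^2) in H^s, and the mean
  value inequality supplies the third power of \<tau>. That the three insertions of N0 agree lets
  the linear part be expressed by a single quintic term Q.\<close>

theorem twisted_flow_expansion:
  fixes a :: "real \<Rightarrow> int ^ 'd::finite \<Rightarrow> complex"
  assumes s: "s > real CARD('d) / 2" and \<tau>: "0 \<le> \<tau>"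
    and bound: "\<And>t. t \<in> {0..\<tau>} \<Longrightarrow> sob_le (s + 2) (a t) M"
    and deriv: "\<And>t k. t \<in> {0..\<tau>} \<Longrightarrow> ((\<lambda>t. a t k) has_vector_derivative
        - \<i> * tri (osc_kernel t) (a t) (a t) (a t) k) (at t within {0..\<tau>})"
    and N0: "N0 = tri (\<lambda>_ _ _. 1) (a 0) (a 0) (a 0)"
    and Q: "tri (\<lambda>_ _ _. 1) N0 (a 0) (a 0) = Q" "tri (\<lambda>_ _ _. 1) (a 0) N0 (a 0) = Q"
      "tri (\<lambda>_ _ _. 1) (a 0) (a 0) N0 = Q"
  shows "sob_le s (\<lambda>k. a \<tau> k - a 0 k
      + \<i> * tri (\<lambda>k1 k2 k3. osc_int0 (resonance k1 k2 k3) \<tau>) (a 0) (a 0) (a 0) k + of_real (\<tau>\<^sup>2 / 2) * Q k)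
    (err_const TYPE('d) s * \<tau> ^ 3 * (1 + M ^ 7))"
proof -
  let ?T = "tri_const TYPE('d) s" and ?T2 = "tri_const TYPE('d) (s + 2)"
  have s2: "s + 2 > real CARD('d) / 2" using s by simp
  have T: "0 \<le> ?T" "0 \<le> ?T2" by (rule tri_const_nonneg)+
  have in0: "0 \<in> {0..\<tau>}" using \<tau> by simp
  have M: "0 \<le> M" by (rule sob_le_nonneg[OF bound[OF in0]])
  have bs: "sob_le s (a t) M" if "t \<in> {0..\<tau>}" for t
    using sob_le_order_mono[OF bound[OF that], of s] by simp
  have e1: "cmod (osc_kernel t k1 k2 k3) \<le> 1" for t and k1 k2 k3 :: "int ^ 'd" by simp
  have o1: "cmod (1::complex) \<le> 1" by simp
  define n where "n = ?T2 * M ^ 3"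
  have n0: "0 \<le> n" using T M by (simp add: n_def)
  have N: "sob_le (s + 2) (tri (osc_kernel t) (a t) (a t) (a t)) n" if "t \<in> {0..\<tau>}" for t
    using tri_unit_bound(2)[OF s2 bound[OF that] bound[OF that] bound[OF that] e1]
    by (simp add: n_def power3_eq_cube mult_ac)
  have N0_bound: "sob_le (s + 2) N0 n" using N[OF in0] by (simp add: N0)
  \<comment> \<open>The first increment is O(t) even in H^(s+2), because the twisted equation has a
    bounded right-hand side there.\<close>
  define \<delta> where "\<delta> t k = a t k - a 0 k" for t k
  have der: "((\<lambda>t. a t k) has_vector_derivative - \<i> * tri (osc_kernel r) (a r) (a r) (a r) k) (at r within {0..t})"
    if "r \<in> {0..t}" "t \<in> {0..\<tau>}" for r t k
    using deriv[of r k] that by (auto elim: has_vector_derivative_within_subset)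
  have \<delta>: "sob_le (s + 2) (\<delta> t) (t * n)" if t: "t \<in> {0..\<tau>}" for t
  proof (rule sob_le_mean_value)
    fix r k assume r: "r \<in> {0..t}"
    show "((\<lambda>t. \<delta> t k) has_vector_derivative - \<i> * tri (osc_kernel r) (a r) (a r) (a r) k) (at r within {0..t})"
      unfolding \<delta>_def using has_vector_derivative_diff[OF der[OF r t] has_vector_derivative_const] by simp
    show "sob_le (s + 2) (\<lambda>k. - \<i> * tri (osc_kernel r) (a r) (a r) (a r) k) n"
      using r t by (intro sob_le_mono[OF N[of r]]) (auto simp: norm_mult)
  qed (use t in \<open>auto simp: \<delta>_def\<close>)
  have \<delta>s: "sob_le s (\<delta> t) (t * n)" if "t \<in> {0..\<tau>}" for t
    using sob_le_order_mono[OF \<delta>[OF that], of s] by simp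
  \<comment> \<open>The deviation of the right-hand side from its initial value is estimated by O(t)
    in H^s, since freezing the phase costs two derivatives.\<close>
  define G where "G t k = tri (osc_kernel t) (a t) (a t) (a t) k - N0 k" for t k
  define g where "g = 30 * ?T * M ^ 3 + 3 * ?T * n * M\<^sup>2"
  have g0: "0 \<le> g" using T M n0 by (simp add: g_def)
  have G: "sob_le s (G t) (t * g)" if t: "t \<in> {0..\<tau>}" for t
  proof -
    have "sob_le s (\<lambda>k. tri (osc_kernel t) (a t) (a t) (a t) k - tri (\<lambda>_ _ _. 1) (a 0) (a 0) (a 0) k)
      (?T * (t * 30) * M * M * M + ?T * (t * n) * M * M + ?T * M * (t * n) * M + ?T * M * M * (t * n))"
      using t by (intro tri_difference(1)[OF s e1 o1 osc_kernel_diff] bound bs in0 \<delta>s[unfolded \<delta>_def [abs_def]]) auto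
    then show ?thesis
      unfolding G_def [abs_def] N0
      by (rule sob_le_bound) (simp add: g_def algebra_simps power2_eq_square power3_eq_cube)
  qed
  \<comment> \<open>Second order information: the increment without its linear part -i t N0 is
    O(t^2).\<close>
  define \<eta> where "\<eta> t k = \<delta> t k - (- (\<i> * of_real t) * N0 k)" for t k
  have \<eta>: "sob_le s (\<eta> t) (t * (t * g))" if t: "t \<in> {0..\<tau>}" for t
  proof (rule sob_le_mean_value)
    fix r k assume r: "r \<in> {0..t}"
    have lin: "((\<lambda>t. - (\<i> * of_real t) * N0 k) has_vector_derivative - \<i> * N0 k) (at r within {0..t})"
      by (auto intro!: derivative_eq_intros)
    have "((\<lambda>t. \<eta> t k) has_vector_derivative
        (- \<i> * tri (osc_kernel r) (a r) (a r) (a r) k - 0) - (- \<i> * N0 k)) (at r within {0..t})"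
      unfolding \<eta>_def \<delta>_def
      by (intro has_vector_derivative_diff der[OF r t] has_vector_derivative_const lin)
    then show "((\<lambda>t. \<eta> t k) has_vector_derivative - \<i> * G r k) (at r within {0..t})"
      by (simp add: G_def algebra_simps)
    show "sob_le s (\<lambda>k. - \<i> * G r k) (t * g)"
      using r t g0 by (intro sob_le_mono[OF G[of r]]) (auto simp: norm_mult intro!: mult_right_mono)
  qed (use t in \<open>auto simp: \<eta>_def \<delta>_def\<close>)
  define b where "b = 30 * ?T * n * M\<^sup>2 + ?T * g * M\<^sup>2 + 2 * ?T * n\<^sup>2 * M"
  define H where "H t k = tri (osc_kernel t) (a t) (a t) (a t) k - tri (osc_kernel t) (a 0) (a 0) (a 0) k
      + \<i> * of_real t * Q k" for t k
  have H: "sob_le s (H t) (3 * (t * t * b))" if t: "t \<in> {0..\<tau>}" for t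
  proof -
    let ?v = "\<lambda>k. - (\<i> * of_real t) * N0 k"
    have v: "sob_le s ?v (t * n)"
      using sob_le_cmult[OF sob_le_order_mono[OF N0_bound], of s "- (\<i> * of_real t)"] t by (simp add: norm_mult)
    have \<eta>': "sob_le s (\<lambda>k. \<delta> t k - ?v k) (t * (t * g))" using \<eta>[OF t] by (simp add: \<eta>_def [abs_def])
    have \<delta>': "sob_le s (\<lambda>k. a t k - a 0 k) (t * n)" using \<delta>s[OF t] by (simp add: \<delta>_def [abs_def])
    have z: "sob_le s (\<lambda>k. a 0 k - a 0 k) 0" by (simp add: sob_le_zero)
    have t0: "0 \<le> t" using t by simp
    note kd = osc_kernel_diff[OF t0]
    \<comment> \<open>The slots produce two, one and no products of two increments; \<open>b\<close>
      contains the largest number, and these nonnegative quantities fill the gaps.\<close>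
    have "0 \<le> t * t * (?T * n * n * M)" "0 \<le> t * t * (2 * ?T * n * n * M)" using T M n0 t0 by auto
    then have le: "?T * (t * 30) * (t * n) * M * M + ?T * (t * (t * g)) * M * M + ?T * (t * n) * (t * n) * M + ?T * (t * n) * M * (t * n) \<le> t * t * b"
      "?T * (t * 30) * M * (t * n) * M + ?T * 0 * (t * n) * M + ?T * M * (t * (t * g)) * M + ?T * M * (t * n) * (t * n) \<le> t * t * b"
      "?T * (t * 30) * M * M * (t * n) + ?T * 0 * M * (t * n) + ?T * M * 0 * (t * n) + ?T * M * M * (t * (t * g)) \<le> t * t * b"
      by (simp_all add: b_def algebra_simps power2_eq_square)
    have 1: "sob_le s (\<lambda>k. tri (osc_kernel t) (\<delta> t) (a t) (a t) k - tri (\<lambda>_ _ _. 1) ?v (a 0) (a 0) k) (t * t * b)"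
      by (rule sob_le_bound[OF tri_difference(1)[OF s e1 o1 kd \<delta>[OF t] v \<eta>' bound[OF t] bs[OF in0] \<delta>'
            bound[OF t] bs[OF in0] \<delta>'] le(1)])
    have 2: "sob_le s (\<lambda>k. tri (osc_kernel t) (a 0) (\<delta> t) (a t) k - tri (\<lambda>_ _ _. 1) (a 0) ?v (a 0) k) (t * t * b)"
      by (rule sob_le_bound[OF tri_difference(1)[OF s e1 o1 kd bound[OF in0] bs[OF in0] z \<delta>[OF t] v \<eta>'
            bound[OF t] bs[OF in0] \<delta>'] le(2)])
    have 3: "sob_le s (\<lambda>k. tri (osc_kernel t) (a 0) (a 0) (\<delta> t) k - tri (\<lambda>_ _ _. 1) (a 0) (a 0) ?v k) (t * t * b)"
      by (rule sob_le_bound[OF tri_difference(1)[OF s e1 o1 kd bound[OF in0] bs[OF in0] z bound[OF in0] bs[OF in0] z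
            \<delta>[OF t] v \<eta>'] le(3)])
    \<comment> \<open>The first slot is conjugated, so -i t becomes i t there. The three slots add
      up to -i t Q, which the last term of \<open>H\<close> cancels.\<close>
    have scale: "tri (\<lambda>_ _ _. 1) ?v (a 0) (a 0) k = \<i> * of_real t * Q k"
      "tri (\<lambda>_ _ _. 1) (a 0) ?v (a 0) k = - (\<i> * of_real t) * Q k"
      "tri (\<lambda>_ _ _. 1) (a 0) (a 0) ?v k = - (\<i> * of_real t) * Q k" for k
    proof -
      have "tri (\<lambda>_ _ _. 1) ?v (a 0) (a 0) k = \<i> * of_real t * tri (\<lambda>_ _ _. 1) N0 (a 0) (a 0) k"
        "tri (\<lambda>_ _ _. 1) (a 0) ?v (a 0) k = - (\<i> * of_real t) * tri (\<lambda>_ _ _. 1) (a 0) N0 (a 0) k"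
        "tri (\<lambda>_ _ _. 1) (a 0) (a 0) ?v k = - (\<i> * of_real t) * tri (\<lambda>_ _ _. 1) (a 0) (a 0) N0 k"
        unfolding tri_def infsum_cmult_right' [symmetric]
        by (auto intro!: infsum_cong simp: algebra_simps)
      then show "tri (\<lambda>_ _ _. 1) ?v (a 0) (a 0) k = \<i> * of_real t * Q k"
        "tri (\<lambda>_ _ _. 1) (a 0) ?v (a 0) k = - (\<i> * of_real t) * Q k"
        "tri (\<lambda>_ _ _. 1) (a 0) (a 0) ?v k = - (\<i> * of_real t) * Q k"
        unfolding Q by blast+
    qed
    have e: "tri (osc_kernel t) (a t) (a t) (a t) k - tri (osc_kernel t) (a 0) (a 0) (a 0) k =
       tri (osc_kernel t) (\<delta> t) (a t) (a t) k + tri (osc_kernel t) (a 0) (\<delta> t) (a t) k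
       + tri (osc_kernel t) (a 0) (a 0) (\<delta> t) k" for k
      unfolding \<delta>_def [abs_def]
      by (rule tri_difference(2)[OF s e1 o1 kd bound[OF t] bs[OF in0] \<delta>' bound[OF t] bs[OF in0] \<delta>' bound[OF t] bs[OF in0] \<delta>'])
    have "H t k = (tri (osc_kernel t) (\<delta> t) (a t) (a t) k - tri (\<lambda>_ _ _. 1) ?v (a 0) (a 0) k) +
        (tri (osc_kernel t) (a 0) (\<delta> t) (a t) k - tri (\<lambda>_ _ _. 1) (a 0) ?v (a 0) k) +
        (tri (osc_kernel t) (a 0) (a 0) (\<delta> t) k - tri (\<lambda>_ _ _. 1) (a 0) (a 0) ?v k)" for k
      unfolding H_def e scale by (simp add: algebra_simps)
    then have "H t = (\<lambda>k. (tri (osc_kernel t) (\<delta> t) (a t) (a t) k - tri (\<lambda>_ _ _. 1) ?v (a 0) (a 0) k) +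
        (tri (osc_kernel t) (a 0) (\<delta> t) (a t) k - tri (\<lambda>_ _ _. 1) (a 0) ?v (a 0) k) +
        (tri (osc_kernel t) (a 0) (a 0) (\<delta> t) k - tri (\<lambda>_ _ _. 1) (a 0) (a 0) ?v k))" by (rule ext)
    moreover have "sob_le s \<dots> (t * t * b + t * t * b + t * t * b)" by (intro sob_le_add 1 2 3)
    ultimately have "sob_le s (H t) (t * t * b + t * t * b + t * t * b)" by (simp only:)
    then show ?thesis by (rule sob_le_bound) simp
  qed
  have b0: "0 \<le> b" using T M n0 g0 by (simp add: b_def)
  let ?F = "\<lambda>t k. a t k - a 0 k + \<i> * tri (\<lambda>k1 k2 k3. osc_int0 (resonance k1 k2 k3) t) (a 0) (a 0) (a 0) k
      + of_real (t\<^sup>2 / 2) * Q k"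
  have "sob_le s (?F \<tau>) (\<tau> * (3 * (\<tau> * \<tau> * b)))"
  proof (rule sob_le_mean_value[OF \<tau>])
    fix t k assume t: "t \<in> {0..\<tau>}"
    have "((\<lambda>t. of_real (t\<^sup>2 / 2) * Q k) has_vector_derivative of_real t * Q k) (at t within {0..\<tau>})"
    proof -
      have "((\<lambda>t. of_real (t\<^sup>2 / 2)) has_vector_derivative of_real t) (at t within {0..\<tau>})"
        by (rule has_vector_derivative_of_real) (auto intro!: derivative_eq_intros)
      then show ?thesis by (rule has_vector_derivative_mult_left)
    qed
    then have "((\<lambda>t. ?F t k) has_vector_derivative
        (- \<i> * tri (osc_kernel t) (a t) (a t) (a t) k - 0) + \<i> * tri (osc_kernel t) (a 0) (a 0) (a 0) k + of_real t * Q k)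
        (at t within {0..\<tau>})"
      by (intro has_vector_derivative_add has_vector_derivative_diff has_vector_derivative_mult_right
          has_vector_derivative_const deriv t tri_osc_int0_deriv[OF s bound[OF in0]])
    also have "(- \<i> * tri (osc_kernel t) (a t) (a t) (a t) k - 0) + \<i> * tri (osc_kernel t) (a 0) (a 0) (a 0) k + of_real t * Q k
        = - \<i> * H t k"
      by (simp add: H_def algebra_simps)
    finally show "((\<lambda>t. ?F t k) has_vector_derivative - \<i> * H t k) (at t within {0..\<tau>})" .
    have "t * t * b \<le> \<tau> * \<tau> * b" using t b0 by (intro mult_right_mono mult_mono) auto
    then show "sob_le s (\<lambda>k. - \<i> * H t k) (3 * (\<tau> * \<tau> * b))"
      by (intro sob_le_mono[OF H[OF t]]) (auto simp: norm_mult)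
  qed (simp add: tri_def case_prod_unfold)
  then show ?thesis
  proof (rule sob_le_bound)
    \<comment> \<open>Degrees 5 and 7 correspond to one and two further substitutions of the cubic
      term.\<close>
    have M57: "M ^ 5 \<le> 1 + M ^ 7" "M ^ 7 \<le> 1 + M ^ 7"
      using power_le_1_plus_power[of M 5 7] M by simp_all
    have "3 * b = 3 * ((30 * ?T * ?T2 + 30 * ?T\<^sup>2) * M ^ 5 + (3 * ?T\<^sup>2 * ?T2 + 2 * ?T * ?T2\<^sup>2) * M ^ 7)"
      by (simp add: b_def g_def n_def eval_nat_numeral algebra_simps)
    also have "\<dots> \<le> 3 * ((30 * ?T * ?T2 + 30 * ?T\<^sup>2) * (1 + M ^ 7) + (3 * ?T\<^sup>2 * ?T2 + 2 * ?T * ?T2\<^sup>2) * (1 + M ^ 7))"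
      using T by (intro mult_left_mono add_mono M57) auto
    also have "\<dots> = err_const TYPE('d) s * (1 + M ^ 7)" by (simp add: err_const_def algebra_simps)
    finally have "\<tau> ^ 3 * (3 * b) \<le> \<tau> ^ 3 * (err_const TYPE('d) s * (1 + M ^ 7))"
      using \<tau> by (intro mult_left_mono) auto
    then show "\<tau> * (3 * (\<tau> * \<tau> * b)) \<le> err_const TYPE('d) s * \<tau> ^ 3 * (1 + M ^ 7)"
      by (simp add: power3_eq_cube mult_ac)
  qed
qed

section \<open>One step maps given by a kernel\<close>

lemma of_real_cmod_power4: "of_real (cmod z ^ 4) = cnj z * z * (cnj z * z)"
proof -
  have "complex_of_real (cmod z ^ 4) = complex_of_real ((cmod z)\<^sup>2) * complex_of_real ((cmod z)\<^sup>2)"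
    by (simp only: of_real_mult [symmetric] power_add [symmetric]) simp
  then show ?thesis unfolding complex_norm_square by (simp add: mult_ac)
qed

definition flow :: "real \<Rightarrow> int ^ 'd::finite \<Rightarrow> complex" where
  "flow \<tau> k = exp (- (\<i> * of_real (\<tau> * (norm (rvec k))\<^sup>2)))"

lemma norm_flow [simp]: "cmod (flow \<tau> k) = 1"
  by (simp add: flow_def norm_exp_eq_Re)

lemma flow_twist: "flow \<tau> k * twist \<tau> a k = a k" "twist \<tau> a k = a k / flow \<tau> k"
  by (simp_all add: flow_def twist_def exp_minus field_simps)

lemma free_flow_series:
  assumes "trig_series f J c m"
  shows "trig_series (free_flow \<tau> f) J (\<lambda>j. flow \<tau> (m j) * c j) m"
proof -
  have e: "exp (\<i> * of_real \<tau> * - of_real ((norm (rvec k))\<^sup>2)) = flow \<tau> k" for k :: "int ^ 'a"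
    by (simp add: flow_def mult.assoc)
  have "trig_series (free_flow \<tau> f) J (\<lambda>j. exp (\<i> * of_real \<tau> * - of_real ((norm (rvec (m j)))\<^sup>2)) * c j) m"
    by (rule trig_series_lapfun[OF assms]) (use trig_series_summable[OF assms] in \<open>simp add: norm_mult e\<close>)
  then show ?thesis unfolding e .
qed

lemma lapfun_series_bounded:
  assumes f: "trig_series f J c m" and h: "\<And>x. 0 \<le> x \<Longrightarrow> cmod (h (- of_real x)) \<le> B"
  shows "trig_series (lapfun h f) J (\<lambda>j. h (- of_real ((norm (rvec (m j)))\<^sup>2)) * c j) m"
proof (rule trig_series_lapfun[OF f])
  show "(\<lambda>j. cmod (h (- of_real ((norm (rvec (m j)))\<^sup>2)) * c j)) summable_on J"
    by (rule Infinite_Sum.abs_summable_on_comparison_test'[OF summable_on_cmult_right[OF trig_series_summable[OF f], of B]])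
      (use h[of "(norm (rvec (m _)))\<^sup>2"] in \<open>auto simp: norm_mult intro!: mult_right_mono\<close>)
qed

definition triple_freq :: "(int ^ 'd) \<times> (int ^ 'd) \<times> (int ^ 'd) \<Rightarrow> int ^ 'd" where
  "triple_freq = (\<lambda>(k1, k2, k3). - k1 + k2 + k3)"

definition quint_freq :: "(int ^ 'd) \<times> (int ^ 'd) \<times> (int ^ 'd) \<times> (int ^ 'd) \<times> (int ^ 'd) \<Rightarrow> int ^ 'd" where
  "quint_freq = (\<lambda>(k1, k2, k3, k4, k5). - k1 + k2 + k3 - k4 + k5)"

text \<open>The parts are described by series over single frequencies, triples and quintuples rather
  than by their coefficients: the tree sum consists of exactly such terms, so the algebraic and the
  analytic side can both start from this form.\<close>

definition is_kernel_step ::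
  "real \<Rightarrow> (int ^ 'd::finite \<Rightarrow> int ^ 'd \<Rightarrow> int ^ 'd \<Rightarrow> complex) \<Rightarrow> (real ^ 'd \<Rightarrow> complex) \<Rightarrow>
     (real ^ 'd \<Rightarrow> complex) \<Rightarrow> bool" where
  "is_kernel_step \<tau> W v w \<longleftrightarrow> (\<exists>f g h. w = (\<lambda>x. f x + g x + h x) \<and>
     trig_series f UNIV (\<lambda>k. flow \<tau> k * fourier_coeff v k) (\<lambda>k. k) \<and>
     trig_series g UNIV (\<lambda>(k1, k2, k3). - \<i> * flow \<tau> (- k1 + k2 + k3) * W k1 k2 k3 *
        cnj (fourier_coeff v k1) * fourier_coeff v k2 * fourier_coeff v k3) triple_freq \<and>
     trig_series h UNIV (\<lambda>(k1, k2, k3, k4, k5). - of_real (\<tau>\<^sup>2 / 2) * flow \<tau> (- k1 + k2 + k3 - k4 + k5) *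
        cnj (fourier_coeff v k1) * fourier_coeff v k2 * fourier_coeff v k3 *
        cnj (fourier_coeff v k4) * fourier_coeff v k5) quint_freq)"

lemma triple_series:
  fixes f g h :: "real ^ 'd::finite \<Rightarrow> complex"
  assumes "trig_series f UNIV a (\<lambda>k. - k)" "trig_series g UNIV b (\<lambda>k. k)" "trig_series h UNIV c (\<lambda>k. k)"
  shows "trig_series (\<lambda>x. f x * g x * h x) UNIV (\<lambda>(k1, k2, k3). a k1 * b k2 * c k3) triple_freq"
  using trig_series_mult[OF assms(1) trig_series_mult[OF assms(2,3)]]
  by (simp add: case_prod_unfold mult.assoc algebra_simps triple_freq_def)

text \<open>The flow expansion works with solutions of order s + 2; smoother ones are brought to
  this order here.\<close>

lemma nls_solution_mono:
  fixes u :: "real \<Rightarrow> real ^ 'd::finite \<Rightarrow> complex"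
  assumes u: "nls_solution \<sigma> T u" and "\<sigma>' \<le> \<sigma>"
  shows "nls_solution \<sigma>' T u"
proof -
  have us: "u t \<in> sobolev \<sigma>" if "t \<in> {0..T}" for t using u that by (simp add: nls_solution_def)
  have "((\<lambda>r. sobolev_norm \<sigma>' (\<lambda>x. u r x - u t x)) \<longlongrightarrow> 0) (at t within {0..T})" if t: "t \<in> {0..T}" for t
  proof (rule tendsto_sandwich[OF _ _ tendsto_const])
    show "((\<lambda>r. sobolev_norm \<sigma> (\<lambda>x. u r x - u t x)) \<longlongrightarrow> 0) (at t within {0..T})"
      using u t by (simp add: nls_solution_def)
    show "\<forall>\<^sub>F r in at t within {0..T}. sobolev_norm \<sigma>' (\<lambda>x. u r x - u t x) \<le> sobolev_norm \<sigma> (\<lambda>x. u r x - u t x)"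
      unfolding eventually_at_filter
      by (intro always_eventually allI impI sob_le_sobolev_norm sob_le_order_mono[OF sobolev_sob_le assms(2)]
          sobolev_diff us t)
  qed (simp add: sobolev_norm_nonneg)
  then show ?thesis
    using u sobolev_order_mono[OF us assms(2)] by (simp add: nls_solution_def)
qed

section \<open>Regularity and local error of a kernel step\<close>

context
  fixes s :: real
  assumes s: "s > real CARD('d::finite) / 2"
begin

lemma cnj_series:
  fixes v :: "real ^ 'd \<Rightarrow> complex"
  assumes "v \<in> sobolev s"
  shows "trig_series (\<lambda>x. cnj (v x)) UNIV (\<lambda>k. cnj (fourier_coeff v k)) (\<lambda>k. - k)"
  by (rule trig_series_cnj[OF sobolev_series[OF s assms]])

lemma quint_series:
  fixes v :: "real ^ 'd \<Rightarrow> complex"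
  assumes v: "v \<in> sobolev s"
  shows "trig_series (\<lambda>x. of_real (cmod (v x) ^ 4) * v x) UNIV
    (\<lambda>(k1, k2, k3, k4, k5). cnj (fourier_coeff v k1) * fourier_coeff v k2 * fourier_coeff v k3 *
        cnj (fourier_coeff v k4) * fourier_coeff v k5) quint_freq"
proof -
  note V = sobolev_series[OF s v] and C = cnj_series[OF v]
  have "trig_series (\<lambda>x. cnj (v x) * (v x * (v x * (cnj (v x) * v x)))) UNIV
    (\<lambda>(k1, k2, k3, k4, k5). cnj (fourier_coeff v k1) * fourier_coeff v k2 * fourier_coeff v k3 *
        cnj (fourier_coeff v k4) * fourier_coeff v k5) quint_freq"
    using trig_series_mult[OF C trig_series_mult[OF V trig_series_mult[OF V trig_series_mult[OF C V]]]]
    by (simp add: case_prod_unfold mult.assoc algebra_simps quint_freq_def)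
  then show ?thesis unfolding of_real_cmod_power4 by (simp add: mult_ac)
qed

text \<open>Collects the cubic term by output frequency, the form in which it can be inserted as an
  argument of \<open>tri\<close> once more.\<close>

lemma cubic_sobolev:
  fixes v :: "real ^ 'd \<Rightarrow> complex"
  assumes v: "v \<in> sobolev s"
  shows "trig_series (\<lambda>x. cnj (v x) * v x * v x) UNIV
    (tri (\<lambda>_ _ _. 1) (fourier_coeff v) (fourier_coeff v) (fourier_coeff v)) (\<lambda>k. k)"
proof -
  note V = sobolev_series[OF s v]
  let ?f = "\<lambda>x. cnj (v x) * v x * v x"
  note t = trig_series_tri[OF V V V]
  have c: "fourier_coeff ?f = tri (\<lambda>_ _ _. 1) (fourier_coeff v) (fourier_coeff v) (fourier_coeff v)"
    by (rule ext) (rule fourier_coeff_tri[OF V V V])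
  note B = tri_unit_bound(2)[OF s sobolev_sob_le[OF v] sobolev_sob_le[OF v] sobolev_sob_le[OF v], of "\<lambda>_ _ _. 1"]
  have "?f \<in> sobolev s"
    unfolding sobolev_iff c using trig_series_continuous[OF t] trig_series_periodic[OF t] B by auto
  from sobolev_series[OF s this] show ?thesis unfolding c .
qed

text \<open>All terms with output frequency k share the unimodular factor
  \<open>flow \<tau> k\<close>, which comes out of each fibre sum.\<close>

lemma kernel_step_coeff:
  fixes v :: "real ^ 'd \<Rightarrow> complex"
  assumes v: "v \<in> sobolev s" and w: "is_kernel_step \<tau> W v w"
  shows "fourier_coeff w k = flow \<tau> k * (fourier_coeff v k - \<i> * tri W (fourier_coeff v) (fourier_coeff v) (fourier_coeff v) k
      - of_real (\<tau>\<^sup>2 / 2) * fourier_coeff (\<lambda>x. of_real (cmod (v x) ^ 4) * v x) k)"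
    and "continuous_on UNIV w" and "periodic_fun w"
proof -
  let ?v = "fourier_coeff v"
  obtain f g h where w_eq: "w = (\<lambda>x. f x + g x + h x)"
    and f: "trig_series f UNIV (\<lambda>k. flow \<tau> k * ?v k) (\<lambda>k. k)"
    and g: "trig_series g UNIV (\<lambda>(k1, k2, k3). - \<i> * flow \<tau> (- k1 + k2 + k3) * W k1 k2 k3 *
        cnj (?v k1) * ?v k2 * ?v k3) triple_freq"
    and h: "trig_series h UNIV (\<lambda>(k1, k2, k3, k4, k5). - of_real (\<tau>\<^sup>2 / 2) * flow \<tau> (- k1 + k2 + k3 - k4 + k5) *
        cnj (?v k1) * ?v k2 * ?v k3 * cnj (?v k4) * ?v k5) quint_freq"
    using w unfolding is_kernel_step_def by (elim exE conjE) (rule that)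
  note C = trig_series_continuous[of _ _ _ _ UNIV]
  show "continuous_on UNIV w" unfolding w_eq by (intro continuous_on_add C[OF f] C[OF g] C[OF h])
  show "periodic_fun w"
    using trig_series_periodic[OF f] trig_series_periodic[OF g] trig_series_periodic[OF h]
    by (simp add: w_eq periodic_fun_def)
  have "fourier_coeff w k = fourier_coeff f k + fourier_coeff g k + fourier_coeff h k"
    unfolding w_eq by (simp add: fourier_coeff_add continuous_on_add C[OF f] C[OF g] C[OF h])
  moreover have "fourier_coeff f k = flow \<tau> k * ?v k" by (rule trig_series_UNIV_coeff[OF f])
  moreover have "fourier_coeff g k = flow \<tau> k * (- \<i> * tri W ?v ?v ?v k)"
  proof -
    have "{j \<in> UNIV. triple_freq j = k} = triads k" by (auto simp: triple_freq_def triads_def)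
    then have "fourier_coeff g k = (\<Sum>\<^sub>\<infinity>(k1, k2, k3)\<in>triads k. - \<i> * flow \<tau> (- k1 + k2 + k3) * W k1 k2 k3 *
        cnj (?v k1) * ?v k2 * ?v k3)"
      using infsumI[OF trig_series_coeff[OF g, of k]] by simp
    also have "\<dots> = flow \<tau> k * (- \<i> * tri W ?v ?v ?v k)"
      unfolding tri_def infsum_cmult_right' [symmetric]
      by (rule infsum_cong) (auto simp: triads_def algebra_simps)
    finally show ?thesis .
  qed
  moreover have "fourier_coeff h k = flow \<tau> k * (- of_real (\<tau>\<^sup>2 / 2) *
      fourier_coeff (\<lambda>x. of_real (cmod (v x) ^ 4) * v x) k)"
  proof -
    let ?c = "\<lambda>(k1, k2, k3, k4, k5). cnj (?v k1) * ?v k2 * ?v k3 * cnj (?v k4) * ?v k5"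
    have "fourier_coeff h k = (\<Sum>\<^sub>\<infinity>j\<in>{j \<in> UNIV. quint_freq j = k}. flow \<tau> k * (- of_real (\<tau>\<^sup>2 / 2) * ?c j))"
      unfolding infsumI[OF trig_series_coeff[OF h], symmetric]
      by (rule infsum_cong) (auto simp: quint_freq_def algebra_simps)
    also have "\<dots> = flow \<tau> k * (- of_real (\<tau>\<^sup>2 / 2) * infsum ?c {j \<in> UNIV. quint_freq j = k})"
      unfolding infsum_cmult_right' ..
    also have "infsum ?c {j \<in> UNIV. quint_freq j = k} = fourier_coeff (\<lambda>x. of_real (cmod (v x) ^ 4) * v x) k"
      by (rule infsumI[OF trig_series_coeff[OF quint_series[OF v]]])
    finally show ?thesis .
  qed
  ultimately show "fourier_coeff w k = flow \<tau> k * (?v k - \<i> * tri W ?v ?v ?v k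
      - of_real (\<tau>\<^sup>2 / 2) * fourier_coeff (\<lambda>x. of_real (cmod (v x) ^ 4) * v x) k)"
    by (simp add: algebra_simps)
qed

text \<open>The kernel term loses p derivatives through the growth of W; the quintic term is an
  iterated \<open>tri\<close> and loses none.\<close>

lemma kernel_step_sobolev:
  fixes v :: "real ^ 'd \<Rightarrow> complex"
  assumes p: "0 \<le> p" and v: "v \<in> sobolev (s + p)" and w: "is_kernel_step \<tau> W v w"
    and W: "\<And>k1 k2 k3. cmod (W k1 k2 k3) \<le> C * (jb k1 * jb k2 * jb k3) powr (p / 2)"
  shows "w \<in> sobolev s"
proof -
  let ?v = "fourier_coeff v" and ?q = "fourier_coeff (\<lambda>x. of_real (cmod (v x) ^ 4) * v x)"
  have v0: "v \<in> sobolev s" using v p by (auto intro: sobolev_order_mono)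
  note K = kernel_step_coeff[OF v0 w] and B = sobolev_sob_le[OF v] and B0 = sobolev_sob_le[OF v0]
  have N: "sob_le s (tri (\<lambda>_ _ _. 1) ?v ?v ?v) (tri_const TYPE('d) s * sobolev_norm s v * sobolev_norm s v * sobolev_norm s v)"
    by (rule tri_unit_bound(2)[OF s B0 B0 B0]) simp
  have q: "?q = tri (\<lambda>_ _ _. 1) ?v ?v (tri (\<lambda>_ _ _. 1) ?v ?v ?v)"
  proof
    fix k
    have "(\<lambda>x. of_real (cmod (v x) ^ 4) * v x) = (\<lambda>x. cnj (v x) * v x * (cnj (v x) * v x * v x))"
      unfolding of_real_cmod_power4 by (simp add: mult_ac)
    then show "?q k = tri (\<lambda>_ _ _. 1) ?v ?v (tri (\<lambda>_ _ _. 1) ?v ?v ?v) k"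
      using fourier_coeff_tri[OF sobolev_series[OF s v0] sobolev_series[OF s v0] cubic_sobolev[OF v0]] by simp
  qed
  have "sob_le s (tri (\<lambda>_ _ _. 1) ?v ?v (tri (\<lambda>_ _ _. 1) ?v ?v ?v))
      (tri_const TYPE('d) s * sobolev_norm s v * sobolev_norm s v *
       (tri_const TYPE('d) s * sobolev_norm s v * sobolev_norm s v * sobolev_norm s v))"
    by (rule tri_unit_bound(2)[OF s B0 B0 N]) simp
  note S = sob_le_diff[OF sob_le_diff[OF B0 sob_le_cmult[OF tri_bound(3)[OF s B B B W], of \<i>]]
      sob_le_cmult[OF this[folded q], of "of_real (\<tau>\<^sup>2 / 2)"]]
  have "\<exists>B. sob_le s (fourier_coeff w) B"
    by (rule exI, rule sob_le_mono[OF S _ order_refl]) (simp add: K(1) norm_mult)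
  then show ?thesis using K(2,3) by (simp add: sobolev_iff)
qed

text \<open>Twisting at time \<tau> removes the outer free flow of the scheme without changing
  norms. What is left is the remainder of the flow expansion and a trilinear form whose symbol is
  the difference of the exact and the numerical kernel.\<close>

theorem kernel_step_error:
  fixes u :: "real \<Rightarrow> real ^ 'd \<Rightarrow> complex"
  assumes p: "2 \<le> p" and \<tau>: "0 \<le> \<tau>" and u: "nls_solution (s + p) \<tau> u"
    and bound: "\<And>t. t \<in> {0..\<tau>} \<Longrightarrow> sob_le (s + p) (fourier_coeff (u t)) M"
    and w: "is_kernel_step \<tau> W (u 0) w"
    and W: "\<And>k1 k2 k3. cmod (osc_int0 (resonance k1 k2 k3) \<tau> - W k1 k2 k3) \<le>
        K * \<tau> ^ 3 * (jb k1 * jb k2 * jb k3) powr (p / 2)"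
    and W0: "\<And>k1 k2 k3. cmod (W k1 k2 k3) \<le> C * (jb k1 * jb k2 * jb k3) powr (p / 2)"
  shows "sob_le s (fourier_coeff (\<lambda>x. u \<tau> x - w x))
      ((err_const TYPE('d) s + tri_const TYPE('d) s * K) * \<tau> ^ 3 * (1 + M ^ 7))"
    and "(\<lambda>x. u \<tau> x - w x) \<in> sobolev s"
proof -
  let ?v = "fourier_coeff (u 0)" and ?q = "fourier_coeff (\<lambda>x. of_real (cmod (u 0 x) ^ 4) * u 0 x)"
  let ?T = "tri_const TYPE('d) s"
  let ?N = "tri (\<lambda>_ _ _. 1) ?v ?v ?v"
  have us: "u t \<in> sobolev (s + p)" if "t \<in> {0..\<tau>}" for t using u that by (simp add: nls_solution_def)
  have in0: "0 \<in> {0..\<tau>}" "\<tau> \<in> {0..\<tau>}" using \<tau> by auto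
  have v: "u 0 \<in> sobolev s" "u \<tau> \<in> sobolev s"
    using sobolev_order_mono[OF us[OF in0(1)], of s] sobolev_order_mono[OF us[OF in0(2)], of s] p by auto
  have u2: "nls_solution (s + 2) \<tau> u" by (rule nls_solution_mono[OF u]) (use p in simp)
  note K = kernel_step_coeff[OF v(1) w]
  note V = sobolev_series[OF s v(1)] and N = cubic_sobolev[OF v(1)]
  define a where "a t = twist t (fourier_coeff (u t))" for t
  have a0: "a 0 = ?v" by (simp add: a_def)
  have ab: "sob_le (s + 2) (a t) M" if "t \<in> {0..\<tau>}" for t
  proof -
    have "sob_le (s + 2) (fourier_coeff (u t)) M"
      using bound[OF that] by (rule sob_le_order_mono) (use p in simp)
    then show ?thesis by (rule sob_le_mono) (simp_all add: a_def)
  qed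
  have M: "0 \<le> M" by (rule sob_le_nonneg[OF ab[OF in0(1)]])
  \<comment> \<open>Inserting |v|^2 v into any slot gives |v|^4 v, also in the conjugated one,
    because the product is commutative and |v|^2 is real.\<close>
  have Q: "tri (\<lambda>_ _ _. 1) ?N ?v ?v = ?q" "tri (\<lambda>_ _ _. 1) ?v ?N ?v = ?q" "tri (\<lambda>_ _ _. 1) ?v ?v ?N = ?q"
    using fourier_coeff_tri[OF N V V] fourier_coeff_tri[OF V N V] fourier_coeff_tri[OF V V N]
    unfolding fun_eq_iff of_real_cmod_power4 by (simp_all add: mult_ac)
  have D: "((\<lambda>t. a t k) has_vector_derivative - \<i> * tri (osc_kernel t) (a t) (a t) (a t) k) (at t within {0..\<tau>})"
    if "t \<in> {0..\<tau>}" for t k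
    unfolding a_def by (rule nls_twisted_derivative[OF s u2 that])
  define E where "E k = a \<tau> k - a 0 k
      + \<i> * tri (\<lambda>k1 k2 k3. osc_int0 (resonance k1 k2 k3) \<tau>) (a 0) (a 0) (a 0) k + of_real (\<tau>\<^sup>2 / 2) * ?q k" for k
  have E: "sob_le s E (err_const TYPE('d) s * \<tau> ^ 3 * (1 + M ^ 7))"
    unfolding E_def using twisted_flow_expansion[OF s \<tau> ab D refl, unfolded a0, OF _ _ Q] by (simp add: a0)
  note B = bound[OF in0(1)]
  note R = tri_bound(3)[OF s B B B W]
  have I_bound: "cmod (osc_int0 (resonance k1 k2 k3) \<tau>) \<le> (K * \<tau> ^ 3 + C) * (jb k1 * jb k2 * jb k3) powr (p / 2)"
    for k1 k2 k3 :: "int ^ 'd"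
    using norm_triangle_sub[of "osc_int0 (resonance k1 k2 k3) \<tau>" "W k1 k2 k3"] W[of k1 k2 k3] W0[of k1 k2 k3]
    by (simp add: distrib_right)
  have lin: "tri (\<lambda>k1 k2 k3. osc_int0 (resonance k1 k2 k3) \<tau> - W k1 k2 k3) ?v ?v ?v k =
      tri (\<lambda>k1 k2 k3. osc_int0 (resonance k1 k2 k3) \<tau>) ?v ?v ?v k + (- 1) * tri W ?v ?v ?v k" for k
    by (rule tri_lincomb[OF tri_bound(2)[OF s B B B I_bound] tri_bound(2)[OF s B B B W0]]) (simp add: algebra_simps)
  let ?D = "\<lambda>k. fourier_coeff (u \<tau>) k - fourier_coeff w k"
  \<comment> \<open>The initial value and the quintic term cancel, since they occur identically in
    the scheme and in the expansion.\<close>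
  have tw: "twist \<tau> ?D k = E k + (- \<i>) * tri (\<lambda>k1 k2 k3. osc_int0 (resonance k1 k2 k3) \<tau> - W k1 k2 k3) ?v ?v ?v k" for k
  proof -
    have "twist \<tau> ?D k = a \<tau> k - (?v k - \<i> * tri W ?v ?v ?v k - of_real (\<tau>\<^sup>2 / 2) * ?q k)"
      unfolding K(1) a_def flow_twist(2) by (simp add: diff_divide_distrib flow_def)
    then show ?thesis unfolding E_def lin a0 by (simp add: algebra_simps)
  qed
  have fc: "fourier_coeff (\<lambda>x. u \<tau> x - w x) = ?D"
    using fourier_coeff_diff[OF sobolev_continuous[OF v(2)] K(2)] by auto
  have K0: "0 \<le> K * \<tau> ^ 3"
  proof -
    have "0 \<le> K * \<tau> ^ 3 * (jb (0::int^'d) * jb (0::int^'d) * jb (0::int^'d)) powr (p / 2)"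
      using W[of 0 0 0] norm_ge_zero order_trans by blast
    then show ?thesis by (simp add: jb_def)
  qed
  have M37: "M ^ 3 \<le> 1 + M ^ 7" using power_le_1_plus_power[of M 3 7] M by simp
  have "sob_le s (twist \<tau> ?D) (err_const TYPE('d) s * \<tau> ^ 3 * (1 + M ^ 7) +
      cmod (- \<i>) * (?T * (K * \<tau> ^ 3) * M * M * M))"
    unfolding tw [abs_def] by (intro sob_le_add E sob_le_cmult R)
  then have "sob_le s ?D (err_const TYPE('d) s * \<tau> ^ 3 * (1 + M ^ 7) +
      cmod (- \<i>) * (?T * (K * \<tau> ^ 3) * M * M * M))"
    by (rule sob_le_mono) auto
  then show *: "sob_le s (fourier_coeff (\<lambda>x. u \<tau> x - w x))
      ((err_const TYPE('d) s + ?T * K) * \<tau> ^ 3 * (1 + M ^ 7))"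
    unfolding fc
  proof (rule sob_le_bound)
    have "?T * (K * \<tau> ^ 3) * M ^ 3 \<le> ?T * (K * \<tau> ^ 3) * (1 + M ^ 7)"
      using M37 K0 by (intro mult_left_mono mult_nonneg_nonneg[OF tri_const_nonneg])
    then show "err_const TYPE('d) s * \<tau> ^ 3 * (1 + M ^ 7) + cmod (- \<i>) * (?T * (K * \<tau> ^ 3) * M * M * M) \<le>
        (err_const TYPE('d) s + ?T * K) * \<tau> ^ 3 * (1 + M ^ 7)"
      by (simp add: power3_eq_cube algebra_simps)
  qed
  show "(\<lambda>x. u \<tau> x - w x) \<in> sobolev s"
    unfolding sobolev_iff using * K(2,3) sobolev_continuous[OF v(2), of UNIV] v(2)
    by (auto simp: sobolev_def periodic_fun_def intro!: continuous_on_diff)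
qed

end

section \<open>Polynomials in the formal frequencies\<close>

definition mono_val :: "(nat \<Rightarrow> int) \<Rightarrow> (nat \<Rightarrow>\<^sub>0 nat) \<Rightarrow> int" where
  "mono_val x m = (\<Prod>i\<in>Poly_Mapping.keys m. x i ^ Poly_Mapping.lookup m i)"

lemma peval_mono_val: "peval x p = (\<Sum>m\<in>Poly_Mapping.keys p. Poly_Mapping.lookup p m * mono_val x m)"
  by (simp add: peval_def mono_val_def)

lemma mono_val_superset:
  assumes "finite S" "Poly_Mapping.keys m \<subseteq> S"
  shows "mono_val x m = (\<Prod>i\<in>S. x i ^ Poly_Mapping.lookup m i)"
  unfolding mono_val_def
  by (rule prod.mono_neutral_left) (use assms in \<open>auto simp: in_keys_iff\<close>)

lemma mono_val_add: "mono_val x (m + n) = mono_val x m * mono_val x n"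
proof -
  let ?S = "Poly_Mapping.keys m \<union> Poly_Mapping.keys n"
  have "mono_val x (m + n) = (\<Prod>i\<in>?S. x i ^ Poly_Mapping.lookup (m + n) i)"
    by (rule mono_val_superset) (auto dest: subsetD[OF Poly_Mapping.keys_add])
  also have "\<dots> = (\<Prod>i\<in>?S. x i ^ Poly_Mapping.lookup m i) * (\<Prod>i\<in>?S. x i ^ Poly_Mapping.lookup n i)"
    by (simp add: lookup_add power_add prod.distrib)
  also have "\<dots> = mono_val x m * mono_val x n"
    by (simp add: mono_val_superset[of ?S])
  finally show ?thesis .
qed

lemma peval_add: "peval x (p + q) = peval x p + peval x q"
  unfolding peval_mono_val
  by (rule setsum_keys_plus_distrib) (auto simp: algebra_simps)

lemma peval_single: "peval x (Poly_Mapping.single m c) = c * mono_val x m"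
  by (simp add: peval_mono_val)

lemma peval_sum: "peval x (\<Sum>a\<in>A. f a) = (\<Sum>a\<in>A. peval x (f a))"
  by (induction A rule: infinite_finite_induct) (auto simp: peval_add)

lemma fpoly_expand: "p = (\<Sum>m\<in>Poly_Mapping.keys p. Poly_Mapping.single m (Poly_Mapping.lookup p m))"
  by (rule poly_mapping_eqI)
    (auto simp: lookup_sum lookup_single when_def in_keys_iff)

lemma peval_mult: "peval x (p * q) = peval x p * peval x q"
proof -
  have "p * q = (\<Sum>m\<in>Poly_Mapping.keys p. \<Sum>n\<in>Poly_Mapping.keys q.
      Poly_Mapping.single (m + n) (Poly_Mapping.lookup p m * Poly_Mapping.lookup q n))"
    by (subst fpoly_expand[of p], subst fpoly_expand[of q]) (simp add: sum_product mult_single)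
  then have "peval x (p * q) = (\<Sum>m\<in>Poly_Mapping.keys p. \<Sum>n\<in>Poly_Mapping.keys q.
      (Poly_Mapping.lookup p m * mono_val x m) * (Poly_Mapping.lookup q n * mono_val x n))"
    by (simp add: peval_sum peval_single mono_val_add mult_ac)
  then show ?thesis by (simp add: peval_mono_val sum_product)
qed

lemma peval_uminus: "peval x (- p) = - peval x p"
  using peval_add[of x p "- p"] by simp

lemma peval_diff: "peval x (p - q) = peval x p - peval x q"
  using peval_add[of x p "- q"] by (simp add: peval_uminus)

lemma peval_one: "peval x 1 = 1"
  using peval_single[of x 0 1] by (simp add: mono_val_def)

lemma peval_numeral: "peval x (numeral n) = numeral n"
  using peval_single[of x 0 "numeral n"] by (simp add: mono_val_def)

lemma peval_power: "peval x (p ^ n) = peval x p ^ n"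
  by (induction n) (auto simp: peval_one peval_mult)

lemma peval_X: "peval x (X i) = x i"
  by (simp add: X_def peval_single mono_val_def)

lemmas peval_simps = peval_add peval_mult peval_uminus peval_diff peval_one peval_numeral peval_power peval_X

lemma quad_eval_add: "quad_eval \<kappa> (p + q) = quad_eval \<kappa> p + quad_eval \<kappa> q"
  by (simp add: quad_eval_def peval_add sum.distrib)

lemma vec_eval_add: "vec_eval \<kappa> (p + q) = vec_eval \<kappa> p + vec_eval \<kappa> q"
  and vec_eval_diff: "vec_eval \<kappa> (p - q) = vec_eval \<kappa> p - vec_eval \<kappa> q"
  and vec_eval_uminus: "vec_eval \<kappa> (- p) = - vec_eval \<kappa> p"
  and vec_eval_X: "vec_eval \<kappa> (X i) = \<kappa> i"
  by (simp_all add: vec_eval_def peval_simps vec_eq_iff)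

lemma quad_eval_uminus: "quad_eval \<kappa> (- p) = - quad_eval \<kappa> p"
  using quad_eval_add[of \<kappa> p "- p"] by simp

lemma quad_eval_diff: "quad_eval \<kappa> (p - q) = quad_eval \<kappa> p - quad_eval \<kappa> q"
  using quad_eval_add[of \<kappa> p "- q"] by (simp add: quad_eval_uminus)

lemma quad_eval_square: "quad_eval \<kappa> (p ^ 2) = (norm (rvec (vec_eval \<kappa> p)))\<^sup>2"
  unfolding power2_norm_eq_inner
  by (simp add: quad_eval_def peval_simps inner_vec_def rvec_def vec_eval_def power2_eq_square)

lemma quad_eval_2_mult: "quad_eval \<kappa> (2 * p) = 2 * quad_eval \<kappa> p"
  by (simp add: quad_eval_def peval_simps sum_distrib_left)

text \<open>\<open>pdeg\<close> is the largest power of a single variable, not the total degree, so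
  k1 k2 has degree 1. This criterion reduces all degree bounds to exponents of monomials.\<close>

lemma pdeg_le_iff: "pdeg p \<le> n \<longleftrightarrow> (\<forall>m\<in>Poly_Mapping.keys p. \<forall>i. Poly_Mapping.lookup m i \<le> n)"
proof -
  have eq: "{Poly_Mapping.lookup m i | m i. m \<in> Poly_Mapping.keys p \<and> i \<in> Poly_Mapping.keys m} =
      (\<Union>m\<in>Poly_Mapping.keys p. Poly_Mapping.lookup m ` Poly_Mapping.keys m)"
    by auto
  have "Poly_Mapping.lookup m i \<le> n" if "\<forall>i\<in>Poly_Mapping.keys m. Poly_Mapping.lookup m i \<le> n" for m :: "nat \<Rightarrow>\<^sub>0 nat" and i
    using that by (cases "i \<in> Poly_Mapping.keys m") (auto simp: in_keys_iff)
  then show ?thesis unfolding pdeg_def eq by (subst Max_le_iff) auto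
qed

lemma pdeg_add_le: "pdeg p \<le> n \<Longrightarrow> pdeg q \<le> n \<Longrightarrow> pdeg (p + q) \<le> n"
  using Poly_Mapping.keys_add[of p q] unfolding pdeg_le_iff by blast

lemma pdeg_uminus_le: "pdeg p \<le> n \<Longrightarrow> pdeg (- p) \<le> n"
  unfolding pdeg_le_iff by (auto simp: in_keys_iff)

lemma pdeg_diff_le: "pdeg p \<le> n \<Longrightarrow> pdeg q \<le> n \<Longrightarrow> pdeg (p - q) \<le> n"
  using pdeg_add_le[OF _ pdeg_uminus_le, of p n q] by simp

lemma pdeg_mult_le:
  assumes "pdeg p \<le> n" "pdeg q \<le> k"
  shows "pdeg (p * q) \<le> n + k"
proof -
  have "Poly_Mapping.lookup (a + b) i \<le> n + k"
    if "a \<in> Poly_Mapping.keys p" "b \<in> Poly_Mapping.keys q" for a b i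
    using assms that unfolding pdeg_le_iff by (auto simp: lookup_add intro: add_mono)
  then show ?thesis using keys_mult[of p q] unfolding pdeg_le_iff by fastforce
qed

lemma pdeg_single_0: "pdeg (Poly_Mapping.single 0 c) \<le> 0"
  unfolding pdeg_le_iff by (auto split: if_splits)

lemma pdeg_of_int: "pdeg (of_int a) \<le> 0"
  using pdeg_single_0[of "of_int a"] unfolding single_of_int .

lemma pdeg_power_le: "pdeg p \<le> 1 \<Longrightarrow> pdeg (p ^ n) \<le> n"
proof (induction n)
  case 0
  then show ?case using pdeg_of_int[of 1] by simp
next
  case (Suc n)
  then show ?case using pdeg_mult_le[of p 1 "p ^ n" n] by simp
qed

lemma pdeg_X: "pdeg (X i) \<le> 1"
  by (auto simp: pdeg_le_iff X_def lookup_single when_def)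

lemma pdeg_sum_X: "pdeg (\<Sum>i\<in>S. X i) \<le> 1"
proof (induction S rule: infinite_finite_induct)
  case (insert i S)
  then show ?case using pdeg_add_le[OF pdeg_X insert.IH, of i] by simp
qed (use pdeg_of_int[of 0] in simp_all)

section \<open>Dominant parts of polynomials\<close>

lemma X_power: "X i ^ n = Poly_Mapping.single (Poly_Mapping.single i n) 1"
proof (induction n)
  case (Suc n)
  have "X i ^ Suc n = Poly_Mapping.single (Poly_Mapping.single i 1 + Poly_Mapping.single i n) 1"
    unfolding power_Suc Suc unfolding X_def by (simp add: mult_single)
  also have "Poly_Mapping.single i 1 + Poly_Mapping.single i n = Poly_Mapping.single i (Suc n)"
    by (simp flip: single_add)
  finally show ?case .
qed simp

lemma lookup_of_int_mult: "Poly_Mapping.lookup (of_int a * p) m = a * Poly_Mapping.lookup p m"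
  for p :: fpoly
proof -
  have "of_int a * p = (\<Sum>n\<in>Poly_Mapping.keys p. Poly_Mapping.single n (a * Poly_Mapping.lookup p n))"
    by (subst fpoly_expand[of p]) (simp add: sum_distrib_left mult_single flip: single_of_int)
  then show ?thesis by (auto simp: lookup_sum lookup_single when_def in_keys_iff)
qed

text \<open>The coefficient of k_j^d reveals whether j belongs to S and, if so, the value of
  a.\<close>

lemma lookup_power_sum:
  assumes "finite S" "d > 0"
  shows "Poly_Mapping.lookup (of_int a * (\<Sum>i\<in>S. X i ^ d)) (Poly_Mapping.single j d) = (if j \<in> S then a else 0)"
proof -
  have "Poly_Mapping.single i d = Poly_Mapping.single j d \<longleftrightarrow> i = j" for i j :: nat
    using assms(2) by (metis lookup_single_eq lookup_single_not_eq less_numeral_extra(3))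
  then show ?thesis
    using assms(1) by (simp add: lookup_of_int_mult lookup_sum X_power lookup_single when_def)
qed

text \<open>Comparing the coefficients of pure powers recovers a and S from the highest part. If all
  of them vanish, then a = 0 or S is empty, and the dominant part is 0 in either representation
  because the degree is positive.\<close>

lemma is_ldom_unique:
  assumes "is_ldom p L" "is_ldom p L'"
  shows "L = L'"
proof -
  let ?d = "pdeg p"
  obtain a S where a: "finite S" "highest_part p = of_int a * (\<Sum>i\<in>S. X i ^ ?d)" "L = of_int a * (\<Sum>i\<in>S. X i) ^ ?d"
    and d: "?d > 0" using assms(1) by (auto simp: is_ldom_def)
  obtain b S' where b: "finite S'" "highest_part p = of_int b * (\<Sum>i\<in>S'. X i ^ ?d)" "L' = of_int b * (\<Sum>i\<in>S'. X i) ^ ?d"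
    using assms(2) by (auto simp: is_ldom_def)
  have eq: "(if j \<in> S then a else 0) = (if j \<in> S' then b else 0)" for j
    using lookup_power_sum[OF a(1) d, of a j] lookup_power_sum[OF b(1) d, of b j] a(2) b(2) by simp
  have zero: "of_int x * (\<Sum>i\<in>Y. X i) ^ ?d = 0" if "\<And>j. (if j \<in> Y then x else 0) = 0" for x :: int and Y
  proof (cases "Y = {}")
    case True
    then show ?thesis using d by simp
  next
    case False
    then obtain j where "j \<in> Y" by auto
    then show ?thesis using that[of j] by simp
  qed
  show ?thesis
  proof (cases "\<exists>j. (if j \<in> S then a else 0) \<noteq> 0")
    case True
    then obtain j where j: "j \<in> S" "a \<noteq> 0" by (auto split: if_splits)
    have "a = b" using eq[of j] j by (auto split: if_splits)
    moreover have "S = S'" using eq j(2) \<open>a = b\<close> by (metis equalityI subsetI)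
    ultimately show ?thesis by (simp add: a(3) b(3))
  next
    case False
    then have "L = 0" "L' = 0" using zero[of S a] zero[of S' b] eq by (simp_all add: a(3) b(3))
    then show ?thesis by simp
  qed
qed

lemma ldom_eq: "is_ldom p L \<Longrightarrow> ldom p = L"
  unfolding ldom_def using is_ldom_unique by (auto intro: the_equality)

text \<open>Serves the nested trees, whose dominant parts are never computed: a bound on their
  degree already settles the value of \<open>Kop_term\<close>.\<close>

lemma pdeg_ldom_le:
  assumes "pdeg p \<le> n"
  shows "pdeg (ldom p) \<le> n"
proof (cases "\<exists>L. is_ldom p L")
  case True
  then obtain L where L: "is_ldom p L" ..
  then obtain a S where "L = of_int a * (\<Sum>i\<in>S. X i) ^ pdeg p" by (auto simp: is_ldom_def)
  then have "pdeg L \<le> 0 + pdeg p"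
    using pdeg_mult_le[OF pdeg_of_int pdeg_power_le[OF pdeg_sum_X]] by simp
  then show ?thesis using assms ldom_eq[OF L] by simp
next
  case False
  then have "ldom p = 0" unfolding ldom_def by auto
  then show ?thesis using pdeg_of_int[of 0] by simp
qed

section \<open>The phase of the tree T_1, its degree and its dominant part\<close>

definition tree1_phase :: fpoly where
  "tree1_phase = (- X 1 + X 2 + X 3) ^ 2 + (X 1 ^ 2 - X 2 ^ 2 - X 3 ^ 2)"

abbreviation mon2 :: "nat \<Rightarrow> nat \<Rightarrow> nat \<Rightarrow>\<^sub>0 nat" where
  "mon2 i j \<equiv> Poly_Mapping.single i 1 + Poly_Mapping.single j 1"

lemma X_mult_X: "X i * X j = Poly_Mapping.single (mon2 i j) 1"
  by (simp add: X_def mult_single)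

lemma tree1_phase_low: "tree1_phase - 2 * X 1 ^ 2 =
    Poly_Mapping.single (mon2 1 2) (- 2) + Poly_Mapping.single (mon2 1 3) (- 2) + Poly_Mapping.single (mon2 2 3) 2"
proof -
  have two: "Poly_Mapping.single m (2::int) = 2 * Poly_Mapping.single m 1" for m :: "nat \<Rightarrow>\<^sub>0 nat"
    using mult_single[of 0 "2::int" m 1] by simp
  have "tree1_phase - 2 * X 1 ^ 2 = - (2 * (X 1 * X 2)) + - (2 * (X 1 * X 3)) + 2 * (X 2 * X 3)"
    unfolding tree1_phase_def by (simp add: power2_eq_square algebra_simps)
  then show ?thesis unfolding X_mult_X by (simp only: single_uminus two)
qed

text \<open>Distinctness of the monomials as keys, so that no terms merge when key sets and
  coefficients are computed. Each pair is separated by the exponent of one variable.\<close>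

lemma mon2_neq: "mon2 1 1 \<noteq> mon2 1 2" "mon2 1 1 \<noteq> mon2 1 3" "mon2 1 1 \<noteq> mon2 2 3"
  "mon2 1 2 \<noteq> mon2 1 3" "mon2 1 2 \<noteq> mon2 2 3" "mon2 1 3 \<noteq> mon2 2 3"
proof -
  have *: "m \<noteq> m'" if "Poly_Mapping.lookup m k \<noteq> Poly_Mapping.lookup m' k" for m m' :: "nat \<Rightarrow>\<^sub>0 nat" and k
    using that by auto
  show "mon2 1 1 \<noteq> mon2 1 2" by (rule *[of _ 2]) (simp add: lookup_add lookup_single when_def)
  show "mon2 1 1 \<noteq> mon2 1 3" by (rule *[of _ 3]) (simp add: lookup_add lookup_single when_def)
  show "mon2 1 1 \<noteq> mon2 2 3" by (rule *[of _ 3]) (simp add: lookup_add lookup_single when_def)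
  show "mon2 1 2 \<noteq> mon2 1 3" by (rule *[of _ 3]) (simp add: lookup_add lookup_single when_def)
  show "mon2 1 2 \<noteq> mon2 2 3" by (rule *[of _ 1]) (simp add: lookup_add lookup_single when_def)
  show "mon2 1 3 \<noteq> mon2 2 3" by (rule *[of _ 1]) (simp add: lookup_add lookup_single when_def)
qed

lemma keys_tree1_low: "Poly_Mapping.keys (tree1_phase - 2 * X 1 ^ 2) = {mon2 1 2, mon2 1 3, mon2 2 3}"
  unfolding tree1_phase_low using mon2_neq
  by (auto simp: in_keys_iff lookup_add lookup_single when_def split: if_splits)

text \<open>The squares have cancelled, and in the mixed products every variable has exponent at
  most 1.\<close>

lemma pdeg_tree1_low: "pdeg (tree1_phase - 2 * X 1 ^ 2) = 1"
proof (rule antisym)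
  show "pdeg (tree1_phase - 2 * X 1 ^ 2) \<le> 1"
    unfolding pdeg_le_iff keys_tree1_low by (auto simp: lookup_add lookup_single when_def)
  have "\<not> pdeg (tree1_phase - 2 * X 1 ^ 2) \<le> 0"
    unfolding pdeg_le_iff keys_tree1_low by (auto simp: lookup_add lookup_single when_def intro!: exI[of _ 1])
  then show "1 \<le> pdeg (tree1_phase - 2 * X 1 ^ 2)" by simp
qed

lemma two_X1_squared: "2 * X 1 ^ 2 = Poly_Mapping.single (mon2 1 1) 2"
  unfolding power2_eq_square X_mult_X using mult_single[of 0 "2::int" "mon2 1 1" 1] by simp

lemma tree1_phase_eq: "tree1_phase = Poly_Mapping.single (mon2 1 1) 2 + (tree1_phase - 2 * X 1 ^ 2)"
  unfolding two_X1_squared [symmetric] by simp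

lemma keys_tree1: "Poly_Mapping.keys tree1_phase = {mon2 1 1, mon2 1 2, mon2 1 3, mon2 2 3}"
  by (subst tree1_phase_eq, unfold tree1_phase_low) (use mon2_neq in
    \<open>auto simp: in_keys_iff lookup_add lookup_single when_def split: if_splits\<close>)

lemma pdeg_tree1: "pdeg tree1_phase = 2"
proof (rule antisym)
  show "pdeg tree1_phase \<le> 2"
    unfolding pdeg_le_iff keys_tree1 by (auto simp: lookup_add lookup_single when_def)
  have "\<not> pdeg tree1_phase \<le> 1"
    unfolding pdeg_le_iff keys_tree1 by (auto simp: lookup_add lookup_single when_def intro!: exI[of _ 1])
  then show "2 \<le> pdeg tree1_phase" by simp
qed

text \<open>The squares of k2 and k3 cancel, so k1^2 is the only monomial with an exponent 2. The
  witnesses are a = 2 and S = {1}.\<close>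

lemma ldom_tree1: "ldom tree1_phase = 2 * X 1 ^ 2"
proof (rule ldom_eq)
  have "{m. m \<in> Poly_Mapping.keys tree1_phase \<and> (\<exists>i. Poly_Mapping.lookup m i = pdeg tree1_phase)} = {mon2 1 1}"
    unfolding keys_tree1 pdeg_tree1 by (auto simp: lookup_add lookup_single when_def split: if_splits intro!: exI[of _ 1])
  moreover have "Poly_Mapping.lookup tree1_phase (mon2 1 1) = 2"
    by (subst tree1_phase_eq, unfold tree1_phase_low) (use mon2_neq in
      \<open>auto simp: lookup_add lookup_single when_def\<close>)
  ultimately have "highest_part tree1_phase = 2 * X 1 ^ 2"
    unfolding highest_part_def two_X1_squared by simp
  then show "is_ldom tree1_phase (2 * X 1 ^ 2)"
    unfolding is_ldom_def pdeg_tree1 by (auto intro!: exI[of _ 2] exI[of _ "{1}"])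
qed

lemma pdeg_single_monomial:
  assumes "c \<noteq> 0"
  shows "pdeg (Poly_Mapping.single (Poly_Mapping.single i n) c) = n"
proof (rule antisym)
  let ?p = "Poly_Mapping.single (Poly_Mapping.single i n) c"
  show "pdeg ?p \<le> n" using assms by (auto simp: pdeg_le_iff lookup_single when_def)
  have "\<forall>m\<in>Poly_Mapping.keys ?p. \<forall>i. Poly_Mapping.lookup m i \<le> pdeg ?p"
    using pdeg_le_iff[of ?p "pdeg ?p"] by simp
  then show "n \<le> pdeg ?p" using assms by (auto dest: spec[of _ i])
qed

text \<open>The value 4 is the threshold for n from which \<open>Kop_term\<close> at order 1 uses
  the full Taylor expansion.\<close>

lemma pdeg_ldom_tree1: "pdeg (2 * X 1 ^ 2) = 2" "pdeg ((2 * X 1 ^ 2) ^ 2) = 4"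
proof -
  have e: "of_int c * X 1 ^ n = Poly_Mapping.single (Poly_Mapping.single 1 n) c" for c :: int and n
    by (rule poly_mapping_eqI) (simp only: lookup_of_int_mult X_power, simp add: lookup_single when_def)
  have "(2 * X 1 ^ 2) ^ 2 = of_int 4 * X 1 ^ 4" by (simp add: power_mult_distrib flip: power_mult)
  then show "pdeg ((2 * X 1 ^ 2) ^ 2) = 4" unfolding e by (simp add: pdeg_single_monomial)
  have "2 * X 1 ^ 2 = of_int 2 * X 1 ^ 2" by simp
  then show "pdeg (2 * X 1 ^ 2) = 2" unfolding e by (simp add: pdeg_single_monomial)
qed

section \<open>Evaluation of the general scheme\<close>

lemma osc_eval_append [simp]: "osc_eval \<kappa> (G @ H) \<xi> = osc_eval \<kappa> G \<xi> + osc_eval \<kappa> H \<xi>"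
  by (simp add: osc_eval_def)

lemma osc_eval_mult: "osc_eval \<kappa> (osc_mult G H) \<xi> = osc_eval \<kappa> G \<xi> * osc_eval \<kappa> H \<xi>"
proof (induction G)
  case (Cons t G)
  obtain a p P where t: "t = (a, p, P)" by (cases t)
  have "osc_eval \<kappa> (map (\<lambda>(b, q, Q). (a * b, p + q, P + Q)) H) \<xi> =
      a * of_real \<xi> ^ p * exp (\<i> * of_real (\<xi> * quad_eval \<kappa> P)) * osc_eval \<kappa> H \<xi>"
  proof (induction H)
    case (Cons h H)
    have "exp (\<i> * of_real (\<xi> * quad_eval \<kappa> (P + Q))) =
        exp (\<i> * of_real (\<xi> * quad_eval \<kappa> P)) * exp (\<i> * of_real (\<xi> * quad_eval \<kappa> Q))" for Q
      by (simp add: quad_eval_add exp_add [symmetric] algebra_simps)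
    then show ?case using Cons by (cases h) (simp add: power_add algebra_simps)
  qed simp
  moreover have "osc_mult (t # G) H = map (\<lambda>(b, q, Q). (a * b, p + q, P + Q)) H @ osc_mult G H"
    by (simp add: osc_mult_def t case_prod_unfold)
  ultimately show ?case using Cons by (simp add: t algebra_simps)
qed (simp add: osc_mult_def)

lemma osc_mult_single: "osc_mult [(a, p, P)] [(b, q, Q)] = [(a * b, p + q, P + Q)]"
  by (simp add: osc_mult_def)

lemma phase_simps:
  "phase E1 0 k = - (k ^ 2)" "phase E1 1 k = k ^ 2" "phase E2 0 k = k ^ 2" "phase E2 1 k = - (k ^ 2)"
  by (simp_all add: phase_def)

section \<open>Values of the trees T_0 to T_3\<close>

lemma Pi_tree_cubic:
  assumes "0 \<le> r"
  shows "Pi_tree \<kappa> sl n r (Graft E2 p k [Graft E1 p1 k1 [], Graft E1 p2 k2 [], Graft E1 p3 k3 []]) =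
    Kop_term \<kappa> sl n r p k (1, 0, phase E1 p1 k1 + (phase E1 p2 k2 + phase E1 p3 k3))"
  using assms by (simp add: osc_mult_single)

text \<open>At order 0 only the constant Taylor term is integrated, and the phase
  disappears.\<close>

lemma Kop_term_order_0:
  assumes "pdeg (phase E2 p k + Q) \<le> n"
  shows "Kop_term \<kappa> sl n 0 p k (c, 0, Q) = [(c * (- \<i> * (- 1) ^ p), 1, 0)]"
  using pdeg_ldom_le[OF assms]
  by (simp add: Kop_term_def Let_def mono_int_def osc_scale_def)

text \<open>The input already carries one power of \<xi>, so r - q = 0 and only the term l = 0 is
  left. If the first degree test fails, the second one asks whether the degree of the dominant part
  exceeds n, which is excluded here; hence both branches integrate \<xi>.\<close>

lemma Kop_term_order_1:
  assumes "pdeg (phase E2 p k + Q) \<le> n"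
  shows "osc_eval \<kappa> (Kop_term \<kappa> sl n 1 p k (c, 1, Q)) \<xi> = c * (- \<i> * (- 1) ^ p) * of_real \<xi> ^ 2 / 2"
  using pdeg_ldom_le[OF assms]
  by (auto simp add: Kop_term_def Let_def osc_eval_mono_int numeral_2_eq_2)

lemma pdeg_square_le: "pdeg k \<le> 1 \<Longrightarrow> pdeg (k ^ 2) \<le> 2"
  by (rule pdeg_power_le)

lemma Pi_tree_order_0_cubic:
  assumes "2 \<le> n" "pdeg k \<le> 1" "pdeg k1 \<le> 1" "pdeg k2 \<le> 1" "pdeg k3 \<le> 1"
    and "p \<in> {0, 1}" "p1 \<in> {0, 1}" "p2 \<in> {0, 1}" "p3 \<in> {0, 1}"
  shows "Pi_tree \<kappa> sl n 0 (Graft E2 p k [Graft E1 p1 k1 [], Graft E1 p2 k2 [], Graft E1 p3 k3 []]) =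
    [(- \<i> * (- 1) ^ p, 1, 0)]"
proof -
  have sq: "pdeg (phase t q x) \<le> n" if "pdeg x \<le> 1" "q \<in> {0, 1}" for t q x
  proof -
    have "pdeg (x ^ 2) \<le> n" using pdeg_square_le[OF that(1)] assms(1) by simp
    then show ?thesis using that(2) by (cases t) (auto simp: phase_simps[simplified] intro: pdeg_uminus_le)
  qed
  have "pdeg (phase E2 p k + (phase E1 p1 k1 + (phase E1 p2 k2 + phase E1 p3 k3))) \<le> n"
    using assms by (intro pdeg_add_le sq)
  then show ?thesis by (simp only: Pi_tree_cubic[OF order_refl] Kop_term_order_0) simp
qed

lemma pdeg_forms:
  "pdeg (- X 1 + X 2 + X 3) \<le> 1" "pdeg (root_freq S) \<le> 1"
proof -
  show "pdeg (- X 1 + X 2 + X 3) \<le> 1"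
    by (intro pdeg_add_le pdeg_uminus_le pdeg_X)
  show "pdeg (root_freq S) \<le> 1"
    by (cases S; simp only: root_freq.simps) (intro pdeg_add_le pdeg_diff_le pdeg_uminus_le pdeg_X)+
qed

text \<open>The outer integration lowers the order, so the inner tree is evaluated at order 0 and
  contributes c \<xi> up to a phase. The outer integral at order 1 then drops that phase and yields
  \<xi>^2 / 2.\<close>

lemma nested_tree_value:
  fixes k A :: fpoly
  assumes n: "2 \<le> n" and k: "pdeg k \<le> 1" "pdeg A \<le> 1" "pdeg k4 \<le> 1" "pdeg k5 \<le> 1"
    and p: "p4 \<in> {0, 1}" "pA \<in> {0, 1}"
    and T: "Pi_tree \<kappa> sl n 0 T = [(c, 1, 0)]" "depth2 T = 1"
  shows "osc_eval \<kappa> (Pi_tree \<kappa> sl n 1 (Graft E2 0 k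
      [Graft E1 p4 k4 [], Graft E1 pA A [T], Graft E1 0 k5 []])) \<xi> = - \<i> * c * of_real \<xi> ^ 2 / 2"
proof -
  let ?Q = "phase E1 p4 k4 + (phase E1 pA A + phase E1 0 k5)"
  have sq: "pdeg (phase t q x) \<le> n" if "pdeg x \<le> 1" "q \<in> {0, 1}" for t q x
  proof -
    have "pdeg (x ^ 2) \<le> n" using pdeg_square_le[OF that(1)] n by simp
    then show ?thesis using that(2) by (cases t) (auto simp: phase_simps[simplified] intro: pdeg_uminus_le)
  qed
  have "Pi_tree \<kappa> sl n 0 (Graft E1 pA A [T]) = [(c, 1, phase E1 pA A)]"
    using T by (simp add: osc_mult_single)
  then have "Pi_tree \<kappa> sl n 1 (Graft E2 0 k [Graft E1 p4 k4 [], Graft E1 pA A [T], Graft E1 0 k5 []]) =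
      Kop_term \<kappa> sl n 1 0 k (c, 1, ?Q)"
    using T(2) by (simp add: osc_mult_single)
  moreover have "pdeg (phase E2 0 k + ?Q) \<le> n"
    using k p by (intro pdeg_add_le sq) auto
  ultimately show ?thesis using Kop_term_order_1[of 0 k ?Q n \<kappa> sl c \<xi>] by simp
qed

text \<open>Depth 2 is the limit r + 1 that \<open>Pi_tree\<close> allows at order 1. The root edge
  contributes the free flow at the root frequency.\<close>

lemma Pi_tree_root:
  assumes "\<forall>T\<in>set F. depth2 T \<le> 2"
  shows "osc_eval \<kappa> (Pi_tree \<kappa> sl n 1 (Graft E1 0 k F)) \<xi> =
    exp (- (\<i> * of_real (\<xi> * (norm (rvec (vec_eval \<kappa> k)))\<^sup>2))) * (\<Prod>T\<leftarrow>F. osc_eval \<kappa> (Pi_tree \<kappa> sl n 1 T) \<xi>)"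
proof -
  have "osc_eval \<kappa> (foldr osc_mult (map (\<lambda>T. Pi_tree \<kappa> sl n 1 T) F) [(1, 0, 0)]) \<xi> =
      (\<Prod>T\<leftarrow>F. osc_eval \<kappa> (Pi_tree \<kappa> sl n 1 T) \<xi>)"
    by (induction F) (auto simp: osc_eval_mult)
  moreover have "\<not> int (depth2 (Graft E1 0 k F)) > 1 + 1"
    using assms by (auto simp: Max_gr_iff not_less[symmetric])
  ultimately show ?thesis
    by (simp add: osc_eval_mult phase_simps quad_eval_uminus quad_eval_square del: depth2.simps)
qed

lemma scheme_term_S0: "scheme_term sl n \<tau> v (S0, \<kappa>) = flow \<tau> (\<kappa> 1) * fourier_coeff v (\<kappa> 1)"
  by (simp add: scheme_term_def Pi_tree_root vec_eval_X flow_def del: Pi_tree.simps One_nat_def)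

lemma scheme_term_S1:
  assumes "osc_eval \<kappa> (Pi_tree \<kappa> sl n 1 tree1) \<tau> = - \<i> * W (\<kappa> 1) (\<kappa> 2) (\<kappa> 3)"
  shows "scheme_term sl n \<tau> v (S1, \<kappa>) = - \<i> * flow \<tau> (- \<kappa> 1 + \<kappa> 2 + \<kappa> 3) * W (\<kappa> 1) (\<kappa> 2) (\<kappa> 3) *
    cnj (fourier_coeff v (\<kappa> 1)) * fourier_coeff v (\<kappa> 2) * fourier_coeff v (\<kappa> 3)"
proof -
  have "depth2 tree1 = 1" by (simp add: tree1_def)
  then show ?thesis
    using assms by (simp add: scheme_term_def Pi_tree_root vec_eval_X vec_eval_add vec_eval_diff vec_eval_uminus flow_def
        del: Pi_tree.simps One_nat_def)
qed

text \<open>The nested integrals give (-i)(-i) \<tau>^2 / 2 = -\<tau>^2 / 2, and the coefficient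
  over the symmetry factor is 4 / 2.\<close>

lemma scheme_term_S2:
  assumes "2 \<le> n"
  shows "scheme_term sl n \<tau> v (S2, \<kappa>) = - of_real (\<tau>\<^sup>2) * flow \<tau> (- \<kappa> 1 + \<kappa> 2 + \<kappa> 3 - \<kappa> 4 + \<kappa> 5) *
    cnj (fourier_coeff v (\<kappa> 1)) * fourier_coeff v (\<kappa> 2) * fourier_coeff v (\<kappa> 3) *
    cnj (fourier_coeff v (\<kappa> 4)) * fourier_coeff v (\<kappa> 5)"
proof -
  let ?T = "Graft E2 0 (root_freq S2) [Graft E1 1 (X 4) [], Graft E1 0 (- X 1 + X 2 + X 3) [tree1], Graft E1 0 (X 5) []]"
  have t: "Pi_tree \<kappa> sl n 0 tree1 = [(- \<i>, 1, 0)]" "depth2 tree1 = 1"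
    using Pi_tree_order_0_cubic[OF assms pdeg_forms(1) pdeg_X pdeg_X pdeg_X, of 0 1 0 0 \<kappa> sl 1 2 3]
    by (simp_all add: tree1_def del: Pi_tree.simps)
  have v: "osc_eval \<kappa> (Pi_tree \<kappa> sl n 1 ?T) \<tau> = - \<i> * (- \<i>) * of_real \<tau> ^ 2 / 2"
    by (rule nested_tree_value[OF assms pdeg_forms(2) pdeg_forms(1) pdeg_X pdeg_X _ _ t]) auto
  have "depth2 ?T \<le> 2" by (simp add: t(2))
  then show ?thesis
    using v by (simp add: scheme_term_def Pi_tree_root vec_eval_X vec_eval_add vec_eval_diff vec_eval_uminus flow_def
        del: Pi_tree.simps One_nat_def depth2.simps)
qed

text \<open>The flipped inner tree contributes i in place of -i, so the integrals give \<tau>^2 / 2,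
  now with the factor 4 / 4.\<close>

lemma scheme_term_S3:
  assumes "2 \<le> n"
  shows "scheme_term sl n \<tau> v (S3, \<kappa>) = of_real (\<tau>\<^sup>2 / 2) * flow \<tau> (\<kappa> 1 - \<kappa> 2 - \<kappa> 3 + \<kappa> 4 + \<kappa> 5) *
    fourier_coeff v (\<kappa> 1) * cnj (fourier_coeff v (\<kappa> 2)) * cnj (fourier_coeff v (\<kappa> 3)) *
    fourier_coeff v (\<kappa> 4) * fourier_coeff v (\<kappa> 5)"
proof -
  let ?T = "Graft E2 0 (root_freq S3) [Graft E1 0 (X 4) [], Graft E1 1 (- X 1 + X 2 + X 3) [flip tree1], Graft E1 0 (X 5) []]"
  have t: "Pi_tree \<kappa> sl n 0 (flip tree1) = [(\<i>, 1, 0)]" "depth2 (flip tree1) = 1"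
    using Pi_tree_order_0_cubic[OF assms pdeg_forms(1) pdeg_X pdeg_X pdeg_X, of 1 0 1 1 \<kappa> sl 1 2 3]
    by (simp_all add: tree1_def del: Pi_tree.simps)
  have v: "osc_eval \<kappa> (Pi_tree \<kappa> sl n 1 ?T) \<tau> = - \<i> * \<i> * of_real \<tau> ^ 2 / 2"
    by (rule nested_tree_value[OF assms pdeg_forms(2) pdeg_forms(1) pdeg_X pdeg_X _ _ t]) auto
  have "depth2 ?T \<le> 2" by (simp add: t(2))
  then show ?thesis
    using v by (simp add: scheme_term_def Pi_tree_root vec_eval_X vec_eval_add vec_eval_diff vec_eval_uminus flow_def
        del: Pi_tree.simps One_nat_def depth2.simps)
qed

lemma quad_eval_tree1:
  "quad_eval \<kappa> tree1_phase = resonance (\<kappa> 1) (\<kappa> 2) (\<kappa> 3)"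
  "quad_eval \<kappa> (2 * X 1 ^ 2) = 2 * (norm (rvec (\<kappa> 1)))\<^sup>2"
  by (simp_all add: tree1_phase_def quad_eval_add quad_eval_diff quad_eval_square quad_eval_2_mult
      vec_eval_add vec_eval_diff vec_eval_uminus vec_eval_X resonance_def del: One_nat_def)

lemma tree1_Kop: "Pi_tree \<kappa> sl n 1 tree1 = Kop_term \<kappa> sl n 1 0 (- X 1 + X 2 + X 3) (1, 0, X 1 ^ 2 - X 2 ^ 2 - X 3 ^ 2)"
proof -
  have "phase E1 1 (X 1) + (phase E1 0 (X 2) + phase E1 0 (X 3)) = X 1 ^ 2 - X 2 ^ 2 - X 3 ^ 2"
    unfolding phase_simps by simp
  then show ?thesis unfolding tree1_def by (simp only: Pi_tree_cubic[OF zero_le_one])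
qed

lemma tree1_phase_E2: "phase E2 0 (- X 1 + X 2 + X 3) + (X 1 ^ 2 - X 2 ^ 2 - X 3 ^ 2) = tree1_phase"
  unfolding phase_simps tree1_phase_def ..

text \<open>With degree 2 for the dominant and 1 for the lower part the tests compare n with 4 for l
  = 0 and with 3 for l = 1. For n = 2 both integrals stay exact, for n = 3 only the one for l = 0,
  and from n = 4 on everything is Taylor expanded.\<close>

lemma Kop_term_split:
  assumes "phase E2 0 k + Q = R" "ldom R = L" "pdeg L = 2" "pdeg (L ^ 2) = 4" "pdeg (R - L) = 1"
  shows "osc_eval \<kappa> (Kop_term \<kappa> sl 2 1 0 k (1, 0, Q)) \<tau> = - \<i> * (osc_eval \<kappa> (osc_int \<kappa> L 0) \<tau> +
      sl (quad_eval \<kappa> R - quad_eval \<kappa> L) * osc_eval \<kappa> (osc_int \<kappa> L 1) \<tau>)"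
    and "osc_eval \<kappa> (Kop_term \<kappa> sl 3 1 0 k (1, 0, Q)) \<tau> = - \<i> * (osc_eval \<kappa> (osc_int \<kappa> L 0) \<tau> +
      sl (quad_eval \<kappa> R - quad_eval \<kappa> L) * of_real (\<tau>\<^sup>2 / 2))"
    and "4 \<le> n \<Longrightarrow> osc_eval \<kappa> (Kop_term \<kappa> sl n 1 0 k (1, 0, Q)) \<tau> = - \<i> * (of_real \<tau> +
      \<i> * of_real (quad_eval \<kappa> R) * of_real (\<tau>\<^sup>2 / 2))"
  using assms(4) unfolding Kop_term_def Let_def prod.case assms(1,2)
  by (simp_all add: assms(3) assms(5)[simplified] quad_eval_diff numeral_2_eq_2 osc_eval_mono_int algebra_simps)

lemma tree1_value:
  "osc_eval \<kappa> (Pi_tree \<kappa> sl 2 1 tree1) \<tau> = - \<i> * (osc_eval \<kappa> (osc_int \<kappa> (2 * X 1 ^ 2) 0) \<tau> +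
    sl (resonance (\<kappa> 1) (\<kappa> 2) (\<kappa> 3) - 2 * (norm (rvec (\<kappa> 1)))\<^sup>2) * osc_eval \<kappa> (osc_int \<kappa> (2 * X 1 ^ 2) 1) \<tau>)"
  "osc_eval \<kappa> (Pi_tree \<kappa> sl 3 1 tree1) \<tau> = - \<i> * (osc_eval \<kappa> (osc_int \<kappa> (2 * X 1 ^ 2) 0) \<tau> +
    sl (resonance (\<kappa> 1) (\<kappa> 2) (\<kappa> 3) - 2 * (norm (rvec (\<kappa> 1)))\<^sup>2) * of_real (\<tau>\<^sup>2 / 2))"
  "4 \<le> n \<Longrightarrow> osc_eval \<kappa> (Pi_tree \<kappa> sl n 1 tree1) \<tau> = - \<i> * (of_real \<tau> +
    \<i> * of_real (resonance (\<kappa> 1) (\<kappa> 2) (\<kappa> 3)) * of_real (\<tau>\<^sup>2 / 2))"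
  using Kop_term_split[OF tree1_phase_E2 ldom_tree1 pdeg_ldom_tree1 pdeg_tree1_low,
    where \<kappa> = \<kappa> and sl = sl and \<tau> = \<tau>]
  unfolding tree1_Kop quad_eval_tree1 by blast+

section \<open>Summation over all trees with a given root frequency\<close>

definition freqs1 :: "int ^ 'd \<Rightarrow> nat \<Rightarrow> int ^ 'd" where
  "freqs1 k1 = (\<lambda>_. 0)(1 := k1)"

definition freqs3 :: "(int ^ 'd) \<times> (int ^ 'd) \<times> (int ^ 'd) \<Rightarrow> nat \<Rightarrow> int ^ 'd" where
  "freqs3 = (\<lambda>(k1, k2, k3). (\<lambda>_. 0)(1 := k1, 2 := k2, 3 := k3))"

definition freqs5 :: "(int ^ 'd) \<times> (int ^ 'd) \<times> (int ^ 'd) \<times> (int ^ 'd) \<times> (int ^ 'd) \<Rightarrow> nat \<Rightarrow> int ^ 'd" where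
  "freqs5 = (\<lambda>(k1, k2, k3, k4, k5). (\<lambda>_. 0)(1 := k1, 2 := k2, 3 := k3, 4 := k4, 5 := k5))"

text \<open>The root frequency of T_3 has the signs + - - + +, that of T_2 the signs - + + - +.
  Exchanging k1 with k2 and k3 with k4 lets both be indexed by \<open>quint_freq\<close>.\<close>

definition swap_pairs :: "'a \<times> 'a \<times> 'a \<times> 'a \<times> 'b \<Rightarrow> 'a \<times> 'a \<times> 'a \<times> 'a \<times> 'b" where
  "swap_pairs = (\<lambda>(k1, k2, k3, k4, k5). (k2, k1, k4, k3, k5))"

lemma freqs_eqI:
  "(\<And>i. i \<notin> {1..1} \<Longrightarrow> \<kappa> i = 0) \<Longrightarrow> \<kappa> = freqs1 (\<kappa> 1)"
  "(\<And>i. i \<notin> {1..3} \<Longrightarrow> \<kappa> i = 0) \<Longrightarrow> \<kappa> = freqs3 (\<kappa> 1, \<kappa> 2, \<kappa> 3)"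
  "(\<And>i. i \<notin> {1..5} \<Longrightarrow> \<kappa> i = 0) \<Longrightarrow> \<kappa> = freqs5 (\<kappa> 1, \<kappa> 2, \<kappa> 3, \<kappa> 4, \<kappa> 5)"
proof -
  have "i \<notin> {1..1} \<longleftrightarrow> i \<noteq> 1" "i \<notin> {1..3} \<longleftrightarrow> i \<noteq> 1 \<and> i \<noteq> 2 \<and> i \<noteq> 3"
    "i \<notin> {1..5} \<longleftrightarrow> i \<noteq> 1 \<and> i \<noteq> 2 \<and> i \<noteq> 3 \<and> i \<noteq> 4 \<and> i \<noteq> 5" for i :: nat
    by auto
  then show
    "(\<And>i. i \<notin> {1..1} \<Longrightarrow> \<kappa> i = 0) \<Longrightarrow> \<kappa> = freqs1 (\<kappa> 1)"
    "(\<And>i. i \<notin> {1..3} \<Longrightarrow> \<kappa> i = 0) \<Longrightarrow> \<kappa> = freqs3 (\<kappa> 1, \<kappa> 2, \<kappa> 3)"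
    "(\<And>i. i \<notin> {1..5} \<Longrightarrow> \<kappa> i = 0) \<Longrightarrow> \<kappa> = freqs5 (\<kappa> 1, \<kappa> 2, \<kappa> 3, \<kappa> 4, \<kappa> 5)"
    by (auto simp: freqs1_def freqs3_def freqs5_def fun_eq_iff simp del: atLeastAtMost_iff)
qed

text \<open>A valuation that vanishes outside the variables of its shape is the same as the tuple of
  its values; \<open>trees\<close> thus becomes four disjoint families indexed by tuples.\<close>

lemma trees_decomp:
  fixes k :: "int ^ 'd"
  shows "trees k = (\<lambda>j. (S0, freqs1 j)) ` {j \<in> UNIV. j = k} \<union>
    ((\<lambda>j. (S1, freqs3 j)) ` {j \<in> UNIV. triple_freq j = k} \<union>
    ((\<lambda>j. (S2, freqs5 j)) ` {j \<in> UNIV. quint_freq j = k} \<union>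
     (\<lambda>j. (S3, freqs5 (swap_pairs j))) ` {j \<in> UNIV. quint_freq j = k}))" (is "_ = ?A \<union> (?B \<union> (?C \<union> ?D))")
proof (intro equalityI subsetI)
  fix t assume t: "t \<in> trees k"
  obtain S \<kappa> where [simp]: "t = (S, \<kappa>)" by (cases t)
  have f: "vec_eval \<kappa> (root_freq S) = k" and z: "\<And>i. i \<notin> {1..nvars S} \<Longrightarrow> \<kappa> i = 0"
    using t by (auto simp: trees_def)
  show "t \<in> ?A \<union> (?B \<union> (?C \<union> ?D))"
  proof (cases S)
    case S0
    then have "\<kappa> = freqs1 (\<kappa> 1)" using z by (intro freqs_eqI(1)) simp
    then have "t \<in> ?A" using f S0 by (intro image_eqI[of _ _ "\<kappa> 1"]) (auto simp: vec_eval_X)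
    then show ?thesis by simp
  next
    case S1
    then have "\<kappa> = freqs3 (\<kappa> 1, \<kappa> 2, \<kappa> 3)" using z by (intro freqs_eqI(2)) simp
    then have "t \<in> ?B" using f S1
      by (intro image_eqI[of _ _ "(\<kappa> 1, \<kappa> 2, \<kappa> 3)"])
        (auto simp: triple_freq_def vec_eval_add vec_eval_diff vec_eval_uminus vec_eval_X)
    then show ?thesis by simp
  next
    case S2
    then have "\<kappa> = freqs5 (\<kappa> 1, \<kappa> 2, \<kappa> 3, \<kappa> 4, \<kappa> 5)" using z by (intro freqs_eqI(3)) simp
    then have "t \<in> ?C" using f S2
      by (intro image_eqI[of _ _ "(\<kappa> 1, \<kappa> 2, \<kappa> 3, \<kappa> 4, \<kappa> 5)"])
        (auto simp: quint_freq_def vec_eval_add vec_eval_diff vec_eval_uminus vec_eval_X)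
    then show ?thesis by simp
  next
    case S3
    then have "\<kappa> = freqs5 (\<kappa> 1, \<kappa> 2, \<kappa> 3, \<kappa> 4, \<kappa> 5)" using z by (intro freqs_eqI(3)) simp
    then have "t \<in> ?D" using f S3
      by (intro image_eqI[of _ _ "(\<kappa> 2, \<kappa> 1, \<kappa> 4, \<kappa> 3, \<kappa> 5)"])
        (auto simp: swap_pairs_def quint_freq_def vec_eval_add vec_eval_diff vec_eval_uminus vec_eval_X algebra_simps)
    then show ?thesis by simp
  qed
next
  fix t assume "t \<in> ?A \<union> (?B \<union> (?C \<union> ?D))"
  then show "t \<in> trees k"
    by (auto simp: trees_def freqs1_def freqs3_def freqs5_def swap_pairs_def triple_freq_def quint_freq_def
        vec_eval_add vec_eval_diff vec_eval_uminus vec_eval_X algebra_simps simp del: One_nat_def)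
qed

lemma inj_freqs: "inj freqs1" "inj freqs3" "inj freqs5"
proof -
  have 1: "freqs1 j 1 = j" for j :: "int ^ 'a" by (simp add: freqs1_def)
  have 3: "(freqs3 j 1, freqs3 j 2, freqs3 j 3) = j" for j :: "(int ^ 'b) \<times> (int ^ 'b) \<times> (int ^ 'b)"
    by (simp add: freqs3_def case_prod_unfold)
  have 5: "(freqs5 j 1, freqs5 j 2, freqs5 j 3, freqs5 j 4, freqs5 j 5) = j"
    for j :: "(int ^ 'c) \<times> (int ^ 'c) \<times> (int ^ 'c) \<times> (int ^ 'c) \<times> (int ^ 'c)"
    by (simp add: freqs5_def case_prod_unfold)
  show "inj (freqs1 :: int ^ 'a \<Rightarrow> _)" by (rule inj_on_inverseI[of _ "\<lambda>\<kappa>. \<kappa> 1"]) (rule 1)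
  show "inj (freqs3 :: (int ^ 'b) \<times> (int ^ 'b) \<times> (int ^ 'b) \<Rightarrow> _)"
    by (rule inj_on_inverseI[of _ "\<lambda>\<kappa>. (\<kappa> 1, \<kappa> 2, \<kappa> 3)"]) (rule 3)
  show "inj (freqs5 :: (int ^ 'c) \<times> (int ^ 'c) \<times> (int ^ 'c) \<times> (int ^ 'c) \<times> (int ^ 'c) \<Rightarrow> _)"
    by (rule inj_on_inverseI[of _ "\<lambda>\<kappa>. (\<kappa> 1, \<kappa> 2, \<kappa> 3, \<kappa> 4, \<kappa> 5)"]) (rule 5)
qed

lemma inj_swap_pairs: "inj swap_pairs"
  by (auto simp: inj_on_def swap_pairs_def)

lemma inj_on_Pair_shape: "inj h \<Longrightarrow> inj_on (\<lambda>j. (S, h j)) A"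
  by (auto simp: inj_on_def)

text \<open>Every shape contributes a reindexed series: T_0 gives f, T_1 gives g, and T_2 and T_3
  give multiples of the quintic series h. Only the value of T_1 distinguishes the schemes.\<close>

theorem general_step_of_kernel:
  fixes v :: "real ^ 'd::finite \<Rightarrow> complex"
  assumes n: "2 \<le> n" and w: "w \<in> sobolev s" "is_kernel_step \<tau> W v w"
    and W: "\<And>\<kappa> :: nat \<Rightarrow> int ^ 'd. osc_eval \<kappa> (Pi_tree \<kappa> sl n 1 tree1) \<tau> = - \<i> * W (\<kappa> 1) (\<kappa> 2) (\<kappa> 3)"
  shows "is_general_step s sl n \<tau> v w"
proof -
  let ?v = "fourier_coeff v"
  obtain f g h where w_eq: "w = (\<lambda>x. f x + g x + h x)"
    and f: "trig_series f UNIV (\<lambda>k. flow \<tau> k * ?v k) (\<lambda>k. k)"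
    and g: "trig_series g UNIV (\<lambda>(k1, k2, k3). - \<i> * flow \<tau> (- k1 + k2 + k3) * W k1 k2 k3 *
        cnj (?v k1) * ?v k2 * ?v k3) triple_freq"
    and h: "trig_series h UNIV (\<lambda>(k1, k2, k3, k4, k5). - of_real (\<tau>\<^sup>2 / 2) * flow \<tau> (- k1 + k2 + k3 - k4 + k5) *
        cnj (?v k1) * ?v k2 * ?v k3 * cnj (?v k4) * ?v k5) quint_freq"
    using w(2) unfolding is_kernel_step_def by (elim exE conjE) (rule that)
  note C = trig_series_continuous[of _ _ _ _ UNIV]
  have "(scheme_term sl n \<tau> v has_sum fourier_coeff w k) (trees k)" for k
  proof -
    let ?t = "scheme_term sl n \<tau> v"
    let ?A = "(\<lambda>j. (S0, freqs1 j)) ` {j \<in> UNIV. j = k}" and ?B = "(\<lambda>j. (S1, freqs3 j)) ` {j \<in> UNIV. triple_freq j = k}"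
      and ?C = "(\<lambda>j. (S2, freqs5 j)) ` {j \<in> UNIV. quint_freq j = k}"
      and ?D = "(\<lambda>j. (S3, freqs5 (swap_pairs j))) ` {j \<in> UNIV. quint_freq j = k}"
    have A: "(?t has_sum fourier_coeff f k) ?A"
    proof (subst has_sum_reindex)
      show "inj_on (\<lambda>j. (S0, freqs1 j)) {j \<in> UNIV. j = k}"
        by (rule inj_on_Pair_shape[OF inj_freqs(1)])
      show "(?t \<circ> (\<lambda>j. (S0, freqs1 j)) has_sum fourier_coeff f k) {j \<in> UNIV. j = k}"
        by (rule has_sum_cong[THEN iffD1, OF _ trig_series_coeff[OF f, of k]])
          (simp add: scheme_term_S0 freqs1_def del: One_nat_def)
    qed
    have B: "(?t has_sum fourier_coeff g k) ?B"
    proof (subst has_sum_reindex)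
      show "inj_on (\<lambda>j. (S1, freqs3 j)) {j \<in> UNIV. triple_freq j = k}"
        by (rule inj_on_Pair_shape[OF inj_freqs(2)])
      show "(?t \<circ> (\<lambda>j. (S1, freqs3 j)) has_sum fourier_coeff g k) {j \<in> UNIV. triple_freq j = k}"
        by (rule has_sum_cong[THEN iffD1, OF _ trig_series_coeff[OF g, of k]])
          (auto simp: scheme_term_S1[where W = W, OF W] freqs3_def simp del: One_nat_def)
    qed
    \<comment> \<open>The weight -\<tau>^2 of T_2 is twice the factor -\<tau>^2 / 2 in h.\<close>
    have C': "(?t has_sum 2 * fourier_coeff h k) ?C"
    proof (subst has_sum_reindex)
      show "inj_on (\<lambda>j. (S2, freqs5 j)) {j \<in> UNIV. quint_freq j = k}"
        by (rule inj_on_Pair_shape[OF inj_freqs(3)])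
      show "(?t \<circ> (\<lambda>j. (S2, freqs5 j)) has_sum 2 * fourier_coeff h k) {j \<in> UNIV. quint_freq j = k}"
        by (rule has_sum_cong[THEN iffD1, OF _ has_sum_cmult_right[OF trig_series_coeff[OF h, of k]]])
          (auto simp: scheme_term_S2[OF n] freqs5_def simp del: One_nat_def)
    qed
    \<comment> \<open>The weight \<tau>^2 / 2 of T_3 is the negative of that factor;
      \<open>swap_pairs\<close> brings its frequencies into the order used in h.\<close>
    have D: "(?t has_sum (- 1) * fourier_coeff h k) ?D"
    proof (subst has_sum_reindex)
      have "inj (\<lambda>j. freqs5 (swap_pairs j))"
        using inj_compose[OF inj_freqs(3) inj_swap_pairs] by (simp add: o_def)
      then show "inj_on (\<lambda>j. (S3, freqs5 (swap_pairs j))) {j \<in> UNIV. quint_freq j = k}"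
        by (rule inj_on_Pair_shape)
      show "(?t \<circ> (\<lambda>j. (S3, freqs5 (swap_pairs j))) has_sum (- 1) * fourier_coeff h k) {j \<in> UNIV. quint_freq j = k}"
        by (rule has_sum_cong[THEN iffD1, OF _ has_sum_cmult_right[OF trig_series_coeff[OF h, of k]]])
          (auto simp: scheme_term_S3[OF n] freqs5_def swap_pairs_def algebra_simps simp del: One_nat_def)
    qed
    have "(?t has_sum fourier_coeff f k + (fourier_coeff g k + (2 * fourier_coeff h k + (- 1) * fourier_coeff h k)))
        (?A \<union> (?B \<union> (?C \<union> ?D)))"
      by (intro has_sum_Un_disjoint A B C' D) auto
    moreover have "fourier_coeff w k = fourier_coeff f k + (fourier_coeff g k + (2 * fourier_coeff h k + (- 1) * fourier_coeff h k))"
      unfolding w_eq by (simp add: fourier_coeff_add continuous_on_add C[OF f] C[OF g] C[OF h])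
    ultimately show ?thesis unfolding trees_decomp by simp
  qed
  then show ?thesis
    unfolding is_general_step_def general_scheme_def using w(1) by (metis has_sum_imp_summable infsumI)
qed

section \<open>The kernels of the three schemes\<close>

text \<open>The integral of \<xi> exp(i \<xi> L) over [0, t], in the form given by integration by
  parts.\<close>

definition osc_int1 :: "real \<Rightarrow> real \<Rightarrow> complex" where
  "osc_int1 L t = (if L = 0 then of_real (t\<^sup>2 / 2)
     else (of_real t * exp (\<i> * of_real (t * L)) - osc_int0 L t) / (\<i> * of_real L))"

lemma osc_int1_zero [simp]: "osc_int1 L 0 = 0"
  by (simp add: osc_int1_def)

lemma has_integral_norm_bound:
  fixes f :: "real \<Rightarrow> complex"
  assumes "(f has_integral I) {0..\<tau>}" "0 \<le> \<tau>" "0 \<le> B" "\<And>\<xi>. \<xi> \<in> {0..\<tau>} \<Longrightarrow> norm (f \<xi>) \<le> B"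
  shows "norm I \<le> B * \<tau>"
  using has_integral_bound_real[OF assms(3) finite.emptyI assms(1)] assms(2,4) by simp

lemma has_integral_osc_int1:
  assumes "0 \<le> t"
  shows "((\<lambda>\<xi>. of_real \<xi> * exp (\<i> * of_real (\<xi> * L))) has_integral osc_int1 L t) {0..t}"
proof -
  have "(osc_int1 L has_vector_derivative of_real x * exp (\<i> * of_real (x * L))) (at x within {0..t})" for x
  proof (cases "L = 0")
    case True
    then have "osc_int1 L = (\<lambda>t. of_real (t\<^sup>2 / 2))" by (simp add: osc_int1_def fun_eq_iff)
    moreover have "((\<lambda>t. of_real (t\<^sup>2 / 2) :: complex) has_vector_derivative of_real x) (at x within {0..t})"
      by (rule has_vector_derivative_of_real) (auto intro!: derivative_eq_intros)
    ultimately show ?thesis using True by simp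
  next
    case False
    have i: "((\<lambda>t. of_real t :: complex) has_vector_derivative of_real 1) (at x within {0..t})"
      by (rule has_vector_derivative_of_real) (auto intro!: derivative_eq_intros)
    have eq: "osc_int1 L = (\<lambda>t. (of_real t * exp (\<i> * of_real (t * L)) - osc_int0 L t) / (\<i> * of_real L))"
      using False by (simp add: osc_int1_def fun_eq_iff)
    have "(osc_int1 L has_vector_derivative
        (of_real x * (\<i> * of_real L * exp (\<i> * of_real (x * L))) + of_real 1 * exp (\<i> * of_real (x * L))
         - exp (\<i> * of_real (x * L))) / (\<i> * of_real L)) (at x within {0..t})"
      unfolding eq
      by (intro has_vector_derivative_divide has_vector_derivative_diff has_vector_derivative_mult i
          has_vector_derivative_exp_i osc_int0_deriv)
    also have "(of_real x * (\<i> * of_real L * exp (\<i> * of_real (x * L))) + of_real 1 * exp (\<i> * of_real (x * L))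
         - exp (\<i> * of_real (x * L))) / (\<i> * of_real L) = of_real x * exp (\<i> * of_real (x * L))"
      using False by (simp add: field_simps)
    finally show ?thesis .
  qed
  from fundamental_theorem_of_calculus[OF assms this] show ?thesis by simp
qed

text \<open>Both sides are values of the same integral, which avoids a comparison of the recursive
  formula with the closed ones.\<close>

lemma osc_int_eq:
  assumes "0 \<le> \<tau>"
  shows "osc_eval \<kappa> (osc_int \<kappa> L 0) \<tau> = osc_int0 (quad_eval \<kappa> L) \<tau>"
    and "osc_eval \<kappa> (osc_int \<kappa> L 1) \<tau> = osc_int1 (quad_eval \<kappa> L) \<tau>"
  using has_integral_unique[OF osc_integral[OF assms, of 0 \<kappa> L] has_integral_osc_int0[OF assms, THEN has_integral_eq[rotated]]]
    has_integral_unique[OF osc_integral[OF assms, of 1 \<kappa> L] has_integral_osc_int1[OF assms, THEN has_integral_eq[rotated]]]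
  by simp_all

lemma phi1_osc_int0:
  assumes "\<tau> \<noteq> 0"
  shows "of_real \<tau> * phi1 (\<i> * of_real (\<tau> * L)) = osc_int0 L \<tau>"
  using assms by (auto simp: phi1_def osc_int0_def)

text \<open>\<open>phi2\<close> at \<sigma> is the integral of \<theta> exp(\<sigma> \<theta>) over
  [0, 1], which explains its value 1/2 at 0; rescaling to [0, \<tau>] produces the factor
  \<tau>^2.\<close>

lemma phi2_osc_int1:
  assumes "\<tau> \<noteq> 0"
  shows "of_real (\<tau>\<^sup>2) * phi2 (\<i> * of_real (\<tau> * L)) = osc_int1 L \<tau>"
proof (cases "L = 0")
  case False
  let ?\<sigma> = "\<i> * of_real (\<tau> * L)"
  have "of_real (\<tau>\<^sup>2) * phi2 ?\<sigma> = (of_real \<tau> * exp ?\<sigma> - of_real \<tau> * phi1 ?\<sigma>) / (\<i> * of_real L)"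
    using False assms by (simp add: phi2_def power2_eq_square field_simps)
  then show ?thesis unfolding phi1_osc_int0[OF assms] using False by (simp add: osc_int1_def)
qed (simp add: phi2_def osc_int1_def)

lemma norm_osc_int0_le: "0 \<le> \<tau> \<Longrightarrow> cmod (osc_int0 L \<tau>) \<le> \<tau>"
  using has_integral_norm_bound[OF has_integral_osc_int0[of \<tau> L], of 1] by simp

lemma norm_osc_int1_le: "0 \<le> \<tau> \<Longrightarrow> cmod (osc_int1 L \<tau>) \<le> \<tau>\<^sup>2"
  using has_integral_norm_bound[OF has_integral_osc_int1[of \<tau> L], of \<tau>] by (simp add: norm_mult power2_eq_square)

lemma norm_phi_le:
  "cmod (phi1 (\<i> * of_real x)) \<le> 1" "cmod (phi2 (\<i> * of_real x)) \<le> 1"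
  using norm_osc_int0_le[of 1 x] phi1_osc_int0[of 1 x] norm_osc_int1_le[of 1 x] phi2_osc_int1[of 1 x] by auto

section \<open>The three kernels: consistency errors and growth\<close>

abbreviation nsq :: "int ^ 'd::finite \<Rightarrow> real" where
  "nsq k \<equiv> (norm (rvec k))\<^sup>2"

definition low_phase :: "int ^ 'd::finite \<Rightarrow> int ^ 'd \<Rightarrow> int ^ 'd \<Rightarrow> real" where
  "low_phase k1 k2 k3 = resonance k1 k2 k3 - 2 * nsq k1"

text \<open>The squares have cancelled. Each of the three remaining inner products of different
  frequencies is at most a product of two brackets, hence of all three, and has the coefficient 2 or
  -2; this gives 6 and the exponent 1/2.\<close>

lemma low_phase_bound: "\<bar>low_phase k1 k2 k3\<bar> \<le> 6 * (jb k1 * jb k2 * jb k3) powr (1 / 2)"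
proof -
  let ?P = "jb k1 * jb k2 * jb k3"
  let ?x = "rvec k1" and ?y = "rvec k2" and ?z = "rvec k3"
  have eq: "low_phase k1 k2 k3 = - 2 * (?x \<bullet> ?y) - 2 * (?x \<bullet> ?z) + 2 * (?y \<bullet> ?z)"
    by (simp add: low_phase_def resonance_def power2_norm_eq_inner inner_add_left inner_add_right
        inner_diff_left inner_diff_right inner_commute algebra_simps)
  have "\<bar>rvec a \<bullet> rvec b\<bar> \<le> ?P powr (1 / 2)" if "jb a * jb b \<le> ?P" for a b :: "int ^ 'a"
  proof -
    have "(rvec a \<bullet> rvec b)\<^sup>2 \<le> nsq a * nsq b"
      using Cauchy_Schwarz_ineq[of "rvec a" "rvec b"] by (simp add: power2_norm_eq_inner)
    also have "\<dots> \<le> jb a * jb b" by (intro mult_mono) (auto simp: jb_def)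
    also note that
    finally have "sqrt ((rvec a \<bullet> rvec b)\<^sup>2) \<le> sqrt ?P" by (rule real_sqrt_le_mono)
    then show ?thesis by (simp add: powr_half_sqrt del: real_sqrt_le_iff)
  qed
  moreover have "x * y \<le> x * y * z" if "0 < x" "0 < y" "1 \<le> z" for x y z :: real
    using mult_left_mono[of 1 z "x * y"] that by simp
  from this[of "jb k1" "jb k2" "jb k3"] this[of "jb k1" "jb k3" "jb k2"] this[of "jb k2" "jb k3" "jb k1"]
  have "jb k1 * jb k2 \<le> ?P" "jb k1 * jb k3 \<le> ?P" "jb k2 * jb k3 \<le> ?P"
    using jb_ge_1 by (auto simp: mult_ac)
  ultimately have "\<bar>?x \<bullet> ?y\<bar> \<le> ?P powr (1 / 2)" "\<bar>?x \<bullet> ?z\<bar> \<le> ?P powr (1 / 2)" "\<bar>?y \<bullet> ?z\<bar> \<le> ?P powr (1 / 2)"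
    by blast+
  then show ?thesis unfolding eq by linarith
qed

lemma triple_powr_mono: "p \<le> q \<Longrightarrow> (jb k1 * jb k2 * jb k3) powr p \<le> (jb k1 * jb k2 * jb k3) powr q"
  using order_trans[OF jb_ge_1[of k1] jb_products(1)[of k1 k2 k3]] by (intro powr_mono) auto

lemma triple_powr_ge_1: "0 \<le> p \<Longrightarrow> 1 \<le> (jb k1 * jb k2 * jb k3) powr p"
  using order_trans[OF jb_ge_1[of k1] jb_products(1)[of k1 k2 k3]] by (intro ge_one_powr_ge_zero) auto

definition kernel_i :: "real \<Rightarrow> int ^ 'd::finite \<Rightarrow> int ^ 'd \<Rightarrow> int ^ 'd \<Rightarrow> complex" where
  "kernel_i \<tau> k1 k2 k3 = osc_int0 (2 * nsq k1) \<tau> + quotient_slope \<tau> (low_phase k1 k2 k3) * osc_int1 (2 * nsq k1) \<tau>"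

definition kernel_ii :: "real \<Rightarrow> int ^ 'd::finite \<Rightarrow> int ^ 'd \<Rightarrow> int ^ 'd \<Rightarrow> complex" where
  "kernel_ii \<tau> k1 k2 k3 = osc_int0 (2 * nsq k1) \<tau> + quotient_slope \<tau> (low_phase k1 k2 k3) * of_real (\<tau>\<^sup>2 / 2)"

definition kernel_iii :: "real \<Rightarrow> int ^ 'd::finite \<Rightarrow> int ^ 'd \<Rightarrow> int ^ 'd \<Rightarrow> complex" where
  "kernel_iii \<tau> k1 k2 k3 = of_real \<tau> + \<i> * of_real (resonance k1 k2 k3) * of_real (\<tau>\<^sup>2 / 2)"

text \<open>The first bound serves consistency, the second stability: it is free of frequencies, so
  the kernels built with the quotient lose no derivatives. The third shows that replacing g'(0) by
  the quotient costs an error which, multiplied by \<xi>, has the size of the Taylor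
  remainder.\<close>

lemma quotient_slope_bounds:
  assumes "0 < \<tau>"
  shows "cmod (quotient_slope \<tau> l) \<le> \<bar>l\<bar>" "cmod (quotient_slope \<tau> l) \<le> 2 / \<tau>"
    "cmod (\<i> * of_real l - quotient_slope \<tau> l) \<le> \<tau> * l\<^sup>2"
proof -
  let ?e = "exp (\<i> * of_real (\<tau> * l))"
  have q: "cmod (quotient_slope \<tau> l) = cmod (?e - 1) / \<tau>"
    using assms by (simp add: quotient_slope_def norm_divide)
  show "cmod (quotient_slope \<tau> l) \<le> \<bar>l\<bar>"
    using norm_exp_i_minus_1[of "\<tau> * l"] assms unfolding q by (simp add: field_simps abs_mult)
  have "cmod (?e - 1) \<le> 2" using norm_triangle_ineq4[of ?e 1] by (simp add: norm_exp_eq_Re)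
  then show "cmod (quotient_slope \<tau> l) \<le> 2 / \<tau>" unfolding q using assms by (intro divide_right_mono) auto
  have "\<i> * of_real l - quotient_slope \<tau> l = - (?e - 1 - \<i> * of_real (\<tau> * l)) / of_real \<tau>"
    using assms by (simp add: quotient_slope_def field_simps)
  then have "cmod (\<i> * of_real l - quotient_slope \<tau> l) = cmod (?e - 1 - \<i> * of_real (\<tau> * l)) / \<tau>"
    using assms by (simp add: norm_divide norm_minus_commute)
  also have "\<dots> \<le> (\<tau> * l)\<^sup>2 / \<tau>" using assms by (intro divide_right_mono norm_exp_i_minus_2) auto
  also have "\<dots> = \<tau> * l\<^sup>2" using assms by (simp add: power_mult_distrib power2_eq_square)
  finally show "cmod (\<i> * of_real l - quotient_slope \<tau> l) \<le> \<tau> * l\<^sup>2" .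
qed

text \<open>The difference is an integral over [0, \<tau>] in which exp(i \<xi> L) factors out,
  leaving the Taylor remainder of exp(i \<xi> l) and the error of the slope, each at most \<tau>^2
  l^2. The constant 72 is 2 times the square of 6.\<close>

lemma kernel_i_error:
  assumes \<tau>: "0 < \<tau>"
  shows "cmod (osc_int0 (resonance k1 k2 k3) \<tau> - kernel_i \<tau> k1 k2 k3) \<le> 72 * \<tau> ^ 3 * (jb k1 * jb k2 * jb k3) powr (2 / 2)"
proof -
  let ?l = "low_phase k1 k2 k3" and ?L = "2 * nsq k1"
  let ?q = "quotient_slope \<tau> ?l"
  let ?f = "\<lambda>\<xi>. exp (\<i> * of_real (\<xi> * resonance k1 k2 k3)) -
      (exp (\<i> * of_real (\<xi> * ?L)) + ?q * (of_real \<xi> * exp (\<i> * of_real (\<xi> * ?L))))"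
  have "(?f has_integral (osc_int0 (resonance k1 k2 k3) \<tau> - kernel_i \<tau> k1 k2 k3)) {0..\<tau>}"
    unfolding kernel_i_def
    by (intro has_integral_diff has_integral_add has_integral_mult_right has_integral_osc_int0 has_integral_osc_int1)
      (use \<tau> in auto)
  moreover have "norm (?f \<xi>) \<le> 2 * \<tau>\<^sup>2 * ?l\<^sup>2" if \<xi>: "\<xi> \<in> {0..\<tau>}" for \<xi>
  proof -
    have R: "resonance k1 k2 k3 = ?L + ?l" by (simp add: low_phase_def)
    have e: "exp (\<i> * of_real (\<xi> * resonance k1 k2 k3)) = exp (\<i> * of_real (\<xi> * ?L)) * exp (\<i> * of_real (\<xi> * ?l))"
      unfolding R by (simp add: exp_add [symmetric] algebra_simps)
    have "?f \<xi> = exp (\<i> * of_real (\<xi> * ?L)) *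
        ((exp (\<i> * of_real (\<xi> * ?l)) - 1 - \<i> * of_real (\<xi> * ?l)) + of_real \<xi> * (\<i> * of_real ?l - ?q))"
      unfolding e by (simp add: algebra_simps)
    then have "norm (?f \<xi>) = norm ((exp (\<i> * of_real (\<xi> * ?l)) - 1 - \<i> * of_real (\<xi> * ?l)) + of_real \<xi> * (\<i> * of_real ?l - ?q))"
      by (simp only: norm_mult) (simp add: norm_exp_eq_Re)
    also have "\<dots> \<le> norm (exp (\<i> * of_real (\<xi> * ?l)) - 1 - \<i> * of_real (\<xi> * ?l)) + norm (of_real \<xi> * (\<i> * of_real ?l - ?q))"
      by (rule norm_triangle_ineq)
    also have "\<dots> \<le> (\<xi> * ?l)\<^sup>2 + \<xi> * (\<tau> * ?l\<^sup>2)"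
      using quotient_slope_bounds(3)[OF \<tau>, of ?l] \<xi>
      by (intro add_mono norm_exp_i_minus_2) (simp add: norm_mult mult_left_mono)
    also have "\<dots> \<le> \<tau>\<^sup>2 * ?l\<^sup>2 + \<tau> * (\<tau> * ?l\<^sup>2)"
      unfolding power_mult_distrib using \<xi> by (intro add_mono mult_right_mono power_mono) auto
    finally show ?thesis by (simp add: power2_eq_square)
  qed
  ultimately have "cmod (osc_int0 (resonance k1 k2 k3) \<tau> - kernel_i \<tau> k1 k2 k3) \<le> 2 * \<tau>\<^sup>2 * ?l\<^sup>2 * \<tau>"
    using has_integral_norm_bound[of ?f _ \<tau> "2 * \<tau>\<^sup>2 * ?l\<^sup>2"] \<tau> by simp
  also have "?l\<^sup>2 \<le> (6 * (jb k1 * jb k2 * jb k3) powr (1 / 2))\<^sup>2"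
    using power_mono[OF low_phase_bound[of k1 k2 k3], of 2] by simp
  also have "\<dots> = 36 * (jb k1 * jb k2 * jb k3) powr (2 / 2)"
    by (simp add: power_mult_distrib power2_eq_square flip: powr_add)
  finally show ?thesis using \<tau> by (simp add: power3_eq_cube power2_eq_square mult_ac)
qed

text \<open>Compared with (i), the oscillation in the integral of \<xi> exp(i \<xi> L) is dropped,
  an error of at most \<tau>^3 L with L = 2 |k1|^2. Multiplied by the slope this adds 6 times 2 to
  72, and the exponents 1/2 and 1 add up to 3/2.\<close>

lemma kernel_ii_error:
  assumes \<tau>: "0 < \<tau>"
  shows "cmod (osc_int0 (resonance k1 k2 k3) \<tau> - kernel_ii \<tau> k1 k2 k3) \<le> 84 * \<tau> ^ 3 * (jb k1 * jb k2 * jb k3) powr (3 / 2)"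
proof -
  let ?P = "jb k1 * jb k2 * jb k3"
  let ?l = "low_phase k1 k2 k3" and ?L = "2 * nsq k1"
  let ?q = "quotient_slope \<tau> ?l"
  let ?f = "\<lambda>\<xi>. of_real \<xi> * exp (\<i> * of_real (\<xi> * ?L)) - of_real \<xi> * exp (\<i> * of_real (\<xi> * 0))"
  have "(?f has_integral (osc_int1 ?L \<tau> - osc_int1 0 \<tau>)) {0..\<tau>}"
    by (intro has_integral_diff has_integral_osc_int1) (use \<tau> in auto)
  moreover have "norm (?f \<xi>) \<le> \<tau> * (\<tau> * ?L)" if \<xi>: "\<xi> \<in> {0..\<tau>}" for \<xi>
  proof -
    have "norm (?f \<xi>) = \<xi> * cmod (exp (\<i> * of_real (\<xi> * ?L)) - 1)"
    proof -
      have "?f \<xi> = of_real \<xi> * (exp (\<i> * of_real (\<xi> * ?L)) - 1)" by (simp add: right_diff_distrib)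
      then show ?thesis using \<xi> by (simp only: norm_mult) simp
    qed
    also have "\<dots> \<le> \<tau> * (\<tau> * ?L)"
    proof (intro mult_mono)
      have "cmod (exp (\<i> * of_real (\<xi> * ?L)) - 1) \<le> \<bar>\<xi> * ?L\<bar>" by (rule norm_exp_i_minus_1)
      also have "\<dots> \<le> \<tau> * ?L" using \<xi> by (simp add: abs_mult mult_right_mono)
      finally show "cmod (exp (\<i> * of_real (\<xi> * ?L)) - 1) \<le> \<tau> * ?L" .
    qed (use \<xi> \<tau> in auto)
    finally show ?thesis .
  qed
  ultimately have d: "cmod (osc_int1 ?L \<tau> - of_real (\<tau>\<^sup>2 / 2)) \<le> \<tau> * (\<tau> * ?L) * \<tau>"
    using has_integral_norm_bound[of ?f _ \<tau> "\<tau> * (\<tau> * ?L)"] \<tau> by (simp add: osc_int1_def[of 0])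
  have "kernel_i \<tau> k1 k2 k3 - kernel_ii \<tau> k1 k2 k3 = ?q * (osc_int1 ?L \<tau> - of_real (\<tau>\<^sup>2 / 2))"
    by (simp add: kernel_i_def kernel_ii_def algebra_simps)
  then have "cmod (kernel_i \<tau> k1 k2 k3 - kernel_ii \<tau> k1 k2 k3) = cmod ?q * cmod (osc_int1 ?L \<tau> - of_real (\<tau>\<^sup>2 / 2))"
    by (simp only: norm_mult)
  also have "\<dots> \<le> (6 * ?P powr (1 / 2)) * (\<tau> * (\<tau> * (2 * ?P powr 1)) * \<tau>)"
  proof (rule mult_mono)
    show "cmod ?q \<le> 6 * ?P powr (1 / 2)"
      using quotient_slope_bounds(1)[OF \<tau>] low_phase_bound order_trans by blast
    have "nsq k1 \<le> ?P" using jb_products(1)[of k1 k2 k3] by (simp add: jb_def[of k1])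
    then have "\<tau> * (\<tau> * ?L) * \<tau> \<le> \<tau> * (\<tau> * (2 * ?P)) * \<tau>" using \<tau> by simp
    also have "?P = ?P powr 1" by simp
    finally show "cmod (osc_int1 ?L \<tau> - of_real (\<tau>\<^sup>2 / 2)) \<le> \<tau> * (\<tau> * (2 * ?P powr 1)) * \<tau>"
      by (rule order_trans[OF d])
  qed (use \<tau> in auto)
  also have "\<dots> = 12 * \<tau> ^ 3 * (?P powr (1 / 2) * ?P powr 1)"
    by (simp add: power3_eq_cube)
  also have "?P powr (1 / 2) * ?P powr 1 = ?P powr (3 / 2)" by (simp only: powr_add [symmetric]) simp
  finally have 1: "cmod (kernel_i \<tau> k1 k2 k3 - kernel_ii \<tau> k1 k2 k3) \<le> 12 * \<tau> ^ 3 * ?P powr (3 / 2)" .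
  have "72 * \<tau> ^ 3 * ?P powr (2 / 2) \<le> 72 * \<tau> ^ 3 * ?P powr (3 / 2)"
    using \<tau> by (intro mult_left_mono triple_powr_mono) auto
  with kernel_i_error[OF \<tau>, of k1 k2 k3]
  have 2: "cmod (osc_int0 (resonance k1 k2 k3) \<tau> - kernel_i \<tau> k1 k2 k3) \<le> 72 * \<tau> ^ 3 * ?P powr (3 / 2)" by simp
  show ?thesis
    using norm_triangle_le[OF add_mono[OF 2 1]] by (simp add: algebra_simps)
qed

text \<open>Here all of R is expanded, with a second order remainder controlled by R^2; 900 is the
  square of the constant in \<open>resonance_bound\<close>.\<close>

lemma kernel_iii_error:
  assumes \<tau>: "0 < \<tau>"
  shows "cmod (osc_int0 (resonance k1 k2 k3) \<tau> - kernel_iii \<tau> k1 k2 k3) \<le> 900 * \<tau> ^ 3 * (jb k1 * jb k2 * jb k3) powr (4 / 2)"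
proof -
  let ?P = "jb k1 * jb k2 * jb k3" and ?R = "resonance k1 k2 k3"
  let ?f = "\<lambda>\<xi>. exp (\<i> * of_real (\<xi> * ?R)) - (exp (\<i> * of_real (\<xi> * 0)) + \<i> * of_real ?R * (of_real \<xi> * exp (\<i> * of_real (\<xi> * 0))))"
  have "(?f has_integral (osc_int0 ?R \<tau> - (osc_int0 0 \<tau> + \<i> * of_real ?R * osc_int1 0 \<tau>))) {0..\<tau>}"
    by (intro has_integral_diff has_integral_add has_integral_mult_right has_integral_osc_int0 has_integral_osc_int1)
      (use \<tau> in auto)
  moreover have "norm (?f \<xi>) \<le> \<tau>\<^sup>2 * ?R\<^sup>2" if \<xi>: "\<xi> \<in> {0..\<tau>}" for \<xi>
  proof -
    have "?f \<xi> = exp (\<i> * of_real (\<xi> * ?R)) - 1 - \<i> * of_real (\<xi> * ?R)" by (simp add: algebra_simps)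
    then have "norm (?f \<xi>) \<le> (\<xi> * ?R)\<^sup>2" by (simp only: norm_exp_i_minus_2)
    also have "\<dots> \<le> \<tau>\<^sup>2 * ?R\<^sup>2"
      unfolding power_mult_distrib using \<xi> by (intro mult_right_mono power_mono) auto
    finally show ?thesis .
  qed
  ultimately have "cmod (osc_int0 ?R \<tau> - kernel_iii \<tau> k1 k2 k3) \<le> \<tau>\<^sup>2 * ?R\<^sup>2 * \<tau>"
    using has_integral_norm_bound[of ?f _ \<tau> "\<tau>\<^sup>2 * ?R\<^sup>2"] \<tau>
    by (simp add: kernel_iii_def osc_int0_def[of 0] osc_int1_def[of 0])
  also have "?R\<^sup>2 \<le> (30 * ?P powr (2 / 2))\<^sup>2"
    using power_mono[OF resonance_bound[of k1 k2 k3], of 2] by simp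
  also have "\<dots> = 900 * ?P powr (4 / 2)"
    by (simp add: power_mult_distrib powr_numeral)
  finally show ?thesis using \<tau> by (simp add: power3_eq_cube power2_eq_square mult_ac)
qed

text \<open>Both integrals are estimated by absolute values, and \<tau>^2 times the slope bound 2 /
  \<tau> contributes 2 \<tau>.\<close>

lemma kernel_i_bound:
  assumes "0 < \<tau>" "0 \<le> p"
  shows "cmod (kernel_i \<tau> k1 k2 k3) \<le> (3 * \<tau>) * (jb k1 * jb k2 * jb k3) powr (p / 2)"
proof -
  have "cmod (kernel_i \<tau> k1 k2 k3) \<le> \<tau> + 2 / \<tau> * \<tau>\<^sup>2"
    unfolding kernel_i_def norm_mult using assms
    by (intro norm_triangle_mono mult_mono quotient_slope_bounds norm_osc_int0_le norm_osc_int1_le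
        order_trans[OF norm_mult_ineq]) auto
  also have "\<dots> = 3 * \<tau> * 1" using assms by (simp add: power2_eq_square)
  also have "\<dots> \<le> 3 * \<tau> * (jb k1 * jb k2 * jb k3) powr (p / 2)"
    using assms by (intro mult_left_mono triple_powr_ge_1) auto
  finally show ?thesis .
qed

lemma kernel_ii_bound:
  assumes "0 < \<tau>" "0 \<le> p"
  shows "cmod (kernel_ii \<tau> k1 k2 k3) \<le> (3 * \<tau>) * (jb k1 * jb k2 * jb k3) powr (p / 2)"
proof -
  have "cmod (of_real (\<tau>\<^sup>2 / 2) :: complex) \<le> \<tau>\<^sup>2" by (simp only: norm_of_real) simp
  then have "cmod (kernel_ii \<tau> k1 k2 k3) \<le> \<tau> + 2 / \<tau> * \<tau>\<^sup>2"
    unfolding kernel_ii_def using assms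
    by (intro norm_triangle_mono mult_mono quotient_slope_bounds norm_osc_int0_le
        order_trans[OF norm_mult_ineq]) auto
  also have "\<dots> = 3 * \<tau> * 1" using assms by (simp add: power2_eq_square)
  also have "\<dots> \<le> 3 * \<tau> * (jb k1 * jb k2 * jb k3) powr (p / 2)"
    using assms by (intro mult_left_mono triple_powr_ge_1) auto
  finally show ?thesis .
qed

text \<open>With the exact slope the kernel grows like R, hence the restriction on p; 15 is half of
  the constant 30.\<close>

lemma kernel_iii_bound:
  assumes "0 < \<tau>" "2 \<le> p"
  shows "cmod (kernel_iii \<tau> k1 k2 k3) \<le> (\<tau> + 15 * \<tau>\<^sup>2) * (jb k1 * jb k2 * jb k3) powr (p / 2)"
proof -
  let ?P = "(jb k1 * jb k2 * jb k3) powr (p / 2)"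
  have "cmod (kernel_iii \<tau> k1 k2 k3) \<le> \<tau> + \<bar>resonance k1 k2 k3\<bar> * (\<tau>\<^sup>2 / 2)"
    unfolding kernel_iii_def using assms
    by (intro norm_triangle_mono) (simp_all add: norm_mult norm_power norm_divide)
  also have "\<dots> \<le> \<tau> * ?P + (30 * ?P) * (\<tau>\<^sup>2 / 2)"
  proof (intro add_mono mult_right_mono)
    show "\<tau> \<le> \<tau> * ?P" using mult_left_mono[OF triple_powr_ge_1[of "p / 2" k1 k2 k3], of \<tau>] assms by simp
    show "\<bar>resonance k1 k2 k3\<bar> \<le> 30 * ?P"
      using order_trans[OF resonance_bound[of k1 k2 k3] mult_left_mono[OF triple_powr_mono[of "2 / 2" "p / 2" k1 k2 k3], of 30]] assms
      by simp
  qed simp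
  finally show ?thesis by (simp add: algebra_simps)
qed

section \<open>The schemes as one step maps of the kernels\<close>

text \<open>Collecting terms of equal frequency makes series over different index sets, such as
  triples and quintuples, comparable. Each coefficient is bounded by the absolute sum over its
  fibre, so summability is preserved.\<close>

lemma trig_series_canonical:
  fixes f :: "real ^ 'd::finite \<Rightarrow> complex"
  assumes f: "trig_series f J c m"
  shows "trig_series f UNIV (fourier_coeff f) (\<lambda>k. k)"
proof (rule fourier_inversion[OF trig_series_continuous[OF f] trig_series_periodic[OF f]])
  let ?F = "\<lambda>k. {j \<in> J. m j = k}"
  have b: "bij_betw snd (SIGMA k:UNIV. ?F k) J"
    by (auto simp: bij_betw_def inj_on_def image_iff)
  have sm: "(\<lambda>p. cmod (c (snd p))) summable_on (SIGMA k:UNIV. ?F k)"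
    using summable_on_reindex_bij_betw[OF b, of "\<lambda>j. cmod (c j)"] trig_series_summable[OF f] by simp
  have fib: "(\<lambda>j. cmod (c j)) summable_on ?F k" for k
    by (rule summable_on_subset[OF trig_series_summable[OF f]]) auto
  have "(\<lambda>k. \<Sum>\<^sub>\<infinity>j\<in>?F k. cmod (c j)) summable_on UNIV"
    using summable_on_SigmaD[OF sm] fib by simp
  then show "(\<lambda>k. cmod (fourier_coeff f k)) summable_on UNIV"
  proof (rule Infinite_Sum.abs_summable_on_comparison_test')
    show "cmod (fourier_coeff f k) \<le> (\<Sum>\<^sub>\<infinity>j\<in>?F k. cmod (c j))" for k
      using norm_infsum_bound[OF fib[of k]] infsumI[OF trig_series_coeff[OF f, of k]] by simp
  qed
qed

lemma trig_series_lapfun_UNIV: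
  fixes f :: "real ^ 'd::finite \<Rightarrow> complex"
  assumes "trig_series f UNIV a (\<lambda>k. k)" and "(\<lambda>k. cmod (h (- of_real (nsq k)) * a k)) summable_on UNIV"
  shows "trig_series (lapfun h f) UNIV (\<lambda>k. h (- of_real (nsq k)) * a k) (\<lambda>k. k)"
  using trig_series_lapfun[OF assms] .

lemma free_flow_diff:
  assumes f: "trig_series f J c m" and g: "trig_series g K d n"
  shows "free_flow \<tau> (\<lambda>x. f x - g x) x = free_flow \<tau> f x - free_flow \<tau> g x"
proof -
  note F = trig_series_canonical[OF f] and G = trig_series_canonical[OF g]
  have "trig_series (free_flow \<tau> (\<lambda>x. f x - g x)) UNIV (\<lambda>k. flow \<tau> k * (fourier_coeff f k - fourier_coeff g k)) (\<lambda>k. k)"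
    by (rule free_flow_series[OF trig_series_minus[OF F G]])
  moreover have "trig_series (\<lambda>x. free_flow \<tau> f x - free_flow \<tau> g x) UNIV
      (\<lambda>k. flow \<tau> k * fourier_coeff f k - flow \<tau> k * fourier_coeff g k) (\<lambda>k. k)"
    by (rule trig_series_minus[OF free_flow_series[OF F] free_flow_series[OF G]])
  ultimately show ?thesis unfolding trig_series_def by (simp add: right_diff_distrib)
qed

lemma lapfun_one:
  assumes f: "trig_series f J c m"
  shows "lapfun (\<lambda>z. 1) f = f"
  using trig_series_lapfun_UNIV[OF trig_series_canonical[OF f], of "\<lambda>z. 1"]
    trig_series_summable[OF trig_series_canonical[OF f]] trig_series_canonical[OF f]
  unfolding trig_series_def by auto

lemma is_kernel_stepI:
  assumes "trig_series f UNIV (\<lambda>k. flow \<tau> k * fourier_coeff v k) (\<lambda>k. k)"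
    and "trig_series g UNIV (\<lambda>(k1, k2, k3). - \<i> * flow \<tau> (- k1 + k2 + k3) * W k1 k2 k3 *
        cnj (fourier_coeff v k1) * fourier_coeff v k2 * fourier_coeff v k3) triple_freq"
    and "trig_series h UNIV (\<lambda>(k1, k2, k3, k4, k5). - of_real (\<tau>\<^sup>2 / 2) * flow \<tau> (- k1 + k2 + k3 - k4 + k5) *
        cnj (fourier_coeff v k1) * fourier_coeff v k2 * fourier_coeff v k3 *
        cnj (fourier_coeff v k4) * fourier_coeff v k5) quint_freq"
    and "\<And>x. w x = f x + g x + h x"
  shows "is_kernel_step \<tau> W v w"
proof -
  have "w = (\<lambda>x. f x + g x + h x)" using assms(4) by auto
  then show ?thesis unfolding is_kernel_step_def using assms(1-3) by (intro exI conjI)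
qed

section \<open>The schemes (i) and (ii) as kernel steps\<close>

context
  fixes s :: real
  assumes s: "s > real CARD('d::finite) / 2"
begin

lemma cnj_lapfun_series:
  fixes v :: "real ^ 'd \<Rightarrow> complex"
  assumes v: "v \<in> sobolev s" and h: "\<And>x. 0 \<le> x \<Longrightarrow> cmod (h (- of_real x)) \<le> B"
  shows "trig_series (lapfun h (\<lambda>y. cnj (v y))) UNIV (\<lambda>k. h (- of_real (nsq k)) * cnj (fourier_coeff v k)) (\<lambda>k. - k)"
  using lapfun_series_bounded[where h = h and B = B, OF cnj_series[OF s v] h] by simp

lemma scheme_first_part:
  fixes v :: "real ^ 'd \<Rightarrow> complex"
  assumes v: "v \<in> sobolev s" and h: "\<And>x. 0 \<le> x \<Longrightarrow> cmod (h (- of_real x)) \<le> B"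
  shows "trig_series (\<lambda>x. - \<i> * of_real \<tau> * free_flow \<tau> (\<lambda>y. (v y)\<^sup>2 * lapfun h (\<lambda>y. cnj (v y)) y) x) UNIV
    (\<lambda>(k1, k2, k3). - \<i> * of_real \<tau> * flow \<tau> (- k1 + k2 + k3) * h (- of_real (nsq k1)) *
       cnj (fourier_coeff v k1) * fourier_coeff v k2 * fourier_coeff v k3) triple_freq"
proof -
  note V = sobolev_series[OF s v]
  have "trig_series (\<lambda>x. lapfun h (\<lambda>y. cnj (v y)) x * v x * v x) UNIV
      (\<lambda>(k1, k2, k3). h (- of_real (nsq k1)) * cnj (fourier_coeff v k1) * fourier_coeff v k2 * fourier_coeff v k3) triple_freq"
    by (rule triple_series[OF cnj_lapfun_series[where h = h and B = B, OF v h] V V])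
  also have "(\<lambda>x. lapfun h (\<lambda>y. cnj (v y)) x * v x * v x) = (\<lambda>y. (v y)\<^sup>2 * lapfun h (\<lambda>y. cnj (v y)) y)"
    by (simp add: power2_eq_square mult_ac)
  finally have "trig_series (\<lambda>y. (v y)\<^sup>2 * lapfun h (\<lambda>y. cnj (v y)) y) UNIV
      (\<lambda>(k1, k2, k3). h (- of_real (nsq k1)) * cnj (fourier_coeff v k1) * fourier_coeff v k2 * fourier_coeff v k3) triple_freq" .
  from trig_series_cmult[OF free_flow_series[OF this, of \<tau>], of "- \<i> * of_real \<tau>"]
  show ?thesis by (rule trig_series_cong) (auto simp: triple_freq_def)
qed

text \<open>The free flow acts on each factor before the product is formed, so every input frequency
  carries its own flow.\<close>

lemma scheme_second_part:
  fixes v :: "real ^ 'd \<Rightarrow> complex"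
  assumes v: "v \<in> sobolev s" and h: "\<And>x. 0 \<le> x \<Longrightarrow> cmod (h (- of_real x)) \<le> B"
  shows "trig_series (\<lambda>x. - \<i> * of_real \<tau> * (free_flow \<tau> v x)\<^sup>2 * lapfun h (free_flow \<tau> (\<lambda>y. cnj (v y))) x) UNIV
    (\<lambda>(k1, k2, k3). - \<i> * of_real \<tau> * (flow \<tau> k1 * flow \<tau> k2 * flow \<tau> k3) * h (- of_real (nsq k1)) *
       cnj (fourier_coeff v k1) * fourier_coeff v k2 * fourier_coeff v k3) triple_freq"
proof -
  note V = free_flow_series[OF sobolev_series[OF s v], of \<tau>]
  have fl: "flow \<tau> (- k) = flow \<tau> k" for k :: "int ^ 'd" by (simp add: flow_def)
  have "trig_series (lapfun h (free_flow \<tau> (\<lambda>y. cnj (v y)))) UNIV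
      (\<lambda>k. h (- of_real (nsq k)) * (flow \<tau> k * cnj (fourier_coeff v k))) (\<lambda>k. - k)"
    using lapfun_series_bounded[where h = h and B = B, OF free_flow_series[OF cnj_series[OF s v]] h, of \<tau>] by (simp add: fl)
  from trig_series_cmult[OF triple_series[OF this V V], of "- \<i> * of_real \<tau>"]
  show ?thesis by (rule trig_series_cong) (auto simp: power2_eq_square mult_ac)
qed

lemma scheme_quintic_part:
  fixes v :: "real ^ 'd \<Rightarrow> complex"
  assumes v: "v \<in> sobolev s"
  shows "trig_series (\<lambda>x. - of_real (\<tau>\<^sup>2 / 2) * free_flow \<tau> (\<lambda>y. of_real (cmod (v y) ^ 4) * v y) x) UNIV
    (\<lambda>(k1, k2, k3, k4, k5). - of_real (\<tau>\<^sup>2 / 2) * flow \<tau> (- k1 + k2 + k3 - k4 + k5) *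
        cnj (fourier_coeff v k1) * fourier_coeff v k2 * fourier_coeff v k3 *
        cnj (fourier_coeff v k4) * fourier_coeff v k5) quint_freq"
  using trig_series_cmult[OF free_flow_series[OF quint_series[OF s v], of \<tau>], of "- of_real (\<tau>\<^sup>2 / 2)"]
  by (rule trig_series_cong) (auto simp: quint_freq_def)

text \<open>This identity realizes the value g(\<tau>) = exp(i \<tau> l) of the difference quotient
  in physical space: propagating the factors separately differs from propagating their product
  exactly by this phase, apart from the dominant part.\<close>

lemma flow_low_phase:
  "flow \<tau> k1 * flow \<tau> k2 * flow \<tau> k3 = flow \<tau> (- k1 + k2 + k3) * exp (\<i> * of_real (\<tau> * low_phase k1 k2 k3))"
  unfolding flow_def exp_add [symmetric]
  by (rule arg_cong[where f = exp]) (simp add: low_phase_def resonance_def algebra_simps)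

lemma phi_arg: "- 2 * \<i> * complex_of_real \<tau> * - of_real x = \<i> * of_real (\<tau> * (2 * x))"
  by simp

theorem scheme_i_kernel:
  fixes v :: "real ^ 'd \<Rightarrow> complex"
  assumes \<tau>: "0 < \<tau>" and v: "v \<in> sobolev s"
  shows "is_kernel_step \<tau> (kernel_i \<tau>) v (scheme_i \<tau> v)"
proof -
  let ?h1 = "\<lambda>z. phi1 (- 2 * \<i> * of_real \<tau> * z) - phi2 (- 2 * \<i> * of_real \<tau> * z)"
    and ?h2 = "\<lambda>z. phi2 (- 2 * \<i> * of_real \<tau> * z)"
  have b1: "cmod (?h1 (- of_real x)) \<le> 2" and b2: "cmod (?h2 (- of_real x)) \<le> 1" for x
    unfolding phi_arg using norm_phi_le[of "\<tau> * (2 * x)"] norm_triangle_ineq4[of "phi1 (\<i> * of_real (\<tau> * (2 * x)))" "phi2 (\<i> * of_real (\<tau> * (2 * x)))"]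
    by (auto simp del: of_real_mult)
  note F = free_flow_series[OF sobolev_series[OF s v], of \<tau>]
  note G = trig_series_add[OF scheme_first_part[where h = ?h1 and B = 2, OF v b1] scheme_second_part[where h = ?h2 and B = 1, OF v b2], of \<tau>]
  note H = scheme_quintic_part[OF v, of \<tau>]
  \<comment> \<open>Sorting the kernel by the phase e = exp(i \<tau> l) leaves \<phi>1 - \<phi>2 for
    the jointly propagated product and \<phi>2 for the separately propagated factors.\<close>
  have c: "- \<i> * of_real \<tau> * flow \<tau> (- k1 + k2 + k3) * ?h1 (- of_real (nsq k1)) +
      - \<i> * of_real \<tau> * (flow \<tau> k1 * flow \<tau> k2 * flow \<tau> k3) * ?h2 (- of_real (nsq k1)) =
      - \<i> * flow \<tau> (- k1 + k2 + k3) * kernel_i \<tau> k1 k2 k3" for k1 k2 k3 :: "int ^ 'd"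
  proof -
    let ?\<sigma> = "\<i> * of_real (\<tau> * (2 * nsq k1))" and ?e = "exp (\<i> * of_real (\<tau> * low_phase k1 k2 k3))"
    have "kernel_i \<tau> k1 k2 k3 = of_real \<tau> * phi1 ?\<sigma> + (?e - 1) / of_real \<tau> * (of_real (\<tau>\<^sup>2) * phi2 ?\<sigma>)"
      using phi1_osc_int0[of \<tau> "2 * nsq k1"] phi2_osc_int1[of \<tau> "2 * nsq k1"] \<tau>
      unfolding kernel_i_def quotient_slope_def by simp
    also have "\<dots> = of_real \<tau> * (phi1 ?\<sigma> - phi2 ?\<sigma> + ?e * phi2 ?\<sigma>)"
      using \<tau> by (simp add: power2_eq_square field_simps)
    finally show ?thesis unfolding flow_low_phase phi_arg by (simp only:) (simp add: algebra_simps)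
  qed
  have G': "trig_series (\<lambda>x. - \<i> * of_real \<tau> * free_flow \<tau> (\<lambda>y. (v y)\<^sup>2 * lapfun ?h1 (\<lambda>y. cnj (v y)) y) x
      + - \<i> * of_real \<tau> * (free_flow \<tau> v x)\<^sup>2 * lapfun ?h2 (free_flow \<tau> (\<lambda>y. cnj (v y))) x) UNIV
      (\<lambda>(k1, k2, k3). - \<i> * flow \<tau> (- k1 + k2 + k3) * kernel_i \<tau> k1 k2 k3 *
        cnj (fourier_coeff v k1) * fourier_coeff v k2 * fourier_coeff v k3) triple_freq"
  proof (rule trig_series_cong[OF G refl])
    fix t :: "(int ^ 'd) \<times> (int ^ 'd) \<times> (int ^ 'd)"
    obtain k1 k2 k3 where t: "t = (k1, k2, k3)" by (cases t)
    show "(case t of (k1, k2, k3) \<Rightarrow> - \<i> * of_real \<tau> * flow \<tau> (- k1 + k2 + k3) * ?h1 (- of_real (nsq k1)) *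
          cnj (fourier_coeff v k1) * fourier_coeff v k2 * fourier_coeff v k3) +
        (case t of (k1, k2, k3) \<Rightarrow> - \<i> * of_real \<tau> * (flow \<tau> k1 * flow \<tau> k2 * flow \<tau> k3) * ?h2 (- of_real (nsq k1)) *
          cnj (fourier_coeff v k1) * fourier_coeff v k2 * fourier_coeff v k3) =
        (case t of (k1, k2, k3) \<Rightarrow> - \<i> * flow \<tau> (- k1 + k2 + k3) * kernel_i \<tau> k1 k2 k3 *
          cnj (fourier_coeff v k1) * fourier_coeff v k2 * fourier_coeff v k3)"
      unfolding t prod.case c [symmetric] by (simp only: distrib_right)
  qed
  show ?thesis
    by (rule is_kernel_stepI[OF F G' H]) (simp add: scheme_i_def)
qed

theorem scheme_ii_kernel:
  fixes v :: "real ^ 'd \<Rightarrow> complex"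
  assumes \<tau>: "0 < \<tau>" and v: "v \<in> sobolev s"
  shows "is_kernel_step \<tau> (kernel_ii \<tau>) v (scheme_ii \<tau> v)"
proof -
  let ?h = "\<lambda>z. phi1 (- 2 * \<i> * of_real \<tau> * z) - 1 / 2"
  have b: "cmod (?h (- of_real x)) \<le> 2" for x
    unfolding phi_arg using norm_phi_le(1)[of "\<tau> * (2 * x)"] norm_triangle_ineq4[of "phi1 (\<i> * of_real (\<tau> * (2 * x)))" "1 / 2"]
    by (auto simp del: of_real_mult)
  note F = free_flow_series[OF sobolev_series[OF s v], of \<tau>]
  note H = scheme_quintic_part[OF v, of \<tau>]
  have fl: "flow \<tau> (- k) = flow \<tau> k" for k :: "int ^ 'd" by (simp add: flow_def)
  have "trig_series (free_flow \<tau> (\<lambda>y. cnj (v y))) UNIV (\<lambda>k. flow \<tau> k * cnj (fourier_coeff v k)) (\<lambda>k. - k)"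
    using free_flow_series[OF cnj_series[OF s v], of \<tau>] by (simp add: fl)
  note G2 = trig_series_cmult[OF triple_series[OF this F F], of "- \<i> * of_real \<tau> / 2"]
  note G = trig_series_add[OF scheme_first_part[where h = ?h and B = 2, OF v b] G2]
  \<comment> \<open>The same sorting as for (i), with \<phi>2 replaced by its value 1/2 at
    0.\<close>
  have c: "- \<i> * of_real \<tau> * flow \<tau> (- k1 + k2 + k3) * ?h (- of_real (nsq k1)) +
      - \<i> * of_real \<tau> / 2 * (flow \<tau> k1 * flow \<tau> k2 * flow \<tau> k3) =
      - \<i> * flow \<tau> (- k1 + k2 + k3) * kernel_ii \<tau> k1 k2 k3" for k1 k2 k3 :: "int ^ 'd"
  proof -
    let ?\<sigma> = "\<i> * of_real (\<tau> * (2 * nsq k1))" and ?e = "exp (\<i> * of_real (\<tau> * low_phase k1 k2 k3))"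
    have "kernel_ii \<tau> k1 k2 k3 = of_real \<tau> * phi1 ?\<sigma> + (?e - 1) / of_real \<tau> * of_real (\<tau>\<^sup>2 / 2)"
      using phi1_osc_int0[of \<tau> "2 * nsq k1"] \<tau> unfolding kernel_ii_def quotient_slope_def by simp
    also have "\<dots> = of_real \<tau> * (phi1 ?\<sigma> - 1 / 2 + ?e / 2)"
      using \<tau> by (simp add: power2_eq_square field_simps)
    finally show ?thesis unfolding flow_low_phase phi_arg by (simp only:) (simp add: algebra_simps)
  qed
  have G': "trig_series (\<lambda>x. - \<i> * of_real \<tau> * free_flow \<tau> (\<lambda>y. (v y)\<^sup>2 * lapfun ?h (\<lambda>y. cnj (v y)) y) x
      - \<i> * of_real \<tau> / 2 * (free_flow \<tau> v x)\<^sup>2 * free_flow \<tau> (\<lambda>y. cnj (v y)) x) UNIV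
      (\<lambda>(k1, k2, k3). - \<i> * flow \<tau> (- k1 + k2 + k3) * kernel_ii \<tau> k1 k2 k3 *
        cnj (fourier_coeff v k1) * fourier_coeff v k2 * fourier_coeff v k3) triple_freq"
  proof (rule trig_series_cong[OF G])
    fix t :: "(int ^ 'd) \<times> (int ^ 'd) \<times> (int ^ 'd)"
    obtain k1 k2 k3 where t: "t = (k1, k2, k3)" by (cases t)
    show "(case t of (k1, k2, k3) \<Rightarrow> - \<i> * of_real \<tau> * flow \<tau> (- k1 + k2 + k3) * ?h (- of_real (nsq k1)) *
          cnj (fourier_coeff v k1) * fourier_coeff v k2 * fourier_coeff v k3) +
        - \<i> * of_real \<tau> / 2 * (case t of (k1, k2, k3) \<Rightarrow> flow \<tau> k1 * cnj (fourier_coeff v k1) *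
          (flow \<tau> k2 * fourier_coeff v k2) * (flow \<tau> k3 * fourier_coeff v k3)) =
        (case t of (k1, k2, k3) \<Rightarrow> - \<i> * flow \<tau> (- k1 + k2 + k3) * kernel_ii \<tau> k1 k2 k3 *
          cnj (fourier_coeff v k1) * fourier_coeff v k2 * fourier_coeff v k3)"
      unfolding t prod.case c [symmetric] by (simp add: algebra_simps)
  qed (simp add: power2_eq_square mult_ac)
  show ?thesis
    by (rule is_kernel_stepI[OF F G' H]) (simp add: scheme_ii_def)
qed

section \<open>The scheme (iii) as a kernel step\<close>

lemma weighted_triple_summable:
  fixes v :: "real ^ 'd \<Rightarrow> complex"
  assumes v: "v \<in> sobolev (s + 2)"
    and m: "\<And>k1 k2 k3. cmod (m k1 k2 k3) \<le> C * (jb k1 * jb k2 * jb k3) powr (2 / 2)"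
  shows "(\<lambda>(k1, k2, k3). cmod (m k1 k2 k3 * (cnj (fourier_coeff v k1) * fourier_coeff v k2 * fourier_coeff v k3))) summable_on UNIV"
proof -
  let ?b = "\<lambda>k. of_real (jb k powr (2 / 2)) * fourier_coeff v k"
  have b: "(\<lambda>k. cmod (?b k)) summable_on UNIV"
    using sobolev_sob_le[OF v] by (intro sob_le_l1(1)[OF s, of ?b "sobolev_norm (s + 2) v"]) (simp only: sob_le_weight)
  have "(\<lambda>(k2, k3). cmod (?b k2 * ?b k3)) summable_on UNIV \<times> UNIV" by (rule summable_norm_product[OF b b])
  then have "(\<lambda>p. cmod (?b (fst p) * ?b (snd p))) summable_on UNIV" by (simp add: case_prod_unfold)
  from summable_norm_product[OF b this]
  have "(\<lambda>(k1, p). C * cmod (?b k1 * (?b (fst p) * ?b (snd p)))) summable_on UNIV"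
    by (simp add: case_prod_unfold summable_on_cmult_right)
  then have "(\<lambda>t. norm (case t of (k1, k2, k3) \<Rightarrow> m k1 k2 k3 * (cnj (fourier_coeff v k1) * fourier_coeff v k2 * fourier_coeff v k3))) summable_on UNIV"
  proof (rule Infinite_Sum.abs_summable_on_comparison_test')
    fix t :: "(int ^ 'd) \<times> (int ^ 'd) \<times> (int ^ 'd)"
    obtain k1 k2 k3 where [simp]: "t = (k1, k2, k3)" by (cases t)
    have "cmod (m k1 k2 k3) * (cmod (fourier_coeff v k1) * cmod (fourier_coeff v k2) * cmod (fourier_coeff v k3)) \<le>
        C * (jb k1 * jb k2 * jb k3) powr (2 / 2) * (cmod (fourier_coeff v k1) * cmod (fourier_coeff v k2) * cmod (fourier_coeff v k3))"
      by (intro mult_right_mono m) auto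
    then show "norm (case t of (k1, k2, k3) \<Rightarrow> m k1 k2 k3 * (cnj (fourier_coeff v k1) * fourier_coeff v k2 * fourier_coeff v k3)) \<le>
        (case t of (k1, p) \<Rightarrow> C * cmod (?b k1 * (?b (fst p) * ?b (snd p))))"
      by (simp add: norm_mult mult_ac)
  qed
  then show ?thesis by (simp add: case_prod_unfold)
qed

lemma cubic_series:
  fixes v :: "real ^ 'd \<Rightarrow> complex"
  assumes v: "v \<in> sobolev s"
  shows "trig_series (\<lambda>y. of_real ((cmod (v y))\<^sup>2) * v y) UNIV
    (\<lambda>(k1, k2, k3). cnj (fourier_coeff v k1) * fourier_coeff v k2 * fourier_coeff v k3) triple_freq"
proof -
  note V = sobolev_series[OF s v]
  show ?thesis
    by (rule trig_series_cong[OF triple_series[OF cnj_series[OF s v] V V]])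
      (simp_all add: complex_norm_square mult_ac del: of_real_power)
qed

text \<open>Each Laplacian contributes minus the squared frequency of its factor; the term with
  coefficient 2 is split into two copies, with the Laplacian on the second and on the third factor.
  Together they give the part |k1|^2 - |k2|^2 - |k3|^2 of R.\<close>

lemma derivative_part_series:
  fixes v :: "real ^ 'd \<Rightarrow> complex"
  assumes v: "v \<in> sobolev (s + 2)"
  shows "trig_series (\<lambda>y. - (v y)\<^sup>2 * laplace (\<lambda>y. cnj (v y)) y + 2 * of_real ((cmod (v y))\<^sup>2) * laplace v y) UNIV
    (\<lambda>(k1, k2, k3). of_real (nsq k1 - nsq k2 - nsq k3) *
      (cnj (fourier_coeff v k1) * fourier_coeff v k2 * fourier_coeff v k3)) triple_freq"
proof -
  have v0: "v \<in> sobolev s" using v by (rule sobolev_order_mono) simp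
  note V = sobolev_series[OF s v0] and C = cnj_series[OF s v0] and L = laplace_series[OF s v]
  have "trig_series (laplace (\<lambda>y. cnj (v y))) UNIV (\<lambda>k. - of_real (nsq (- k)) * cnj (fourier_coeff v k)) (\<lambda>k. - k)"
    by (rule trig_series_lapfun[OF C]) (use trig_series_summable[OF L] in \<open>simp add: norm_mult\<close>)
  note D = trig_series_cmult[OF triple_series[OF this V V], of "- 1"]
  from trig_series_add[OF D trig_series_add[OF triple_series[OF C L V] triple_series[OF C V L]]]
  show ?thesis
  proof (rule trig_series_cong)
    show "- 1 * (laplace (\<lambda>y. cnj (v y)) x * v x * v x) + (cnj (v x) * laplace v x * v x + cnj (v x) * v x * laplace v x) =
        - (v x)\<^sup>2 * laplace (\<lambda>y. cnj (v y)) x + 2 * of_real ((cmod (v x))\<^sup>2) * laplace v x" for x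
      unfolding complex_norm_square by (simp add: power2_eq_square algebra_simps)
  qed (auto simp: algebra_simps)
qed

text \<open>The remaining part |k|^2 of R comes from the Laplacian applied to the whole product
  |v|^2 v; together with \<open>derivative_part_series\<close> the bracket reproduces R.\<close>

theorem scheme_iii_kernel:
  fixes v :: "real ^ 'd \<Rightarrow> complex"
  assumes \<tau>: "0 < \<tau>" and v: "v \<in> sobolev (s + 2)"
  shows "is_kernel_step \<tau> (kernel_iii \<tau>) v (scheme_iii (\<lambda>_. 1) (\<lambda>_. 1) (\<lambda>_. 1) \<tau> v)"
proof -
  have v0: "v \<in> sobolev s" using v by (rule sobolev_order_mono) simp
  let ?c = "\<lambda>k1 k2 k3. cnj (fourier_coeff v k1) * fourier_coeff v k2 * fourier_coeff v k3"
  let ?h = "\<lambda>z. 1 - \<i> * 1 * (1 / 2) * of_real \<tau> * z"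
  let ?N = "\<lambda>y. of_real ((cmod (v y))\<^sup>2) * v y" and ?B = "\<lambda>y. of_real (cmod (v y) ^ 4) * v y"
  let ?A = "\<lambda>y. - (v y)\<^sup>2 * laplace (\<lambda>y. cnj (v y)) y + 2 * of_real ((cmod (v y))\<^sup>2) * laplace v y"
  note F = free_flow_series[OF sobolev_series[OF s v0], of \<tau>]
  note H = scheme_quintic_part[OF v0, of \<tau>]
  note A = derivative_part_series[OF v] and B = quint_series[OF s v0]
  have hb: "cmod (?h (- of_real (nsq (- k1 + k2 + k3)))) \<le> (1 + 15 * \<tau>) * (jb k1 * jb k2 * jb k3) powr (2 / 2)"
    for k1 k2 k3 :: "int ^ 'd"
  proof -
    let ?P = "(jb k1 * jb k2 * jb k3) powr (2 / 2)"
    have "jb (- k1 + k2 + k3) \<le> 9 * jb k1 + 9 * jb k2 + 9 * jb k3"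
      using jb_triad[of k1 k2 k3 "- k1 + k2 + k3" 1] by (simp add: triads_def)
    moreover have "jb k1 \<le> ?P" "jb k2 \<le> ?P" "jb k3 \<le> ?P" using jb_products[of k1 k2 k3] jb_products(2)[of k2 k1 k3] jb_products(3)[of k3 k1 k2] by simp_all
    ultimately have n: "nsq (- k1 + k2 + k3) \<le> 30 * ?P" unfolding jb_def[of "- k1 + k2 + k3"]
      using triple_powr_ge_1[of "2 / 2" k1 k2 k3] by linarith
    have "cmod (?h (- of_real (nsq (- k1 + k2 + k3)))) \<le> 1 + \<tau> / 2 * nsq (- k1 + k2 + k3)"
      using norm_triangle_ineq[of 1 "\<i> * of_real (\<tau> / 2 * nsq (- k1 + k2 + k3))"] \<tau>
      by (simp add: norm_mult norm_divide norm_power mult_ac)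
    also have "\<dots> \<le> ?P + \<tau> / 2 * (30 * ?P)"
      using \<tau> n by (intro add_mono mult_left_mono triple_powr_ge_1) auto
    finally show ?thesis by (simp add: algebra_simps)
  qed
  have N: "trig_series (lapfun ?h ?N) UNIV
      (\<lambda>t. ?h (- of_real (nsq (triple_freq t))) * (case t of (k1, k2, k3) \<Rightarrow> ?c k1 k2 k3)) triple_freq"
  proof (rule trig_series_lapfun[OF cubic_series[OF v0]])
    show "(\<lambda>t. cmod (?h (- of_real (nsq (triple_freq t))) * (case t of (k1, k2, k3) \<Rightarrow> ?c k1 k2 k3))) summable_on UNIV"
      using weighted_triple_summable[OF v hb] by (simp only: triple_freq_def case_prod_unfold)
  qed
  note G = trig_series_add[OF trig_series_cmult[OF free_flow_series[OF N, of \<tau>], of "- \<i> * of_real \<tau>"]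
      trig_series_cmult[OF free_flow_series[OF A, of \<tau>], of "of_real (\<tau>\<^sup>2 / 2)"]]
  have c: "- \<i> * of_real \<tau> * (flow \<tau> (- k1 + k2 + k3) * (?h (- of_real (nsq (- k1 + k2 + k3))) * z)) +
      of_real (\<tau>\<^sup>2 / 2) * (flow \<tau> (- k1 + k2 + k3) * (of_real (nsq k1 - nsq k2 - nsq k3) * z)) =
      - \<i> * flow \<tau> (- k1 + k2 + k3) * kernel_iii \<tau> k1 k2 k3 * z" for k1 k2 k3 :: "int ^ 'd" and z
    by (simp add: kernel_iii_def resonance_def power2_eq_square field_simps)
  have G': "trig_series (\<lambda>x. - \<i> * of_real \<tau> * free_flow \<tau> (lapfun ?h ?N) x + of_real (\<tau>\<^sup>2 / 2) * free_flow \<tau> ?A x) UNIV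
      (\<lambda>(k1, k2, k3). - \<i> * flow \<tau> (- k1 + k2 + k3) * kernel_iii \<tau> k1 k2 k3 *
        cnj (fourier_coeff v k1) * fourier_coeff v k2 * fourier_coeff v k3) triple_freq"
  proof (rule trig_series_cong[OF G refl])
    fix t :: "(int ^ 'd) \<times> (int ^ 'd) \<times> (int ^ 'd)"
    obtain k1 k2 k3 where t: "t = (k1, k2, k3)" by (cases t)
    show "- \<i> * of_real \<tau> * (flow \<tau> (triple_freq t) * (?h (- of_real (nsq (triple_freq t))) * (case t of (k1, k2, k3) \<Rightarrow> ?c k1 k2 k3))) +
        of_real (\<tau>\<^sup>2 / 2) * (flow \<tau> (triple_freq t) * (case t of (k1, k2, k3) \<Rightarrow> of_real (nsq k1 - nsq k2 - nsq k3) * ?c k1 k2 k3)) =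
        (case t of (k1, k2, k3) \<Rightarrow> - \<i> * flow \<tau> (- k1 + k2 + k3) * kernel_iii \<tau> k1 k2 k3 *
        cnj (fourier_coeff v k1) * fourier_coeff v k2 * fourier_coeff v k3)"
      using c[of k1 k2 k3 "?c k1 k2 k3"] unfolding t triple_freq_def prod.case by (simp only: mult.assoc)
  qed
  \<comment> \<open>With the trivial filter the bracket splits, so that its quintic part can be
    matched separately.\<close>
  have AB: "free_flow \<tau> (lapfun (\<lambda>z. 1) (\<lambda>y. ?A y - ?B y)) x = free_flow \<tau> ?A x - free_flow \<tau> ?B x" for x
  proof -
    have "trig_series (\<lambda>y. ?A y - ?B y) UNIV (\<lambda>k. fourier_coeff ?A k - fourier_coeff ?B k) (\<lambda>k. k)"
      by (rule trig_series_minus[OF trig_series_canonical[OF A] trig_series_canonical[OF B]])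
    from lapfun_one[OF this] show ?thesis by (simp only: free_flow_diff[OF A B])
  qed
  show ?thesis
  proof (rule is_kernel_stepI[OF F G' H])
    fix x
    have "scheme_iii (\<lambda>_. 1) (\<lambda>_. 1) (\<lambda>_. 1) \<tau> v x = free_flow \<tau> v x - \<i> * of_real \<tau> * free_flow \<tau> (lapfun ?h ?N) x +
        of_real (\<tau>\<^sup>2 / 2) * free_flow \<tau> (lapfun (\<lambda>z. 1) (\<lambda>y. ?A y - ?B y)) x"
      unfolding scheme_iii_def by (rule refl)
    then show "scheme_iii (\<lambda>_. 1) (\<lambda>_. 1) (\<lambda>_. 1) \<tau> v x = free_flow \<tau> v x +
        (- \<i> * of_real \<tau> * free_flow \<tau> (lapfun ?h ?N) x + of_real (\<tau>\<^sup>2 / 2) * free_flow \<tau> ?A x) +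
        - of_real (\<tau>\<^sup>2 / 2) * free_flow \<tau> ?B x"
      unfolding AB by (simp add: right_diff_distrib)
  qed
qed

end

section \<open>Local errors\<close>

lemma sobolev_norm_mono:
  "f \<in> sobolev \<sigma> \<Longrightarrow> \<sigma>' \<le> \<sigma> \<Longrightarrow> sobolev_norm \<sigma>' f \<le> sobolev_norm \<sigma> f"
  by (intro sob_le_sobolev_norm sob_le_order_mono[OF sobolev_sob_le])

text \<open>The norm of a solution is continuous in time by the reverse triangle inequality, and
  [0, T] is compact. This makes the supremum in the local error the supremum of a bounded
  set.\<close>

lemma sobolev_norm_bounded:
  fixes u :: "real \<Rightarrow> real ^ 'd::finite \<Rightarrow> complex"
  assumes u: "nls_solution \<sigma> T u"
  obtains B where "\<And>t. t \<in> {0..T} \<Longrightarrow> sobolev_norm \<sigma> (u t) \<le> B"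
proof -
  let ?N = "\<lambda>t. sobolev_norm \<sigma> (u t)"
  have us: "u t \<in> sobolev \<sigma>" if "t \<in> {0..T}" for t using u that by (simp add: nls_solution_def)
  have tri: "?N r \<le> ?N t + sobolev_norm \<sigma> (\<lambda>x. u r x - u t x)" "?N t \<le> ?N r + sobolev_norm \<sigma> (\<lambda>x. u r x - u t x)"
    if "r \<in> {0..T}" "t \<in> {0..T}" for r t
  proof -
    note D = sobolev_sob_le[OF sobolev_diff[OF us[OF that(1)] us[OF that(2)]]]
    note d = D[unfolded fourier_coeff_diff_sobolev[OF us[OF that(1)] us[OF that(2)]]]
    show "?N r \<le> ?N t + sobolev_norm \<sigma> (\<lambda>x. u r x - u t x)"
      using sob_le_sobolev_norm[of \<sigma> "u r"] sob_le_add[OF sobolev_sob_le[OF us[OF that(2)]] d] by simp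
    show "?N t \<le> ?N r + sobolev_norm \<sigma> (\<lambda>x. u r x - u t x)"
      using sob_le_sobolev_norm[of \<sigma> "u t"] sob_le_diff[OF sobolev_sob_le[OF us[OF that(1)]] d] by simp
  qed
  have "continuous_on {0..T} ?N"
    unfolding continuous_on_def
  proof (intro ballI)
    fix t assume t: "t \<in> {0..T}"
    have "((\<lambda>r. ?N r - ?N t) \<longlongrightarrow> 0) (at t within {0..T})"
    proof (rule Lim_null_comparison)
      show "((\<lambda>r. sobolev_norm \<sigma> (\<lambda>x. u r x - u t x)) \<longlongrightarrow> 0) (at t within {0..T})"
        using u t by (simp add: nls_solution_def)
      have "norm (?N r - ?N t) \<le> sobolev_norm \<sigma> (\<lambda>x. u r x - u t x)" if "r \<in> {0..T}" for r
        using tri[OF that t] by (simp add: abs_le_iff)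
      then show "\<forall>\<^sub>F r in at t within {0..T}. norm (?N r - ?N t) \<le> sobolev_norm \<sigma> (\<lambda>x. u r x - u t x)"
        unfolding eventually_at_filter by (intro always_eventually) auto
    qed
    then show "(?N \<longlongrightarrow> ?N t) (at t within {0..T})" by (simp add: Lim_null[symmetric])
  qed
  then have "bounded (?N ` {0..T})" by (intro compact_imp_bounded compact_continuous_image) auto
  then obtain B where B: "\<forall>x\<in>?N ` {0..T}. norm x \<le> B" unfolding bounded_iff by blast
  have "?N t \<le> B" if "t \<in> {0..T}" for t
    using B[rule_format, OF imageI[OF that]] by simp
  then show ?thesis by (rule that)
qed

context
  fixes s :: real
  assumes s: "s > real CARD('d::finite) / 2"
begin

text \<open>With \<open>q(x) = 1 + x\<^sup>7\<close> a supremum \<open>B\<close> of the values of \<open>q\<close> bounds the norms themselves by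
  \<open>(B - 1)\<^bsup>1/7\<^esup>\<close>.\<close>

lemma local_error_orderI:
  fixes \<Phi> :: "real \<Rightarrow> (real ^ 'd \<Rightarrow> complex) \<Rightarrow> real ^ 'd \<Rightarrow> complex"
  assumes c: "1 \<le> c" "0 \<le> c'" "0 \<le> K"
    and nonneg: "\<And>f. 0 \<le> Lnorm f"
    and lower: "\<And>f. f \<in> sobolev (s + p) \<Longrightarrow> sob_le (s + p) (fourier_coeff f) (c * (sobolev_norm s f + Lnorm f))"
    and upper: "\<And>f. f \<in> sobolev (s + p) \<Longrightarrow> sobolev_norm s f + Lnorm f \<le> c' * sobolev_norm (s + p) f"
    and error: "\<And>\<tau> u M. 0 < \<tau> \<Longrightarrow> nls_solution (s + p) \<tau> u \<Longrightarrow>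
        (\<And>t. t \<in> {0..\<tau>} \<Longrightarrow> sob_le (s + p) (fourier_coeff (u t)) M) \<Longrightarrow>
        (\<lambda>x. u \<tau> x - \<Phi> \<tau> (u 0) x) \<in> sobolev s \<and>
        sob_le s (fourier_coeff (\<lambda>x. u \<tau> x - \<Phi> \<tau> (u 0) x)) (K * \<tau> ^ 3 * (1 + M ^ 7))"
  shows "local_error_order s (s + p) \<Phi> 3 Lnorm"
  unfolding local_error_order_def
proof (rule exI[of _ "K * c ^ 7"], rule exI[of _ "1 + monom 1 7"], intro allI impI conjI)
  fix \<tau> :: real and u :: "real \<Rightarrow> real ^ 'd \<Rightarrow> complex"
  assume \<tau>: "0 < \<tau>" and u: "nls_solution (s + p) \<tau> u"
  let ?q = "1 + monom 1 7 :: real poly"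
  let ?f = "\<lambda>t. sobolev_norm s (u t) + Lnorm (u t)"
  let ?B = "SUP t\<in>{0..\<tau>}. poly ?q (?f t)"
  have us: "u t \<in> sobolev (s + p)" if "t \<in> {0..\<tau>}" for t using u that by (simp add: nls_solution_def)
  have q: "poly ?q x = 1 + x ^ 7" for x by (simp add: poly_monom)
  have f0: "0 \<le> ?f t" for t by (simp add: sobolev_norm_nonneg nonneg)
  obtain N where N: "\<And>t. t \<in> {0..\<tau>} \<Longrightarrow> sobolev_norm (s + p) (u t) \<le> N"
    using sobolev_norm_bounded[OF u] by blast
  \<comment> \<open>A supremum bounds its members only for sets bounded above, which
    \<open>upper\<close> guarantees.\<close>
  have bdd: "bdd_above ((\<lambda>t. poly ?q (?f t)) ` {0..\<tau>})"
  proof (rule bdd_aboveI2)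
    fix t assume t: "t \<in> {0..\<tau>}"
    have "?f t \<le> c' * N" using upper[OF us[OF t]] mult_left_mono[OF N[OF t] c(2)] by linarith
    then show "poly ?q (?f t) \<le> 1 + (c' * N) ^ 7" unfolding q using f0 by (simp add: power_mono)
  qed
  have B: "1 + ?f t ^ 7 \<le> ?B" if "t \<in> {0..\<tau>}" for t
    using cSUP_upper[OF that bdd] by (simp only: q)
  have B1: "1 \<le> ?B"
  proof -
    have "0 \<le> ?f 0 ^ 7" using f0 by (rule zero_le_power)
    moreover have "0 \<in> {0..\<tau>}" using \<tau> by simp
    note B[OF this]
    ultimately show ?thesis by linarith
  qed
  define m where "m = root 7 (?B - 1)"
  have m: "?f t \<le> m" if "t \<in> {0..\<tau>}" for t
  proof -
    have "?f t = root 7 (?f t ^ 7)" using f0 by (simp add: real_root_power_cancel)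
    also have "\<dots> \<le> m" unfolding m_def using B[OF that] by (intro real_root_le_mono) auto
    finally show ?thesis .
  qed
  have m7: "m ^ 7 = ?B - 1" unfolding m_def using B1 by simp
  have "sob_le (s + p) (fourier_coeff (u t)) (c * m)" if "t \<in> {0..\<tau>}" for t
    using lower[OF us[OF that]] by (rule sob_le_bound) (use c m[OF that] in auto)
  note E = error[OF \<tau> u this]
  show "(\<lambda>x. u \<tau> x - \<Phi> \<tau> (u 0) x) \<in> sobolev s" using E by blast
  have "sobolev_norm s (\<lambda>x. u \<tau> x - \<Phi> \<tau> (u 0) x) \<le> K * \<tau> ^ 3 * (1 + (c * m) ^ 7)"
    using E sob_le_sobolev_norm by blast
  also have "\<dots> \<le> K * \<tau> ^ 3 * (c ^ 7 * ?B)"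
  proof (rule mult_left_mono)
    \<comment> \<open>The summand 1 in 1 + (c m)^7 is absorbed because c^7 is at least 1.\<close>
    have "1 \<le> c ^ 7" using c by simp
    then have "1 + c ^ 7 * (?B - 1) \<le> c ^ 7 * ?B" by (simp add: algebra_simps)
    then show "1 + (c * m) ^ 7 \<le> c ^ 7 * ?B" by (simp add: power_mult_distrib m7)
  qed (use c \<tau> in simp)
  finally show "sobolev_norm s (\<lambda>x. u \<tau> x - \<Phi> \<tau> (u 0) x) \<le> (K * c ^ 7) * \<tau> ^ 3 * ?B"
    by (simp add: mult_ac)
qed

section \<open>Sobolev norms controlled by differential operators\<close>

lemma laplace_coeff:
  fixes f :: "real ^ 'd \<Rightarrow> complex"
  assumes "f \<in> sobolev (s + 2)"
  shows "fourier_coeff (laplace f) = (\<lambda>k. - of_real (nsq k) * fourier_coeff f k)"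
  using trig_series_UNIV_coeff[OF laplace_series[OF s assms]] by auto

lemma laplace_sobolev:
  fixes f :: "real ^ 'd \<Rightarrow> complex"
  assumes "f \<in> sobolev (s + 2)"
  shows "laplace f \<in> sobolev s" "sobolev_norm s (laplace f) \<le> sobolev_norm (s + 2) f"
proof -
  note L = sob_le_laplace[OF sobolev_sob_le[OF assms]]
  show "laplace f \<in> sobolev s" by (rule trig_series_sobolev[OF laplace_series[OF s assms] L])
  show "sobolev_norm s (laplace f) \<le> sobolev_norm (s + 2) f"
    by (rule sob_le_sobolev_norm) (use L in \<open>simp add: laplace_coeff[OF assms]\<close>)
qed

text \<open>The coefficients of f - \<Delta>f are exactly \<open>jb k\<close> times those of f, so
  the triangle inequality gives the constant 1.\<close>

lemma laplace_controls:
  fixes f :: "real ^ 'd \<Rightarrow> complex"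
  assumes f: "f \<in> sobolev (s + 2)"
  shows "sob_le (s + 2) (fourier_coeff f) (1 * (sobolev_norm s f + sobolev_norm s (laplace f)))"
proof -
  have f0: "f \<in> sobolev s" using f by (rule sobolev_order_mono) simp
  show ?thesis
  proof (rule sob_le_weighted_mono[OF sob_le_diff[OF sobolev_sob_le[OF f0] sobolev_sob_le[OF laplace_sobolev(1)[OF f]]]])
    fix k
    have "fourier_coeff f k - fourier_coeff (laplace f) k = of_real (jb k) * fourier_coeff f k"
      by (simp add: laplace_coeff[OF f] jb_def algebra_simps)
    then show "jb k powr ((s + 2) / 2) * cmod (fourier_coeff f k) \<le>
        jb k powr (s / 2) * cmod (fourier_coeff f k - fourier_coeff (laplace f) k)"
      by (simp add: norm_mult add_divide_distrib powr_add)
  qed simp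
qed

text \<open>The weight (1 + x)^2 with x = |k|^2 is at most 2 (1 + x^2), the symbol that maps f to 2
  (f + \<Delta>^2 f).\<close>

lemma bilaplace_controls:
  fixes f :: "real ^ 'd \<Rightarrow> complex"
  assumes f: "f \<in> sobolev (s + 4)"
  shows "sob_le (s + 4) (fourier_coeff f) (2 * (sobolev_norm s f + sobolev_norm s (laplace (laplace f))))"
    and "sobolev_norm s (laplace (laplace f)) \<le> sobolev_norm (s + 4) f"
proof -
  have f0: "f \<in> sobolev s" and f2: "f \<in> sobolev (s + 2)" using f by (auto elim: sobolev_order_mono)
  have l: "laplace f \<in> sobolev (s + 2)"
  proof (rule trig_series_sobolev[OF laplace_series[OF s f2]])
    show "sob_le (s + 2) (\<lambda>k. - of_real (nsq k) * fourier_coeff f k) (sobolev_norm (s + 4) f)"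
      using sob_le_laplace[of "s + 2" "fourier_coeff f"] sobolev_sob_le[OF f] by (simp add: add.assoc)
  qed
  have cc: "fourier_coeff (laplace (laplace f)) k = of_real ((nsq k)\<^sup>2) * fourier_coeff f k" for k
    by (simp add: laplace_coeff[OF l] laplace_coeff[OF f2] power2_eq_square)
  note D = sob_le_add[OF sobolev_sob_le[OF f0] sobolev_sob_le[OF laplace_sobolev(1)[OF l]]]
  show "sob_le (s + 4) (fourier_coeff f) (2 * (sobolev_norm s f + sobolev_norm s (laplace (laplace f))))"
  proof (rule sob_le_weighted_mono[OF sob_le_cmult[OF D, of 2]])
    fix k :: "int ^ 'd"
    have "jb k powr ((s + 4) / 2) = jb k powr (s / 2) * (jb k)\<^sup>2"
      by (simp add: add_divide_distrib powr_add powr_numeral)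
    moreover have "(jb k)\<^sup>2 \<le> 2 * (1 + (nsq k)\<^sup>2)"
      using sum_squares_bound[of 1 "nsq k"] unfolding jb_def by (simp add: power2_eq_square algebra_simps)
    moreover have "cmod (2 * (fourier_coeff f k + fourier_coeff (laplace (laplace f)) k)) = 2 * (1 + (nsq k)\<^sup>2) * cmod (fourier_coeff f k)"
    proof -
      have "2 * (fourier_coeff f k + fourier_coeff (laplace (laplace f)) k) = of_real (2 * (1 + (nsq k)\<^sup>2)) * fourier_coeff f k"
        by (simp add: cc algebra_simps)
      moreover have "0 \<le> 2 * (1 + (nsq k)\<^sup>2)" by simp
      ultimately show ?thesis by (simp only: norm_mult norm_of_real abs_of_nonneg)
    qed
    ultimately show "jb k powr ((s + 4) / 2) * cmod (fourier_coeff f k) \<le>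
        jb k powr (s / 2) * cmod (2 * (fourier_coeff f k + fourier_coeff (laplace (laplace f)) k))"
      by (simp add: mult.assoc mult_left_mono mult_right_mono)
  qed simp
  have "sobolev_norm s (laplace (laplace f)) \<le> sobolev_norm (s + 2) (laplace f)" by (rule laplace_sobolev(2)[OF l])
  also have "\<dots> \<le> sobolev_norm (s + 4) f"
    using sob_le_laplace[of "s + 2" "fourier_coeff f"] sobolev_sob_le[OF f]
    by (intro sob_le_sobolev_norm) (simp add: laplace_coeff[OF f2] add.assoc)
  finally show "sobolev_norm s (laplace (laplace f)) \<le> sobolev_norm (s + 4) f" .
qed

end

text \<open>A component of k is at most <k>, so one derivative costs one order. The bound is stated
  for coefficient sequences so that it can be iterated.\<close>

lemma partial_series:
  fixes f :: "real ^ 'd::finite \<Rightarrow> complex"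
  assumes \<sigma>: "\<sigma> > real CARD('d) / 2" and f: "trig_series f UNIV a (\<lambda>k. k)" and a: "sob_le (\<sigma> + 1) a A"
  shows "trig_series (partial b f) UNIV (\<lambda>k. \<i> * of_int (k $ b) * a k) (\<lambda>k. k)"
    and "sob_le \<sigma> (\<lambda>k. \<i> * of_int (k $ b) * a k) A"
proof -
  show B: "sob_le \<sigma> (\<lambda>k. \<i> * of_int (k $ b) * a k) A"
  proof (rule sob_le_weighted_mono[OF a])
    fix k :: "int ^ 'd"
    have "(real_of_int (k $ b))\<^sup>2 \<le> (norm (rvec k))\<^sup>2"
      using power_mono[OF component_le_norm_cart[of "rvec k" b], of 2] by (simp add: rvec_def)
    then have "\<bar>real_of_int (k $ b)\<bar> \<le> jb k powr (1 / 2)"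
      by (simp add: powr_half_sqrt jb_def real_le_rsqrt)
    then have "jb k powr (\<sigma> / 2) * \<bar>real_of_int (k $ b)\<bar> * cmod (a k) \<le> jb k powr (\<sigma> / 2) * jb k powr (1 / 2) * cmod (a k)"
      by (intro mult_right_mono mult_left_mono) auto
    then show "jb k powr (\<sigma> / 2) * cmod (\<i> * of_int (k $ b) * a k) \<le> jb k powr ((\<sigma> + 1) / 2) * cmod (a k)"
      by (simp add: norm_mult add_divide_distrib powr_add mult_ac)
  qed simp
  show "trig_series (partial b f) UNIV (\<lambda>k. \<i> * of_int (k $ b) * a k) (\<lambda>k. k)"
    unfolding partial_def by (rule trig_series_multiplier[OF f]) (rule sob_le_l1(1)[OF \<sigma> B])
qed

text \<open>The squared symbols of all third derivatives add up to |k|^6, so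
  \<open>grad3_norm\<close> is the H^s norm of |k|^3 times the coefficients. There are d^3 third
  derivatives, whence the root in the second bound.\<close>

lemma grad3_controls:
  fixes f :: "real ^ 'd::finite \<Rightarrow> complex"
  assumes s: "s > real CARD('d) / 2" and f: "f \<in> sobolev (s + 3)"
  shows "sob_le (s + 3) (fourier_coeff f) (4 * (sobolev_norm s f + grad3_norm s f))"
    and "grad3_norm s f \<le> sqrt (real CARD('d) ^ 3) * sobolev_norm (s + 3) f"
proof -
  let ?a = "fourier_coeff f" and ?N = "sobolev_norm (s + 3) f"
  let ?D = "\<lambda>a b c. partial a (partial b (partial c f))"
  have f0: "f \<in> sobolev s" using f by (rule sobolev_order_mono) simp
  have F: "trig_series f UNIV ?a (\<lambda>k. k)" by (rule sobolev_series[OF s f0])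
  have A: "sob_le (s + 1 + 1 + 1) ?a ?N" using sobolev_sob_le[OF f] by (simp add: add.assoc)
  have s1: "s + 1 > real CARD('d) / 2" "s + 1 + 1 > real CARD('d) / 2" using s by auto
  note P1 = partial_series[OF s1(2) F A]
  note P2 = partial_series[OF s1(1) P1]
  note P3 = partial_series[OF s P2]
  have D: "?D a b c \<in> sobolev s" for a b c by (rule trig_series_sobolev[OF P3])
  have coeff: "fourier_coeff (?D a b c) k = \<i> * of_int (k $ a) * (\<i> * of_int (k $ b) * (\<i> * of_int (k $ c) * ?a k))" for a b c k
    using trig_series_UNIV_coeff[OF P3(1)] .
  have Dn: "sobolev_norm s (?D a b c) \<le> ?N" for a b c
  proof (rule sob_le_sobolev_norm)
    have "fourier_coeff (?D a b c) = (\<lambda>k. \<i> * of_int (k $ a) * (\<i> * of_int (k $ b) * (\<i> * of_int (k $ c) * ?a k)))"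
      by (rule ext) (rule coeff)
    then show "sob_le s (fourier_coeff (?D a b c)) ?N" using P3(2) by (simp only:)
  qed
  have "(grad3_norm s f)\<^sup>2 = (\<Sum>a\<in>UNIV. \<Sum>b\<in>UNIV. \<Sum>c\<in>UNIV. (sobolev_norm s (?D a b c))\<^sup>2)"
    unfolding grad3_norm_def by (rule real_sqrt_pow2) (intro sum_nonneg zero_le_power2)
  note g2 = this
  have g0: "0 \<le> grad3_norm s f" unfolding grad3_norm_def by (intro real_sqrt_ge_zero sum_nonneg zero_le_power2)
  have "(\<Sum>a\<in>(UNIV::'d set). \<Sum>b\<in>(UNIV::'d set). \<Sum>c\<in>(UNIV::'d set). (sobolev_norm s (?D a b c))\<^sup>2) \<le>
      (\<Sum>a\<in>(UNIV::'d set). \<Sum>b\<in>(UNIV::'d set). \<Sum>c\<in>(UNIV::'d set). ?N\<^sup>2)"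
    by (intro sum_mono power_mono Dn sobolev_norm_nonneg)
  also have "\<dots> = (sqrt (real CARD('d) ^ 3) * ?N)\<^sup>2"
    by (simp add: power_mult_distrib power3_eq_cube mult_ac)
  finally show "grad3_norm s f \<le> sqrt (real CARD('d) ^ 3) * ?N"
    unfolding g2 [symmetric] by (rule power2_le_imp_le) (simp add: sobolev_norm_nonneg)
  have G: "sob_le s (\<lambda>k. of_real (nsq k powr (3 / 2)) * ?a k) (grad3_norm s f)"
    unfolding sob_le_def
  proof (intro allI impI)
    fix Y :: "(int ^ 'd) set" assume Y: "finite Y"
    have sq: "(jb k powr (s / 2) * cmod (of_real (nsq k powr (3 / 2)) * ?a k))\<^sup>2 =
        (\<Sum>a\<in>UNIV. \<Sum>b\<in>UNIV. \<Sum>c\<in>UNIV. (jb k powr (s / 2) * cmod (fourier_coeff (?D a b c) k))\<^sup>2)" for k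
    proof -
      have n: "nsq k = (\<Sum>a\<in>UNIV. (real_of_int (k $ a))\<^sup>2)"
        unfolding power2_norm_eq_inner by (simp add: inner_vec_def rvec_def power2_eq_square)
      have "(nsq k powr (3 / 2))\<^sup>2 = nsq k ^ 3"
        by (simp add: power2_eq_square powr_numeral flip: powr_add)
      also have "\<dots> = nsq k * (nsq k * nsq k)" by (simp add: power3_eq_cube)
      also have "\<dots> = (\<Sum>a\<in>UNIV. \<Sum>b\<in>UNIV. \<Sum>c\<in>UNIV. (real_of_int (k $ a))\<^sup>2 * ((real_of_int (k $ b))\<^sup>2 * (real_of_int (k $ c))\<^sup>2))"
        unfolding n by (subst sum_product, subst sum_distrib_right, simp only: sum_distrib_left)
      finally show ?thesis
        by (simp add: coeff norm_mult power_mult_distrib sum_distrib_left sum_distrib_right mult_ac)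
    qed
    have "(\<Sum>k\<in>Y. (jb k powr (s / 2) * cmod (of_real (nsq k powr (3 / 2)) * ?a k))\<^sup>2) =
        (\<Sum>a\<in>UNIV. \<Sum>b\<in>UNIV. \<Sum>c\<in>UNIV. \<Sum>k\<in>Y. (jb k powr (s / 2) * cmod (fourier_coeff (?D a b c) k))\<^sup>2)"
      unfolding sq by (subst sum.swap, intro sum.cong refl)+
    also have "\<dots> \<le> (\<Sum>a\<in>UNIV. \<Sum>b\<in>UNIV. \<Sum>c\<in>UNIV. (sobolev_norm s (?D a b c))\<^sup>2)"
    proof (intro sum_mono)
      fix a b c
      have "sqrt (\<Sum>k\<in>Y. (jb k powr (s / 2) * cmod (fourier_coeff (?D a b c) k))\<^sup>2) \<le> sobolev_norm s (?D a b c)"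
        using sob_leD[OF sobolev_sob_le[OF D] Y] unfolding L2_set_def .
      then show "(\<Sum>k\<in>Y. (jb k powr (s / 2) * cmod (fourier_coeff (?D a b c) k))\<^sup>2) \<le> (sobolev_norm s (?D a b c))\<^sup>2"
        by (rule sqrt_le_D)
    qed
    finally show "L2_set (\<lambda>k. jb k powr (s / 2) * cmod (of_real (nsq k powr (3 / 2)) * ?a k)) Y \<le> grad3_norm s f"
      unfolding L2_set_def grad3_norm_def by (rule real_sqrt_le_mono)
  qed
  note S = sob_le_cmult[OF sob_le_add[OF sobolev_sob_le[OF f0] G], of 4]
  show "sob_le (s + 3) ?a (4 * (sobolev_norm s f + grad3_norm s f))"
  proof (rule sob_le_weighted_mono[OF S])
    fix k :: "int ^ 'd"
    let ?n = "nsq k"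
    have "jb k powr (3 / 2) \<le> 4 * (1 + ?n powr (3 / 2))"
    proof -
      \<comment> \<open>This bounds the factor arising from 1 + x \<le> 2 max(1, x) after raising to
        the power 3/2.\<close>
      have four: "(2::real) powr (3 / 2) \<le> 4"
        using powr_mono[of "3 / 2" 2 "2::real"] by simp
      have "jb k powr (3 / 2) \<le> (2 * max 1 ?n) powr (3 / 2)"
        unfolding jb_def by (intro powr_mono2) auto
      also have "\<dots> = 2 powr (3 / 2) * max 1 ?n powr (3 / 2)" by (rule powr_mult)
      also have "\<dots> \<le> 4 * (1 + ?n powr (3 / 2))"
        by (intro mult_mono four) (auto simp: max_def)
      finally show ?thesis .
    qed
    moreover have "cmod (4 * (?a k + of_real (?n powr (3 / 2)) * ?a k)) = 4 * (1 + ?n powr (3 / 2)) * cmod (?a k)"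
    proof -
      have "4 * (?a k + of_real (?n powr (3 / 2)) * ?a k) = of_real (4 * (1 + ?n powr (3 / 2))) * ?a k"
        by (simp add: algebra_simps)
      moreover have "0 \<le> 4 * (1 + ?n powr (3 / 2))" by (simp add: add_nonneg_nonneg)
      ultimately show ?thesis by (simp only: norm_mult norm_of_real abs_of_nonneg)
    qed
    ultimately show "jb k powr ((s + 3) / 2) * cmod (?a k) \<le>
        jb k powr (s / 2) * cmod (4 * (?a k + of_real (?n powr (3 / 2)) * ?a k))"
      by (simp add: add_divide_distrib powr_add mult.assoc mult_left_mono mult_right_mono)
  qed simp
qed

section \<open>Filter functions and their effect on the scheme (iii)\<close>

lemma cutoff_filter:
  "filter_function TYPE('d::finite) s (\<lambda>z. if cmod z \<le> 1 then 1 else 0)" (is "filter_function _ _ ?\<Psi>")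
  if s: "s > real CARD('d) / 2"
  unfolding filter_function_def
proof (intro conjI allI impI)
  fix \<tau> :: real and f :: "real ^ 'd \<Rightarrow> complex"
  assume \<tau>: "0 < \<tau>" and f: "f \<in> sobolev (s + 2)"
  \<comment> \<open>The filter projects onto the frequencies with \<tau> |k|^2 \<le> 1, where
    \<tau>\<Delta> is a contraction.\<close>
  let ?g = "\<lambda>x. of_real \<tau> * lapfun (\<lambda>z. ?\<Psi> (\<i> * of_real \<tau> * z)) (laplace f) x"
  have f0: "f \<in> sobolev s" using f by (rule sobolev_order_mono) simp
  have "trig_series (lapfun (\<lambda>z. ?\<Psi> (\<i> * of_real \<tau> * z)) (laplace f)) UNIV
      (\<lambda>k. ?\<Psi> (\<i> * of_real \<tau> * - of_real (nsq k)) * (- of_real (nsq k) * fourier_coeff f k)) (\<lambda>k. k)"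
    by (rule lapfun_series_bounded[where B = 1, OF laplace_series[OF s f]]) simp
  note G = trig_series_cmult[OF this, of "of_real \<tau>"]
  have B: "sob_le s (\<lambda>k. of_real \<tau> * (?\<Psi> (\<i> * of_real \<tau> * - of_real (nsq k)) * (- of_real (nsq k) * fourier_coeff f k)))
      (sobolev_norm s f)"
  proof (rule sob_le_mono[OF sobolev_sob_le[OF f0] _ order_refl])
    fix k :: "int ^ 'd"
    have n: "cmod (\<i> * of_real \<tau> * - of_real (nsq k)) = \<tau> * nsq k"
      using \<tau> by (simp add: norm_mult norm_power)
    show "cmod (of_real \<tau> * (?\<Psi> (\<i> * of_real \<tau> * - of_real (nsq k)) * (- of_real (nsq k) * fourier_coeff f k)))
        \<le> cmod (fourier_coeff f k)"
    proof (cases "\<tau> * nsq k \<le> 1")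
      case True
      have "cmod (of_real \<tau> * (- of_real (nsq k) * fourier_coeff f k)) = (\<tau> * nsq k) * cmod (fourier_coeff f k)"
        using \<tau> by (simp add: norm_mult norm_power)
      also have "\<dots> \<le> 1 * cmod (fourier_coeff f k)" using True by (intro mult_right_mono) auto
      finally show ?thesis unfolding n using True by simp
    qed (simp only: n, simp)
  qed
  show "?g \<in> sobolev s" by (rule trig_series_sobolev[OF G B])
  have "fourier_coeff ?g = (\<lambda>k. of_real \<tau> * (?\<Psi> (\<i> * of_real \<tau> * - of_real (nsq k)) * (- of_real (nsq k) * fourier_coeff f k)))"
    by (rule ext) (rule trig_series_UNIV_coeff[OF G])
  then show "sobolev_norm s ?g \<le> sobolev_norm s f"
    using B by (intro sob_le_sobolev_norm) (simp only:)
qed simp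

text \<open>The deviation from 1 is 0 for \<sigma> \<le> 1 and equals 1 beyond, where \<sigma>^m is
  at least 1.\<close>

lemma cutoff_consistent: "consistent_filter m (\<lambda>z. if cmod z \<le> 1 then 1 else 0)"
  unfolding consistent_filter_def
  by (rule exI[of _ 1]) (auto simp: norm_mult intro!: one_le_power)

text \<open>Consistent filters are controlled through a power bound, so their symbols may grow; p
  additional derivatives restore summability.\<close>

lemma lapfun_growth:
  fixes f :: "real ^ 'd::finite \<Rightarrow> complex"
  assumes s: "s > real CARD('d) / 2" and f: "trig_series f UNIV a (\<lambda>k. k)" and a: "sob_le (s + p) a A"
    and h: "\<And>k :: int ^ 'd. cmod (h (- of_real (nsq k))) \<le> C * jb k powr (p / 2)"
  shows "trig_series (lapfun h f) UNIV (\<lambda>k. h (- of_real (nsq k)) * a k) (\<lambda>k. k)"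
proof -
  have "sob_le s (\<lambda>k. of_real (jb k powr (p / 2)) * a k) A" using a by (simp only: sob_le_weight)
  from summable_on_cmult_right[OF sob_le_l1(1)[OF s this], of C]
  have "(\<lambda>k. cmod (h (- of_real (nsq k)) * a k)) summable_on UNIV"
  proof (rule Infinite_Sum.abs_summable_on_comparison_test')
    show "cmod (h (- of_real (nsq k)) * a k) \<le> C * cmod (of_real (jb k powr (p / 2)) * a k)" for k
      using mult_right_mono[OF h[of k] norm_ge_zero[of "a k"]] by (simp add: norm_mult)
  qed
  then show ?thesis by (rule trig_series_lapfun_UNIV[OF f])
qed

text \<open>The filters perturb the scheme at third order: \<Psi>1 - 1 = O((\<tau> |k|^2)^2) is
  multiplied by \<tau>, \<Psi>2 - 1 = O(\<tau> |k|^2) by \<tau>^2 |k|^2 / 2, and \<Psi>3 - 1 =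
  O(\<tau> |k|^2) by \<tau>^2 / 2. The last one acts on a bracket that already contains a Laplacian,
  so four derivatives are lost in each case.\<close>

lemma filter_correction:
  fixes v :: "real ^ 'd::finite \<Rightarrow> complex"
  assumes s: "s > real CARD('d) / 2" and \<tau>: "0 < \<tau>" and v: "v \<in> sobolev (s + 4)"
    and M: "sob_le (s + 4) (fourier_coeff v) M"
    and C1: "\<And>\<sigma>. 0 \<le> \<sigma> \<Longrightarrow> cmod (\<Psi>1 (- \<i> * of_real \<sigma>) - 1) \<le> C1 * \<sigma> ^ 2"
    and C2: "\<And>\<sigma>. 0 \<le> \<sigma> \<Longrightarrow> cmod (\<Psi>2 (- \<i> * of_real \<sigma>) - 1) \<le> C2 * \<sigma> ^ 1"
    and C3: "\<And>\<sigma>. 0 \<le> \<sigma> \<Longrightarrow> cmod (\<Psi>3 (- \<i> * of_real \<sigma>) - 1) \<le> C3 * \<sigma> ^ 1"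
  shows "\<exists>d. trig_series (\<lambda>x. scheme_iii \<Psi>1 \<Psi>2 \<Psi>3 \<tau> v x - scheme_iii (\<lambda>_. 1) (\<lambda>_. 1) (\<lambda>_. 1) \<tau> v x) UNIV d (\<lambda>k. k) \<and>
    sob_le s d (((C1 + C2) * tri_const TYPE('d) (s + 4) +
      C3 * (3 * tri_const TYPE('d) (s + 2) + (tri_const TYPE('d) (s + 2))\<^sup>2)) * \<tau> ^ 3 * (1 + M ^ 7))"
proof -
  have v2: "v \<in> sobolev (s + 2)" and v0: "v \<in> sobolev s" using v by (auto elim: sobolev_order_mono)
  have M0: "0 \<le> M" by (rule sob_le_nonneg[OF M])
  have C0: "0 \<le> C1" "0 \<le> C2" "0 \<le> C3"
    using order_trans[OF norm_ge_zero C1[of 1]] order_trans[OF norm_ge_zero C2[of 1]] order_trans[OF norm_ge_zero C3[of 1]] by auto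
  let ?v = "fourier_coeff v" and ?T2 = "tri_const TYPE('d) (s + 2)" and ?T4 = "tri_const TYPE('d) (s + 4)"
  have T: "0 \<le> ?T2" "0 \<le> ?T4" by (rule tri_const_nonneg)+
  let ?N = "\<lambda>y. of_real ((cmod (v y))\<^sup>2) * v y" and ?B = "\<lambda>y. of_real (cmod (v y) ^ 4) * v y"
  let ?A = "\<lambda>y. - (v y)\<^sup>2 * laplace (\<lambda>y. cnj (v y)) y + 2 * of_real ((cmod (v y))\<^sup>2) * laplace v y"
  have s2: "s + 2 > real CARD('d) / 2" and s4: "s + 4 > real CARD('d) / 2" using s by auto
  have fib: "{t \<in> UNIV. triple_freq t = k} = triads k" for k :: "int ^ 'd" by (auto simp: triple_freq_def triads_def)
  have Nc: "fourier_coeff ?N = tri (\<lambda>_ _ _. 1) ?v ?v ?v"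
  proof
    show "fourier_coeff ?N k = tri (\<lambda>_ _ _. 1) ?v ?v ?v k" for k
      using infsumI[OF trig_series_coeff[OF cubic_series[OF s v0], of k]] unfolding fib tri_def by simp
  qed
  have Ac: "fourier_coeff ?A = tri (\<lambda>k1 k2 k3. of_real (nsq k1 - nsq k2 - nsq k3)) ?v ?v ?v"
  proof
    show "fourier_coeff ?A k = tri (\<lambda>k1 k2 k3. of_real (nsq k1 - nsq k2 - nsq k3)) ?v ?v ?v k" for k
      using infsumI[OF trig_series_coeff[OF derivative_part_series[OF s v2], of k]]
      unfolding fib tri_def by (simp add: mult.assoc)
  qed
  note Ns = trig_series_canonical[OF cubic_series[OF s v0], unfolded Nc]
  have NM: "sob_le (s + 4) (tri (\<lambda>_ _ _. 1) ?v ?v ?v) (?T4 * M * M * M)"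
    by (rule tri_unit_bound(2)[OF s4 M M M]) simp
  have M2: "sob_le (s + 2) ?v M" by (rule sob_le_order_mono[OF M]) simp
  have M22: "sob_le (s + 2 + 2) ?v M" using M by (simp add: add.assoc)
  \<comment> \<open>Two of the four derivatives are spent on the bracket, the other two are kept for
    the filter.\<close>
  have AM: "sob_le (s + 2) (fourier_coeff ?A) (?T2 * 3 * M * M * M)"
    unfolding Ac
  proof (rule tri_bound(3)[OF s2 M22 M22 M22])
    fix k1 k2 k3 :: "int ^ 'd"
    let ?P = "jb k1 * jb k2 * jb k3"
    have "nsq k1 \<le> ?P" "nsq k2 \<le> ?P" "nsq k3 \<le> ?P"
      using jb_products(1)[of k1 k2 k3] jb_products(2)[of k2 k1 k3] jb_products(3)[of k3 k1 k2]
      by (simp_all add: jb_def[of k1] jb_def[of k2] jb_def[of k3])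
    moreover have "0 \<le> nsq k" for k :: "int ^ 'd" by simp
    from this[of k1] this[of k2] this[of k3] calculation
    have "\<bar>nsq k1 - nsq k2 - nsq k3\<bar> \<le> 3 * ?P" by linarith
    then show "cmod (of_real (nsq k1 - nsq k2 - nsq k3)) \<le> 3 * ?P powr (2 / 2)"
      by (simp only: norm_of_real) simp
  qed
  have N2: "sob_le (s + 2) (tri (\<lambda>_ _ _. 1) ?v ?v ?v) (?T2 * M * M * M)"
    by (rule tri_unit_bound(2)[OF s2 M2 M2 M2]) simp
  have Bc: "fourier_coeff ?B = tri (\<lambda>_ _ _. 1) ?v ?v (tri (\<lambda>_ _ _. 1) ?v ?v ?v)"
  proof
    fix k
    note V = sobolev_series[OF s v0]
    have "?B = (\<lambda>x. cnj (v x) * v x * (cnj (v x) * v x * v x))"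
      unfolding of_real_cmod_power4 by (simp add: mult_ac)
    then show "fourier_coeff ?B k = tri (\<lambda>_ _ _. 1) ?v ?v (tri (\<lambda>_ _ _. 1) ?v ?v ?v) k"
      using fourier_coeff_tri[OF V V cubic_sobolev[OF s v0]] by simp
  qed
  have BM: "sob_le (s + 2) (fourier_coeff ?B) (?T2 * M * M * (?T2 * M * M * M))"
    unfolding Bc by (rule tri_unit_bound(2)[OF s2 M2 M2 N2]) simp
  let ?G = "\<lambda>y. ?A y - ?B y" and ?g = "\<lambda>k. fourier_coeff ?A k - fourier_coeff ?B k"
  have Gs: "trig_series ?G UNIV ?g (\<lambda>k. k)"
    by (rule trig_series_minus[OF trig_series_canonical[OF derivative_part_series[OF s v2]]
          trig_series_canonical[OF quint_series[OF s v0]]])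
  note GM = sob_le_diff[OF AM BM]
  have arg: "\<i> * of_real \<tau> * - of_real x = - \<i> * of_real (\<tau> * x)" for x by simp
  let ?h = "\<lambda>\<Psi>1 \<Psi>2 z. \<Psi>1 (\<i> * of_real \<tau> * z) - \<i> * \<Psi>2 (\<i> * of_real \<tau> * z) * (1 / 2) * of_real \<tau> * z"
  let ?e = "\<lambda>k :: int ^ 'd. ?h \<Psi>1 \<Psi>2 (- of_real (nsq k)) - ?h (\<lambda>_. 1) (\<lambda>_. 1) (- of_real (nsq k))"
  let ?e3 = "\<lambda>k :: int ^ 'd. \<Psi>3 (\<i> * of_real \<tau> * - of_real (nsq k)) - 1"
  have n: "0 \<le> nsq k" "nsq k \<le> jb k" for k :: "int ^ 'd" by (auto simp: jb_def)
  have j2: "jb k powr (4 / 2) = jb k * jb k" for k :: "int ^ 'd" by (simp add: powr_numeral power2_eq_square)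
  have e: "cmod (?e k) \<le> ((C1 + C2) * \<tau>\<^sup>2) * jb k powr (4 / 2)" for k :: "int ^ 'd"
  proof -
    let ?\<sigma> = "\<tau> * nsq k"
    have \<sigma>: "0 \<le> ?\<sigma>" using \<tau> n(1)[of k] by simp
    have "?e k = (\<Psi>1 (- \<i> * of_real ?\<sigma>) - 1) + \<i> / 2 * of_real ?\<sigma> * (\<Psi>2 (- \<i> * of_real ?\<sigma>) - 1)"
      unfolding arg by (simp add: field_simps)
    then have "cmod (?e k) \<le> cmod (\<Psi>1 (- \<i> * of_real ?\<sigma>) - 1) + cmod (\<i> / 2 * of_real ?\<sigma> * (\<Psi>2 (- \<i> * of_real ?\<sigma>) - 1))"
      by (simp only: norm_triangle_ineq)
    also have "cmod (\<i> / 2 * of_real ?\<sigma> * (\<Psi>2 (- \<i> * of_real ?\<sigma>) - 1)) = ?\<sigma> / 2 * cmod (\<Psi>2 (- \<i> * of_real ?\<sigma>) - 1)"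
      unfolding norm_mult norm_of_real using \<sigma> by (simp add: norm_divide)
    also have "cmod (\<Psi>1 (- \<i> * of_real ?\<sigma>) - 1) + ?\<sigma> / 2 * cmod (\<Psi>2 (- \<i> * of_real ?\<sigma>) - 1) \<le>
        C1 * ?\<sigma> ^ 2 + ?\<sigma> / 2 * (C2 * ?\<sigma> ^ 1)"
      using \<sigma> by (intro add_mono C1 mult_left_mono C2) auto
    also have "\<dots> = (C1 + C2 / 2) * ?\<sigma>\<^sup>2"
      by (simp add: power2_eq_square algebra_simps)
    also have "\<dots> \<le> (C1 + C2) * ?\<sigma>\<^sup>2"
      using C0(2) by (intro mult_right_mono) auto
    also have "?\<sigma>\<^sup>2 \<le> \<tau>\<^sup>2 * (jb k * jb k)"
      unfolding power_mult_distrib using mult_mono[OF n(2) n(2), of k k] by (intro mult_left_mono) (auto simp: power2_eq_square)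
    finally show ?thesis using C0 unfolding j2 by (simp add: mult_left_mono mult.assoc)
  qed
  have e3: "cmod (?e3 k) \<le> (C3 * \<tau>) * jb k powr (2 / 2)" for k :: "int ^ 'd"
  proof -
    have "cmod (?e3 k) \<le> C3 * (\<tau> * nsq k) ^ 1" unfolding arg using \<tau> n(1)[of k] by (intro C3) simp
    also have "\<dots> \<le> C3 * (\<tau> * jb k)" using C0 \<tau> n(2)[of k] by (simp add: mult_left_mono)
    finally show ?thesis by (simp add: mult.assoc)
  qed
  have h1: "cmod (?h (\<lambda>_. 1) (\<lambda>_. 1) (- of_real (nsq k))) \<le> (1 + \<tau>) * jb k powr (4 / 2)" for k :: "int ^ 'd"
  proof -
    have "?h (\<lambda>_. 1) (\<lambda>_. 1) (- of_real (nsq k)) = 1 + \<i> * of_real (\<tau> / 2 * nsq k)" by simp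
    then have "cmod (?h (\<lambda>_. 1) (\<lambda>_. 1) (- of_real (nsq k))) \<le> cmod 1 + cmod (\<i> * of_real (\<tau> / 2 * nsq k))"
      by (simp only: norm_triangle_ineq)
    also have "\<dots> = 1 + \<tau> / 2 * nsq k"
      unfolding norm_mult norm_of_real using \<tau> n(1)[of k] by simp
    also have "\<dots> \<le> 1 * (jb k * jb k) + \<tau> * (jb k * jb k)"
    proof (intro add_mono mult_mono)
      show jj: "1 \<le> 1 * (jb k * jb k)" using mult_mono[OF jb_ge_1[of k] jb_ge_1[of k]] by simp
      have "jb k * 1 \<le> jb k * jb k" by (intro mult_left_mono jb_ge_1) simp
      then show "nsq k \<le> jb k * jb k" using n(2)[of k] by linarith
    qed (use \<tau> in auto)
    finally show ?thesis unfolding j2 by (simp add: distrib_right)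
  qed
  have hb: "cmod (?h \<Psi>1 \<Psi>2 (- of_real (nsq k))) \<le> (1 + \<tau> + (C1 + C2) * \<tau>\<^sup>2) * jb k powr (4 / 2)" for k :: "int ^ 'd"
    using norm_triangle_sub[of "?h \<Psi>1 \<Psi>2 (- of_real (nsq k))" "?h (\<lambda>_. 1) (\<lambda>_. 1) (- of_real (nsq k))"] h1[of k] e[of k]
    unfolding distrib_right by linarith
  have h3b: "cmod (\<Psi>3 (\<i> * of_real \<tau> * - of_real (nsq k))) \<le> (1 + C3 * \<tau>) * jb k powr (2 / 2)" for k :: "int ^ 'd"
    using norm_triangle_sub[of "\<Psi>3 (\<i> * of_real \<tau> * - of_real (nsq k))" 1] e3[of k] jb_powr_ge_1[of "2 / 2" k]
    unfolding distrib_right by simp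
  note L = free_flow_series[OF lapfun_growth[where h = "?h \<Psi>1 \<Psi>2", OF s Ns NM hb], of \<tau>]
    and L1 = free_flow_series[OF lapfun_growth[where h = "?h (\<lambda>_. 1) (\<lambda>_. 1)", OF s Ns NM h1], of \<tau>]
    and L3 = free_flow_series[OF lapfun_growth[where h = "\<lambda>z. \<Psi>3 (\<i> * of_real \<tau> * z)", OF s Gs GM h3b], of \<tau>]
  have one: "cmod ((\<lambda>z. 1) (- of_real (nsq k))) \<le> 1 * jb k powr (2 / 2)" for k :: "int ^ 'd"
    using jb_ge_1[of k] by simp
  note L4 = free_flow_series[OF lapfun_growth[where h = "\<lambda>z. 1", OF s Gs GM one], of \<tau>]
  let ?d = "\<lambda>k. - \<i> * of_real \<tau> * (flow \<tau> k * (?h \<Psi>1 \<Psi>2 (- of_real (nsq k)) * tri (\<lambda>_ _ _. 1) ?v ?v ?v k)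
        - flow \<tau> k * (?h (\<lambda>_. 1) (\<lambda>_. 1) (- of_real (nsq k)) * tri (\<lambda>_ _ _. 1) ?v ?v ?v k))
      + of_real (\<tau>\<^sup>2 / 2) * (flow \<tau> k * (\<Psi>3 (\<i> * of_real \<tau> * - of_real (nsq k)) * ?g k) - flow \<tau> k * (1 * ?g k))"
  note S = trig_series_add[OF trig_series_cmult[OF trig_series_minus[OF L L1], of "- \<i> * of_real \<tau>"]
      trig_series_cmult[OF trig_series_minus[OF L3 L4], of "of_real (\<tau>\<^sup>2 / 2)"]]
  have ser: "trig_series (\<lambda>x. scheme_iii \<Psi>1 \<Psi>2 \<Psi>3 \<tau> v x - scheme_iii (\<lambda>_. 1) (\<lambda>_. 1) (\<lambda>_. 1) \<tau> v x) UNIV ?d (\<lambda>k. k)"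
    by (rule trig_series_cong[OF S _ refl]) (simp only: scheme_iii_def right_diff_distrib, algebra)
  have d_eq: "?d k = - \<i> * of_real \<tau> * flow \<tau> k * ?e k * tri (\<lambda>_ _ _. 1) ?v ?v ?v k +
      of_real (\<tau>\<^sup>2 / 2) * flow \<tau> k * ?e3 k * ?g k" for k
  proof -
    have "x * (F * (H * N) - F * (H' * N)) + c * (F * (P * g) - F * (1 * g)) = x * F * (H - H') * N + c * F * (P - 1) * g"
      for x F H H' N c P g :: complex by (simp add: algebra_simps)
    then show ?thesis .
  qed
  let ?x = "\<lambda>k. of_real (\<tau> * ((C1 + C2) * \<tau>\<^sup>2)) * (of_real (jb k powr (4 / 2)) * tri (\<lambda>_ _ _. 1) ?v ?v ?v k)"
  let ?y = "\<lambda>k. of_real (\<tau>\<^sup>2 / 2 * (C3 * \<tau>)) * (of_real (jb k powr (2 / 2)) * ?g k)"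
  have cx: "sob_le s ?x (\<bar>\<tau> * ((C1 + C2) * \<tau>\<^sup>2)\<bar> * (?T4 * M * M * M))"
    using sob_le_cmult[OF NM[folded sob_le_weight], of "of_real (\<tau> * ((C1 + C2) * \<tau>\<^sup>2))"] by (simp only: norm_of_real)
  have cy: "sob_le s ?y (\<bar>\<tau>\<^sup>2 / 2 * (C3 * \<tau>)\<bar> * (?T2 * 3 * M * M * M + ?T2 * M * M * (?T2 * M * M * M)))"
    using sob_le_cmult[OF GM[folded sob_le_weight], of "of_real (\<tau>\<^sup>2 / 2 * (C3 * \<tau>))"] by (simp only: norm_of_real)
  have b1: "sob_le s (\<lambda>k. - \<i> * of_real \<tau> * flow \<tau> k * ?e k * tri (\<lambda>_ _ _. 1) ?v ?v ?v k) (\<bar>\<tau> * ((C1 + C2) * \<tau>\<^sup>2)\<bar> * (?T4 * M * M * M))"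
  proof (rule sob_le_mono[OF cx _ order_refl])
    fix k
    have "\<tau> * cmod (?e k) * cmod (tri (\<lambda>_ _ _. 1) ?v ?v ?v k) \<le> \<tau> * (((C1 + C2) * \<tau>\<^sup>2) * jb k powr (4 / 2)) * cmod (tri (\<lambda>_ _ _. 1) ?v ?v ?v k)"
      using \<tau> e[of k] by (intro mult_right_mono mult_left_mono) auto
    moreover have "0 \<le> \<tau> * ((C1 + C2) * \<tau>\<^sup>2)" using \<tau> C0 by simp
    ultimately show "cmod (- \<i> * of_real \<tau> * flow \<tau> k * ?e k * tri (\<lambda>_ _ _. 1) ?v ?v ?v k) \<le> cmod (?x k)"
      using \<tau> by (simp only: norm_mult norm_of_real norm_flow norm_minus_cancel norm_ii abs_of_nonneg powr_ge_zero mult_1_left mult_1_right abs_of_pos mult.assoc)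
  qed
  have b2: "sob_le s (\<lambda>k. of_real (\<tau>\<^sup>2 / 2) * flow \<tau> k * ?e3 k * ?g k)
      (\<bar>\<tau>\<^sup>2 / 2 * (C3 * \<tau>)\<bar> * (?T2 * 3 * M * M * M + ?T2 * M * M * (?T2 * M * M * M)))"
  proof (rule sob_le_mono[OF cy _ order_refl])
    fix k
    have "\<tau>\<^sup>2 / 2 * cmod (?e3 k) * cmod (?g k) \<le> \<tau>\<^sup>2 / 2 * ((C3 * \<tau>) * jb k powr (2 / 2)) * cmod (?g k)"
      using \<tau> e3[of k] by (intro mult_right_mono mult_left_mono) auto
    moreover have "0 \<le> \<tau>\<^sup>2 / 2 * (C3 * \<tau>)" "0 \<le> \<tau>\<^sup>2 / 2" using \<tau> C0 by auto
    ultimately show "cmod (of_real (\<tau>\<^sup>2 / 2) * flow \<tau> k * ?e3 k * ?g k) \<le> cmod (?y k)"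
      by (simp only: norm_mult norm_of_real norm_flow abs_of_nonneg powr_ge_zero mult_1_left mult_1_right mult.assoc)
  qed
  have "sob_le s ?d (\<bar>\<tau> * ((C1 + C2) * \<tau>\<^sup>2)\<bar> * (?T4 * M * M * M) +
      \<bar>\<tau>\<^sup>2 / 2 * (C3 * \<tau>)\<bar> * (?T2 * 3 * M * M * M + ?T2 * M * M * (?T2 * M * M * M)))"
    unfolding d_eq by (rule sob_le_add[OF b1 b2])
  then have "sob_le s ?d (((C1 + C2) * ?T4 + C3 * (3 * ?T2 + ?T2\<^sup>2)) * \<tau> ^ 3 * (1 + M ^ 7))"
  proof (rule sob_le_bound)
    have M3: "M ^ 3 \<le> 1 + M ^ 7" and M5: "M ^ 5 \<le> 1 + M ^ 7" using M0 by (auto intro: power_le_1_plus_power)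
    have "\<bar>\<tau> * ((C1 + C2) * \<tau>\<^sup>2)\<bar> * (?T4 * M * M * M) = (C1 + C2) * ?T4 * \<tau> ^ 3 * M ^ 3"
      using \<tau> C0 by (simp add: power3_eq_cube power2_eq_square abs_mult)
    also have "\<dots> \<le> (C1 + C2) * ?T4 * \<tau> ^ 3 * (1 + M ^ 7)"
      using \<tau> C0 T by (intro mult_left_mono M3) auto
    finally have 1: "\<bar>\<tau> * ((C1 + C2) * \<tau>\<^sup>2)\<bar> * (?T4 * M * M * M) \<le> (C1 + C2) * ?T4 * \<tau> ^ 3 * (1 + M ^ 7)" .
    have "\<bar>\<tau>\<^sup>2 / 2 * (C3 * \<tau>)\<bar> * (?T2 * 3 * M * M * M + ?T2 * M * M * (?T2 * M * M * M)) =
        C3 * \<tau> ^ 3 / 2 * (3 * ?T2 * M ^ 3 + ?T2\<^sup>2 * M ^ 5)"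
      using \<tau> C0 by (simp add: eval_nat_numeral abs_mult algebra_simps)
    also have "\<dots> \<le> C3 * \<tau> ^ 3 * (3 * ?T2 * (1 + M ^ 7) + ?T2\<^sup>2 * (1 + M ^ 7))"
      using \<tau> C0 T M0 by (intro mult_mono add_mono mult_left_mono M3 M5) auto
    finally have 2: "\<bar>\<tau>\<^sup>2 / 2 * (C3 * \<tau>)\<bar> * (?T2 * 3 * M * M * M + ?T2 * M * M * (?T2 * M * M * M)) \<le>
        C3 * \<tau> ^ 3 * (3 * ?T2 * (1 + M ^ 7) + ?T2\<^sup>2 * (1 + M ^ 7))" .
    show "\<bar>\<tau> * ((C1 + C2) * \<tau>\<^sup>2)\<bar> * (?T4 * M * M * M) +
        \<bar>\<tau>\<^sup>2 / 2 * (C3 * \<tau>)\<bar> * (?T2 * 3 * M * M * M + ?T2 * M * M * (?T2 * M * M * M)) \<le>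
        ((C1 + C2) * ?T4 + C3 * (3 * ?T2 + ?T2\<^sup>2)) * \<tau> ^ 3 * (1 + M ^ 7)"
      using add_mono[OF 1 2] by (simp add: algebra_simps)
  qed
  with ser show ?thesis by blast
qed

section \<open>Tree series and local error of the individual schemes\<close>

lemma general_step_i:
  fixes v :: "real ^ 'd::finite \<Rightarrow> complex"
  assumes s: "s > real CARD('d) / 2" and \<tau>: "0 < \<tau>" and v: "v \<in> sobolev s"
  shows "is_general_step s (quotient_slope \<tau>) 2 \<tau> v (scheme_i \<tau> v)"
proof (rule general_step_of_kernel[OF order_refl _ scheme_i_kernel[OF s \<tau> v]])
  show "scheme_i \<tau> v \<in> sobolev s"
    by (rule kernel_step_sobolev[OF s order_refl _ scheme_i_kernel[OF s \<tau> v] kernel_i_bound[OF \<tau> order_refl]])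
      (use v in simp)
  show "osc_eval \<kappa> (Pi_tree \<kappa> (quotient_slope \<tau>) 2 1 tree1) \<tau> = - \<i> * kernel_i \<tau> (\<kappa> 1) (\<kappa> 2) (\<kappa> 3)"
    for \<kappa> :: "nat \<Rightarrow> int ^ 'd"
    unfolding tree1_value osc_int_eq[OF less_imp_le[OF \<tau>]] quad_eval_tree1 kernel_i_def low_phase_def ..
qed

lemma general_step_ii:
  fixes v :: "real ^ 'd::finite \<Rightarrow> complex"
  assumes s: "s > real CARD('d) / 2" and \<tau>: "0 < \<tau>" and v: "v \<in> sobolev s"
  shows "is_general_step s (quotient_slope \<tau>) 3 \<tau> v (scheme_ii \<tau> v)"
proof (rule general_step_of_kernel[OF _ _ scheme_ii_kernel[OF s \<tau> v]])
  show "scheme_ii \<tau> v \<in> sobolev s"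
    by (rule kernel_step_sobolev[OF s order_refl _ scheme_ii_kernel[OF s \<tau> v] kernel_ii_bound[OF \<tau> order_refl]])
      (use v in simp)
  show "osc_eval \<kappa> (Pi_tree \<kappa> (quotient_slope \<tau>) 3 1 tree1) \<tau> = - \<i> * kernel_ii \<tau> (\<kappa> 1) (\<kappa> 2) (\<kappa> 3)"
    for \<kappa> :: "nat \<Rightarrow> int ^ 'd"
    unfolding tree1_value osc_int_eq[OF less_imp_le[OF \<tau>]] quad_eval_tree1 kernel_ii_def low_phase_def ..
qed simp

lemma general_step_iii:
  fixes v :: "real ^ 'd::finite \<Rightarrow> complex"
  assumes s: "s > real CARD('d) / 2" and \<tau>: "0 < \<tau>" and v: "v \<in> sobolev (s + 2)" and n: "4 \<le> n"
  shows "is_general_step s exact_slope n \<tau> v (scheme_iii (\<lambda>_. 1) (\<lambda>_. 1) (\<lambda>_. 1) \<tau> v)"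
proof (rule general_step_of_kernel[OF _ _ scheme_iii_kernel[OF s \<tau> v]])
  show "scheme_iii (\<lambda>_. 1) (\<lambda>_. 1) (\<lambda>_. 1) \<tau> v \<in> sobolev s"
    by (rule kernel_step_sobolev[OF s _ v scheme_iii_kernel[OF s \<tau> v] kernel_iii_bound[OF \<tau> order_refl]]) simp
  show "osc_eval \<kappa> (Pi_tree \<kappa> exact_slope n 1 tree1) \<tau> = - \<i> * kernel_iii \<tau> (\<kappa> 1) (\<kappa> 2) (\<kappa> 3)"
    for \<kappa> :: "nat \<Rightarrow> int ^ 'd"
    unfolding tree1_value(3)[OF n] kernel_iii_def ..
qed (use n in simp)

lemma err_const_nonneg: "0 \<le> err_const TYPE('d::finite) s"
  unfolding err_const_def using tri_const_nonneg[where 'd = 'd] by (intro mult_nonneg_nonneg add_nonneg_nonneg) auto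

lemma initial_value:
  assumes "nls_solution \<sigma> \<tau> u" "0 \<le> \<tau>"
  shows "u 0 \<in> sobolev \<sigma>"
  using assms by (simp add: nls_solution_def)

text \<open>\<open>K\<close> is the constant of the flow expansion plus the algebra constant times
  the kernel constant 72; c = 1 is the constant of \<open>laplace_controls\<close>.\<close>

lemma local_error_i:
  assumes s: "s > real CARD('d::finite) / 2"
  shows "local_error_order s (s + 2) (scheme_i :: real \<Rightarrow> (real ^ 'd \<Rightarrow> complex) \<Rightarrow> _) 3 (\<lambda>f. sobolev_norm s (laplace f))"
proof (rule local_error_orderI[OF s, where c = 1 and c' = 2 and K = "err_const TYPE('d) s + tri_const TYPE('d) s * 72"])
  fix f :: "real ^ 'd \<Rightarrow> complex" assume f: "f \<in> sobolev (s + 2)"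
  show "sob_le (s + 2) (fourier_coeff f) (1 * (sobolev_norm s f + sobolev_norm s (laplace f)))"
    by (rule laplace_controls[OF s f])
  show "sobolev_norm s f + sobolev_norm s (laplace f) \<le> 2 * sobolev_norm (s + 2) f"
    using sobolev_norm_mono[OF f, of s] laplace_sobolev(2)[OF s f] by simp
next
  fix \<tau> :: real and u :: "real \<Rightarrow> real ^ 'd \<Rightarrow> complex" and M
  assume \<tau>: "0 < \<tau>" and u: "nls_solution (s + 2) \<tau> u"
    and b: "\<And>t. t \<in> {0..\<tau>} \<Longrightarrow> sob_le (s + 2) (fourier_coeff (u t)) M"
  have v: "u 0 \<in> sobolev s" using initial_value[OF u] \<tau> by (auto elim: sobolev_order_mono)
  note E = kernel_step_error[OF s order_refl less_imp_le[OF \<tau>] u b scheme_i_kernel[OF s \<tau> v]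
      kernel_i_error[OF \<tau>] kernel_i_bound[OF \<tau> zero_le_numeral]]
  show "(\<lambda>x. u \<tau> x - scheme_i \<tau> (u 0) x) \<in> sobolev s \<and>
      sob_le s (fourier_coeff (\<lambda>x. u \<tau> x - scheme_i \<tau> (u 0) x))
        ((err_const TYPE('d) s + tri_const TYPE('d) s * 72) * \<tau> ^ 3 * (1 + M ^ 7))"
    using E by blast
qed (simp_all add: sobolev_norm_nonneg err_const_nonneg tri_const_nonneg)

lemma local_error_ii:
  assumes s: "s > real CARD('d::finite) / 2"
  shows "local_error_order s (s + 3) (scheme_ii :: real \<Rightarrow> (real ^ 'd \<Rightarrow> complex) \<Rightarrow> _) 3 (grad3_norm s)"
proof (rule local_error_orderI[OF s, where c = 4 and c' = "1 + sqrt (real CARD('d) ^ 3)"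
      and K = "err_const TYPE('d) s + tri_const TYPE('d) s * 84"])
  fix f :: "real ^ 'd \<Rightarrow> complex"
  show "0 \<le> grad3_norm s f" unfolding grad3_norm_def by (intro real_sqrt_ge_zero sum_nonneg zero_le_power2)
  assume f: "f \<in> sobolev (s + 3)"
  show "sob_le (s + 3) (fourier_coeff f) (4 * (sobolev_norm s f + grad3_norm s f))"
    by (rule grad3_controls(1)[OF s f])
  show "sobolev_norm s f + grad3_norm s f \<le> (1 + sqrt (real CARD('d) ^ 3)) * sobolev_norm (s + 3) f"
    using sobolev_norm_mono[OF f, of s] grad3_controls(2)[OF s f] by (simp add: distrib_right)
next
  fix \<tau> :: real and u :: "real \<Rightarrow> real ^ 'd \<Rightarrow> complex" and M
  assume \<tau>: "0 < \<tau>" and u: "nls_solution (s + 3) \<tau> u"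
    and b: "\<And>t. t \<in> {0..\<tau>} \<Longrightarrow> sob_le (s + 3) (fourier_coeff (u t)) M"
  have v: "u 0 \<in> sobolev s" using initial_value[OF u] \<tau> by (auto elim: sobolev_order_mono)
  have "(2::real) \<le> 3" by simp
  note E = kernel_step_error[OF s this less_imp_le[OF \<tau>] u b scheme_ii_kernel[OF s \<tau> v]
      kernel_ii_error[OF \<tau>] kernel_ii_bound[OF \<tau> zero_le_numeral]]
  show "(\<lambda>x. u \<tau> x - scheme_ii \<tau> (u 0) x) \<in> sobolev s \<and>
      sob_le s (fourier_coeff (\<lambda>x. u \<tau> x - scheme_ii \<tau> (u 0) x))
        ((err_const TYPE('d) s + tri_const TYPE('d) s * 84) * \<tau> ^ 3 * (1 + M ^ 7))"
    using E by blast
qed (simp_all add: err_const_nonneg tri_const_nonneg)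

text \<open>The error is that of the unfiltered scheme minus the filter correction, and both are of
  third order in terms of the same norm of order s + 4.\<close>

lemma local_error_iii:
  assumes s: "s > real CARD('d::finite) / 2"
    and \<Psi>: "consistent_filter 2 \<Psi>1" "consistent_filter 1 \<Psi>2" "consistent_filter 1 \<Psi>3"
  shows "local_error_order s (s + 4) (scheme_iii \<Psi>1 \<Psi>2 \<Psi>3 :: real \<Rightarrow> (real ^ 'd \<Rightarrow> complex) \<Rightarrow> _) 3
    (\<lambda>f. sobolev_norm s (laplace (laplace f)))"
proof -
  obtain C1 C2 C3 where C: "\<And>\<sigma>. 0 \<le> \<sigma> \<Longrightarrow> cmod (\<Psi>1 (- \<i> * of_real \<sigma>) - 1) \<le> C1 * \<sigma> ^ 2"
    "\<And>\<sigma>. 0 \<le> \<sigma> \<Longrightarrow> cmod (\<Psi>2 (- \<i> * of_real \<sigma>) - 1) \<le> C2 * \<sigma> ^ 1"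
    "\<And>\<sigma>. 0 \<le> \<sigma> \<Longrightarrow> cmod (\<Psi>3 (- \<i> * of_real \<sigma>) - 1) \<le> C3 * \<sigma> ^ 1"
    using \<Psi> unfolding consistent_filter_def by blast
  have C0: "0 \<le> C1" "0 \<le> C2" "0 \<le> C3"
    using order_trans[OF norm_ge_zero C(1)[of 1]] order_trans[OF norm_ge_zero C(2)[of 1]]
      order_trans[OF norm_ge_zero C(3)[of 1]] by auto
  let ?K1 = "err_const TYPE('d) s + tri_const TYPE('d) s * 900"
    and ?K2 = "(C1 + C2) * tri_const TYPE('d) (s + 4) + C3 * (3 * tri_const TYPE('d) (s + 2) + (tri_const TYPE('d) (s + 2))\<^sup>2)"
  show ?thesis
  proof (rule local_error_orderI[OF s, where c = 2 and c' = 2 and K = "?K1 + ?K2"])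
    fix f :: "real ^ 'd \<Rightarrow> complex" assume f: "f \<in> sobolev (s + 4)"
    show "sob_le (s + 4) (fourier_coeff f) (2 * (sobolev_norm s f + sobolev_norm s (laplace (laplace f))))"
      by (rule bilaplace_controls(1)[OF s f])
    show "sobolev_norm s f + sobolev_norm s (laplace (laplace f)) \<le> 2 * sobolev_norm (s + 4) f"
      using sobolev_norm_mono[OF f, of s] bilaplace_controls(2)[OF s f] by simp
  next
    fix \<tau> :: real and u :: "real \<Rightarrow> real ^ 'd \<Rightarrow> complex" and M
    assume \<tau>: "0 < \<tau>" and u: "nls_solution (s + 4) \<tau> u"
      and b: "\<And>t. t \<in> {0..\<tau>} \<Longrightarrow> sob_le (s + 4) (fourier_coeff (u t)) M"
    have v: "u 0 \<in> sobolev (s + 4)" using initial_value[OF u] \<tau> by simp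
    then have v2: "u 0 \<in> sobolev (s + 2)" by (rule sobolev_order_mono) simp
    have p: "(2::real) \<le> 4" by simp
    let ?w1 = "scheme_iii (\<lambda>_. 1) (\<lambda>_. 1) (\<lambda>_. 1) \<tau> (u 0)" and ?w = "scheme_iii \<Psi>1 \<Psi>2 \<Psi>3 \<tau> (u 0)"
    note E = kernel_step_error[OF s p less_imp_le[OF \<tau>] u b scheme_iii_kernel[OF s \<tau> v2]
        kernel_iii_error[OF \<tau>] kernel_iii_bound[OF \<tau> p]]
    have "0 \<in> {0..\<tau>}" using \<tau> by simp
    from filter_correction[OF s \<tau> v b[OF this] C]
    obtain d where d: "trig_series (\<lambda>x. ?w x - ?w1 x) UNIV d (\<lambda>k. k)"
      "sob_le s d (?K2 * \<tau> ^ 3 * (1 + M ^ 7))" by blast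
    have fd: "fourier_coeff (\<lambda>x. ?w x - ?w1 x) = d" using trig_series_UNIV_coeff[OF d(1)] by auto
    have D: "(\<lambda>x. ?w x - ?w1 x) \<in> sobolev s" by (rule trig_series_sobolev[OF d])
    have eq: "(\<lambda>x. u \<tau> x - ?w x) = (\<lambda>x. (u \<tau> x - ?w1 x) - (?w x - ?w1 x))" by simp
    have "(\<lambda>x. u \<tau> x - ?w x) \<in> sobolev s" unfolding eq by (rule sobolev_diff[OF E(2) D])
    moreover have "sob_le s (fourier_coeff (\<lambda>x. u \<tau> x - ?w x))
        (?K1 * \<tau> ^ 3 * (1 + M ^ 7) + ?K2 * \<tau> ^ 3 * (1 + M ^ 7))"
    proof -
      have "fourier_coeff (\<lambda>x. u \<tau> x - ?w x) = (\<lambda>k. fourier_coeff (\<lambda>x. u \<tau> x - ?w1 x) k - d k)"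
        using fourier_coeff_diff_sobolev[OF E(2) D] unfolding fd by simp
      then show ?thesis using sob_le_diff[OF E(1) d(2)] by (simp only:)
    qed
    ultimately show "(\<lambda>x. u \<tau> x - ?w x) \<in> sobolev s \<and>
        sob_le s (fourier_coeff (\<lambda>x. u \<tau> x - ?w x)) ((?K1 + ?K2) * \<tau> ^ 3 * (1 + M ^ 7))"
      by (simp only: distrib_right)
  qed (use C0 in \<open>auto simp: sobolev_norm_nonneg err_const_nonneg tri_const_nonneg intro!: add_nonneg_nonneg mult_nonneg_nonneg\<close>)
qed

text \<open>In (iii) the tree series is identified with the unfiltered expression, while the error
  bound covers every admissible insertion of filters. The constant 1 does not satisfy
  \<open>filter_function\<close>, as \<tau> |k|^2 is unbounded; suitable filters are therefore
  exhibited separately, by taking the frequency cut-off for all three.\<close>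

theorem corollary5p3:
  fixes s :: real
  assumes "s > real CARD('d::finite) / 2"
  shows
   "((\<forall>\<tau>>0. \<forall>v :: real ^ 'd \<Rightarrow> complex. v \<in> sobolev s \<longrightarrow>
        is_general_step s (quotient_slope \<tau>) 2 \<tau> v (scheme_i \<tau> v))
     \<and> local_error_order s (s + 2) (scheme_i :: real \<Rightarrow> (real ^ 'd \<Rightarrow> complex) \<Rightarrow> _) 3
         (\<lambda>f. sobolev_norm s (laplace f)))
    \<and>
    ((\<forall>\<tau>>0. \<forall>v :: real ^ 'd \<Rightarrow> complex. v \<in> sobolev s \<longrightarrow>
        is_general_step s (quotient_slope \<tau>) 3 \<tau> v (scheme_ii \<tau> v))
     \<and> local_error_order s (s + 3) (scheme_ii :: real \<Rightarrow> (real ^ 'd \<Rightarrow> complex) \<Rightarrow> _) 3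
         (grad3_norm s))
    \<and>
    ((\<forall>n\<ge>4. \<forall>\<tau>>0. \<forall>v :: real ^ 'd \<Rightarrow> complex. v \<in> sobolev (s + 2) \<longrightarrow>
        is_general_step s exact_slope n \<tau> v (scheme_iii (\<lambda>_. 1) (\<lambda>_. 1) (\<lambda>_. 1) \<tau> v))
     \<and> (\<exists>\<Psi>1 \<Psi>2 \<Psi>3. suitable_filters TYPE('d) s \<Psi>1 \<Psi>2 \<Psi>3)
     \<and> (\<forall>\<Psi>1 \<Psi>2 \<Psi>3. suitable_filters TYPE('d) s \<Psi>1 \<Psi>2 \<Psi>3 \<longrightarrow>
          local_error_order s (s + 4)
            (scheme_iii \<Psi>1 \<Psi>2 \<Psi>3 :: real \<Rightarrow> (real ^ 'd \<Rightarrow> complex) \<Rightarrow> _) 3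
            (\<lambda>f. sobolev_norm s (laplace (laplace f)))))"
proof (intro conjI allI impI)
  fix \<tau> :: real and v :: "real ^ 'd \<Rightarrow> complex" assume \<tau>: "0 < \<tau>"
  show "is_general_step s (quotient_slope \<tau>) 2 \<tau> v (scheme_i \<tau> v)"
    and "is_general_step s (quotient_slope \<tau>) 3 \<tau> v (scheme_ii \<tau> v)" if "v \<in> sobolev s"
    using general_step_i[OF assms \<tau> that] general_step_ii[OF assms \<tau> that] by auto
  show "is_general_step s exact_slope n \<tau> v (scheme_iii (\<lambda>_. 1) (\<lambda>_. 1) (\<lambda>_. 1) \<tau> v)"
    if "4 \<le> n" "v \<in> sobolev (s + 2)" for n
    by (rule general_step_iii[OF assms \<tau> that(2,1)])
next
  show "\<exists>\<Psi>1 \<Psi>2 \<Psi>3. suitable_filters TYPE('d) s \<Psi>1 \<Psi>2 \<Psi>3"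
    unfolding suitable_filters_def using cutoff_filter[OF assms] cutoff_consistent by blast
next
  fix \<Psi>1 \<Psi>2 \<Psi>3 assume "suitable_filters TYPE('d) s \<Psi>1 \<Psi>2 \<Psi>3"
  then show "local_error_order s (s + 4) (scheme_iii \<Psi>1 \<Psi>2 \<Psi>3 :: real \<Rightarrow> (real ^ 'd \<Rightarrow> complex) \<Rightarrow> _) 3
      (\<lambda>f. sobolev_norm s (laplace (laplace f)))"
    unfolding suitable_filters_def by (intro local_error_iii[OF assms]) auto
qed (rule local_error_i[OF assms] local_error_ii[OF assms])+

end
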